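(* Let $(A,B)$ be an inclusion of abelian $C^*$-algebras having the faithful unique pseudo-expectation property. If $J$ is a regular ideal of $A$, then $(A/J,B/(J\cap B))$ has the faithful unique pseudo-expectation property.
   Context: Ideals are closed and two-sided. An inclusion $(A,B)$ of $C^*$-algebras is a $C^*$-algebra $A$ with a $C^*$-subalgebra $B\subseteq A$ containing an approximate unit for $A$. $B/(J\cap B)$ is identified with the image of $B$ in $A/J$. For a subset $X$ of a $C^*$-algebra $A$, $X^\perp=\{a\in A:aX=Xa=\{0\}\}$; an ideal $J$ of $A$ is regular if $J=J^{\perp\perp}$. Injective envelope: for unital $B$, $(I(B),\iota)$ consists of an injective $C^*$-algebra $I(B)$ and a unital $*$-monomorphism $\iota\colon B\to I(B)$ such that the only unital completely positive map $\phi\colon I(B)\to I(B)$ with $\phi\circ\iota=\iota$ is the identity; for non-unital $B$, an injective envelope of $B$ is one of the unitization $\tilde B$. A pseudo-expectation for $(A,B)$ is a completely positive contraction $\Phi\colon A\to I(B)$ with $\Phi|_B=\iota$; it is faithful if $\Phi(a^*a)=0$ implies $a=0$. The inclusion $(A,B)$ has the faithful unique pseudo-expectation property if there is exactly one pseudo-expectation $A\to I(B)$ and it is faithful. *)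

theory Defs
  imports Complex_Main "HOL-Algebra.Module" "HOL-Algebra.QuotRing"
begin

section \<open>C*-algebras with explicit carriers\<close>

text \<open>C*-algebras need not be unital, so the field \<open>one\<close> inherited from the ring record carries no
  information: no definition below reads it, except to fill the same field of another record. Units
  are treated by the predicate \<open>is_unit\<close> instead.\<close>

record 'a cstar = "(complex, 'a) module" +
  star :: "'a \<Rightarrow> 'a"
  cnorm :: "'a \<Rightarrow> real"

locale cstar_algebra = abelian_group A for A :: "'a cstar" (structure) +
  assumes mult_closed: "\<lbrakk>x \<in> carrier A; y \<in> carrier A\<rbrakk> \<Longrightarrow> x \<otimes> y \<in> carrier A"
    and mult_assoc: "\<lbrakk>x \<in> carrier A; y \<in> carrier A; z \<in> carrier A\<rbrakk> \<Longrightarrow>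
      (x \<otimes> y) \<otimes> z = x \<otimes> (y \<otimes> z)"
    and distrib_left: "\<lbrakk>x \<in> carrier A; y \<in> carrier A; z \<in> carrier A\<rbrakk> \<Longrightarrow>
      x \<otimes> (y \<oplus> z) = x \<otimes> y \<oplus> x \<otimes> z"
    and distrib_right: "\<lbrakk>x \<in> carrier A; y \<in> carrier A; z \<in> carrier A\<rbrakk> \<Longrightarrow>
      (x \<oplus> y) \<otimes> z = x \<otimes> z \<oplus> y \<otimes> z"
    and smult_closed: "x \<in> carrier A \<Longrightarrow> c \<odot> x \<in> carrier A"
    and smult_add_left: "x \<in> carrier A \<Longrightarrow> (c + d) \<odot> x = c \<odot> x \<oplus> d \<odot> x"
    and smult_add_right: "\<lbrakk>x \<in> carrier A; y \<in> carrier A\<rbrakk> \<Longrightarrow> c \<odot> (x \<oplus> y) = c \<odot> x \<oplus> c \<odot> y"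
    and smult_smult: "x \<in> carrier A \<Longrightarrow> (c * d) \<odot> x = c \<odot> (d \<odot> x)"
    and smult_one: "x \<in> carrier A \<Longrightarrow> 1 \<odot> x = x"
    and smult_mult_left: "\<lbrakk>x \<in> carrier A; y \<in> carrier A\<rbrakk> \<Longrightarrow> (c \<odot> x) \<otimes> y = c \<odot> (x \<otimes> y)"
    and smult_mult_right: "\<lbrakk>x \<in> carrier A; y \<in> carrier A\<rbrakk> \<Longrightarrow> x \<otimes> (c \<odot> y) = c \<odot> (x \<otimes> y)"
    and star_closed: "x \<in> carrier A \<Longrightarrow> star A x \<in> carrier A"
    and star_star: "x \<in> carrier A \<Longrightarrow> star A (star A x) = x"
    and star_add: "\<lbrakk>x \<in> carrier A; y \<in> carrier A\<rbrakk> \<Longrightarrow> star A (x \<oplus> y) = star A x \<oplus> star A y"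
    and star_mult: "\<lbrakk>x \<in> carrier A; y \<in> carrier A\<rbrakk> \<Longrightarrow> star A (x \<otimes> y) = star A y \<otimes> star A x"
    and star_smult: "x \<in> carrier A \<Longrightarrow> star A (c \<odot> x) = cnj c \<odot> star A x"
    and cnorm_nonneg: "x \<in> carrier A \<Longrightarrow> 0 \<le> cnorm A x"
    and cnorm_eq_zero: "x \<in> carrier A \<Longrightarrow> cnorm A x = 0 \<longleftrightarrow> x = \<zero>"
    and cnorm_triangle: "\<lbrakk>x \<in> carrier A; y \<in> carrier A\<rbrakk> \<Longrightarrow> cnorm A (x \<oplus> y) \<le> cnorm A x + cnorm A y"
    and cnorm_smult: "x \<in> carrier A \<Longrightarrow> cnorm A (c \<odot> x) = cmod c * cnorm A x"
    and cnorm_mult: "\<lbrakk>x \<in> carrier A; y \<in> carrier A\<rbrakk> \<Longrightarrow> cnorm A (x \<otimes> y) \<le> cnorm A x * cnorm A y"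
    and cnorm_star_mult: "x \<in> carrier A \<Longrightarrow> cnorm A (star A x \<otimes> x) = (cnorm A x)\<^sup>2"
    and complete:
      "\<lbrakk>\<And>n :: nat. X n \<in> carrier A;
        \<And>e. 0 < e \<Longrightarrow> \<exists>N. \<forall>m\<ge>N. \<forall>n\<ge>N. cnorm A (X m \<ominus> X n) < e\<rbrakk> \<Longrightarrow>
       \<exists>x\<in>carrier A. (\<lambda>n. cnorm A (X n \<ominus> x)) \<longlonglongrightarrow> 0"

definition abelian :: "'a cstar \<Rightarrow> bool" where
  "abelian A \<longleftrightarrow> (\<forall>x\<in>carrier A. \<forall>y\<in>carrier A. x \<otimes>\<^bsub>A\<^esub> y = y \<otimes>\<^bsub>A\<^esub> x)"

definition is_unit :: "'a cstar \<Rightarrow> 'a \<Rightarrow> bool" where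
  "is_unit A e \<longleftrightarrow> e \<in> carrier A \<and> (\<forall>x\<in>carrier A. e \<otimes>\<^bsub>A\<^esub> x = x \<and> x \<otimes>\<^bsub>A\<^esub> e = x)"

definition unital :: "'a cstar \<Rightarrow> bool" where
  "unital A \<longleftrightarrow> (\<exists>e. is_unit A e)"

definition linear_subspace :: "'a cstar \<Rightarrow> 'a set \<Rightarrow> bool" where
  "linear_subspace A S \<longleftrightarrow> S \<subseteq> carrier A \<and> \<zero>\<^bsub>A\<^esub> \<in> S \<and>
     (\<forall>x\<in>S. \<forall>y\<in>S. x \<oplus>\<^bsub>A\<^esub> y \<in> S) \<and> (\<forall>c. \<forall>x\<in>S. c \<odot>\<^bsub>A\<^esub> x \<in> S)"

definition norm_closed :: "'a cstar \<Rightarrow> 'a set \<Rightarrow> bool" where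
  "norm_closed A S \<longleftrightarrow>
     (\<forall>X. \<forall>x\<in>carrier A. (\<forall>n :: nat. X n \<in> S) \<and> (\<lambda>n. cnorm A (X n \<ominus>\<^bsub>A\<^esub> x)) \<longlonglongrightarrow> 0 \<longrightarrow> x \<in> S)"

definition cstar_subalgebra :: "'a cstar \<Rightarrow> 'a set \<Rightarrow> bool" where
  "cstar_subalgebra A B \<longleftrightarrow> linear_subspace A B \<and> norm_closed A B \<and>
     (\<forall>x\<in>B. \<forall>y\<in>B. x \<otimes>\<^bsub>A\<^esub> y \<in> B) \<and> (\<forall>x\<in>B. star A x \<in> B)"

text \<open>The C*-subalgebra as an algebra in its own right.\<close>

abbreviation subalg :: "'a cstar \<Rightarrow> 'a set \<Rightarrow> 'a cstar" where
  "subalg A B \<equiv> A\<lparr>carrier := B\<rparr>"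


section \<open>Inclusions, ideals and quotients\<close>

text \<open>An approximate unit is a net of positive elements of norm at most 1. Nets are encoded by proper
  filters, so that no index type has to be chosen.\<close>

definition has_approximate_unit_in :: "'a cstar \<Rightarrow> 'a set \<Rightarrow> bool" where
  "has_approximate_unit_in A B \<longleftrightarrow>
     (\<exists>F :: 'a filter. F \<noteq> bot \<and>
        (\<forall>\<^sub>F e in F. e \<in> B \<and> cnorm A e \<le> 1 \<and> (\<exists>y\<in>carrier A. e = star A y \<otimes>\<^bsub>A\<^esub> y)) \<and>
        (\<forall>a\<in>carrier A. ((\<lambda>e. cnorm A (e \<otimes>\<^bsub>A\<^esub> a \<ominus>\<^bsub>A\<^esub> a)) \<longlongrightarrow> 0) F \<and>
                       ((\<lambda>e. cnorm A (a \<otimes>\<^bsub>A\<^esub> e \<ominus>\<^bsub>A\<^esub> a)) \<longlongrightarrow> 0) F))"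

definition cstar_inclusion :: "'a cstar \<Rightarrow> 'a set \<Rightarrow> bool" where
  "cstar_inclusion A B \<longleftrightarrow>
     cstar_algebra A \<and> cstar_subalgebra A B \<and> has_approximate_unit_in A B"

definition closed_ideal :: "'a cstar \<Rightarrow> 'a set \<Rightarrow> bool" where
  "closed_ideal A J \<longleftrightarrow> linear_subspace A J \<and> norm_closed A J \<and>
     (\<forall>a\<in>carrier A. \<forall>x\<in>J. a \<otimes>\<^bsub>A\<^esub> x \<in> J \<and> x \<otimes>\<^bsub>A\<^esub> a \<in> J)"

definition annihilator :: "'a cstar \<Rightarrow> 'a set \<Rightarrow> 'a set" where
  "annihilator A X = {a \<in> carrier A. \<forall>x\<in>X. a \<otimes>\<^bsub>A\<^esub> x = \<zero>\<^bsub>A\<^esub> \<and> x \<otimes>\<^bsub>A\<^esub> a = \<zero>\<^bsub>A\<^esub>}"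

definition regular_ideal :: "'a cstar \<Rightarrow> 'a set \<Rightarrow> bool" where
  "regular_ideal A J \<longleftrightarrow> closed_ideal A J \<and> annihilator A (annihilator A J) = J"

definition quotient_cstar :: "'a cstar \<Rightarrow> 'a set \<Rightarrow> 'a set cstar" where
  "quotient_cstar A J =
     \<lparr>carrier = a_rcosets\<^bsub>A\<^esub> J,
      mult = rcoset_mult A J,
      one = J +>\<^bsub>A\<^esub> \<one>\<^bsub>A\<^esub>,
      zero = J,
      add = set_add A,
      smult = (\<lambda>c X. \<Union>x\<in>X. J +>\<^bsub>A\<^esub> (c \<odot>\<^bsub>A\<^esub> x)),
      star = (\<lambda>X. \<Union>x\<in>X. J +>\<^bsub>A\<^esub> star A x),
      cnorm = (\<lambda>X. INF x\<in>X. cnorm A x)\<rparr>"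

definition quotient_image :: "'a cstar \<Rightarrow> 'a set \<Rightarrow> 'a set \<Rightarrow> 'a set set" where
  "quotient_image A J B = (\<lambda>b. J +>\<^bsub>A\<^esub> b) ` B"

text \<open>The norm is the norm of left multiplication by \<open>b + z1\<close> on the ideal \<open>B\<close>; for non-unital \<open>B\<close>
  (the only case in which the unitization is used) this is the C*-norm.\<close>

definition unitization :: "'a cstar \<Rightarrow> ('a \<times> complex) cstar" where
  "unitization B =
     \<lparr>carrier = carrier B \<times> UNIV,
      mult = (\<lambda>(a, z) (b, w). (a \<otimes>\<^bsub>B\<^esub> b \<oplus>\<^bsub>B\<^esub> z \<odot>\<^bsub>B\<^esub> b \<oplus>\<^bsub>B\<^esub> w \<odot>\<^bsub>B\<^esub> a, z * w)),
      one = (\<zero>\<^bsub>B\<^esub>, 1),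
      zero = (\<zero>\<^bsub>B\<^esub>, 0),
      add = (\<lambda>(a, z) (b, w). (a \<oplus>\<^bsub>B\<^esub> b, z + w)),
      smult = (\<lambda>c (a, z). (c \<odot>\<^bsub>B\<^esub> a, c * z)),
      star = (\<lambda>(a, z). (star B a, cnj z)),
      cnorm = (\<lambda>(a, z). SUP x\<in>{x \<in> carrier B. cnorm B x \<le> 1}. cnorm B (a \<otimes>\<^bsub>B\<^esub> x \<oplus>\<^bsub>B\<^esub> z \<odot>\<^bsub>B\<^esub> x))\<rparr>"


section \<open>Completely positive maps\<close>

text \<open>\<open>matrix_positive A n X\<close>: the matrix \<open>(X i j)\<close>, \<open>i, j < n\<close>, is a positive element of \<open>M\<^sub>n(A)\<close>,
  i.e. \<open>X = Y\<^sup>*Y\<close> for some \<open>Y \<in> M\<^sub>n(A)\<close>.\<close>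

definition matrix_positive :: "'a cstar \<Rightarrow> nat \<Rightarrow> (nat \<Rightarrow> nat \<Rightarrow> 'a) \<Rightarrow> bool" where
  "matrix_positive A n X \<longleftrightarrow>
     (\<exists>Y. (\<forall>i<n. \<forall>j<n. Y i j \<in> carrier A) \<and>
          (\<forall>i<n. \<forall>j<n. X i j = (\<Oplus>\<^bsub>A\<^esub>k\<in>{..<n}. star A (Y k i) \<otimes>\<^bsub>A\<^esub> Y k j)))"

definition linear_map_on :: "'a cstar \<Rightarrow> 'a set \<Rightarrow> 'b cstar \<Rightarrow> ('a \<Rightarrow> 'b) \<Rightarrow> bool" where
  "linear_map_on A S C \<phi> \<longleftrightarrow> \<phi> \<in> S \<rightarrow> carrier C \<and>
     (\<forall>x\<in>S. \<forall>y\<in>S. \<phi> (x \<oplus>\<^bsub>A\<^esub> y) = \<phi> x \<oplus>\<^bsub>C\<^esub> \<phi> y) \<and>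
     (\<forall>c. \<forall>x\<in>S. \<phi> (c \<odot>\<^bsub>A\<^esub> x) = c \<odot>\<^bsub>C\<^esub> \<phi> x)"

text \<open>Complete positivity of a map on a subspace \<open>S\<close> of \<open>A\<close>, where \<open>M\<^sub>n(S)\<close> is ordered as a subspace
  of \<open>M\<^sub>n(A)\<close>.\<close>

definition cp_map_on :: "'a cstar \<Rightarrow> 'a set \<Rightarrow> 'b cstar \<Rightarrow> ('a \<Rightarrow> 'b) \<Rightarrow> bool" where
  "cp_map_on A S C \<phi> \<longleftrightarrow> linear_map_on A S C \<phi> \<and>
     (\<forall>n X. (\<forall>i<n. \<forall>j<n. X i j \<in> S) \<and> matrix_positive A n X \<longrightarrow>
            matrix_positive C n (\<lambda>i j. \<phi> (X i j)))"

abbreviation cp_map :: "'a cstar \<Rightarrow> 'b cstar \<Rightarrow> ('a \<Rightarrow> 'b) \<Rightarrow> bool" where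
  "cp_map A C \<phi> \<equiv> cp_map_on A (carrier A) C \<phi>"

definition unit_preserving :: "'a cstar \<Rightarrow> 'b cstar \<Rightarrow> ('a \<Rightarrow> 'b) \<Rightarrow> bool" where
  "unit_preserving A C \<phi> \<longleftrightarrow> (\<forall>e. is_unit A e \<longrightarrow> is_unit C (\<phi> e))"

definition star_monomorphism :: "'a cstar \<Rightarrow> 'b cstar \<Rightarrow> ('a \<Rightarrow> 'b) \<Rightarrow> bool" where
  "star_monomorphism A C \<phi> \<longleftrightarrow> linear_map_on A (carrier A) C \<phi> \<and> inj_on \<phi> (carrier A) \<and>
     (\<forall>x\<in>carrier A. \<forall>y\<in>carrier A. \<phi> (x \<otimes>\<^bsub>A\<^esub> y) = \<phi> x \<otimes>\<^bsub>C\<^esub> \<phi> y) \<and>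
     (\<forall>x\<in>carrier A. \<phi> (star A x) = star C (\<phi> x))"


section \<open>Injective envelopes\<close>

definition operator_system :: "'a cstar \<Rightarrow> 'a set \<Rightarrow> bool" where
  "operator_system F S \<longleftrightarrow> linear_subspace F S \<and> (\<forall>x\<in>S. star F x \<in> S) \<and> (\<forall>e. is_unit F e \<longrightarrow> e \<in> S)"

text \<open>Injectivity of a unital C*-algebra (Arveson, Hamana): completely positive maps into \<open>I\<close> extend
  from operator systems to the ambient unital C*-algebra. HOL cannot quantify over all C*-algebras
  of all types, so the type \<open>'u\<close> of the elements of the ambient algebras is a parameter.\<close>

definition injective_cstar :: "'u itself \<Rightarrow> 'i cstar \<Rightarrow> bool" where
  "injective_cstar U I \<longleftrightarrow> cstar_algebra I \<and> unital I \<and>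
     (\<forall>(F :: 'u cstar) S \<phi>. cstar_algebra F \<and> unital F \<and> operator_system F S \<and> cp_map_on F S I \<phi> \<longrightarrow>
        (\<exists>\<psi>. cp_map F I \<psi> \<and> (\<forall>x\<in>S. \<psi> x = \<phi> x)))"

text \<open>With the parameter chosen below, injectivity is no weaker than injectivity with respect to C*-algebras
  of every type: a C*-algebra \<open>I\<close> with elements of type \<open>'i\<close> acts faithfully on a Hilbert space of
  dimension at most the cardinality of \<open>'i\<close> (a sum of one cyclic representation for each element of
  \<open>I\<close>), so a copy of the algebra of all operators on that space, given by their matrices, has its
  carrier in \<open>'i \<Rightarrow> 'i \<Rightarrow> complex\<close>, hence also one in the type below. If the identity of \<open>I\<close> extends
  to a completely positive map from that algebra onto \<open>I\<close>, then \<open>I\<close> is injective by Arveson's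
  extension theorem.\<close>

definition injective_envelope_unital :: "'b cstar \<Rightarrow> 'i cstar \<Rightarrow> ('b \<Rightarrow> 'i) \<Rightarrow> bool" where
  "injective_envelope_unital B I \<iota> \<longleftrightarrow> cstar_algebra B \<and> unital B \<and>
     injective_cstar TYPE('b + 'i \<Rightarrow> 'b + 'i \<Rightarrow> complex) I \<and>
     star_monomorphism B I \<iota> \<and> unit_preserving B I \<iota> \<and>
     (\<forall>\<phi>. cp_map I I \<phi> \<and> unit_preserving I I \<phi> \<and> (\<forall>b\<in>carrier B. \<phi> (\<iota> b) = \<iota> b) \<longrightarrow>
          (\<forall>x\<in>carrier I. \<phi> x = x))"

text \<open>For non-unital \<open>B\<close>, \<open>\<iota>\<close> is the restriction to \<open>B\<close> of the embedding of the unitization.\<close>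

definition injective_envelope :: "'b cstar \<Rightarrow> 'i cstar \<Rightarrow> ('b \<Rightarrow> 'i) \<Rightarrow> bool" where
  "injective_envelope B I \<iota> \<longleftrightarrow> cstar_algebra B \<and>
     (if unital B then injective_envelope_unital B I \<iota>
      else (\<exists>\<kappa>. injective_envelope_unital (unitization B) I \<kappa> \<and> (\<forall>b\<in>carrier B. \<iota> b = \<kappa> (b, 0))))"


section \<open>Pseudo-expectations\<close>

definition pseudo_expectation ::
    "'a cstar \<Rightarrow> 'a set \<Rightarrow> 'i cstar \<Rightarrow> ('a \<Rightarrow> 'i) \<Rightarrow> ('a \<Rightarrow> 'i) \<Rightarrow> bool" where
  "pseudo_expectation A B I \<iota> \<Phi> \<longleftrightarrow> cp_map A I \<Phi> \<and>
     (\<forall>a\<in>carrier A. cnorm I (\<Phi> a) \<le> cnorm A a) \<and> (\<forall>b\<in>B. \<Phi> b = \<iota> b)"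

definition faithful_map :: "'a cstar \<Rightarrow> 'i cstar \<Rightarrow> ('a \<Rightarrow> 'i) \<Rightarrow> bool" where
  "faithful_map A I \<Phi> \<longleftrightarrow> (\<forall>a\<in>carrier A. \<Phi> (star A a \<otimes>\<^bsub>A\<^esub> a) = \<zero>\<^bsub>I\<^esub> \<longrightarrow> a = \<zero>\<^bsub>A\<^esub>)"

text \<open>The property is stated relative to a given injective envelope \<open>(I, \<iota>)\<close> of \<open>B\<close>; injective envelopes are
  unique up to isomorphism over \<open>B\<close> (and always exist, by Hamana), so it does not depend on the
  choice. Maps are taken in
  \<open>extensional (carrier A)\<close> to make uniqueness refer to their values on \<open>A\<close> only.\<close>

definition faithful_unique_pseudo_expectation ::
    "'a cstar \<Rightarrow> 'a set \<Rightarrow> 'i cstar \<Rightarrow> ('a \<Rightarrow> 'i) \<Rightarrow> bool" where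
  "faithful_unique_pseudo_expectation A B I \<iota> \<longleftrightarrow>
     cstar_inclusion A B \<and> injective_envelope (subalg A B) I \<iota> \<and>
     (\<exists>!\<Phi>. \<Phi> \<in> extensional (carrier A) \<and> pseudo_expectation A B I \<iota> \<Phi>) \<and>
     (\<forall>\<Phi>. pseudo_expectation A B I \<iota> \<Phi> \<longrightarrow> faithful_map A I \<Phi>)"

end

theory Submission
  imports Defs "HOL-Analysis.Analysis"
begin

text \<open>Call \<open>(A, B)\<close> essential if no nonzero closed ideal of \<open>A\<close> meets \<open>B\<close> trivially. For abelian \<open>A\<close> the
  faithful unique pseudo-expectation property is equivalent to essentiality. If \<open>K \<inter> B = 0\<close>, then \<open>B\<close> embeds
  into \<open>A/K\<close>, and injectivity of \<open>I(B)\<close> gives a pseudo-expectation that vanishes on \<open>K\<close>, so faithfulness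
  forces \<open>K = 0\<close>. Conversely, every pseudo-expectation \<open>\<Phi>\<close> is a \<open>B\<close>-bimodule map; in an essential inclusion the
  ideal \<open>{a. \<Phi>(ca) = 0 for all c}\<close> vanishes, so \<open>\<Phi>\<close> is faithful, and a similar ideal shows that \<open>\<Phi>\<close> is an order
  embedding. For a second pseudo-expectation \<open>\<Phi>'\<close>, the map \<open>\<Phi>' \<circ> \<Phi>\<^sup>-\<^sup>1\<close> on \<open>\<Phi>(A)\<close> therefore extends to \<open>I(B)\<close>, and
  rigidity of the envelope gives \<open>\<Phi> = \<Phi>'\<close>. Essentiality passes to the quotient by a regular ideal: if \<open>K\<close>
  contains \<open>J\<close> and \<open>K \<inter> B \<subseteq> J\<close>, then \<open>K \<inter> J\<^sup>\<bottom>\<close> meets \<open>B\<close> trivially, so \<open>K \<inter> J\<^sup>\<bottom> = 0\<close> and \<open>K \<subseteq> J\<^sup>\<bottom>\<^sup>\<bottom> = J\<close>.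

  Characters replace the Gelfand representation. They are obtained from the Kadison--Dubois theorem on
  Archimedean preorderings, applied to the hermitian elements with the real numbers adjoined.\<close>

section \<open>Archimedean preorderings of commutative rings\<close>

text \<open>Injectivity of the envelope is available only for ambient algebras whose elements have
  one prescribed type of complex functions, so \<open>A\<close>, its quotients and \<open>I\<close>
  cannot serve as ambient algebras themselves. Instead a family of characters, indexed by a type
  with an index for every element of \<open>A\<close> and of \<open>I\<close>, carries them into
  bounded functions. The envelope of an abelian algebra is itself abelian, which is deduced from
  rigidity; hence positivity can be checked character by character, and positive maps into
  \<open>I\<close> are completely positive. Units are the second obstacle. \<open>A\<close> and
  \<open>B\<close> may lack them while \<open>I\<close> has one, so the order arguments never add a
  scalar to an element of \<open>A\<close>: inequalities take the form
  \<open>0 \<le> Re (\<zeta> a) + z\<close>, with the number \<open>z\<close> kept outside, and the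
  zero functional remains among the characters. The Kadison--Dubois theorem yields characters from
  Zorn's lemma and from norm estimates that rest on the C*-identity, in place of a Gelfand--Mazur
  argument.\<close>

locale arch_preorder = cring R for R (structure) +
  fixes sc :: "real \<Rightarrow> 'a" and P :: "'a set"
  assumes sc_closed [simp, intro]: "sc r \<in> carrier R"
    and sc_add: "sc (r + s) = sc r \<oplus> sc s"
    and sc_mult: "sc (r * s) = sc r \<otimes> sc s"
    and sc_one: "sc 1 = \<one>"
    and P_carrier: "P \<subseteq> carrier R"
    and P_add: "\<lbrakk>x \<in> P; y \<in> P\<rbrakk> \<Longrightarrow> x \<oplus> y \<in> P"
    and P_mult: "\<lbrakk>x \<in> P; y \<in> P\<rbrakk> \<Longrightarrow> x \<otimes> y \<in> P"
    and P_square: "x \<in> carrier R \<Longrightarrow> x \<otimes> x \<in> P"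
    and archimedean: "x \<in> carrier R \<Longrightarrow> \<exists>r. sc r \<ominus> x \<in> P"
begin

lemma sc_zero: "sc 0 = \<zero>"
proof -
  have "sc 0 = sc 0 \<oplus> sc 0 \<ominus> sc 0"
    using sc_closed[of 0] by algebra
  also have "\<dots> = sc 0 \<ominus> sc 0"
    by (simp flip: sc_add)
  also have "\<dots> = \<zero>"
    using sc_closed[of 0] by algebra
  finally show ?thesis .
qed

lemma sc_minus: "sc (- r) = \<ominus> sc r"
proof -
  have "sc (- r) \<oplus> sc r = \<zero>"
    by (simp flip: sc_add add: sc_zero)
  then show ?thesis
    by (simp add: minus_equality)
qed

lemma sc_diff: "sc (r - s) = sc r \<ominus> sc s"
  using sc_add[of r "- s"] by (simp add: sc_minus a_minus_def)

lemma sc_nonneg: "0 \<le> r \<Longrightarrow> sc r \<in> P"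
  using P_square[of "sc (sqrt r)"] by (simp flip: sc_mult)

text \<open>Squares belong to \<open>Q\<close> because they belong to \<open>P\<close>. Properness,
  that is \<open>\<ominus> \<one> \<notin> Q\<close>, is kept as a separate condition so that
  \<open>adjoin\<close> can be formed freely.\<close>

definition preordering :: "'a set \<Rightarrow> bool" where
  "preordering Q \<longleftrightarrow> P \<subseteq> Q \<and> Q \<subseteq> carrier R \<and>
     (\<forall>x\<in>Q. \<forall>y\<in>Q. x \<oplus> y \<in> Q \<and> x \<otimes> y \<in> Q)"

text \<open>For a preordering \<open>Q\<close> this is the preordering generated by \<open>Q\<close>
  and \<open>a\<close>: as \<open>a \<otimes> a\<close> lies in \<open>P\<close>, higher powers of
  \<open>a\<close> reduce to degree at most one.\<close>

definition adjoin :: "'a set \<Rightarrow> 'a \<Rightarrow> 'a set" where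
  "adjoin Q a = {x. \<exists>q\<in>Q. \<exists>p\<in>Q. x = q \<oplus> a \<otimes> p}"

lemma preordering_adjoin:
  assumes Q: "preordering Q" and a: "a \<in> carrier R"
  shows "preordering (adjoin Q a)" and "Q \<subseteq> adjoin Q a" and "a \<in> adjoin Q a"
proof -
  have z: "\<zero> \<in> Q" and o: "\<one> \<in> Q"
    using Q sc_nonneg[of 0] sc_nonneg[of 1] by (auto simp: preordering_def sc_zero sc_one)
  have Qc: "x \<in> carrier R" if "x \<in> Q" for x
    using Q that by (auto simp: preordering_def)
  show sub: "Q \<subseteq> adjoin Q a"
  proof
    fix q assume q: "q \<in> Q"
    have "q = q \<oplus> a \<otimes> \<zero>"
      using q a Qc by simp
    then show "q \<in> adjoin Q a"
      unfolding adjoin_def using q z by blast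
  qed
  have "a = \<zero> \<oplus> a \<otimes> \<one>"
    using a by simp
  then show "a \<in> adjoin Q a"
    unfolding adjoin_def using z o by blast
  have "a \<otimes> a \<in> Q"
    using P_square[OF a] Q by (auto simp: preordering_def)
  moreover have "x \<oplus> y \<in> adjoin Q a \<and> x \<otimes> y \<in> adjoin Q a"
    if xy: "x \<in> adjoin Q a" "y \<in> adjoin Q a" and aa: "a \<otimes> a \<in> Q" for x y
  proof -
    obtain q p where x: "q \<in> Q" "p \<in> Q" "x = q \<oplus> a \<otimes> p"
      using xy by (auto simp: adjoin_def)
    obtain q' p' where y: "q' \<in> Q" "p' \<in> Q" "y = q' \<oplus> a \<otimes> p'"
      using xy by (auto simp: adjoin_def)
    note c = Qc[OF x(1)] Qc[OF x(2)] Qc[OF y(1)] Qc[OF y(2)] a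
    have 1: "x \<oplus> y = (q \<oplus> q') \<oplus> a \<otimes> (p \<oplus> p')"
      unfolding x(3) y(3) using c by algebra
    have 2: "x \<otimes> y = (q \<otimes> q' \<oplus> (a \<otimes> a) \<otimes> (p \<otimes> p')) \<oplus> a \<otimes> (q \<otimes> p' \<oplus> p \<otimes> q')"
      unfolding x(3) y(3) using c by algebra
    have cl: "u \<oplus> v \<in> Q" "u \<otimes> v \<in> Q" if "u \<in> Q" "v \<in> Q" for u v
      using Q that by (auto simp: preordering_def)
    have "q \<oplus> q' \<in> Q" "p \<oplus> p' \<in> Q" "q \<otimes> q' \<oplus> (a \<otimes> a) \<otimes> (p \<otimes> p') \<in> Q" "q \<otimes> p' \<oplus> p \<otimes> q' \<in> Q"
      using x y aa by (simp_all add: cl)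
    then show ?thesis
      unfolding 1 2 adjoin_def by blast
  qed
  moreover have "adjoin Q a \<subseteq> carrier R"
    using Qc a by (auto simp: adjoin_def)
  ultimately show "preordering (adjoin Q a)"
    using sub Q unfolding preordering_def by blast
qed

text \<open>Zorn's lemma gives a preordering maximal among those that omit -1. It is total: if
  neither \<open>x\<close> nor \<open>\<ominus> x\<close> belongs to it, adjoining either one
  produces -1, and multiplying the two resulting equations writes -1 as an element of
  \<open>Q\<close>.\<close>

lemma maximal_preordering:
  assumes Q0: "preordering Q0" and proper: "\<ominus> \<one> \<notin> Q0"
  obtains Q where "preordering Q" "Q0 \<subseteq> Q" "\<ominus> \<one> \<notin> Q" "\<And>x. x \<in> carrier R \<Longrightarrow> x \<in> Q \<or> \<ominus> x \<in> Q"
proof -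
  let ?F = "{Q. preordering Q \<and> Q0 \<subseteq> Q \<and> \<ominus> \<one> \<notin> Q}"
  have "\<exists>M\<in>?F. \<forall>X\<in>?F. M \<subseteq> X \<longrightarrow> X = M"
  proof (rule subset_Zorn_nonempty)
    show "?F \<noteq> {}"
      using assms by auto
    fix \<C> assume ne: "\<C> \<noteq> {}" and ch: "subset.chain ?F \<C>"
    have mem: "preordering Q" "Q0 \<subseteq> Q" "\<ominus> \<one> \<notin> Q" if "Q \<in> \<C>" for Q
      using ch that by (auto simp: subset.chain_def)
    have "x \<oplus> y \<in> \<Union>\<C> \<and> x \<otimes> y \<in> \<Union>\<C>" if xy: "x \<in> \<Union>\<C>" "y \<in> \<Union>\<C>" for x y
    proof -
      obtain X Y where XY: "X \<in> \<C>" "x \<in> X" "Y \<in> \<C>" "y \<in> Y"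
        using xy by auto
      then have "X \<subseteq> Y \<or> Y \<subseteq> X"
        using ch by (auto simp: subset.chain_def)
      then obtain Z where "Z \<in> \<C>" "x \<in> Z" "y \<in> Z"
        using XY by auto
      then show ?thesis
        using mem(1)[of Z] unfolding preordering_def by blast
    qed
    moreover have "P \<subseteq> \<Union>\<C>" "\<Union>\<C> \<subseteq> carrier R" "Q0 \<subseteq> \<Union>\<C>"
      using ne mem by (fastforce simp: preordering_def)+
    ultimately show "\<Union>\<C> \<in> ?F"
      using mem(3) by (auto simp: preordering_def)
  qed
  then obtain Q where Q: "preordering Q" "Q0 \<subseteq> Q" "\<ominus> \<one> \<notin> Q"
    and max: "\<And>X. preordering X \<Longrightarrow> Q0 \<subseteq> X \<Longrightarrow> \<ominus> \<one> \<notin> X \<Longrightarrow> Q \<subseteq> X \<Longrightarrow> X = Q"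
    by auto
  have Qc: "x \<in> carrier R" if "x \<in> Q" for x
    using Q that by (auto simp: preordering_def)
  have cl: "u \<oplus> v \<in> Q" "u \<otimes> v \<in> Q" if "u \<in> Q" "v \<in> Q" for u v
    using Q that by (auto simp: preordering_def)
  have adj: "\<ominus> \<one> \<in> adjoin Q a" if "a \<in> carrier R" "a \<notin> Q" for a
    using max[of "adjoin Q a"] preordering_adjoin[OF Q(1) that(1)] Q(2) that(2) by auto
  have "x \<in> Q \<or> \<ominus> x \<in> Q" if x: "x \<in> carrier R" for x
  proof (rule ccontr)
    assume n: "\<not> ?thesis"
    obtain q p where qp: "q \<in> Q" "p \<in> Q" "\<ominus> \<one> = q \<oplus> x \<otimes> p"
      using adj[of x] x n by (auto simp: adjoin_def)
    obtain q' p' where qp': "q' \<in> Q" "p' \<in> Q" "\<ominus> \<one> = q' \<oplus> (\<ominus> x) \<otimes> p'"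
      using adj[of "\<ominus> x"] x n by (auto simp: adjoin_def)
    note c = Qc[OF qp(1)] Qc[OF qp(2)] Qc[OF qp'(1)] Qc[OF qp'(2)] x
    have e1: "x \<otimes> p = \<ominus> \<one> \<ominus> q"
      unfolding qp(3) using c by algebra
    have e2: "x \<otimes> p' = \<one> \<oplus> q'"
    proof -
      have "x \<otimes> p' = (q' \<oplus> \<one>) \<ominus> (q' \<oplus> (\<ominus> x) \<otimes> p') \<ominus> \<one>"
        using c by algebra
      also have "\<dots> = (q' \<oplus> \<one>) \<ominus> (\<ominus> \<one>) \<ominus> \<one>"
        by (simp only: qp'(3))
      also have "\<dots> = \<one> \<oplus> q'"
        using c by algebra
      finally show ?thesis .
    qed
    \<comment> \<open>From \<open>x p = - (1 + q)\<close> and \<open>x p' = 1 + q'\<close> the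
      product is \<open>- (1 + q) (1 + q')\<close>; moving \<open>q + q' + q q'\<close> to the other
      side leaves -1 as a sum of elements of \<open>Q\<close>.\<close>
    have "(x \<otimes> x) \<otimes> (p \<otimes> p') = (x \<otimes> p) \<otimes> (x \<otimes> p')"
      using c by algebra
    also have "\<dots> = \<ominus> \<one> \<ominus> q \<ominus> q' \<ominus> q \<otimes> q'"
      unfolding e1 e2 using c by algebra
    finally have e3: "(x \<otimes> x) \<otimes> (p \<otimes> p') = \<ominus> \<one> \<ominus> q \<ominus> q' \<ominus> q \<otimes> q'" .
    have "\<ominus> \<one> = (\<ominus> \<one> \<ominus> q \<ominus> q' \<ominus> q \<otimes> q') \<oplus> (q \<oplus> q' \<oplus> q \<otimes> q')"
      using c by algebra
    also have "\<dots> = (x \<otimes> x) \<otimes> (p \<otimes> p') \<oplus> (q \<oplus> q' \<oplus> q \<otimes> q')"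
      using e3 by simp
    also have "\<dots> \<in> Q"
    proof -
      have "x \<otimes> x \<in> Q"
        using P_square[OF x] Q(1) by (auto simp: preordering_def)
      then show ?thesis
        using qp(1,2) qp'(1,2) by (simp add: cl)
    qed
    finally show False
      using Q(3) by simp
  qed
  with Q show ?thesis
    using that by blast
qed

definition real_character :: "('a \<Rightarrow> real) \<Rightarrow> bool" where
  "real_character f \<longleftrightarrow>
     (\<forall>x\<in>carrier R. \<forall>y\<in>carrier R. f (x \<oplus> y) = f x + f y \<and> f (x \<otimes> y) = f x * f y) \<and>
     (\<forall>r. f (sc r) = r)"

text \<open>The functional is the Dedekind cut of a total preordering.\<close>

lemma real_character_of_total_preordering:
  assumes Q: "preordering Q" and proper: "\<ominus> \<one> \<notin> Q"
    and total: "\<And>x. x \<in> carrier R \<Longrightarrow> x \<in> Q \<or> \<ominus> x \<in> Q"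
  obtains f where "real_character f" "\<And>x. x \<in> Q \<Longrightarrow> 0 \<le> f x"
proof -
  have Qc: "x \<in> carrier R" if "x \<in> Q" for x
    using Q that by (auto simp: preordering_def)
  have cl: "u \<oplus> v \<in> Q" "u \<otimes> v \<in> Q" if "u \<in> Q" "v \<in> Q" for u v
    using Q that by (auto simp: preordering_def)
  have PQ: "x \<in> Q" if "x \<in> P" for x
    using Q that by (auto simp: preordering_def)
  \<comment> \<open>A negative scalar in \<open>Q\<close> could be rescaled by a positive one to
    -1.\<close>
  have scQ: "0 \<le> r" if "sc r \<in> Q" for r
  proof (rule ccontr)
    assume "\<not> 0 \<le> r"
    then have r: "r < 0"
      by simp
    have "sc (- 1 / r) \<otimes> sc r \<in> Q"
      using r by (intro cl(2)[OF PQ[OF sc_nonneg] that]) (simp add: divide_simps)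
    moreover have "sc (- 1 / r) \<otimes> sc r = sc (- 1)"
      using r by (simp flip: sc_mult)
    ultimately show False
      using proper by (simp add: sc_minus sc_one)
  qed
  \<comment> \<open>The slack \<open>e\<close> is essential: \<open>Q\<close> need not be closed, so
    \<open>sc c \<ominus> x\<close> itself may fail to lie in \<open>Q\<close> at the cut point
    \<open>c\<close>.\<close>
  define cut where "cut x c \<longleftrightarrow> (\<forall>e>0. sc (c + e) \<ominus> x \<in> Q \<and> x \<ominus> sc (c - e) \<in> Q)" for x c
  have cut_le: "c \<le> d" if "cut x c" "cut x d" "x \<in> carrier R" for x c d
  proof (rule field_le_epsilon)
    fix e :: real assume e: "0 < e"
    have "(x \<ominus> sc (c - e/2)) \<oplus> (sc (d + e/2) \<ominus> x) \<in> Q"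
      using that e by (intro cl) (auto simp: cut_def)
    also have "(x \<ominus> sc (c - e/2)) \<oplus> (sc (d + e/2) \<ominus> x) = sc (d + e/2) \<ominus> sc (c - e/2)"
      using that(3) by (simp add: a_minus_def a_ac r_neg1 r_neg2)
    also have "\<dots> = sc (d + e - c)"
      by (simp flip: sc_diff add: algebra_simps)
    finally show "c \<le> d + e"
      using scQ by force
  qed
  have cut_unique: "c = d" if "cut x c" "cut x d" "x \<in> carrier R" for x c d
    using cut_le[OF that] cut_le[OF that(2,1,3)] by simp
  have cut_ex: "\<exists>c. cut x c" if x: "x \<in> carrier R" for x
  proof -
    let ?L = "{r. sc r \<ominus> x \<in> Q}"
    have ne: "?L \<noteq> {}"
      using archimedean[OF x] PQ by auto
    obtain s where s: "sc s \<ominus> (\<ominus> x) \<in> Q"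
      using archimedean[of "\<ominus> x"] x PQ by auto
    have lower: "- s \<le> r" if "r \<in> ?L" for r
    proof -
      have "(sc r \<ominus> x) \<oplus> (sc s \<ominus> (\<ominus> x)) \<in> Q"
        using that s by (intro cl) auto
      also have "(sc r \<ominus> x) \<oplus> (sc s \<ominus> (\<ominus> x)) = sc r \<oplus> sc s"
        using x sc_closed[of r] sc_closed[of s] by algebra
      finally show ?thesis
        using scQ[of "r + s"] by (simp add: sc_add)
    qed
    have bdd: "bdd_below ?L"
      using lower by (auto simp: bdd_below_def)
    have "sc (Inf ?L + e) \<ominus> x \<in> Q \<and> x \<ominus> sc (Inf ?L - e) \<in> Q" if e: "e > 0" for e
    proof
      obtain r where r: "r \<in> ?L" "r < Inf ?L + e"
        using cInf_lessD[OF ne, of "Inf ?L + e"] e by auto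
      have "(sc r \<ominus> x) \<oplus> sc (Inf ?L + e - r) \<in> Q"
        using r by (intro cl PQ[OF sc_nonneg]) auto
      also have "(sc r \<ominus> x) \<oplus> sc (Inf ?L + e - r) = sc (Inf ?L + e) \<ominus> x"
        using sc_add[of r "Inf ?L + e - r"] x by (simp add: a_minus_def a_ac)
      finally show "sc (Inf ?L + e) \<ominus> x \<in> Q" .
      \<comment> \<open>Here totality enters: below the infimum the difference is not in
        \<open>Q\<close>, so its negative is.\<close>
      have "Inf ?L - e \<notin> ?L"
        using cInf_lower[OF _ bdd, of "Inf ?L - e"] e by auto
      then have "\<ominus> (sc (Inf ?L - e) \<ominus> x) \<in> Q"
        using total[of "sc (Inf ?L - e) \<ominus> x"] x by auto
      also have "\<ominus> (sc (Inf ?L - e) \<ominus> x) = x \<ominus> sc (Inf ?L - e)"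
        using x by (simp add: a_minus_def a_ac minus_add)
      finally show "x \<ominus> sc (Inf ?L - e) \<in> Q" .
    qed
    then show ?thesis
      unfolding cut_def by blast
  qed
  define f where "f x = (THE c. cut x c)" for x
  have cut_f: "cut x (f x)" if "x \<in> carrier R" for x
    unfolding f_def using cut_ex[OF that] cut_unique that by (blast intro: theI2)
  have f_eq: "f x = c" if "cut x c" "x \<in> carrier R" for x c
    using cut_unique cut_f that by blast
  have f_add: "f (x \<oplus> y) = f x + f y" if xy: "x \<in> carrier R" "y \<in> carrier R" for x y
  proof (rule f_eq)
    have "sc (f x + f y + e) \<ominus> (x \<oplus> y) \<in> Q \<and> (x \<oplus> y) \<ominus> sc (f x + f y - e) \<in> Q" if e: "e > 0" for e
    proof
      have "(sc (f x + e/2) \<ominus> x) \<oplus> (sc (f y + e/2) \<ominus> y) \<in> Q"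
        using cut_f xy e by (intro cl) (auto simp: cut_def)
      moreover have "sc (f x + f y + e) = sc (f x + e/2) \<oplus> sc (f y + e/2)"
        by (simp flip: sc_add add: algebra_simps)
      moreover have "sc (f x + e/2) \<oplus> sc (f y + e/2) \<ominus> (x \<oplus> y) = (sc (f x + e/2) \<ominus> x) \<oplus> (sc (f y + e/2) \<ominus> y)"
        using xy by (simp add: a_minus_def a_ac minus_add)
      ultimately show "sc (f x + f y + e) \<ominus> (x \<oplus> y) \<in> Q"
        by simp
      have "(x \<ominus> sc (f x - e/2)) \<oplus> (y \<ominus> sc (f y - e/2)) \<in> Q"
        using cut_f xy e by (intro cl) (auto simp: cut_def)
      moreover have "sc (f x + f y - e) = sc (f x - e/2) \<oplus> sc (f y - e/2)"
        by (simp flip: sc_add add: algebra_simps)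
      moreover have "(x \<oplus> y) \<ominus> (sc (f x - e/2) \<oplus> sc (f y - e/2)) = (x \<ominus> sc (f x - e/2)) \<oplus> (y \<ominus> sc (f y - e/2))"
        using xy by (simp add: a_minus_def a_ac minus_add)
      ultimately show "(x \<oplus> y) \<ominus> sc (f x + f y - e) \<in> Q"
        by simp
    qed
    then show "cut (x \<oplus> y) (f x + f y)"
      by (simp add: cut_def)
  qed (use xy in auto)
  have f_sc: "f (sc r) = r" for r
    by (rule f_eq) (auto simp: cut_def simp flip: sc_diff intro!: PQ sc_nonneg)
  have f_nonneg: "0 \<le> f x" if x: "x \<in> Q" for x
  proof (rule field_le_epsilon)
    fix e :: real assume e: "0 < e"
    have "(sc (f x + e) \<ominus> x) \<oplus> x \<in> Q"
      using x cut_f[of x] Qc e by (intro cl) (auto simp: cut_def)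
    also have "(sc (f x + e) \<ominus> x) \<oplus> x = sc (f x + e)"
      using Qc[OF x] by (simp add: a_minus_def a_assoc l_neg)
    finally show "0 \<le> f x + e"
      by (rule scQ)
  qed
  have f_diff: "f (x \<ominus> y) = f x - f y" if xy: "x \<in> carrier R" "y \<in> carrier R" for x y
  proof -
    have "x = (x \<ominus> y) \<oplus> y"
      using xy by algebra
    then show ?thesis
      using f_add[of "x \<ominus> y" y] xy by simp
  qed
  have f_mult_0: "f (x \<otimes> y) = 0" if x: "x \<in> carrier R" "f x = 0" and y: "y \<in> carrier R" for x y
  proof -
    obtain r1 r2 where r12: "sc r1 \<ominus> y \<in> Q" "sc r2 \<ominus> (\<ominus> y) \<in> Q"
      using archimedean[of y] archimedean[of "\<ominus> y"] y PQ by (metis a_inv_closed)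
    \<comment> \<open>A common bound for \<open>y\<close> and its negative, at least 1 so that
      \<open>d = e / r\<close> below is positive with \<open>d * r = e\<close>.\<close>
    define r where "r = max 1 (max r1 r2)"
    have "(sc r1 \<ominus> y) \<oplus> sc (r - r1) \<in> Q" "(sc r2 \<ominus> (\<ominus> y)) \<oplus> sc (r - r2) \<in> Q"
      using r12 by (simp_all add: cl(1) PQ sc_nonneg r_def)
    moreover have "(sc r1 \<ominus> y) \<oplus> sc (r - r1) = sc r \<ominus> y"
      using y sc_add[of r1 "r - r1"] by (simp add: a_minus_def a_ac)
    moreover have "(sc r2 \<ominus> (\<ominus> y)) \<oplus> sc (r - r2) = sc r \<oplus> y"
      using y sc_add[of r2 "r - r2"] by (simp add: a_minus_def a_ac)
    ultimately have ry: "sc r \<ominus> y \<in> Q" "sc r \<oplus> y \<in> Q"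
      by auto
    have le: "\<bar>f (x \<otimes> y)\<bar> \<le> e" if e: "0 < e" for e
    proof -
      define d where "d = e / r"
      have d: "0 < d" and dr: "d * r = e"
        using e by (auto simp: d_def r_def)
      have "sc (f x + d) \<ominus> x \<in> Q" "x \<ominus> sc (f x - d) \<in> Q"
        using cut_f[OF x(1)] d by (auto simp: cut_def)
      moreover have "x \<ominus> sc (f x - d) = sc d \<oplus> x"
        using x by (simp add: sc_minus a_minus_def a_ac)
      ultimately have dx: "sc d \<ominus> x \<in> Q" "sc d \<oplus> x \<in> Q"
        using x by auto
      \<comment> \<open>Both are sums of products of elements of \<open>Q\<close>. The mixed terms
        cancel, leaving twice \<open>d r - x y\<close> and twice \<open>d r + x y\<close>, whence
        \<open>\<bar>f (x \<otimes> y)\<bar> \<le> d r\<close>.\<close>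
      have "(sc d \<ominus> x) \<otimes> (sc r \<oplus> y) \<oplus> (sc d \<oplus> x) \<otimes> (sc r \<ominus> y) \<in> Q"
        "(sc d \<oplus> x) \<otimes> (sc r \<oplus> y) \<oplus> (sc d \<ominus> x) \<otimes> (sc r \<ominus> y) \<in> Q"
        using dx ry by (simp_all add: cl)
      moreover have "(sc d \<ominus> x) \<otimes> (sc r \<oplus> y) \<oplus> (sc d \<oplus> x) \<otimes> (sc r \<ominus> y)
          = (sc d \<otimes> sc r \<ominus> x \<otimes> y) \<oplus> (sc d \<otimes> sc r \<ominus> x \<otimes> y)"
        using x y sc_closed[of d] sc_closed[of r] by algebra
      moreover have "(sc d \<oplus> x) \<otimes> (sc r \<oplus> y) \<oplus> (sc d \<ominus> x) \<otimes> (sc r \<ominus> y)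
          = (sc d \<otimes> sc r \<oplus> x \<otimes> y) \<oplus> (sc d \<otimes> sc r \<oplus> x \<otimes> y)"
        using x y sc_closed[of d] sc_closed[of r] by algebra
      ultimately have "0 \<le> f ((sc e \<ominus> x \<otimes> y) \<oplus> (sc e \<ominus> x \<otimes> y))"
        "0 \<le> f ((sc e \<oplus> x \<otimes> y) \<oplus> (sc e \<oplus> x \<otimes> y))"
        using f_nonneg by (simp_all flip: sc_mult add: dr)
      then show ?thesis
        using x y by (simp add: f_add f_diff f_sc)
    qed
    show ?thesis
    proof (rule ccontr)
      assume "f (x \<otimes> y) \<noteq> 0"
      with le[of "\<bar>f (x \<otimes> y)\<bar> / 2"] show False
        by simp
    qed
  qed
  \<comment> \<open>The element \<open>x - f x\<close> has value 0, so \<open>f_mult_0\<close>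
    applies to its products. Scalar factors come first because \<open>f_mult\<close> meets
    \<open>y\<close> multiplied by the scalar \<open>f x\<close>.\<close>
  have f_scale: "f (x \<otimes> sc c) = f x * c" if x: "x \<in> carrier R" for x c
  proof -
    have "f ((x \<ominus> sc (f x)) \<otimes> sc c) = 0"
      using x by (intro f_mult_0) (auto simp: f_diff f_sc)
    moreover have "(x \<ominus> sc (f x)) \<otimes> sc c = x \<otimes> sc c \<ominus> sc (f x * c)"
      unfolding sc_mult using x sc_closed[of c] sc_closed[of "f x"] by algebra
    ultimately show ?thesis
      using x by (simp add: f_diff f_sc)
  qed
  have f_mult: "f (x \<otimes> y) = f x * f y" if x: "x \<in> carrier R" and y: "y \<in> carrier R" for x y
  proof -
    have "f ((x \<ominus> sc (f x)) \<otimes> y) = 0"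
      using x y by (intro f_mult_0) (auto simp: f_diff f_sc)
    moreover have "(x \<ominus> sc (f x)) \<otimes> y = x \<otimes> y \<ominus> y \<otimes> sc (f x)"
      using x y sc_closed[of "f x"] by algebra
    ultimately show ?thesis
      using x y by (simp add: f_diff f_scale)
  qed
  have "real_character f"
    unfolding real_character_def using f_add f_mult f_sc by blast
  then show ?thesis
    using that f_nonneg by blast
qed

text \<open>The Kadison--Dubois theorem. If adjoining \<open>\<ominus> k\<close> to \<open>P\<close>
  gave a proper preordering, a total one above it would provide a character with
  \<open>f k \<le> 0\<close>. Hence -1 lies in the adjunction, that is \<open>t k = 1 + q\<close>
  with \<open>q\<close> and \<open>t\<close> in \<open>P\<close>. The archimedean axiom gives
  \<open>k + r \<in> P\<close> for some \<open>r\<close>, and \<open>t\<close> allows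
  \<open>r\<close> to be lowered until it reaches 0.\<close>

lemma positive_if_positive_at_characters:
  assumes k: "k \<in> carrier R"
    and pos: "\<And>f. \<lbrakk>real_character f; \<And>x. x \<in> P \<Longrightarrow> 0 \<le> f x\<rbrakk> \<Longrightarrow> 0 < f k"
  shows "k \<in> P"
proof -
  have PP: "preordering P"
    using P_carrier P_add P_mult by (auto simp: preordering_def)
  have Pc: "x \<in> carrier R" if "x \<in> P" for x
    using P_carrier that by auto
  note pre = preordering_adjoin[OF PP, of "\<ominus> k"]
  have "\<ominus> \<one> \<in> adjoin P (\<ominus> k)"
  proof (rule ccontr)
    assume "\<ominus> \<one> \<notin> adjoin P (\<ominus> k)"
    then obtain Q where Q: "preordering Q" "adjoin P (\<ominus> k) \<subseteq> Q" "\<ominus> \<one> \<notin> Q"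
      "\<And>x. x \<in> carrier R \<Longrightarrow> x \<in> Q \<or> \<ominus> x \<in> Q"
      using maximal_preordering[of "adjoin P (\<ominus> k)"] pre k by auto
    obtain f where f: "real_character f" "\<And>x. x \<in> Q \<Longrightarrow> 0 \<le> f x"
      using real_character_of_total_preordering[OF Q(1,3,4)] by auto
    have "0 < f k"
      using pos[OF f(1)] f(2) Q(1) by (auto simp: preordering_def)
    moreover have "0 \<le> f (\<ominus> k)"
      using f(2) Q(2) pre(3) k by auto
    moreover have "f (k \<oplus> \<ominus> k) = f k + f (\<ominus> k)" "f \<zero> = 0"
      using f(1) k a_inv_closed[OF k] unfolding real_character_def by (blast, metis sc_zero)
    ultimately show False
      using k by (simp add: r_neg)
  qed
  then obtain q t where qt: "q \<in> P" "t \<in> P" "\<ominus> \<one> = q \<oplus> (\<ominus> k) \<otimes> t"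
    by (auto simp: adjoin_def)
  have qtc: "q \<in> carrier R" "t \<in> carrier R"
    using qt Pc by auto
  have tk: "t \<otimes> k \<ominus> \<one> = q"
  proof -
    have "t \<otimes> k \<ominus> \<one> = t \<otimes> k \<oplus> (q \<oplus> (\<ominus> k) \<otimes> t)"
      using qt(3) by (simp add: a_minus_def)
    also have "\<dots> = q"
      using qtc k by algebra
    finally show ?thesis .
  qed
  obtain n1 n2 r0 where n: "sc n1 \<ominus> t \<in> P" "sc n2 \<ominus> t \<otimes> t \<otimes> k \<in> P" "sc r0 \<ominus> (\<ominus> k) \<in> P"
    using archimedean[of t] archimedean[of "t \<otimes> t \<otimes> k"] archimedean[of "\<ominus> k"] qtc k
    by (metis a_inv_closed m_closed)
  \<comment> \<open>Large enough for the two upper bounds that the identity below uses: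
    \<open>2 n\<close> for \<open>t\<close> and \<open>2 n - 1\<close> for
    \<open>t^2 k\<close>.\<close>
  define n where "n = max 1 (max n1 (n2 + 1))"
  have enlarge: "sc c' \<ominus> x \<in> P" if "sc c \<ominus> x \<in> P" "c \<le> c'" "x \<in> carrier R" for c c' x
  proof -
    have "(sc c \<ominus> x) \<oplus> sc (c' - c) \<in> P"
      using that by (intro P_add sc_nonneg) auto
    then show ?thesis
      using that sc_add[of c "c' - c"] by (simp add: a_minus_def a_ac)
  qed
  have n_bounds: "n1 \<le> 2 * n" "n2 \<le> 2 * n - 1" "0 < n"
    unfolding n_def by (auto simp: max_def)
  have n_t: "sc (2 * n) \<ominus> t \<in> P" and n_ttk: "sc (2 * n - 1) \<ominus> t \<otimes> t \<otimes> k \<in> P"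
    using enlarge[OF n(1), of "2 * n"] enlarge[OF n(2), of "2 * n - 1"] qtc k n_bounds by simp_all
  text \<open>Woermann's identity lets the bound \<open>k \<ge> -r\<close> be improved by a fixed amount.\<close>
  have step: "k \<oplus> sc (r - 1 / n\<^sup>2) \<in> P" if r: "0 \<le> r" "k \<oplus> sc r \<in> P" for r
  proof -
    \<comment> \<open>With \<open>N = n\<close> and \<open>s = r\<close> each of the four summands
      on the left lies in \<open>P\<close>: a square times \<open>k + r\<close>, then
      \<open>2 n\<close> times \<open>t k - 1 = q\<close>, and two terms controlled by the upper
      bounds for \<open>t\<close> and \<open>t^2 k\<close>. Dividing the right side by
      \<open>n^2\<close> lowers the bound by \<open>1 / n^2\<close>.\<close>
    have id: "(N \<ominus> t) \<otimes> (N \<ominus> t) \<otimes> (k \<oplus> s) \<oplus> ((N \<oplus> N) \<otimes> t \<otimes> k \<ominus> (N \<oplus> N))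
        \<oplus> s \<otimes> t \<otimes> ((N \<oplus> N) \<ominus> t) \<oplus> ((N \<oplus> N) \<ominus> \<one> \<ominus> t \<otimes> t \<otimes> k)
        = N \<otimes> N \<otimes> (k \<oplus> s) \<ominus> \<one>"
      if "N \<in> carrier R" "s \<in> carrier R" for N s
      using that qtc k by algebra
    have N1: "(N \<oplus> N) \<otimes> t \<otimes> k \<ominus> (N \<oplus> N) = (N \<oplus> N) \<otimes> (t \<otimes> k \<ominus> \<one>)"
      if "N \<in> carrier R" for N
      using that qtc k by (simp add: r_distr a_minus_def r_minus m_assoc)
    have NN: "sc n \<oplus> sc n = sc (2 * n)" "sc (2 * n - 1) = sc n \<oplus> sc n \<ominus> \<one>"
      by (simp_all flip: sc_add sc_one sc_diff)
    have n0: "n > 0"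
      by (auto simp: n_def)
    have "sc n \<otimes> sc n \<otimes> (k \<oplus> sc r) \<ominus> \<one> \<in> P"
    proof (subst id[symmetric])
      have "(sc n \<ominus> t) \<otimes> (sc n \<ominus> t) \<in> P" "sc (2 * n) \<in> P" "sc r \<in> P"
        using qtc n0 r by (auto intro: P_square sc_nonneg)
      then show "(sc n \<ominus> t) \<otimes> (sc n \<ominus> t) \<otimes> (k \<oplus> sc r) \<oplus> ((sc n \<oplus> sc n) \<otimes> t \<otimes> k \<ominus> (sc n \<oplus> sc n))
        \<oplus> sc r \<otimes> t \<otimes> ((sc n \<oplus> sc n) \<ominus> t) \<oplus> ((sc n \<oplus> sc n) \<ominus> \<one> \<ominus> t \<otimes> t \<otimes> k) \<in> P"
        using r qt n_t n_ttk unfolding N1[OF sc_closed] tk NN(2)[symmetric] unfolding NN(1)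
        by (simp add: P_add P_mult)
    qed auto
    then have "sc (1 / n\<^sup>2) \<otimes> (sc n \<otimes> sc n \<otimes> (k \<oplus> sc r) \<ominus> \<one>) \<in> P"
      by (simp add: P_mult sc_nonneg)
    also have "sc (1 / n\<^sup>2) \<otimes> (sc n \<otimes> sc n \<otimes> (k \<oplus> sc r) \<ominus> \<one>)
        = (sc (1 / n\<^sup>2) \<otimes> (sc n \<otimes> sc n)) \<otimes> (k \<oplus> sc r) \<ominus> sc (1 / n\<^sup>2)"
      using k sc_closed[of n] sc_closed[of r] sc_closed[of "1 / n\<^sup>2"] by algebra
    also have "sc (1 / n\<^sup>2) \<otimes> (sc n \<otimes> sc n) = \<one>"
      using n0 by (simp flip: sc_mult sc_one add: power2_eq_square)
    also have "\<one> \<otimes> (k \<oplus> sc r) \<ominus> sc (1 / n\<^sup>2) = k \<oplus> sc (r - 1 / n\<^sup>2)"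
      using k by (simp add: sc_diff a_minus_def a_ac)
    finally show ?thesis .
  qed
  \<comment> \<open>The gain \<open>1 / n^2\<close> does not depend on \<open>r\<close>, so finitely
    many steps suffice; once the bound is negative, adding a nonnegative scalar puts
    \<open>k\<close> itself into \<open>P\<close>.\<close>
  have descent: "k \<in> P \<or> k \<oplus> sc (r0 - real m / n\<^sup>2) \<in> P" for m
  proof (induction m)
    case 0
    then show ?case
      using n(3) k by (simp add: a_minus_def a_ac)
  next
    case (Suc m)
    show ?case
    proof (cases "k \<in> P \<or> 0 \<le> r0 - real m / n\<^sup>2")
      case True
      then show ?thesis
        using Suc step[of "r0 - real m / n\<^sup>2"] by (auto simp: add_divide_distrib algebra_simps)
    next
      case False
      with Suc have "(k \<oplus> sc (r0 - real m / n\<^sup>2)) \<oplus> sc (- (r0 - real m / n\<^sup>2)) \<in> P"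
        by (simp add: P_add sc_nonneg)
      then show ?thesis
        using k by (simp add: a_assoc sc_zero flip: sc_add)
    qed
  qed
  obtain m :: nat where "r0 * n\<^sup>2 \<le> real m"
    using real_arch_simple by blast
  moreover have "n > 0"
    by (auto simp: n_def)
  ultimately have m: "r0 - real m / n\<^sup>2 \<le> 0"
    by (simp add: divide_simps)
  show ?thesis
  proof (rule ccontr)
    assume "k \<notin> P"
    with descent[of m] have "(k \<oplus> sc (r0 - real m / n\<^sup>2)) \<oplus> sc (- (r0 - real m / n\<^sup>2)) \<in> P"
      using m \<open>k \<notin> P\<close> by (simp add: P_add sc_nonneg)
    then show False
      using k \<open>k \<notin> P\<close> by (simp add: a_assoc sc_zero flip: sc_add)
  qed
qed

end

section \<open>Elementary facts about C*-algebras\<close>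

context cstar_algebra
begin

lemmas closed_rules [simp, intro] = mult_closed smult_closed star_closed

lemma double_eq_imp_zero: "\<lbrakk>u \<in> carrier A; u \<oplus> u = u\<rbrakk> \<Longrightarrow> u = \<zero>"
  by (metis a_assoc a_inv_closed r_neg r_zero)

lemma smult_zero_left [simp]: "x \<in> carrier A \<Longrightarrow> 0 \<odot> x = \<zero>"
  using smult_add_left[of x 0 0] by (intro double_eq_imp_zero) auto

lemma smult_zero_right [simp]: "c \<odot> \<zero> = \<zero>"
  using smult_add_right[of \<zero> \<zero> c] by (intro double_eq_imp_zero) auto

lemma mult_zero_left [simp]: "x \<in> carrier A \<Longrightarrow> \<zero> \<otimes> x = \<zero>"
  using distrib_right[of \<zero> \<zero> x] by (intro double_eq_imp_zero) auto

lemma mult_zero_right [simp]: "x \<in> carrier A \<Longrightarrow> x \<otimes> \<zero> = \<zero>"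
  using distrib_left[of x \<zero> \<zero>] by (intro double_eq_imp_zero) auto

lemma star_zero [simp]: "star A \<zero> = \<zero>"
  using star_add[of \<zero> \<zero>] by (intro double_eq_imp_zero) auto

lemma a_inv_eq_smult: "x \<in> carrier A \<Longrightarrow> \<ominus> x = (- 1) \<odot> x"
  using smult_add_left[of x "- 1" 1] by (intro minus_equality) (auto simp: smult_one)

lemma smult_minus_one_add: "x \<in> carrier A \<Longrightarrow> (- 1) \<odot> x \<oplus> x = \<zero>"
  using a_inv_eq_smult l_neg by simp

lemma minus_eq_smult: "\<lbrakk>x \<in> carrier A; y \<in> carrier A\<rbrakk> \<Longrightarrow> x \<ominus> y = x \<oplus> (- 1) \<odot> y"
  by (simp add: a_minus_def a_inv_eq_smult)

lemma mult_diff_left: "\<lbrakk>x \<in> carrier A; y \<in> carrier A; z \<in> carrier A\<rbrakk> \<Longrightarrow> x \<otimes> (y \<ominus> z) = x \<otimes> y \<ominus> x \<otimes> z"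
  by (simp add: minus_eq_smult distrib_left smult_mult_right)

lemma mult_diff_right: "\<lbrakk>x \<in> carrier A; y \<in> carrier A; z \<in> carrier A\<rbrakk> \<Longrightarrow> (y \<ominus> z) \<otimes> x = y \<otimes> x \<ominus> z \<otimes> x"
  by (simp add: minus_eq_smult distrib_right smult_mult_left)

lemma smult_diff: "\<lbrakk>x \<in> carrier A; y \<in> carrier A\<rbrakk> \<Longrightarrow> c \<odot> (x \<ominus> y) = c \<odot> x \<ominus> c \<odot> y"
  by (simp add: minus_eq_smult smult_add_right flip: smult_smult)

lemma star_diff: "\<lbrakk>x \<in> carrier A; y \<in> carrier A\<rbrakk> \<Longrightarrow> star A (x \<ominus> y) = star A x \<ominus> star A y"
  by (simp add: minus_eq_smult star_add star_smult)

lemma diff_eq_zero_iff: "\<lbrakk>x \<in> carrier A; y \<in> carrier A\<rbrakk> \<Longrightarrow> x \<ominus> y = \<zero> \<longleftrightarrow> x = y"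
  by (metis a_minus_def minus_equality minus_minus r_neg a_inv_closed)

lemma diff_self [simp]: "x \<in> carrier A \<Longrightarrow> x \<ominus> x = \<zero>"
  by (simp add: diff_eq_zero_iff)

lemma cnorm_zero [simp]: "cnorm A \<zero> = 0"
  by (simp add: cnorm_eq_zero)

lemma cnorm_a_inv [simp]: "x \<in> carrier A \<Longrightarrow> cnorm A (\<ominus> x) = cnorm A x"
  by (simp add: a_inv_eq_smult cnorm_smult)

lemma cnorm_diff_le: "\<lbrakk>x \<in> carrier A; y \<in> carrier A\<rbrakk> \<Longrightarrow> cnorm A (x \<ominus> y) \<le> cnorm A x + cnorm A y"
  using cnorm_triangle[of x "\<ominus> y"] by (simp add: a_minus_def)

lemma diff_split: "\<lbrakk>x \<in> carrier A; y \<in> carrier A; z \<in> carrier A\<rbrakk> \<Longrightarrow> x \<ominus> z = (x \<ominus> y) \<oplus> (y \<ominus> z)"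
  by (simp add: a_minus_def a_assoc r_neg1 r_neg2)

lemma a_inv_diff: "\<lbrakk>x \<in> carrier A; y \<in> carrier A\<rbrakk> \<Longrightarrow> \<ominus> (x \<ominus> y) = y \<ominus> x"
  by (simp add: a_minus_def minus_add a_comm)

lemma cnorm_diff_commute: "\<lbrakk>x \<in> carrier A; y \<in> carrier A\<rbrakk> \<Longrightarrow> cnorm A (x \<ominus> y) = cnorm A (y \<ominus> x)"
  by (metis a_inv_diff cnorm_a_inv minus_closed)

lemma cnorm_diff_triangle:
  "\<lbrakk>x \<in> carrier A; y \<in> carrier A; z \<in> carrier A\<rbrakk> \<Longrightarrow> cnorm A (x \<ominus> z) \<le> cnorm A (x \<ominus> y) + cnorm A (y \<ominus> z)"
  using cnorm_triangle[of "x \<ominus> y" "y \<ominus> z"] by (simp flip: diff_split)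

lemma cnorm_star [simp]:
  assumes x: "x \<in> carrier A"
  shows "cnorm A (star A x) = cnorm A x"
proof -
  have "cnorm A y \<le> cnorm A (star A y)" if y: "y \<in> carrier A" for y
  proof -
    have "(cnorm A y)\<^sup>2 \<le> cnorm A (star A y) * cnorm A y"
      using cnorm_mult[of "star A y" y] y by (simp add: cnorm_star_mult)
    then show ?thesis
      using cnorm_nonneg[of y] cnorm_nonneg[of "star A y"] y
      by (cases "cnorm A y = 0") (auto simp: power2_eq_square)
  qed
  from this[of x] this[of "star A x"] show ?thesis
    using x by (simp add: star_star)
qed

lemma limit_unique:
  assumes "\<And>n. X n \<in> carrier A" "x \<in> carrier A" "y \<in> carrier A"
    and "(\<lambda>n. cnorm A (X n \<ominus> x)) \<longlonglongrightarrow> 0" "(\<lambda>n. cnorm A (X n \<ominus> y)) \<longlonglongrightarrow> 0"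
  shows "x = y"
proof -
  have "(\<lambda>n. cnorm A (X n \<ominus> x) + cnorm A (X n \<ominus> y)) \<longlonglongrightarrow> 0"
    using tendsto_add[OF assms(4,5)] by simp
  moreover have "cnorm A (x \<ominus> y) \<le> cnorm A (X n \<ominus> x) + cnorm A (X n \<ominus> y)" for n
    using cnorm_diff_triangle[of x "X n" y] cnorm_diff_commute[of x "X n"] assms by simp
  ultimately have "cnorm A (x \<ominus> y) \<le> 0"
    by (intro LIMSEQ_le_const) auto
  then have "cnorm A (x \<ominus> y) = 0"
    using cnorm_nonneg[of "x \<ominus> y"] assms by simp
  then show ?thesis
    using assms by (simp add: cnorm_eq_zero diff_eq_zero_iff)
qed

text \<open>Comparison with the increments of a convergent real sequence gives the Cauchy property
  directly, without summing a series. It serves for the Neumann series in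
  \<open>chars_cnorm_le\<close> and for the step-by-step lifting in
  \<open>lift_limit\<close>.\<close>

lemma complete_telescoping:
  assumes X: "\<And>n. X n \<in> carrier A"
    and step: "\<And>n. cnorm A (X (Suc n) \<ominus> X n) \<le> t (Suc n) - t n"
    and t: "convergent t"
  obtains x where "x \<in> carrier A" "(\<lambda>n. cnorm A (X n \<ominus> x)) \<longlonglongrightarrow> 0"
proof -
  have le: "cnorm A (X (n + k) \<ominus> X n) \<le> t (n + k) - t n" for n k
  proof (induction k)
    case (Suc k)
    have "cnorm A (X (n + Suc k) \<ominus> X n) \<le> cnorm A (X (Suc (n + k)) \<ominus> X (n + k)) + cnorm A (X (n + k) \<ominus> X n)"
      using cnorm_diff_triangle[of "X (Suc (n + k))" "X (n + k)" "X n"] X by simp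
    also have "\<dots> \<le> t (n + Suc k) - t n"
      using step[of "n + k"] Suc by simp
    finally show ?case .
  qed (use X in simp)
  have "\<exists>N. \<forall>m\<ge>N. \<forall>n\<ge>N. cnorm A (X m \<ominus> X n) < e" if e: "0 < e" for e
  proof -
    obtain N where N: "\<And>m n. m \<ge> N \<Longrightarrow> n \<ge> N \<Longrightarrow> \<bar>t m - t n\<bar> < e"
      using convergent_Cauchy[OF t] e unfolding Cauchy_def dist_real_def by metis
    have "cnorm A (X m \<ominus> X n) < e" if "m \<ge> N" "n \<ge> N" for m n
    proof (cases "n \<le> m")
      case True
      then have "cnorm A (X m \<ominus> X n) \<le> t m - t n"
        using le[of n "m - n"] by simp
      also have "\<dots> < e"
        using N[OF that] by simp
      finally show ?thesis .
    next
      case False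
      then have "cnorm A (X m \<ominus> X n) \<le> t n - t m"
        using le[of m "n - m"] cnorm_diff_commute[of "X m" "X n"] X by simp
      also have "\<dots> < e"
        using N[OF that] by simp
      finally show ?thesis .
    qed
    then show ?thesis
      by blast
  qed
  with complete[of X] X show ?thesis
    using that by blast
qed

end

section \<open>The ordered ring of hermitian elements with adjoined reals\<close>

locale comm_cstar = cstar_algebra +
  assumes abelian: "abelian A"
begin

lemma mult_comm: "\<lbrakk>x \<in> carrier A; y \<in> carrier A\<rbrakk> \<Longrightarrow> x \<otimes> y = y \<otimes> x"
  using abelian by (simp add: abelian_def)

text \<open>The real part of the unitization: a pair stands for \<open>a + z\<close> with
  \<open>a\<close> hermitian. It is only a ring; sizes are measured through its action on
  \<open>A\<close>. A unit is adjoined even if \<open>A\<close> has one, so this action may have a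
  kernel, and positivity of ring elements is a preordering rather than a partial order.\<close>

definition herm :: "('a \<times> real) ring" where
  "herm = \<lparr>carrier = {a \<in> carrier A. star A a = a} \<times> UNIV,
     monoid.mult = (\<lambda>(a, z) (b, w). (a \<otimes> b \<oplus> complex_of_real z \<odot> b \<oplus> complex_of_real w \<odot> a, z * w)),
     one = (\<zero>, 1), zero = (\<zero>, 0),
     add = (\<lambda>(a, z) (b, w). (a \<oplus> b, z + w))\<rparr>"

lemma herm_simps:
  "(a, z) \<in> carrier herm \<longleftrightarrow> a \<in> carrier A \<and> star A a = a"
  "(a, z) \<otimes>\<^bsub>herm\<^esub> (b, w) = (a \<otimes> b \<oplus> complex_of_real z \<odot> b \<oplus> complex_of_real w \<odot> a, z * w)"
  "(a, z) \<oplus>\<^bsub>herm\<^esub> (b, w) = (a \<oplus> b, z + w)"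
  "\<one>\<^bsub>herm\<^esub> = (\<zero>, 1)" "\<zero>\<^bsub>herm\<^esub> = (\<zero>, 0)"
  by (simp_all add: herm_def)

lemma cring_herm: "cring herm"
proof (rule cringI)
  show "abelian_group herm"
  proof (rule abelian_groupI)
    show "\<exists>y\<in>carrier herm. y \<oplus>\<^bsub>herm\<^esub> x = \<zero>\<^bsub>herm\<^esub>" if "x \<in> carrier herm" for x
    proof (cases x)
      case (Pair a z)
      then show ?thesis
        using that by (intro bexI[of _ "((- 1) \<odot> a, - z)"])
          (auto simp: herm_simps star_smult simp del: a_inv_closed intro!: smult_minus_one_add)
    qed
  qed (auto simp: herm_simps star_add a_ac)
  show "comm_monoid herm"
  proof (rule comm_monoidI)
    fix x y z assume "x \<in> carrier herm" "y \<in> carrier herm" "z \<in> carrier herm"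
    then show "x \<otimes>\<^bsub>herm\<^esub> y \<otimes>\<^bsub>herm\<^esub> z = x \<otimes>\<^bsub>herm\<^esub> (y \<otimes>\<^bsub>herm\<^esub> z)"
      by (cases x; cases y; cases z)
        (auto simp: herm_simps distrib_left distrib_right smult_add_right smult_mult_left smult_mult_right
            mult_assoc a_ac mult.commute simp flip: smult_smult)
  qed (auto simp: herm_simps star_add star_mult star_smult mult_comm a_ac smult_one)
qed (auto simp: herm_simps distrib_right smult_add_left smult_add_right algebra_simps a_ac)

sublocale herm: cring herm
  by (rule cring_herm)

definition act :: "'a \<times> real \<Rightarrow> 'a \<Rightarrow> 'a" where
  "act u x = fst u \<otimes> x \<oplus> complex_of_real (snd u) \<odot> x"

lemma act_closed [simp, intro]: "\<lbrakk>u \<in> carrier herm; x \<in> carrier A\<rbrakk> \<Longrightarrow> act u x \<in> carrier A"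
  by (cases u) (auto simp: act_def herm_simps)

lemma act_mult: "\<lbrakk>u \<in> carrier herm; v \<in> carrier herm; x \<in> carrier A\<rbrakk> \<Longrightarrow> act (u \<otimes>\<^bsub>herm\<^esub> v) x = act u (act v x)"
  by (cases u; cases v)
    (auto simp: act_def herm_simps distrib_left distrib_right smult_add_right smult_mult_left
       smult_mult_right mult_assoc a_ac simp flip: smult_smult)

lemma act_add: "\<lbrakk>u \<in> carrier herm; v \<in> carrier herm; x \<in> carrier A\<rbrakk> \<Longrightarrow> act (u \<oplus>\<^bsub>herm\<^esub> v) x = act u x \<oplus> act v x"
  by (cases u; cases v) (auto simp: act_def herm_simps distrib_right smult_add_left a_ac)

lemma act_real: "x \<in> carrier A \<Longrightarrow> act (\<zero>, r) x = complex_of_real r \<odot> x"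
  by (simp add: act_def)

lemma act_star: "\<lbrakk>u \<in> carrier herm; x \<in> carrier A\<rbrakk> \<Longrightarrow> star A (act u x) = act u (star A x)"
  by (cases u) (auto simp: act_def herm_simps star_add star_mult star_smult mult_comm)

lemma act_mult_left: "\<lbrakk>u \<in> carrier herm; x \<in> carrier A; y \<in> carrier A\<rbrakk> \<Longrightarrow> act u x \<otimes> y = act u (x \<otimes> y)"
  by (cases u) (auto simp: act_def herm_simps distrib_right smult_mult_left mult_assoc)

lemma act_mult_right: "\<lbrakk>u \<in> carrier herm; x \<in> carrier A; y \<in> carrier A\<rbrakk> \<Longrightarrow> x \<otimes> act u y = act u (x \<otimes> y)"
  by (metis act_mult_left act_closed mult_comm)

text \<open>An upper bound for the operator norm of \<open>u\<close>, kept as a relation: no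
  supremum is formed, and estimates compose by adding and multiplying bounds.\<close>

definition bd :: "'a \<times> real \<Rightarrow> real \<Rightarrow> bool" where
  "bd u C \<longleftrightarrow> (\<forall>x\<in>carrier A. cnorm A (act u x) \<le> C * cnorm A x)"

lemma bdD: "\<lbrakk>bd u C; x \<in> carrier A\<rbrakk> \<Longrightarrow> cnorm A (act u x) \<le> C * cnorm A x"
  by (simp add: bd_def)

lemma bd_mono: "\<lbrakk>bd u C; C \<le> D\<rbrakk> \<Longrightarrow> bd u D"
  unfolding bd_def by (meson cnorm_nonneg mult_right_mono order_trans)

lemma bd_add: "\<lbrakk>bd u C; bd v D; u \<in> carrier herm; v \<in> carrier herm\<rbrakk> \<Longrightarrow> bd (u \<oplus>\<^bsub>herm\<^esub> v) (C + D)"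
  unfolding bd_def
  by (auto simp: act_add ring_distribs intro!: order_trans[OF cnorm_triangle] add_mono)

lemma bd_mult:
  assumes "bd u C" "bd v D" "0 \<le> C" "u \<in> carrier herm" "v \<in> carrier herm"
  shows "bd (u \<otimes>\<^bsub>herm\<^esub> v) (C * D)"
  unfolding bd_def
proof
  fix x assume x: "x \<in> carrier A"
  have "cnorm A (act (u \<otimes>\<^bsub>herm\<^esub> v) x) \<le> C * cnorm A (act v x)"
    using assms x by (auto simp: act_mult intro: bdD)
  also have "\<dots> \<le> C * (D * cnorm A x)"
    using assms x by (intro mult_left_mono bdD)
  finally show "cnorm A (act (u \<otimes>\<^bsub>herm\<^esub> v) x) \<le> C * D * cnorm A x"
    by (simp add: mult.assoc)
qed

lemma bd_real: "bd (\<zero>, r) \<bar>r\<bar>"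
  by (simp add: bd_def act_real cnorm_smult)

lemma bd_pair: "a \<in> carrier A \<Longrightarrow> bd (a, z) (cnorm A a + \<bar>z\<bar>)"
  unfolding bd_def act_def
proof
  fix x assume ax: "a \<in> carrier A" "x \<in> carrier A"
  have "cnorm A (a \<otimes> x \<oplus> complex_of_real z \<odot> x) \<le> cnorm A (a \<otimes> x) + cnorm A (complex_of_real z \<odot> x)"
    using ax by (intro cnorm_triangle) auto
  also have "\<dots> \<le> (cnorm A a + \<bar>z\<bar>) * cnorm A x"
    using cnorm_mult[OF ax] ax by (simp add: cnorm_smult ring_distribs)
  finally show "cnorm A (fst (a, z) \<otimes> x \<oplus> complex_of_real (snd (a, z)) \<odot> x) \<le> (cnorm A a + \<bar>z\<bar>) * cnorm A x"
    by simp
qed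

lemma bd_limit: "(\<And>e. 0 < e \<Longrightarrow> bd u (C + e)) \<Longrightarrow> bd u C"
  unfolding bd_def
proof
  fix x assume le: "\<And>e. 0 < e \<Longrightarrow> \<forall>x\<in>carrier A. cnorm A (act u x) \<le> (C + e) * cnorm A x" and x: "x \<in> carrier A"
  have n: "0 \<le> cnorm A x"
    using x by (rule cnorm_nonneg)
  show "cnorm A (act u x) \<le> C * cnorm A x"
  proof (rule field_le_epsilon)
    fix e :: real assume e: "0 < e"
    \<comment> \<open>The slack is divided by \<open>cnorm A x + 1\<close> instead of
      \<open>cnorm A x\<close>, which may be 0.\<close>
    have "cnorm A (act u x) \<le> (C + e / (cnorm A x + 1)) * cnorm A x"
      using le[of "e / (cnorm A x + 1)"] x e n by auto
    also have "\<dots> = C * cnorm A x + e * (cnorm A x / (cnorm A x + 1))"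
      by (simp add: ring_distribs)
    also have "\<dots> \<le> C * cnorm A x + e * 1"
      using e n by (intro add_left_mono mult_left_mono) (auto simp: divide_simps)
    finally show "cnorm A (act u x) \<le> C * cnorm A x + e"
      by simp
  qed
qed

text \<open>The C*-identity, applied to \<open>u x \<plusminus> \<i> v x\<close>.\<close>

lemma bd_of_sum_squares:
  assumes u: "u \<in> carrier herm" and v: "v \<in> carrier herm" and C: "0 \<le> C"
    and bd: "bd (u \<otimes>\<^bsub>herm\<^esub> u \<oplus>\<^bsub>herm\<^esub> v \<otimes>\<^bsub>herm\<^esub> v) (C\<^sup>2)"
  shows "bd u C"
  unfolding bd_def
proof
  fix x assume x: "x \<in> carrier A"
  let ?w = "u \<otimes>\<^bsub>herm\<^esub> u \<oplus>\<^bsub>herm\<^esub> v \<otimes>\<^bsub>herm\<^esub> v"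
  have w: "?w \<in> carrier herm"
    using u v by auto
  \<comment> \<open>The two conditions say that \<open>c\<close> is \<open>\<i>\<close> or
    \<open>- \<i>\<close>: unimodular, and purely imaginary so that the mixed terms of
    \<open>star A ?y \<otimes> ?y\<close> cancel and \<open>star A x \<otimes> act ?w x\<close>
    remains.\<close>
  have ineq: "cnorm A (act u x \<oplus> c \<odot> act v x) \<le> C * cnorm A x" if c: "c * cnj c = 1" "c + cnj c = 0" for c
  proof -
    let ?y = "act u x \<oplus> c \<odot> act v x"
    have cc: "cnj c * c = 1" "c = - cnj c"
      using c by (simp_all add: mult.commute eq_neg_iff_add_eq_0)
    have sx: "star A x \<in> carrier A"
      using x by simp
    have "star A ?y \<otimes> ?y = (act u (star A x) \<oplus> cnj c \<odot> act v (star A x)) \<otimes> (act u x \<oplus> c \<odot> act v x)"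
      using x u v by (simp add: star_add star_smult act_star)
    also have "\<dots> = act u (star A x) \<otimes> act u x \<oplus> c \<odot> (act u (star A x) \<otimes> act v x)
        \<oplus> (cnj c \<odot> (act v (star A x) \<otimes> act u x) \<oplus> (cnj c * c) \<odot> (act v (star A x) \<otimes> act v x))"
      using x u v by (simp add: distrib_left distrib_right smult_mult_left smult_mult_right smult_add_right smult_smult
          mult.commute[of "cnj c" c] a_ac)
    also have "act v (star A x) \<otimes> act u x = act u (star A x) \<otimes> act v x"
      using x u v by (simp add: act_mult_left act_mult_right act_mult[symmetric] herm.m_comm)
    also have "act u (star A x) \<otimes> act u x \<oplus> c \<odot> (act u (star A x) \<otimes> act v x)
        \<oplus> (cnj c \<odot> (act u (star A x) \<otimes> act v x) \<oplus> (cnj c * c) \<odot> (act v (star A x) \<otimes> act v x))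
        = act u (star A x) \<otimes> act u x \<oplus> (c + cnj c) \<odot> (act u (star A x) \<otimes> act v x) \<oplus> act v (star A x) \<otimes> act v x"
      using x u v cc by (simp only: smult_add_left a_assoc smult_one mult_closed act_closed star_closed a_closed smult_closed)
    also have "\<dots> = act u (star A x) \<otimes> act u x \<oplus> act v (star A x) \<otimes> act v x"
      using x u v c by simp
    also have "\<dots> = star A x \<otimes> act ?w x"
      using x u v by (simp add: act_add act_mult act_mult_left act_mult_right distrib_left)
    finally have "(cnorm A ?y)\<^sup>2 = cnorm A (star A x \<otimes> act ?w x)"
      using x u v cnorm_star_mult[of ?y] by simp
    also have "\<dots> \<le> cnorm A x * cnorm A (act ?w x)"
      using cnorm_mult[of "star A x" "act ?w x"] x w by simp
    also have "\<dots> \<le> cnorm A x * (C\<^sup>2 * cnorm A x)"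
      using bd x by (intro mult_left_mono) (auto simp: bd_def cnorm_nonneg)
    also have "\<dots> = (C * cnorm A x)\<^sup>2"
      by (simp add: power2_eq_square)
    finally show ?thesis
      by (rule power2_le_imp_le) (use C cnorm_nonneg[OF x] in simp)
  qed
  \<comment> \<open>Averaging the two choices of \<open>c\<close> isolates
    \<open>act u x\<close>.\<close>
  have "2 \<odot> act u x = (act u x \<oplus> \<i> \<odot> act v x) \<oplus> (act u x \<oplus> (- \<i>) \<odot> act v x)"
  proof -
    have "(act u x \<oplus> \<i> \<odot> act v x) \<oplus> (act u x \<oplus> (- \<i>) \<odot> act v x)
        = (act u x \<oplus> act u x) \<oplus> (\<i> \<odot> act v x \<oplus> (- \<i>) \<odot> act v x)"
      using u v x by (simp add: a_ac)
    also have "\<dots> = 2 \<odot> act u x"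
      using u v x smult_add_left[of "act u x" 1 1] smult_add_left[of "act v x" "\<i>" "- \<i>"] by (simp add: smult_one)
    finally show ?thesis ..
  qed
  moreover have "cnorm A (2 \<odot> act u x) = 2 * cnorm A (act u x)"
    using u x by (simp add: cnorm_smult)
  moreover have "cnorm A ((act u x \<oplus> \<i> \<odot> act v x) \<oplus> (act u x \<oplus> (- \<i>) \<odot> act v x)) \<le> 2 * (C * cnorm A x)"
    using u v x ineq[of "\<i>"] ineq[of "- \<i>"] by (intro order_trans[OF cnorm_triangle]) auto
  ultimately show "cnorm A (act u x) \<le> C * cnorm A x"
    by simp
qed

end

text \<open>The iteration for \<open>1 - sqrt (1 - h)\<close> at the scalar \<open>h = 1\<close>,
  started at 0. Its increments dominate those of the operator iteration in \<open>herm\<close> and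
  of the matrix iteration further on, so both are controlled at one fixed rate.\<close>

primrec sqrt_bound :: "nat \<Rightarrow> real" where
  "sqrt_bound 0 = 0"
| "sqrt_bound (Suc n) = (1 + (sqrt_bound n)\<^sup>2) / 2"

lemma sqrt_bound_range: "0 \<le> sqrt_bound n \<and> sqrt_bound n \<le> 1"
  by (induction n) (auto simp: power_le_one)

lemma sqrt_bound_mono: "sqrt_bound n \<le> sqrt_bound (Suc n)"
  using zero_le_power2[of "1 - sqrt_bound n"] by (simp add: power2_eq_square algebra_simps)

text \<open>Half the difference of two consecutive squares, factored in the way in which the
  operator estimates arise.\<close>

lemma sqrt_bound_step:
  "1/2 * ((sqrt_bound (Suc n) - sqrt_bound n) * (sqrt_bound (Suc n) + sqrt_bound n))
     = sqrt_bound (Suc (Suc n)) - sqrt_bound (Suc n)"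
  by (simp add: power2_eq_square field_simps)

lemma convergent_sqrt_bound: "convergent sqrt_bound"
  using sqrt_bound_range sqrt_bound_mono
  by (intro Bseq_mono_convergent BseqI'[of _ 1]) (auto simp: incseq_def lift_Suc_mono_le)

section \<open>Approximate square roots and the positive cone of \<open>herm\<close>\<close>

context comm_cstar
begin

abbreviation hr :: "real \<Rightarrow> 'a \<times> real" where
  "hr r \<equiv> (\<zero>, r)"

lemma hr_closed [simp, intro]: "hr r \<in> carrier herm"
  by (simp add: herm_simps)

lemma hr_add: "hr r \<oplus>\<^bsub>herm\<^esub> hr s = hr (r + s)" and hr_mult: "hr r \<otimes>\<^bsub>herm\<^esub> hr s = hr (r * s)"
  and hr_one: "\<one>\<^bsub>herm\<^esub> = hr 1" and hr_zero: "\<zero>\<^bsub>herm\<^esub> = hr 0"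
  by (simp_all add: herm_simps)

lemma hr_mult_left:
  "u \<in> carrier herm \<Longrightarrow> hr r \<otimes>\<^bsub>herm\<^esub> (hr s \<otimes>\<^bsub>herm\<^esub> u) = hr (r * s) \<otimes>\<^bsub>herm\<^esub> u"
  by (simp flip: hr_mult add: herm.m_assoc)

lemma hr_one_mult: "u \<in> carrier herm \<Longrightarrow> hr 1 \<otimes>\<^bsub>herm\<^esub> u = u"
  by (simp flip: hr_one)

lemma hr_minus: "\<ominus>\<^bsub>herm\<^esub> hr r = hr (- r)"
  by (rule herm.minus_equality) (auto simp: hr_add hr_zero)

lemma hr_diff: "hr r \<ominus>\<^bsub>herm\<^esub> hr s = hr (r - s)"
  by (simp add: a_minus_def hr_minus hr_add)

lemma bd_minus: "\<lbrakk>bd u C; u \<in> carrier herm\<rbrakk> \<Longrightarrow> bd (\<ominus>\<^bsub>herm\<^esub> u) C"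
proof -
  assume u: "bd u C" "u \<in> carrier herm"
  have "\<ominus>\<^bsub>herm\<^esub> u = hr (- 1) \<otimes>\<^bsub>herm\<^esub> u"
    using u(2) by (simp flip: hr_minus hr_one add: herm.l_minus)
  then show ?thesis
    using bd_mult[OF bd_real[of "- 1"] u(1)] u(2) by simp
qed

lemma bd_diff: "\<lbrakk>bd u C; bd v D; u \<in> carrier herm; v \<in> carrier herm\<rbrakk> \<Longrightarrow> bd (u \<ominus>\<^bsub>herm\<^esub> v) (C + D)"
  unfolding a_minus_def by (intro bd_add bd_minus) auto

lemma bd_scale:
  assumes "bd u C" "u \<in> carrier herm" "0 \<le> r"
  shows "bd (hr r \<otimes>\<^bsub>herm\<^esub> u) (r * C)"
  using bd_mult[OF bd_real[of r] assms(1)] assms by simp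

text \<open>The iteration \<open>q \<mapsto> (h + q\<^sup>2) / 2\<close> converges to \<open>1 - \<surd>(1 - h)\<close>; the increments are
  dominated by those of the scalar iteration with \<open>h = 1\<close>.\<close>

lemma approximate_sqrt:
  assumes h: "h \<in> carrier herm" "bd h 1" and e: "0 < e"
  obtains s where "s \<in> carrier herm" "bd (s \<otimes>\<^bsub>herm\<^esub> s \<ominus>\<^bsub>herm\<^esub> (\<one>\<^bsub>herm\<^esub> \<ominus>\<^bsub>herm\<^esub> h)) e"
proof -
  define q where "q = rec_nat (hr 0) (\<lambda>_ q. hr (1/2) \<otimes>\<^bsub>herm\<^esub> (h \<oplus>\<^bsub>herm\<^esub> q \<otimes>\<^bsub>herm\<^esub> q))"
  define r where "r = sqrt_bound"
  have q: "q 0 = hr 0" "q (Suc n) = hr (1/2) \<otimes>\<^bsub>herm\<^esub> (h \<oplus>\<^bsub>herm\<^esub> q n \<otimes>\<^bsub>herm\<^esub> q n)" for n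
    by (simp_all add: q_def)
  have r: "r 0 = 0" "r (Suc n) = (1 + (r n)\<^sup>2) / 2" for n
    by (simp_all add: r_def)
  have r01: "0 \<le> r n \<and> r n \<le> 1" and r_mono: "r n \<le> r (Suc n)" for n
    unfolding r_def by (rule sqrt_bound_range sqrt_bound_mono)+
  have qc [simp]: "q n \<in> carrier herm" for n
    by (induction n) (auto simp: q h)
  have q_bd: "bd (q n) (r n)" for n
  proof (induction n)
    case 0
    then show ?case
      using bd_real[of 0] by (simp add: q r)
  next
    case (Suc n)
    have "bd (h \<oplus>\<^bsub>herm\<^esub> q n \<otimes>\<^bsub>herm\<^esub> q n) (1 + r n * r n)"
      using h Suc r01 by (intro bd_add bd_mult) auto
    from bd_scale[OF this, of "1/2"] show ?case
      using h by (simp add: q r power2_eq_square)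
  qed
  have step: "bd (q (Suc n) \<ominus>\<^bsub>herm\<^esub> q n) (r (Suc n) - r n)" for n
  proof (induction n)
    case 0
    have "q (Suc 0) \<ominus>\<^bsub>herm\<^esub> q 0 = hr (1/2) \<otimes>\<^bsub>herm\<^esub> h"
      unfolding q hr_zero[symmetric] using h by (simp add: a_minus_def)
    then show ?case
      using bd_scale[OF h(2,1), of "1/2"] by (simp add: r)
  next
    case (Suc n)
    have id: "t \<otimes>\<^bsub>herm\<^esub> (h \<oplus>\<^bsub>herm\<^esub> y \<otimes>\<^bsub>herm\<^esub> y) \<ominus>\<^bsub>herm\<^esub> t \<otimes>\<^bsub>herm\<^esub> (h \<oplus>\<^bsub>herm\<^esub> x \<otimes>\<^bsub>herm\<^esub> x)
       = t \<otimes>\<^bsub>herm\<^esub> ((y \<ominus>\<^bsub>herm\<^esub> x) \<otimes>\<^bsub>herm\<^esub> (y \<oplus>\<^bsub>herm\<^esub> x))"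
      if "t \<in> carrier herm" "x \<in> carrier herm" "y \<in> carrier herm" for t x y
      using that h by algebra
    have "bd ((q (Suc n) \<ominus>\<^bsub>herm\<^esub> q n) \<otimes>\<^bsub>herm\<^esub> (q (Suc n) \<oplus>\<^bsub>herm\<^esub> q n))
        ((r (Suc n) - r n) * (r (Suc n) + r n))"
      using Suc q_bd r_mono by (intro bd_add bd_mult) auto
    from bd_scale[OF this, of "1/2"]
    have "bd (q (Suc (Suc n)) \<ominus>\<^bsub>herm\<^esub> q (Suc n)) (1/2 * ((r (Suc n) - r n) * (r (Suc n) + r n)))"
      unfolding q(2)[of "Suc n"] by (subst (3) q(2)) (simp add: id)
    moreover have "1/2 * ((r (Suc n) - r n) * (r (Suc n) + r n)) = r (Suc (Suc n)) - r (Suc n)"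
      unfolding r_def by (rule sqrt_bound_step)
    ultimately show ?case
      by (simp only:)
  qed
  obtain l where "r \<longlonglongrightarrow> l"
    using convergent_sqrt_bound by (auto simp: convergent_def r_def)
  then have "(\<lambda>n. r (Suc n) - r n) \<longlonglongrightarrow> l - l"
    by (intro tendsto_diff LIMSEQ_Suc)
  then have "eventually (\<lambda>n. r (Suc n) - r n < e / 2) sequentially"
    using e by (intro order_tendstoD) auto
  then obtain n where n: "r (Suc n) - r n < e / 2"
    by (auto simp: eventually_sequentially)
  \<comment> \<open>The error \<open>s^2 - (1 - h)\<close> equals \<open>h + q^2 - 2 q\<close>,
    exactly twice the next increment of the iteration. An approximate root thus comes without
    forming a limit in \<open>herm\<close>.\<close>
  define s where "s = \<one>\<^bsub>herm\<^esub> \<ominus>\<^bsub>herm\<^esub> q n"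
  have "hr 2 \<otimes>\<^bsub>herm\<^esub> (q (Suc n) \<ominus>\<^bsub>herm\<^esub> q n)
      = hr 2 \<otimes>\<^bsub>herm\<^esub> (hr (1/2) \<otimes>\<^bsub>herm\<^esub> (h \<oplus>\<^bsub>herm\<^esub> q n \<otimes>\<^bsub>herm\<^esub> q n)) \<ominus>\<^bsub>herm\<^esub> hr 2 \<otimes>\<^bsub>herm\<^esub> q n"
    unfolding q(2) using h hr_closed[of 2] hr_closed[of "1/2"] qc[of n] by algebra
  also have "hr 2 \<otimes>\<^bsub>herm\<^esub> (hr (1/2) \<otimes>\<^bsub>herm\<^esub> (h \<oplus>\<^bsub>herm\<^esub> q n \<otimes>\<^bsub>herm\<^esub> q n)) = h \<oplus>\<^bsub>herm\<^esub> q n \<otimes>\<^bsub>herm\<^esub> q n"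
    using h by (simp add: hr_mult_left hr_one_mult)
  also have "hr 2 \<otimes>\<^bsub>herm\<^esub> q n = q n \<oplus>\<^bsub>herm\<^esub> q n"
    using herm.l_distr[of "hr 1" "hr 1" "q n"] by (simp add: hr_add hr_one_mult)
  also have "(h \<oplus>\<^bsub>herm\<^esub> q n \<otimes>\<^bsub>herm\<^esub> q n) \<ominus>\<^bsub>herm\<^esub> (q n \<oplus>\<^bsub>herm\<^esub> q n)
      = s \<otimes>\<^bsub>herm\<^esub> s \<ominus>\<^bsub>herm\<^esub> (\<one>\<^bsub>herm\<^esub> \<ominus>\<^bsub>herm\<^esub> h)"
    unfolding s_def using h qc[of n] by algebra
  finally have "bd (s \<otimes>\<^bsub>herm\<^esub> s \<ominus>\<^bsub>herm\<^esub> (\<one>\<^bsub>herm\<^esub> \<ominus>\<^bsub>herm\<^esub> h)) (2 * (r (Suc n) - r n))"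
    using bd_scale[OF step[of n], of 2] by simp
  then have "bd (s \<otimes>\<^bsub>herm\<^esub> s \<ominus>\<^bsub>herm\<^esub> (\<one>\<^bsub>herm\<^esub> \<ominus>\<^bsub>herm\<^esub> h)) e"
    by (rule bd_mono) (use n in simp)
  then show ?thesis
    by (intro that[of s]) (auto simp: s_def)
qed

text \<open>Take \<open>s\<close> with \<open>s^2\<close> close to \<open>1 - w^2\<close>. Then
  \<open>s^2 + w^2\<close> is close to 1, so \<open>bd_of_sum_squares\<close> bounds
  \<open>s\<close> by about 1, and with it \<open>s^2\<close>, hence \<open>1 - w^2\<close>.\<close>

lemma bd_one_minus_square:
  assumes w: "w \<in> carrier herm" "bd w 1"
  shows "bd (\<one>\<^bsub>herm\<^esub> \<ominus>\<^bsub>herm\<^esub> w \<otimes>\<^bsub>herm\<^esub> w) 1"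
proof (rule bd_limit)
  fix e :: real assume e: "0 < e"
  have ww: "bd (w \<otimes>\<^bsub>herm\<^esub> w) 1" "w \<otimes>\<^bsub>herm\<^esub> w \<in> carrier herm"
    using bd_mult[OF w(2,2) _ w(1,1)] w by auto
  obtain s where s: "s \<in> carrier herm"
    and bd: "bd (s \<otimes>\<^bsub>herm\<^esub> s \<ominus>\<^bsub>herm\<^esub> (\<one>\<^bsub>herm\<^esub> \<ominus>\<^bsub>herm\<^esub> w \<otimes>\<^bsub>herm\<^esub> w)) (e / 2)"
    using approximate_sqrt[OF ww(2,1), of "e/2"] e by auto
  let ?d = "s \<otimes>\<^bsub>herm\<^esub> s \<ominus>\<^bsub>herm\<^esub> (\<one>\<^bsub>herm\<^esub> \<ominus>\<^bsub>herm\<^esub> w \<otimes>\<^bsub>herm\<^esub> w)"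
  have d: "?d \<in> carrier herm"
    using s w by auto
  have "s \<otimes>\<^bsub>herm\<^esub> s \<oplus>\<^bsub>herm\<^esub> w \<otimes>\<^bsub>herm\<^esub> w = \<one>\<^bsub>herm\<^esub> \<oplus>\<^bsub>herm\<^esub> ?d"
    using s w by algebra
  moreover have "bd (\<one>\<^bsub>herm\<^esub> \<oplus>\<^bsub>herm\<^esub> ?d) (1 + e / 2)"
    using bd_add[OF bd_real[of 1] bd hr_closed d] by (simp add: hr_one)
  ultimately have sw: "bd (s \<otimes>\<^bsub>herm\<^esub> s \<oplus>\<^bsub>herm\<^esub> w \<otimes>\<^bsub>herm\<^esub> w) ((sqrt (1 + e / 2))\<^sup>2)"
    using e by simp
  have "bd s (sqrt (1 + e / 2))"
    by (rule bd_of_sum_squares[OF s w(1) _ sw]) (use e in simp)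
  from bd_mult[OF this this _ s s] have "bd (s \<otimes>\<^bsub>herm\<^esub> s) (1 + e / 2)"
    using e by simp
  then have "bd (s \<otimes>\<^bsub>herm\<^esub> s \<ominus>\<^bsub>herm\<^esub> ?d) (1 + e / 2 + e / 2)"
    using bd s w by (intro bd_diff) auto
  moreover have "s \<otimes>\<^bsub>herm\<^esub> s \<ominus>\<^bsub>herm\<^esub> ?d = \<one>\<^bsub>herm\<^esub> \<ominus>\<^bsub>herm\<^esub> w \<otimes>\<^bsub>herm\<^esub> w"
    using s w by algebra
  ultimately show "bd (\<one>\<^bsub>herm\<^esub> \<ominus>\<^bsub>herm\<^esub> w \<otimes>\<^bsub>herm\<^esub> w) (1 + e)"
    by (simp add: add.commute)
qed

text \<open>Obtained from \<open>bd_one_minus_square\<close> by rescaling; it is what puts squares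
  into \<open>pos\<close>.\<close>

lemma bd_square:
  assumes w: "w \<in> carrier herm" "bd w C" and C: "0 < C"
  shows "bd (hr (C * C) \<ominus>\<^bsub>herm\<^esub> w \<otimes>\<^bsub>herm\<^esub> w) (C * C)"
proof -
  let ?w = "hr (1 / C) \<otimes>\<^bsub>herm\<^esub> w"
  have w': "?w \<in> carrier herm" "bd ?w 1"
    using w C bd_scale[OF w(2,1), of "1 / C"] by auto
  from bd_scale[OF bd_one_minus_square[OF this], of "C * C"]
  have "bd (hr (C * C) \<otimes>\<^bsub>herm\<^esub> (\<one>\<^bsub>herm\<^esub> \<ominus>\<^bsub>herm\<^esub> ?w \<otimes>\<^bsub>herm\<^esub> ?w)) (C * C)"
    using C w' by simp
  also have "hr (C * C) \<otimes>\<^bsub>herm\<^esub> (\<one>\<^bsub>herm\<^esub> \<ominus>\<^bsub>herm\<^esub> ?w \<otimes>\<^bsub>herm\<^esub> ?w)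
      = hr (C * C) \<ominus>\<^bsub>herm\<^esub> (hr (C * C) \<otimes>\<^bsub>herm\<^esub> hr (1 / C) \<otimes>\<^bsub>herm\<^esub> hr (1 / C)) \<otimes>\<^bsub>herm\<^esub> (w \<otimes>\<^bsub>herm\<^esub> w)"
    using w hr_closed[of "1/C"] hr_closed[of "C * C"] by (algebra; simp)
  also have "(hr (C * C) \<otimes>\<^bsub>herm\<^esub> hr (1 / C) \<otimes>\<^bsub>herm\<^esub> hr (1 / C)) \<otimes>\<^bsub>herm\<^esub> (w \<otimes>\<^bsub>herm\<^esub> w) = w \<otimes>\<^bsub>herm\<^esub> w"
    using C w by (simp only: hr_mult) (simp add: hr_one_mult)
  finally show ?thesis .
qed

text \<open>The norm description of positivity in a C*-algebra: \<open>u \<ge> 0\<close> when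
  \<open>r - u\<close> has norm at most \<open>r\<close>. Sums are then immediate, while squares
  need \<open>bd_square\<close> and products need approximate square roots.\<close>

definition pos :: "('a \<times> real) set" where
  "pos = {u \<in> carrier herm. \<exists>r\<ge>0. bd (hr r \<ominus>\<^bsub>herm\<^esub> u) r}"

text \<open>Lets several elements of \<open>pos\<close> share one \<open>r\<close>, which may
  moreover be taken positive.\<close>

lemma bd_enlarge:
  assumes "bd (hr r \<ominus>\<^bsub>herm\<^esub> u) r" "r \<le> r'" "u \<in> carrier herm"
  shows "bd (hr r' \<ominus>\<^bsub>herm\<^esub> u) r'"
proof -
  have "hr r' \<ominus>\<^bsub>herm\<^esub> u = (hr r \<ominus>\<^bsub>herm\<^esub> u) \<oplus>\<^bsub>herm\<^esub> (hr r' \<ominus>\<^bsub>herm\<^esub> hr r)"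
    using assms(3) hr_closed[of r] hr_closed[of r'] by algebra
  moreover have "bd ((hr r \<ominus>\<^bsub>herm\<^esub> u) \<oplus>\<^bsub>herm\<^esub> (hr r' \<ominus>\<^bsub>herm\<^esub> hr r)) (r + (r' - r))"
    using assms bd_real[of "r' - r"] by (intro bd_add) (auto simp: hr_diff)
  ultimately show ?thesis
    by simp
qed

lemma posE:
  assumes "u \<in> pos" 
  obtains r where "u \<in> carrier herm" "c \<le> r" "bd (hr r \<ominus>\<^bsub>herm\<^esub> u) r"
proof -
  obtain r where r: "u \<in> carrier herm" "bd (hr r \<ominus>\<^bsub>herm\<^esub> u) r"
    using assms by (auto simp: pos_def)
  show ?thesis
    by (rule that[of "max c r"]) (use r bd_enlarge[of r u "max c r"] in simp_all)
qed

text \<open>This is \<open>approximate_sqrt\<close> for \<open>h = 1 - u / r\<close>, which the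
  hypothesis bounds by 1.\<close>

lemma pos_approximate_sqrt:
  assumes u: "u \<in> carrier herm" "bd (hr r \<ominus>\<^bsub>herm\<^esub> u) r" and r: "0 < r" and e: "0 < e"
  obtains s where "s \<in> carrier herm" "bd (s \<otimes>\<^bsub>herm\<^esub> s \<ominus>\<^bsub>herm\<^esub> hr (1 / r) \<otimes>\<^bsub>herm\<^esub> u) e"
proof -
  let ?u = "hr (1 / r) \<otimes>\<^bsub>herm\<^esub> u"
  have "hr (1 / r) \<otimes>\<^bsub>herm\<^esub> (hr r \<ominus>\<^bsub>herm\<^esub> u) = hr (1 / r) \<otimes>\<^bsub>herm\<^esub> hr r \<ominus>\<^bsub>herm\<^esub> ?u"
    using u hr_closed[of r] hr_closed[of "1/r"] by algebra
  also have "hr (1 / r) \<otimes>\<^bsub>herm\<^esub> hr r = \<one>\<^bsub>herm\<^esub>"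
    using r by (simp add: hr_mult hr_one)
  finally have "bd (\<one>\<^bsub>herm\<^esub> \<ominus>\<^bsub>herm\<^esub> ?u) 1"
    using bd_scale[OF u(2), of "1 / r"] u r by simp
  then obtain s where "s \<in> carrier herm"
    "bd (s \<otimes>\<^bsub>herm\<^esub> s \<ominus>\<^bsub>herm\<^esub> (\<one>\<^bsub>herm\<^esub> \<ominus>\<^bsub>herm\<^esub> (\<one>\<^bsub>herm\<^esub> \<ominus>\<^bsub>herm\<^esub> ?u))) e"
    using approximate_sqrt[of "\<one>\<^bsub>herm\<^esub> \<ominus>\<^bsub>herm\<^esub> ?u" e] u e by auto
  moreover have "\<one>\<^bsub>herm\<^esub> \<ominus>\<^bsub>herm\<^esub> (\<one>\<^bsub>herm\<^esub> \<ominus>\<^bsub>herm\<^esub> ?u) = ?u"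
    using u hr_closed[of "1/r"] by algebra
  ultimately show ?thesis
    using that by auto
qed

text \<open>If \<open>u / r\<close> is close to \<open>s^2\<close> and \<open>v / r\<close> to
  \<open>t^2\<close>, the product is close to the square of \<open>s t\<close>, which is positive by
  \<open>bd_square\<close>. The constant in the bound stays fixed while the error tends to 0, so
  \<open>bd_limit\<close> removes the error.\<close>

lemma pos_mult:
  assumes "u \<in> pos" "v \<in> pos"
  shows "u \<otimes>\<^bsub>herm\<^esub> v \<in> pos"
proof -
  obtain r1 where r1: "u \<in> carrier herm" "1 \<le> r1" "bd (hr r1 \<ominus>\<^bsub>herm\<^esub> u) r1"
    using posE[OF assms(1)] by blast
  obtain r where r: "v \<in> carrier herm" "r1 \<le> r" "bd (hr r \<ominus>\<^bsub>herm\<^esub> v) r"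
    using posE[OF assms(2)] by blast
  have r0: "0 < r"
    using r r1 by simp
  have "bd (hr r \<ominus>\<^bsub>herm\<^esub> u) r"
    by (rule bd_enlarge[of r1]) (use r r1 in auto)
  note u = r1(1) this and v = r(1,3)
  let ?s = "\<lambda>x. hr (1 / r) \<otimes>\<^bsub>herm\<^esub> x"
  have two: "bd (?s x) 2" if x: "x \<in> carrier herm" "bd (hr r \<ominus>\<^bsub>herm\<^esub> x) r" for x
  proof -
    have "hr r \<ominus>\<^bsub>herm\<^esub> (hr r \<ominus>\<^bsub>herm\<^esub> x) = x"
      using x hr_closed[of r] by algebra
    moreover have "bd (hr r \<ominus>\<^bsub>herm\<^esub> (hr r \<ominus>\<^bsub>herm\<^esub> x)) (r + r)"
      using bd_real[of r] r0 x by (intro bd_diff) auto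
    ultimately show ?thesis
      using bd_scale[of x "r + r" "1 / r"] x r0 by simp
  qed
  \<comment> \<open>The origin of 9: \<open>u / r\<close> has bound 2 and the approximation adds at
    most 1, so \<open>s\<close> and \<open>t\<close> have bound \<open>sqrt 3\<close>, their product
    has bound 3, and its square is subtracted from 9.\<close>
  have "bd (hr 9 \<ominus>\<^bsub>herm\<^esub> ?s u \<otimes>\<^bsub>herm\<^esub> ?s v) 9"
  proof (rule bd_limit)
    fix e0 :: real assume e0: "0 < e0"
    \<comment> \<open>The 5 collects the total error \<open>e * 2 + 3 * e\<close> below; the cap 1
      keeps the bound 3 for \<open>s^2\<close> and \<open>t^2\<close>.\<close>
    define e where "e = min 1 (e0 / 5)"
    have e: "0 < e" "e \<le> 1" "5 * e \<le> e0"
      using e0 by (auto simp: e_def min_def)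
    obtain s where s: "s \<in> carrier herm" "bd (s \<otimes>\<^bsub>herm\<^esub> s \<ominus>\<^bsub>herm\<^esub> ?s u) e"
      using pos_approximate_sqrt[OF u r0 e(1)] .
    obtain t where t: "t \<in> carrier herm" "bd (t \<otimes>\<^bsub>herm\<^esub> t \<ominus>\<^bsub>herm\<^esub> ?s v) e"
      using pos_approximate_sqrt[OF v r0 e(1)] .
    have three: "bd (y \<otimes>\<^bsub>herm\<^esub> y) 3 \<and> bd y (sqrt 3)"
      if y: "y \<in> carrier herm" "bd (y \<otimes>\<^bsub>herm\<^esub> y \<ominus>\<^bsub>herm\<^esub> ?s x) e"
        and x: "x \<in> carrier herm" "bd (hr r \<ominus>\<^bsub>herm\<^esub> x) r" for x y
    proof -
      have "y \<otimes>\<^bsub>herm\<^esub> y = (y \<otimes>\<^bsub>herm\<^esub> y \<ominus>\<^bsub>herm\<^esub> ?s x) \<oplus>\<^bsub>herm\<^esub> ?s x"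
        using x y hr_closed[of "1/r"] by algebra
      moreover have "bd ((y \<otimes>\<^bsub>herm\<^esub> y \<ominus>\<^bsub>herm\<^esub> ?s x) \<oplus>\<^bsub>herm\<^esub> ?s x) (e + 2)"
        using x y two by (intro bd_add) auto
      ultimately have yy: "bd (y \<otimes>\<^bsub>herm\<^esub> y) 3"
        using bd_mono[of "y \<otimes>\<^bsub>herm\<^esub> y" "e + 2" 3] e by simp
      have "hr 0 \<otimes>\<^bsub>herm\<^esub> hr 0 = \<zero>\<^bsub>herm\<^esub>"
        by (simp add: hr_mult hr_zero)
      with yy have "bd y (sqrt 3)"
        using bd_of_sum_squares[of y "hr 0" "sqrt 3"] y by simp
      with yy show ?thesis
        by blast
    qed
    note s3 = three[OF s u] and t3 = three[OF t v]
    have "bd (s \<otimes>\<^bsub>herm\<^esub> t) 3"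
      using bd_mult[of s "sqrt 3" t "sqrt 3"] s3 t3 s t by simp
    from bd_square[OF _ this]
    have w: "bd (hr 9 \<ominus>\<^bsub>herm\<^esub> (s \<otimes>\<^bsub>herm\<^esub> t) \<otimes>\<^bsub>herm\<^esub> (s \<otimes>\<^bsub>herm\<^esub> t)) 9"
      using s t by simp
    have d: "bd ((s \<otimes>\<^bsub>herm\<^esub> s \<ominus>\<^bsub>herm\<^esub> ?s u) \<otimes>\<^bsub>herm\<^esub> ?s v \<oplus>\<^bsub>herm\<^esub>
               (s \<otimes>\<^bsub>herm\<^esub> s) \<otimes>\<^bsub>herm\<^esub> (t \<otimes>\<^bsub>herm\<^esub> t \<ominus>\<^bsub>herm\<^esub> ?s v)) (e * 2 + 3 * e)"
      using s t u v s3 two e by (intro bd_add bd_mult) auto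
    have "hr 9 \<ominus>\<^bsub>herm\<^esub> ?s u \<otimes>\<^bsub>herm\<^esub> ?s v
      = (hr 9 \<ominus>\<^bsub>herm\<^esub> (s \<otimes>\<^bsub>herm\<^esub> t) \<otimes>\<^bsub>herm\<^esub> (s \<otimes>\<^bsub>herm\<^esub> t)) \<oplus>\<^bsub>herm\<^esub>
        ((s \<otimes>\<^bsub>herm\<^esub> s \<ominus>\<^bsub>herm\<^esub> ?s u) \<otimes>\<^bsub>herm\<^esub> ?s v \<oplus>\<^bsub>herm\<^esub>
               (s \<otimes>\<^bsub>herm\<^esub> s) \<otimes>\<^bsub>herm\<^esub> (t \<otimes>\<^bsub>herm\<^esub> t \<ominus>\<^bsub>herm\<^esub> ?s v))"
      (is "?L = ?R")
    proof -
      have id: "a \<ominus>\<^bsub>herm\<^esub> b \<otimes>\<^bsub>herm\<^esub> c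
      = (a \<ominus>\<^bsub>herm\<^esub> (s \<otimes>\<^bsub>herm\<^esub> t) \<otimes>\<^bsub>herm\<^esub> (s \<otimes>\<^bsub>herm\<^esub> t)) \<oplus>\<^bsub>herm\<^esub>
        ((s \<otimes>\<^bsub>herm\<^esub> s \<ominus>\<^bsub>herm\<^esub> b) \<otimes>\<^bsub>herm\<^esub> c \<oplus>\<^bsub>herm\<^esub>
               (s \<otimes>\<^bsub>herm\<^esub> s) \<otimes>\<^bsub>herm\<^esub> (t \<otimes>\<^bsub>herm\<^esub> t \<ominus>\<^bsub>herm\<^esub> c))"
        if "a \<in> carrier herm" "b \<in> carrier herm" "c \<in> carrier herm" for a b c
        using that s(1) t(1) by algebra
      show ?thesis
        by (rule id) (use u v in auto)
    qed
    moreover have "bd ?R (9 + (e * 2 + 3 * e))"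
      by (rule bd_add[OF w d]) (use s t u v in auto)
    ultimately show "bd ?L (9 + e0)"
      using e by (auto intro: bd_mono)
  qed
  from bd_scale[OF this, of "r * r"] r0 u v
  have "bd (hr (r * r) \<otimes>\<^bsub>herm\<^esub> (hr 9 \<ominus>\<^bsub>herm\<^esub> ?s u \<otimes>\<^bsub>herm\<^esub> ?s v)) (r * r * 9)"
    by simp
  also have "hr (r * r) \<otimes>\<^bsub>herm\<^esub> (hr 9 \<ominus>\<^bsub>herm\<^esub> ?s u \<otimes>\<^bsub>herm\<^esub> ?s v)
      = hr (r * r) \<otimes>\<^bsub>herm\<^esub> hr 9 \<ominus>\<^bsub>herm\<^esub> (hr (r * r) \<otimes>\<^bsub>herm\<^esub> hr (1 / r) \<otimes>\<^bsub>herm\<^esub> hr (1 / r)) \<otimes>\<^bsub>herm\<^esub> (u \<otimes>\<^bsub>herm\<^esub> v)"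
    using u(1) v(1) hr_closed[of "1/r"] hr_closed[of "r * r"] hr_closed[of 9] by algebra
  also have "(hr (r * r) \<otimes>\<^bsub>herm\<^esub> hr (1 / r) \<otimes>\<^bsub>herm\<^esub> hr (1 / r)) \<otimes>\<^bsub>herm\<^esub> (u \<otimes>\<^bsub>herm\<^esub> v) = u \<otimes>\<^bsub>herm\<^esub> v"
    using r0 u v by (simp only: hr_mult) (simp add: hr_one_mult)
  finally show ?thesis
    using u v r0 unfolding pos_def by (auto simp: hr_mult intro!: exI[of _ "r * r * 9"])
qed

text \<open>For the archimedean axiom take the bound \<open>r\<close> of \<open>x\<close> from
  \<open>bd_pair\<close>: subtracting \<open>r - x\<close> from \<open>r\<close> gives back
  \<open>x\<close>, which has norm at most \<open>r\<close>.\<close>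

lemma arch_preorder_pos: "arch_preorder herm hr pos"
proof
  show "pos \<subseteq> carrier herm"
    by (auto simp: pos_def)
  show "x \<otimes>\<^bsub>herm\<^esub> y \<in> pos" if "x \<in> pos" "y \<in> pos" for x y
    using pos_mult that .
  show "x \<oplus>\<^bsub>herm\<^esub> y \<in> pos" if xy: "x \<in> pos" "y \<in> pos" for x y
  proof -
    obtain r where r: "x \<in> carrier herm" "0 \<le> r" "bd (hr r \<ominus>\<^bsub>herm\<^esub> x) r"
      using posE[OF xy(1)] .
    obtain s where s: "y \<in> carrier herm" "0 \<le> s" "bd (hr s \<ominus>\<^bsub>herm\<^esub> y) s"
      using posE[OF xy(2)] .
    have "bd ((hr r \<ominus>\<^bsub>herm\<^esub> x) \<oplus>\<^bsub>herm\<^esub> (hr s \<ominus>\<^bsub>herm\<^esub> y)) (r + s)"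
      using r s by (intro bd_add) auto
    moreover have "(hr r \<ominus>\<^bsub>herm\<^esub> x) \<oplus>\<^bsub>herm\<^esub> (hr s \<ominus>\<^bsub>herm\<^esub> y) = (hr r \<oplus>\<^bsub>herm\<^esub> hr s) \<ominus>\<^bsub>herm\<^esub> (x \<oplus>\<^bsub>herm\<^esub> y)"
      using r s hr_closed[of r] hr_closed[of s] by algebra
    ultimately show ?thesis
      using r s unfolding pos_def by (auto simp: hr_add intro!: exI[of _ "r + s"])
  qed
  show "x \<otimes>\<^bsub>herm\<^esub> x \<in> pos" if x: "x \<in> carrier herm" for x
  proof -
    obtain a z where az: "x = (a, z)"
      by (cases x)
    have "bd x (cnorm A a + \<bar>z\<bar> + 1)"
      by (rule bd_mono[of _ "cnorm A a + \<bar>z\<bar>"]) (use x bd_pair[of a z] in \<open>auto simp: az herm_simps\<close>)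
    moreover have "0 < cnorm A a + \<bar>z\<bar> + 1"
      using x cnorm_nonneg[of a] by (simp add: az herm_simps add_nonneg_pos)
    ultimately have "bd (hr ((cnorm A a + \<bar>z\<bar> + 1) * (cnorm A a + \<bar>z\<bar> + 1)) \<ominus>\<^bsub>herm\<^esub> x \<otimes>\<^bsub>herm\<^esub> x)
        ((cnorm A a + \<bar>z\<bar> + 1) * (cnorm A a + \<bar>z\<bar> + 1))"
      using x by (intro bd_square) auto
    then show ?thesis
      unfolding pos_def using x by (auto intro!: exI[of _ "(cnorm A a + \<bar>z\<bar> + 1) * (cnorm A a + \<bar>z\<bar> + 1)"])
  qed
  show "\<exists>r. hr r \<ominus>\<^bsub>herm\<^esub> x \<in> pos" if x: "x \<in> carrier herm" for x
  proof -
    obtain a z where az: "x = (a, z)"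
      by (cases x)
    let ?r = "cnorm A a + \<bar>z\<bar>"
    have "hr ?r \<ominus>\<^bsub>herm\<^esub> (hr ?r \<ominus>\<^bsub>herm\<^esub> x) = x"
      using x hr_closed[of ?r] by algebra
    moreover have "bd x ?r" "0 \<le> ?r"
      using x bd_pair[of a z] cnorm_nonneg[of a] by (auto simp: az herm_simps)
    ultimately show ?thesis
      using x by (auto simp: pos_def intro!: exI[of _ ?r])
  qed
qed (auto simp: hr_add hr_mult hr_one)

sublocale herm: arch_preorder herm hr pos
  by (rule arch_preorder_pos)

text \<open>For \<open>d > 0\<close> the element \<open>(r + d)^2 - a^2\<close> is positive at every
  real character, hence lies in \<open>pos\<close>. A multiple of an approximate square root of it
  completes \<open>a^2\<close> to a sum of two squares close to \<open>(r + d)^2\<close>, and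
  \<open>bd_of_sum_squares\<close> bounds \<open>a\<close>.\<close>

lemma cnorm_le_of_real_characters:
  assumes a: "a \<in> carrier A" "star A a = a" and r: "0 \<le> r"
    and le: "\<And>f. herm.real_character f \<Longrightarrow> \<bar>f (a, 0)\<bar> \<le> r"
  shows "cnorm A a \<le> r"
proof -
  have u: "(a, 0) \<in> carrier herm"
    using a by (simp add: herm_simps)
  have "bd (a, 0) r"
  proof (rule bd_limit)
    fix d0 :: real assume d0: "0 < d0"
    define d where "d = d0 / 2"
    have d: "0 < d" "r + d + d = r + d0"
      using d0 by (auto simp: d_def)
    let ?k = "hr ((r + d)\<^sup>2) \<ominus>\<^bsub>herm\<^esub> (a, 0) \<otimes>\<^bsub>herm\<^esub> (a, 0)"
    have "?k \<in> pos"
    proof (rule herm.positive_if_positive_at_characters)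
      fix f assume f: "herm.real_character f"
      have eq: "hr ((r + d)\<^sup>2) = ?k \<oplus>\<^bsub>herm\<^esub> (a, 0) \<otimes>\<^bsub>herm\<^esub> (a, 0)"
        using u hr_closed[of "(r + d)\<^sup>2"] by algebra
      have f': "\<And>x y. x \<in> carrier herm \<Longrightarrow> y \<in> carrier herm \<Longrightarrow> f (x \<oplus>\<^bsub>herm\<^esub> y) = f x + f y"
        "\<And>x y. x \<in> carrier herm \<Longrightarrow> y \<in> carrier herm \<Longrightarrow> f (x \<otimes>\<^bsub>herm\<^esub> y) = f x * f y"
        "\<And>r. f (hr r) = r"
        using f unfolding herm.real_character_def by blast+
      have "f (hr ((r + d)\<^sup>2)) = f ?k + f (a, 0) * f (a, 0)"
        by (subst eq) (use u in \<open>simp only: f' herm.minus_closed herm.m_closed hr_closed\<close>)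
      moreover have "f (a, 0) * f (a, 0) < (r + d)\<^sup>2"
      proof -
        have "\<bar>f (a, 0)\<bar> < r + d"
          using le[OF f] d by simp
        then have "\<bar>f (a, 0)\<bar>\<^sup>2 < (r + d)\<^sup>2"
          by (intro power_strict_mono) auto
        then show ?thesis
          by (simp add: power2_eq_square)
      qed
      ultimately show "0 < f ?k"
        using f'(3) by simp
    qed (use u in auto)
    then obtain c where c: "?k \<in> carrier herm" "1 \<le> c" "bd (hr c \<ominus>\<^bsub>herm\<^esub> ?k) c"
      by (rule posE)
    \<comment> \<open>Chosen so that the error \<open>c * e\<close> is \<open>d^2\<close>, which is
      absorbed by \<open>(r + d)^2 + d^2 \<le> (r + 2 d)^2\<close>.\<close>
    define e where "e = d\<^sup>2 / c"
    have e: "0 < e" "c * e = d\<^sup>2"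
      using d c by (auto simp: e_def)
    obtain s where s: "s \<in> carrier herm" "bd (s \<otimes>\<^bsub>herm\<^esub> s \<ominus>\<^bsub>herm\<^esub> hr (1 / c) \<otimes>\<^bsub>herm\<^esub> ?k) e"
      using pos_approximate_sqrt[OF c(1,3) _ e(1)] c by auto
    let ?v = "hr (sqrt c) \<otimes>\<^bsub>herm\<^esub> s"
    have "(a, 0) \<otimes>\<^bsub>herm\<^esub> (a, 0) \<oplus>\<^bsub>herm\<^esub> ?v \<otimes>\<^bsub>herm\<^esub> ?v
        = (a, 0) \<otimes>\<^bsub>herm\<^esub> (a, 0) \<oplus>\<^bsub>herm\<^esub> (hr (sqrt c) \<otimes>\<^bsub>herm\<^esub> hr (sqrt c)) \<otimes>\<^bsub>herm\<^esub> (s \<otimes>\<^bsub>herm\<^esub> s)"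
      using u s hr_closed[of "sqrt c"] by algebra
    also have "hr (sqrt c) \<otimes>\<^bsub>herm\<^esub> hr (sqrt c) = hr c"
      using c by (simp add: hr_mult)
    also have "(a, 0) \<otimes>\<^bsub>herm\<^esub> (a, 0) \<oplus>\<^bsub>herm\<^esub> hr c \<otimes>\<^bsub>herm\<^esub> (s \<otimes>\<^bsub>herm\<^esub> s)
        = ((a, 0) \<otimes>\<^bsub>herm\<^esub> (a, 0) \<oplus>\<^bsub>herm\<^esub> hr c \<otimes>\<^bsub>herm\<^esub> (hr (1 / c) \<otimes>\<^bsub>herm\<^esub> ?k)) \<oplus>\<^bsub>herm\<^esub>
          hr c \<otimes>\<^bsub>herm\<^esub> (s \<otimes>\<^bsub>herm\<^esub> s \<ominus>\<^bsub>herm\<^esub> hr (1 / c) \<otimes>\<^bsub>herm\<^esub> ?k)" (is "?x \<oplus>\<^bsub>herm\<^esub> ?y = ?z")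
    proof -
      have id: "x \<oplus>\<^bsub>herm\<^esub> y \<otimes>\<^bsub>herm\<^esub> (s \<otimes>\<^bsub>herm\<^esub> s)
          = (x \<oplus>\<^bsub>herm\<^esub> y \<otimes>\<^bsub>herm\<^esub> z) \<oplus>\<^bsub>herm\<^esub> y \<otimes>\<^bsub>herm\<^esub> (s \<otimes>\<^bsub>herm\<^esub> s \<ominus>\<^bsub>herm\<^esub> z)"
        if "x \<in> carrier herm" "y \<in> carrier herm" "z \<in> carrier herm" for x y z
        using that s(1) by algebra
      show ?thesis
        by (rule id) (use u c in auto)
    qed
    also have "(a, 0) \<otimes>\<^bsub>herm\<^esub> (a, 0) \<oplus>\<^bsub>herm\<^esub> hr c \<otimes>\<^bsub>herm\<^esub> (hr (1 / c) \<otimes>\<^bsub>herm\<^esub> ?k) = hr ((r + d)\<^sup>2)"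
    proof -
      have "hr c \<otimes>\<^bsub>herm\<^esub> (hr (1 / c) \<otimes>\<^bsub>herm\<^esub> ?k) = ?k"
        using c by (simp add: hr_mult_left hr_one_mult)
      then show ?thesis
        using u hr_closed[of "(r + d)\<^sup>2"] by algebra
    qed
    finally have eq: "(a, 0) \<otimes>\<^bsub>herm\<^esub> (a, 0) \<oplus>\<^bsub>herm\<^esub> ?v \<otimes>\<^bsub>herm\<^esub> ?v = hr ((r + d)\<^sup>2) \<oplus>\<^bsub>herm\<^esub>
          hr c \<otimes>\<^bsub>herm\<^esub> (s \<otimes>\<^bsub>herm\<^esub> s \<ominus>\<^bsub>herm\<^esub> hr (1 / c) \<otimes>\<^bsub>herm\<^esub> ?k)" .
    have "bd (hr ((r + d)\<^sup>2)) ((r + d)\<^sup>2)"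
      using bd_real[of "(r + d)\<^sup>2"] by simp
    then have "bd ((a, 0) \<otimes>\<^bsub>herm\<^esub> (a, 0) \<oplus>\<^bsub>herm\<^esub> ?v \<otimes>\<^bsub>herm\<^esub> ?v) ((r + d)\<^sup>2 + c * e)"
      unfolding eq using s c by (intro bd_add bd_scale) auto
    moreover have "(r + d)\<^sup>2 + c * e \<le> (r + d + d)\<^sup>2"
      using e(2) r d(1) by (simp add: power2_eq_square algebra_simps)
    ultimately have "bd ((a, 0) \<otimes>\<^bsub>herm\<^esub> (a, 0) \<oplus>\<^bsub>herm\<^esub> ?v \<otimes>\<^bsub>herm\<^esub> ?v) ((r + d + d)\<^sup>2)"
      by (rule bd_mono)
    from bd_of_sum_squares[OF u _ _ this] show "bd (a, 0) (r + d0)"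
      using s r d by simp
  qed
  \<comment> \<open>The bound is applied to \<open>a\<close> acting on itself, where the C*-identity
    makes the left side a square.\<close>
  from bdD[OF this a(1)] have "cnorm A a * cnorm A a \<le> r * cnorm A a"
    using a cnorm_star_mult[of a] by (simp add: act_def power2_eq_square)
  then show ?thesis
    using cnorm_nonneg[OF a(1)] r by (cases "cnorm A a = 0") auto
qed

end

section \<open>Characters\<close>

text \<open>The zero functional counts as a character, so non-unital algebras need no separate treatment.\<close>

definition chars :: "'a cstar \<Rightarrow> ('a \<Rightarrow> complex) set" where
  "chars A = {\<xi>. (\<forall>x\<in>carrier A. \<forall>y\<in>carrier A. \<xi> (x \<oplus>\<^bsub>A\<^esub> y) = \<xi> x + \<xi> y \<and> \<xi> (x \<otimes>\<^bsub>A\<^esub> y) = \<xi> x * \<xi> y) \<and>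
     (\<forall>x\<in>carrier A. \<xi> (star A x) = cnj (\<xi> x) \<and> (\<forall>c. \<xi> (c \<odot>\<^bsub>A\<^esub> x) = c * \<xi> x))}"

lemma chars_simps [simp]:
  assumes "\<xi> \<in> chars A"
  shows "\<lbrakk>x \<in> carrier A; y \<in> carrier A\<rbrakk> \<Longrightarrow> \<xi> (x \<oplus>\<^bsub>A\<^esub> y) = \<xi> x + \<xi> y"
    and "\<lbrakk>x \<in> carrier A; y \<in> carrier A\<rbrakk> \<Longrightarrow> \<xi> (x \<otimes>\<^bsub>A\<^esub> y) = \<xi> x * \<xi> y"
    and "x \<in> carrier A \<Longrightarrow> \<xi> (star A x) = cnj (\<xi> x)"
    and "x \<in> carrier A \<Longrightarrow> \<xi> (c \<odot>\<^bsub>A\<^esub> x) = c * \<xi> x"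
  using assms by (auto simp: chars_def)

lemma (in cstar_algebra) chars_zero [simp]: "\<xi> \<in> chars A \<Longrightarrow> \<xi> \<zero> = 0"
  using chars_simps(1)[of \<xi> A \<zero> \<zero>] by simp

lemma (in cstar_algebra) chars_diff [simp]:
  "\<lbrakk>\<xi> \<in> chars A; x \<in> carrier A; y \<in> carrier A\<rbrakk> \<Longrightarrow> \<xi> (x \<ominus> y) = \<xi> x - \<xi> y"
  by (simp add: minus_eq_smult)

text \<open>If \<open>\<xi> a\<close> exceeded the norm, a multiple \<open>b\<close> of
  \<open>a\<close> would satisfy \<open>\<xi> b = 1\<close> with norm below 1. The Neumann series
  then solves \<open>x = b + b x\<close> without a unit, and applying \<open>\<xi>\<close> gives the
  contradiction \<open>\<xi> x = 1 + \<xi> x\<close>.\<close>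

lemma (in cstar_algebra) chars_cnorm_le:
  assumes \<xi>: "\<xi> \<in> chars A" and a: "a \<in> carrier A"
  shows "cmod (\<xi> a) \<le> cnorm A a"
proof (rule ccontr)
  assume n: "\<not> ?thesis"
  define b where "b = (1 / \<xi> a) \<odot> a"
  have \<xi>a: "\<xi> a \<noteq> 0"
    using n cnorm_nonneg[OF a] by auto
  have b: "b \<in> carrier A" "\<xi> b = 1"
    using a \<xi> \<xi>a by (auto simp: b_def)
  define c where "c = cnorm A b"
  have c: "0 \<le> c" "c < 1"
    using a b n \<xi>a cnorm_nonneg[OF b(1)] unfolding c_def
    by (auto simp: b_def cnorm_smult norm_divide)
  define X where "X = rec_nat b (\<lambda>_ x. b \<oplus> b \<otimes> x)"
  have X: "X 0 = b" "X (Suc n) = b \<oplus> b \<otimes> X n" for n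
    by (simp_all add: X_def)
  have Xc [simp]: "X n \<in> carrier A" for n
    by (induction n) (auto simp: X b)
  have step: "cnorm A (X (Suc n) \<ominus> X n) \<le> c ^ Suc n" for n
  proof (induction n)
    case 0
    have "X (Suc 0) \<ominus> X 0 = b \<otimes> b"
      using b by (simp add: X a_minus_def a_comm[of b "b \<otimes> b"] a_assoc r_neg)
    then have "cnorm A (X (Suc 0) \<ominus> X 0) \<le> c * c"
      using cnorm_mult[OF b(1) b(1)] by (simp add: c_def)
    also have "\<dots> \<le> c * 1"
      using c by (intro mult_left_mono) auto
    finally show ?case
      by simp
  next
    case (Suc n)
    have "X (Suc (Suc n)) \<ominus> X (Suc n) = (b \<oplus> b \<otimes> X (Suc n)) \<ominus> (b \<oplus> b \<otimes> X n)"
      by (simp add: X)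
    also have "\<dots> = b \<otimes> X (Suc n) \<ominus> b \<otimes> X n"
      using b(1) Xc[of "Suc n"] Xc[of n] by (simp add: a_minus_def minus_add a_ac r_neg1 r_neg2 del: Xc)
    also have "\<dots> = b \<otimes> (X (Suc n) \<ominus> X n)"
      using b by (simp add: mult_diff_left)
    finally have "cnorm A (X (Suc (Suc n)) \<ominus> X (Suc n)) \<le> c * cnorm A (X (Suc n) \<ominus> X n)"
      using cnorm_mult[of b "X (Suc n) \<ominus> X n"] b by (simp add: c_def)
    also have "\<dots> \<le> c * c ^ Suc n"
      using Suc c by (intro mult_left_mono) auto
    finally show ?case
      by simp
  qed
  \<comment> \<open>The negatives of the tails of the geometric series serve as the telescoping
    sequence.\<close>
  have "c ^ Suc n = - (c ^ Suc (Suc n)) / (1 - c) - (- (c ^ Suc n) / (1 - c))" for n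
    using c by (simp add: divide_simps) (simp add: algebra_simps)
  then have step': "cnorm A (X (Suc n) \<ominus> X n) \<le> - (c ^ Suc (Suc n)) / (1 - c) - (- (c ^ Suc n) / (1 - c))" for n
    using step[of n] by simp
  have "(\<lambda>n. - (c ^ Suc n) / (1 - c)) \<longlonglongrightarrow> - 0 / (1 - c)"
    using c by (intro tendsto_intros LIMSEQ_Suc LIMSEQ_realpow_zero) auto
  then have "convergent (\<lambda>n. - (c ^ Suc n) / (1 - c))"
    by (auto simp: convergent_def)
  from complete_telescoping[of X "\<lambda>n. - (c ^ Suc n) / (1 - c)", OF Xc step' this]
  obtain x where x: "x \<in> carrier A" "(\<lambda>n. cnorm A (X n \<ominus> x)) \<longlonglongrightarrow> 0"
    by blast
  have "(\<lambda>n. cnorm A (X (Suc n) \<ominus> (b \<oplus> b \<otimes> x))) \<longlonglongrightarrow> 0"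
  proof (rule tendsto_sandwich[OF always_eventually always_eventually])
    show "\<forall>n. 0 \<le> cnorm A (X (Suc n) \<ominus> (b \<oplus> b \<otimes> x))"
      using b x by (auto intro: cnorm_nonneg)
    show "\<forall>n. cnorm A (X (Suc n) \<ominus> (b \<oplus> b \<otimes> x)) \<le> c * cnorm A (X n \<ominus> x)"
    proof
      fix n
      have "X (Suc n) \<ominus> (b \<oplus> b \<otimes> x) = b \<otimes> X n \<ominus> b \<otimes> x"
        using b(1) x Xc[of n] by (simp add: X a_minus_def minus_add a_ac r_neg1 r_neg2 del: Xc)
      also have "\<dots> = b \<otimes> (X n \<ominus> x)"
        using b x by (simp add: mult_diff_left)
      finally have "X (Suc n) \<ominus> (b \<oplus> b \<otimes> x) = b \<otimes> (X n \<ominus> x)" .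
      then show "cnorm A (X (Suc n) \<ominus> (b \<oplus> b \<otimes> x)) \<le> c * cnorm A (X n \<ominus> x)"
        using cnorm_mult[of b "X n \<ominus> x"] b x by (simp add: c_def)
    qed
    show "(\<lambda>n. c * cnorm A (X n \<ominus> x)) \<longlonglongrightarrow> 0"
      using tendsto_mult_left[OF x(2), of c] by simp
  qed auto
  then have "x = b \<oplus> b \<otimes> x"
    using limit_unique[of "\<lambda>n. X (Suc n)" x "b \<oplus> b \<otimes> x"] LIMSEQ_Suc[OF x(2)] b x by simp
  then have "\<xi> x = \<xi> (b \<oplus> b \<otimes> x)"
    by simp
  then show False
    using b x \<xi> by simp
qed

context comm_cstar
begin

lemma smult_collect: "x \<in> carrier A \<Longrightarrow> c \<odot> x \<oplus> d \<odot> x = (c + d) \<odot> x"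
  by (simp add: smult_add_left)

text \<open>Complexification by real and imaginary parts. The result may be the zero functional,
  namely when \<open>f\<close> sees only the scalar component of a pair.\<close>

lemma character_of_real_character:
  assumes f: "herm.real_character f"
  obtains \<xi> where "\<xi> \<in> chars A" "\<And>a. \<lbrakk>a \<in> carrier A; star A a = a\<rbrakk> \<Longrightarrow> \<xi> a = complex_of_real (f (a, 0))"
proof -
  define g where "g a = f (a, 0)" for a
  have f': "\<And>x y. x \<in> carrier herm \<Longrightarrow> y \<in> carrier herm \<Longrightarrow> f (x \<oplus>\<^bsub>herm\<^esub> y) = f x + f y"
    "\<And>x y. x \<in> carrier herm \<Longrightarrow> y \<in> carrier herm \<Longrightarrow> f (x \<otimes>\<^bsub>herm\<^esub> y) = f x * f y"
    "\<And>r. f (hr r) = r"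
    using f unfolding herm.real_character_def by blast+
  have g_add: "g (h \<oplus> k) = g h + g k" if "h \<in> carrier A" "star A h = h" "k \<in> carrier A" "star A k = k" for h k
    using f'(1)[of "(h, 0)" "(k, 0)"] that by (simp add: herm_simps g_def)
  have g_mult: "g (h \<otimes> k) = g h * g k" if "h \<in> carrier A" "star A h = h" "k \<in> carrier A" "star A k = k" for h k
    using f'(2)[of "(h, 0)" "(k, 0)"] that by (simp add: herm_simps g_def)
  have g_smult: "g (complex_of_real c \<odot> h) = c * g h" if "h \<in> carrier A" "star A h = h" for h c
    using f'(2)[of "hr c" "(h, 0)"] that by (simp add: herm_simps g_def f'(3))
  define re where "re a = (1 / 2) \<odot> (a \<oplus> star A a)" for a
  define im where "im a = (- \<i> / 2) \<odot> (a \<oplus> (- 1) \<odot> star A a)" for a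
  define \<xi> where "\<xi> a = Complex (g (re a)) (g (im a))" for a
  have herm_re: "re a \<in> carrier A" "star A (re a) = re a" if "a \<in> carrier A" for a
    using that by (auto simp: re_def star_smult star_add star_star a_comm)
  have herm_im: "im a \<in> carrier A" "star A (im a) = im a" if "a \<in> carrier A" for a
    using that by (auto simp: im_def star_smult star_add star_star smult_add_right a_comm simp flip: smult_smult)
  have split: "re a \<oplus> \<i> \<odot> im a = a" if "a \<in> carrier A" for a
  proof -
    have "re a \<oplus> \<i> \<odot> im a = ((1/2) \<odot> a \<oplus> (1/2) \<odot> star A a) \<oplus> ((1/2) \<odot> a \<oplus> (-1/2) \<odot> star A a)"
      using that by (simp add: re_def im_def smult_add_right flip: smult_smult)
    also have "\<dots> = ((1/2) \<odot> a \<oplus> (1/2) \<odot> a) \<oplus> ((1/2) \<odot> star A a \<oplus> (-1/2) \<odot> star A a)"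
      using that by (simp add: a_ac)
    also have "\<dots> = a"
      using that by (simp add: smult_collect smult_one)
    finally show ?thesis .
  qed
  have \<xi>_split: "\<xi> (h \<oplus> \<i> \<odot> k) = Complex (g h) (g k)"
    if hk: "h \<in> carrier A" "star A h = h" "k \<in> carrier A" "star A k = k" for h k
  proof -
    have s: "star A (h \<oplus> \<i> \<odot> k) = h \<oplus> (- \<i>) \<odot> k"
      using hk by (simp add: star_add star_smult)
    have "(h \<oplus> \<i> \<odot> k) \<oplus> (h \<oplus> (- \<i>) \<odot> k) = (1 \<odot> h \<oplus> 1 \<odot> h) \<oplus> (\<i> \<odot> k \<oplus> (- \<i>) \<odot> k)"
      using hk by (simp add: a_ac smult_one)
    also have "\<dots> = 2 \<odot> h"
      using hk unfolding smult_collect[OF hk(1)] smult_collect[OF hk(3)] by simp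
    finally have "re (h \<oplus> \<i> \<odot> k) = h"
      unfolding re_def s using hk by (simp add: smult_one flip: smult_smult)
    moreover have "(h \<oplus> \<i> \<odot> k) \<oplus> (- 1) \<odot> (h \<oplus> (- \<i>) \<odot> k) = (1 \<odot> h \<oplus> (- 1) \<odot> h) \<oplus> (\<i> \<odot> k \<oplus> \<i> \<odot> k)"
      using hk by (simp add: a_ac smult_one smult_add_right flip: smult_smult)
    then have "(h \<oplus> \<i> \<odot> k) \<oplus> (- 1) \<odot> (h \<oplus> (- \<i>) \<odot> k) = (2 * \<i>) \<odot> k"
      using hk unfolding smult_collect[OF hk(1)] smult_collect[OF hk(3)] by simp
    then have "im (h \<oplus> \<i> \<odot> k) = k"
      unfolding im_def s using hk by (simp add: smult_one flip: smult_smult)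
    ultimately show ?thesis
      by (simp add: \<xi>_def)
  qed
  have "\<xi> \<in> chars A"
    unfolding chars_def
  proof (intro CollectI conjI ballI allI)
    fix x y assume x: "x \<in> carrier A" and y: "y \<in> carrier A"
    note rx = herm_re[OF x] herm_im[OF x] and ry = herm_re[OF y] herm_im[OF y]
    have "x \<oplus> y = (re x \<oplus> \<i> \<odot> im x) \<oplus> (re y \<oplus> \<i> \<odot> im y)"
      using x y by (simp add: split)
    also have "\<dots> = (re x \<oplus> re y) \<oplus> \<i> \<odot> (im x \<oplus> im y)"
      using rx ry by (simp add: smult_add_right a_ac)
    finally have "\<xi> (x \<oplus> y) = Complex (g (re x \<oplus> re y)) (g (im x \<oplus> im y))"
      using rx ry by (simp add: \<xi>_split star_add)
    then show "\<xi> (x \<oplus> y) = \<xi> x + \<xi> y"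
      using rx ry by (simp add: g_add \<xi>_def complex_eq_iff)
    have "x \<otimes> y = (re x \<oplus> \<i> \<odot> im x) \<otimes> (re y \<oplus> \<i> \<odot> im y)"
      using x y by (simp add: split)
    also have "\<dots> = (re x \<otimes> re y \<oplus> (- 1) \<odot> (im x \<otimes> im y)) \<oplus> \<i> \<odot> (re x \<otimes> im y \<oplus> im x \<otimes> re y)"
      using rx ry by (simp add: distrib_left distrib_right smult_mult_left smult_mult_right smult_add_right a_ac
          flip: smult_smult)
    finally have "\<xi> (x \<otimes> y) = Complex (g (re x \<otimes> re y \<oplus> (- 1) \<odot> (im x \<otimes> im y))) (g (re x \<otimes> im y \<oplus> im x \<otimes> re y))"
      using rx ry by (simp add: \<xi>_split star_add star_mult star_smult mult_comm)
    then show "\<xi> (x \<otimes> y) = \<xi> x * \<xi> y"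
      using rx ry g_smult[of _ "- 1"] by (simp add: g_add g_mult star_mult star_smult mult_comm \<xi>_def complex_eq_iff)
  next
    fix x assume x: "x \<in> carrier A"
    note rx = herm_re[OF x] herm_im[OF x]
    have "star A x = star A (re x \<oplus> \<i> \<odot> im x)"
      using x by (simp add: split)
    also have "\<dots> = re x \<oplus> \<i> \<odot> ((- 1) \<odot> im x)"
      using rx by (simp add: star_add star_smult flip: smult_smult)
    finally have "\<xi> (star A x) = Complex (g (re x)) (g ((- 1) \<odot> im x))"
      using rx by (simp add: \<xi>_split star_smult)
    then show "\<xi> (star A x) = cnj (\<xi> x)"
      using rx g_smult[of _ "- 1"] by (simp add: \<xi>_def complex_eq_iff)
    fix c
    let ?u = "complex_of_real (Re c)" and ?v = "complex_of_real (Im c)"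
    have c: "c = ?u + \<i> * ?v"
      by (simp add: complex_eq_iff)
    have "c \<odot> x = (?u + \<i> * ?v) \<odot> (re x \<oplus> \<i> \<odot> im x)"
      using x c by (simp add: split)
    also have "\<dots> = ?u \<odot> (re x \<oplus> \<i> \<odot> im x) \<oplus> (\<i> * ?v) \<odot> (re x \<oplus> \<i> \<odot> im x)"
      using rx by (intro smult_add_left) auto
    also have "\<dots> = (?u \<odot> re x \<oplus> (- ?v) \<odot> im x) \<oplus> \<i> \<odot> (?v \<odot> re x \<oplus> ?u \<odot> im x)"
      using rx by (simp add: smult_add_right a_ac mult.commute flip: smult_smult)
    finally have "\<xi> (c \<odot> x) = Complex (g (?u \<odot> re x \<oplus> (- ?v) \<odot> im x)) (g (?v \<odot> re x \<oplus> ?u \<odot> im x))"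
      using rx by (simp add: \<xi>_split star_add star_smult)
    also have "\<dots> = c * \<xi> x"
      using rx g_smult[of _ "- Im c"] by (simp add: g_add g_smult star_smult \<xi>_def complex_eq_iff)
    finally show "\<xi> (c \<odot> x) = c * \<xi> x" .
  qed
  moreover have "\<xi> a = complex_of_real (f (a, 0))" if "a \<in> carrier A" "star A a = a" for a
    using \<xi>_split[of a \<zero>] that f'(3)[of 0] by (simp add: g_def complex_eq_iff)
  ultimately show ?thesis
    using that by blast
qed

text \<open>The C*-identity reduces the claim to the hermitian element
  \<open>star A a \<otimes> a\<close>. Together with \<open>chars_cnorm_le\<close> it says that the
  Gelfand transform is isometric.\<close>

theorem cnorm_le_of_chars:
  assumes a: "a \<in> carrier A" and r: "0 \<le> r" and le: "\<And>\<xi>. \<xi> \<in> chars A \<Longrightarrow> cmod (\<xi> a) \<le> r"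
  shows "cnorm A a \<le> r"
proof -
  have "cnorm A (star A a \<otimes> a) \<le> r\<^sup>2"
  proof (rule cnorm_le_of_real_characters)
    show sa: "star A a \<otimes> a \<in> carrier A" "star A (star A a \<otimes> a) = star A a \<otimes> a"
      using a by (auto simp: star_mult star_star)
    fix f assume "herm.real_character f"
    then obtain \<xi> where \<xi>: "\<xi> \<in> chars A" "\<And>a. \<lbrakk>a \<in> carrier A; star A a = a\<rbrakk> \<Longrightarrow> \<xi> a = complex_of_real (f (a, 0))"
      using character_of_real_character by blast
    have "\<bar>f (star A a \<otimes> a, 0)\<bar> = cmod (\<xi> (star A a \<otimes> a))"
      using sa by (simp only: \<xi>(2) norm_of_real)
    also have "\<dots> = (cmod (\<xi> a))\<^sup>2"
      using a \<xi>(1) by (simp add: norm_mult power2_eq_square)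
    also have "\<dots> \<le> r\<^sup>2"
      using le[OF \<xi>(1)] by (intro power_mono) auto
    finally show "\<bar>f (star A a \<otimes> a, 0)\<bar> \<le> r\<^sup>2" .
  qed auto
  then show ?thesis
    using a r by (simp add: cnorm_star_mult abs_le_square_iff[symmetric] cnorm_nonneg)
qed

text \<open>From here on identities in a commutative algebra are verified at characters, where they
  become identities of complex numbers.\<close>

lemma chars_eqI:
  assumes "a \<in> carrier A" "b \<in> carrier A" "\<And>\<xi>. \<xi> \<in> chars A \<Longrightarrow> \<xi> a = \<xi> b"
  shows "a = b"
proof -
  have "cnorm A (a \<ominus> b) \<le> 0"
    by (rule cnorm_le_of_chars) (use assms in auto)
  then have "cnorm A (a \<ominus> b) = 0"
    using cnorm_nonneg[of "a \<ominus> b"] assms by simp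
  then show ?thesis
    using assms by (simp add: cnorm_eq_zero diff_eq_zero_iff)
qed

end

section \<open>Subalgebras and continuous functional calculus\<close>

text \<open>Additive inverses are defined through the carrier, so differences in the restricted
  record must first be identified with those of \<open>A\<close>; completeness is stated in terms of
  them.\<close>

lemma (in cstar_algebra) cstar_algebra_subalg:
  assumes B: "cstar_subalgebra A B"
  shows "cstar_algebra (subalg A B)"
    and "\<lbrakk>x \<in> B; y \<in> B\<rbrakk> \<Longrightarrow> x \<ominus>\<^bsub>subalg A B\<^esub> y = x \<ominus> y"
proof -
  have cl: "B \<subseteq> carrier A" "\<zero> \<in> B" "\<And>x y. x \<in> B \<Longrightarrow> y \<in> B \<Longrightarrow> x \<oplus> y \<in> B"
    "\<And>c x. x \<in> B \<Longrightarrow> c \<odot> x \<in> B" "\<And>x y. x \<in> B \<Longrightarrow> y \<in> B \<Longrightarrow> x \<otimes> y \<in> B"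
    "\<And>x. x \<in> B \<Longrightarrow> star A x \<in> B"
    using B by (auto simp: cstar_subalgebra_def linear_subspace_def)
  have c: "x \<in> carrier A" if "x \<in> B" for x
    using cl(1) that by blast
  have ab: "abelian_group (subalg A B)"
  proof (rule abelian_groupI)
    fix x assume "x \<in> carrier (subalg A B)"
    then show "\<exists>y\<in>carrier (subalg A B). y \<oplus>\<^bsub>subalg A B\<^esub> x = \<zero>\<^bsub>subalg A B\<^esub>"
      using cl(4)[of x "- 1"] c by (auto intro!: bexI[of _ "(- 1) \<odot> x"] smult_minus_one_add)
  qed (auto simp: cl c a_ac)
  have inv: "\<ominus>\<^bsub>subalg A B\<^esub> x = \<ominus> x" if x: "x \<in> B" for x
  proof -
    have "\<ominus> x \<in> B"
      using cl(4)[OF x, of "- 1"] c[OF x] by (simp add: a_inv_eq_smult)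
    then show ?thesis
      using abelian_group.minus_equality[OF ab, of "\<ominus> x" x] x c by (simp add: l_neg)
  qed
  show diff: "x \<ominus>\<^bsub>subalg A B\<^esub> y = x \<ominus> y" if "x \<in> B" "y \<in> B" for x y
    using that by (simp add: a_minus_def inv)
  have "\<exists>x\<in>B. (\<lambda>n. cnorm A (X n \<ominus> x)) \<longlonglongrightarrow> 0"
    if X: "\<And>n :: nat. X n \<in> B" and C: "\<And>e. 0 < e \<Longrightarrow> \<exists>N. \<forall>m\<ge>N. \<forall>n\<ge>N. cnorm A (X m \<ominus> X n) < e" for X
  proof -
    obtain x where "x \<in> carrier A" "(\<lambda>n. cnorm A (X n \<ominus> x)) \<longlonglongrightarrow> 0"
      using complete[of X] X C c by blast
    then show ?thesis
      using X B by (auto simp: cstar_subalgebra_def norm_closed_def)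
  qed
  then have complete': "\<exists>x\<in>carrier (subalg A B). (\<lambda>n. cnorm (subalg A B) (X n \<ominus>\<^bsub>subalg A B\<^esub> x)) \<longlonglongrightarrow> 0"
    if X: "\<And>n :: nat. X n \<in> carrier (subalg A B)"
      and C: "\<And>e. 0 < e \<Longrightarrow> \<exists>N. \<forall>m\<ge>N. \<forall>n\<ge>N. cnorm (subalg A B) (X m \<ominus>\<^bsub>subalg A B\<^esub> X n) < e" for X
    using X C by (simp add: diff)
  \<comment> \<open>Subgoal 23 is completeness; all others restrict from \<open>A\<close>.\<close>
  show "cstar_algebra (subalg A B)"
    by (rule cstar_algebra.intro[OF ab], rule cstar_algebra_axioms.intro, rule_tac [23] complete')
      (simp_all add: cl c distrib_left distrib_right mult_assoc smult_add_left smult_add_right smult_smult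
         smult_one smult_mult_left smult_mult_right star_star star_add star_mult star_smult cnorm_nonneg
         cnorm_eq_zero cnorm_triangle cnorm_smult cnorm_mult cnorm_star_mult)
qed

lemma (in comm_cstar) comm_cstar_subalg:
  assumes B: "cstar_subalgebra A B"
  shows "comm_cstar (subalg A B)"
proof -
  have "abelian (subalg A B)"
    using B abelian by (auto simp: abelian_def cstar_subalgebra_def linear_subspace_def)
  then show ?thesis
    using cstar_algebra_subalg(1)[OF B] by (simp add: comm_cstar_def comm_cstar_axioms_def)
qed

lemma chars_subalg: "\<lbrakk>\<xi> \<in> chars A; B \<subseteq> carrier A\<rbrakk> \<Longrightarrow> \<xi> \<in> chars (subalg A B)"
  unfolding chars_def by (auto simp: subset_iff)

lemma chars_herm_of_real:
  assumes "\<xi> \<in> chars A" "a \<in> carrier A" "star A a = a"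
  shows "\<xi> a = complex_of_real (Re (\<xi> a))"
  using chars_simps(3)[OF assms(1,2)] assms(3) by (simp add: complex_eq_iff)

lemma (in cstar_algebra) closed_ideal_rules:
  assumes "closed_ideal A J"
  shows "x \<in> J \<Longrightarrow> x \<in> carrier A" and "\<zero> \<in> J" and "\<lbrakk>x \<in> J; y \<in> J\<rbrakk> \<Longrightarrow> x \<oplus> y \<in> J" and "x \<in> J \<Longrightarrow> c \<odot> x \<in> J"
    and "\<lbrakk>a \<in> carrier A; x \<in> J\<rbrakk> \<Longrightarrow> a \<otimes> x \<in> J" and "\<lbrakk>a \<in> carrier A; x \<in> J\<rbrakk> \<Longrightarrow> x \<otimes> a \<in> J"
    and "\<lbrakk>x \<in> J; y \<in> J\<rbrakk> \<Longrightarrow> x \<ominus> y \<in> J"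
    and "\<lbrakk>\<And>n. X n \<in> J; x \<in> carrier A; (\<lambda>n. cnorm A (X n \<ominus> x)) \<longlonglongrightarrow> 0\<rbrakk> \<Longrightarrow> x \<in> J"
proof -
  show 1: "x \<in> J \<Longrightarrow> x \<in> carrier A" "\<zero> \<in> J" "\<lbrakk>x \<in> J; y \<in> J\<rbrakk> \<Longrightarrow> x \<oplus> y \<in> J" "x \<in> J \<Longrightarrow> c \<odot> x \<in> J"
    "\<lbrakk>a \<in> carrier A; x \<in> J\<rbrakk> \<Longrightarrow> a \<otimes> x \<in> J" "\<lbrakk>a \<in> carrier A; x \<in> J\<rbrakk> \<Longrightarrow> x \<otimes> a \<in> J" for x y a c
    using assms by (auto simp: closed_ideal_def linear_subspace_def)
  show "\<lbrakk>x \<in> J; y \<in> J\<rbrakk> \<Longrightarrow> x \<ominus> y \<in> J"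
    using 1 by (simp add: minus_eq_smult)
  show "\<lbrakk>\<And>n. X n \<in> J; x \<in> carrier A; (\<lambda>n. cnorm A (X n \<ominus> x)) \<longlonglongrightarrow> 0\<rbrakk> \<Longrightarrow> x \<in> J"
    using assms unfolding closed_ideal_def norm_closed_def by blast
qed

context comm_cstar
begin

text \<open>The calculus is set up for two elements that agree modulo an ideal, so that it descends to quotients.\<close>

lemma polynomial_calculus:
  assumes J: "closed_ideal A J"
    and a: "a \<in> carrier A" "star A a = a" and g: "g \<in> carrier A" "star A g = g" and ag: "a \<ominus> g \<in> J"
    and p: "real_polynomial_function p"
  shows "\<exists>c\<in>carrier A. \<exists>d\<in>carrier A. c \<ominus> d \<in> J \<and>
    (\<forall>\<xi>\<in>chars A. \<xi> c = complex_of_real (p (Re (\<xi> a)) - p 0) \<and> \<xi> d = complex_of_real (p (Re (\<xi> g)) - p 0))"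
  using p
proof induction
  case (linear p)
  have p: "p x = p 1 * x" for x
    using linear_scale[OF bounded_linear.linear[OF linear], of x 1] by (simp add: mult.commute)
  let ?k = "complex_of_real (p 1)"
  have ag': "?k \<odot> a \<ominus> ?k \<odot> g \<in> J"
    using closed_ideal_rules(4)[OF J ag, of ?k] a g by (simp add: smult_diff)
  have ch: "\<xi> (?k \<odot> y) = complex_of_real (p (Re (\<xi> y)) - p 0)" if "\<xi> \<in> chars A" "y \<in> carrier A" "star A y = y" for \<xi> y
    using that chars_herm_of_real[OF that] by (simp add: p[of "Re (\<xi> y)"] p[of 0])
  show ?case
    by (rule bexI[of _ "?k \<odot> a"], rule bexI[of _ "?k \<odot> g"]) (use a g ag' ch in auto)
next
  \<comment> \<open>What is represented is \<open>p x - p 0\<close>, because constants have no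
    representative in a non-unital algebra; for a constant polynomial this is 0.\<close>
  case (const c)
  show ?case
    by (rule bexI[of _ \<zero>], rule bexI[of _ \<zero>]) (use closed_ideal_rules(2)[OF J] in auto)
next
  case (add p q)
  then obtain c d c' d' where cd: "c \<in> carrier A" "d \<in> carrier A" "c \<ominus> d \<in> J" "c' \<in> carrier A" "d' \<in> carrier A" "c' \<ominus> d' \<in> J"
    and ch: "\<And>\<xi>. \<xi> \<in> chars A \<Longrightarrow> \<xi> c = complex_of_real (p (Re (\<xi> a)) - p 0) \<and> \<xi> d = complex_of_real (p (Re (\<xi> g)) - p 0)"
      "\<And>\<xi>. \<xi> \<in> chars A \<Longrightarrow> \<xi> c' = complex_of_real (q (Re (\<xi> a)) - q 0) \<and> \<xi> d' = complex_of_real (q (Re (\<xi> g)) - q 0)"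
    by meson
  have "(c \<oplus> c') \<ominus> (d \<oplus> d') = (c \<ominus> d) \<oplus> (c' \<ominus> d')"
    using cd by (intro chars_eqI) auto
  then have "(c \<oplus> c') \<ominus> (d \<oplus> d') \<in> J"
    using closed_ideal_rules(3)[OF J cd(3,6)] by simp
  note cd' = cd this
  have ch': "\<xi> (c \<oplus> c') = complex_of_real ((\<lambda>x. p x + q x) (Re (\<xi> a)) - (\<lambda>x. p x + q x) 0) \<and>
      \<xi> (d \<oplus> d') = complex_of_real ((\<lambda>x. p x + q x) (Re (\<xi> g)) - (\<lambda>x. p x + q x) 0)" if "\<xi> \<in> chars A" for \<xi>
  proof -
    have e: "\<xi> c = complex_of_real (p (Re (\<xi> a)) - p 0)" "\<xi> d = complex_of_real (p (Re (\<xi> g)) - p 0)"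
      "\<xi> c' = complex_of_real (q (Re (\<xi> a)) - q 0)" "\<xi> d' = complex_of_real (q (Re (\<xi> g)) - q 0)"
      using ch that by blast+
    show ?thesis
      using cd that by (simp add: e algebra_simps)
  qed
  show ?case
    by (rule bexI[of _ "c \<oplus> c'"], rule bexI[of _ "d \<oplus> d'"], rule conjI[OF cd'(7) ballI[OF ch']]) (use cd in auto)
next
  case (mult p q)
  then obtain c d c' d' where cd: "c \<in> carrier A" "d \<in> carrier A" "c \<ominus> d \<in> J" "c' \<in> carrier A" "d' \<in> carrier A" "c' \<ominus> d' \<in> J"
    and ch: "\<And>\<xi>. \<xi> \<in> chars A \<Longrightarrow> \<xi> c = complex_of_real (p (Re (\<xi> a)) - p 0) \<and> \<xi> d = complex_of_real (p (Re (\<xi> g)) - p 0)"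
      "\<And>\<xi>. \<xi> \<in> chars A \<Longrightarrow> \<xi> c' = complex_of_real (q (Re (\<xi> a)) - q 0) \<and> \<xi> d' = complex_of_real (q (Re (\<xi> g)) - q 0)"
    by meson
  \<comment> \<open>The identity behind it is \<open>p q - p 0 q 0 = (p - p 0) (q - q 0) + p 0 (q -
    q 0) + q 0 (p - p 0)\<close>.\<close>
  let ?m = "\<lambda>c c'. c \<otimes> c' \<oplus> (complex_of_real (p 0) \<odot> c' \<oplus> complex_of_real (q 0) \<odot> c)"
  have "?m c c' \<ominus> ?m d d' = c \<otimes> (c' \<ominus> d') \<oplus> (c \<ominus> d) \<otimes> d' \<oplus>
      (complex_of_real (p 0) \<odot> (c' \<ominus> d') \<oplus> complex_of_real (q 0) \<odot> (c \<ominus> d))"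
    using cd by (intro chars_eqI) (auto simp: algebra_simps)
  also have "\<dots> \<in> J"
    using cd by (simp add: closed_ideal_rules(3-6)[OF J])
  finally have "?m c c' \<ominus> ?m d d' \<in> J" .
  note cd' = cd this
  have ch': "\<xi> (?m c c') = complex_of_real ((\<lambda>x. p x * q x) (Re (\<xi> a)) - (\<lambda>x. p x * q x) 0) \<and>
      \<xi> (?m d d') = complex_of_real ((\<lambda>x. p x * q x) (Re (\<xi> g)) - (\<lambda>x. p x * q x) 0)" if "\<xi> \<in> chars A" for \<xi>
  proof -
    have e: "\<xi> c = complex_of_real (p (Re (\<xi> a)) - p 0)" "\<xi> d = complex_of_real (p (Re (\<xi> g)) - p 0)"
      "\<xi> c' = complex_of_real (q (Re (\<xi> a)) - q 0)" "\<xi> d' = complex_of_real (q (Re (\<xi> g)) - q 0)"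
      using ch that by blast+
    show ?thesis
      using cd that by (simp add: e algebra_simps)
  qed
  show ?case
    by (rule bexI[of _ "?m c c'"], rule bexI[of _ "?m d d'"], rule conjI[OF cd'(7) ballI[OF ch']]) (use cd in auto)
qed

text \<open>By \<open>cnorm_le_of_chars\<close> a sequence that is uniformly Cauchy on the
  characters is Cauchy in norm; completeness gives the element, and contractivity of characters its
  values.\<close>

lemma uniform_limit_of_elements:
  assumes X: "\<And>n. X n \<in> carrier A"
    and F: "\<And>n \<xi>. \<xi> \<in> chars A \<Longrightarrow> cmod (\<xi> (X n) - F \<xi>) \<le> inverse (real (Suc n))"
  shows "\<exists>x\<in>carrier A. (\<lambda>n. cnorm A (X n \<ominus> x)) \<longlonglongrightarrow> 0 \<and> (\<forall>\<xi>\<in>chars A. \<xi> x = F \<xi>)"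
proof -
  have "\<exists>N. \<forall>m\<ge>N. \<forall>n\<ge>N. cnorm A (X m \<ominus> X n) < e" if e: "0 < e" for e
  proof -
    obtain N where N: "inverse (real (Suc N)) < e / 2"
      using reals_Archimedean[of "e/2"] e by auto
    have "cnorm A (X m \<ominus> X n) < e" if mn: "m \<ge> N" "n \<ge> N" for m n
    proof -
      have "cnorm A (X m \<ominus> X n) \<le> 2 * inverse (real (Suc N))"
      proof (rule cnorm_le_of_chars)
        fix \<xi> assume \<xi>: "\<xi> \<in> chars A"
        have "cmod (\<xi> (X m \<ominus> X n)) = cmod ((\<xi> (X m) - F \<xi>) - (\<xi> (X n) - F \<xi>))"
          using \<xi> X by simp
        also have "\<dots> \<le> inverse (real (Suc m)) + inverse (real (Suc n))"
          by (rule order_trans[OF norm_triangle_ineq4]) (intro add_mono F \<xi>)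
        also have "\<dots> \<le> inverse (real (Suc N)) + inverse (real (Suc N))"
          using mn by (intro add_mono le_imp_inverse_le) auto
        finally show "cmod (\<xi> (X m \<ominus> X n)) \<le> 2 * inverse (real (Suc N))"
          by simp
      qed (use X in auto)
      with N show ?thesis
        by simp
    qed
    then show ?thesis
      by blast
  qed
  then obtain x where x: "x \<in> carrier A" "(\<lambda>n. cnorm A (X n \<ominus> x)) \<longlonglongrightarrow> 0"
    using complete[of X] X by blast
  have "\<xi> x = F \<xi>" if \<xi>: "\<xi> \<in> chars A" for \<xi>
  proof -
    have "(\<lambda>n. inverse (real (Suc n)) + cnorm A (X n \<ominus> x)) \<longlonglongrightarrow> 0 + 0"
      by (intro tendsto_add LIMSEQ_inverse_real_of_nat x(2))
    moreover have "cmod (\<xi> x - F \<xi>) \<le> inverse (real (Suc n)) + cnorm A (X n \<ominus> x)" for n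
    proof -
      have "cmod (\<xi> x - F \<xi>) \<le> cmod (\<xi> (X n) - F \<xi>) + cmod (\<xi> (X n \<ominus> x))"
        using norm_triangle_ineq4[of "\<xi> (X n) - F \<xi>" "\<xi> (X n \<ominus> x)"] \<xi> X x by simp
      then show ?thesis
        using F[OF \<xi>, of n] chars_cnorm_le[OF \<xi>, of "X n \<ominus> x"] X x by simp
    qed
    ultimately have "cmod (\<xi> x - F \<xi>) \<le> 0"
      by (intro LIMSEQ_le_const) auto
    then show ?thesis
      by simp
  qed
  with x show ?thesis
    by blast
qed

lemma element_of_approximations:
  assumes "\<And>e. 0 < e \<Longrightarrow> \<exists>x\<in>carrier A. \<forall>\<xi>\<in>chars A. cmod (\<xi> x - F \<xi>) \<le> e"
  shows "\<exists>x\<in>carrier A. \<forall>\<xi>\<in>chars A. \<xi> x = F \<xi>"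
proof -
  have "\<exists>x. x \<in> carrier A \<and> (\<forall>\<xi>\<in>chars A. cmod (\<xi> x - F \<xi>) \<le> inverse (real (Suc n)))" for n
    using assms[of "inverse (real (Suc n))"] by auto
  then obtain X where "\<And>n. X n \<in> carrier A" "\<And>n \<xi>. \<xi> \<in> chars A \<Longrightarrow> cmod (\<xi> (X n) - F \<xi>) \<le> inverse (real (Suc n))"
    by metis
  then show ?thesis
    using uniform_limit_of_elements[of X F] by blast
qed

text \<open>Polynomials approximate \<open>f\<close> on an interval that contains the values of all
  characters at \<open>a\<close> and \<open>g\<close>; their constant terms are small because
  \<open>f 0 = 0\<close> and may be dropped. The congruence modulo \<open>J\<close> holds for each
  polynomial and survives the limit because \<open>J\<close> is closed.\<close>

lemma functional_calculus_modulo: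
  assumes J: "closed_ideal A J"
    and a: "a \<in> carrier A" "star A a = a" and g: "g \<in> carrier A" "star A g = g" and ag: "a \<ominus> g \<in> J"
    and f: "continuous_on UNIV f" "f 0 = (0::real)"
  obtains c d where "c \<in> carrier A" "d \<in> carrier A" "c \<ominus> d \<in> J"
    "\<And>\<xi>. \<xi> \<in> chars A \<Longrightarrow> \<xi> c = complex_of_real (f (Re (\<xi> a)))"
    "\<And>\<xi>. \<xi> \<in> chars A \<Longrightarrow> \<xi> d = complex_of_real (f (Re (\<xi> g)))"
proof -
  define M where "M = max (cnorm A a) (cnorm A g)"
  have M0: "0 \<le> M"
    using cnorm_nonneg[OF a(1)] by (simp add: M_def)
  have range: "Re (\<xi> a) \<in> {-M..M}" "Re (\<xi> g) \<in> {-M..M}" if "\<xi> \<in> chars A" for \<xi>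
    using chars_cnorm_le[OF that a(1)] chars_cnorm_le[OF that g(1)] abs_Re_le_cmod[of "\<xi> a"] abs_Re_le_cmod[of "\<xi> g"]
    by (auto simp: M_def)
  have "\<exists>c d. c \<in> carrier A \<and> d \<in> carrier A \<and> c \<ominus> d \<in> J \<and>
    (\<forall>\<xi>\<in>chars A. cmod (\<xi> c - complex_of_real (f (Re (\<xi> a)))) \<le> e \<and> cmod (\<xi> d - complex_of_real (f (Re (\<xi> g)))) \<le> e)"
    if e: "0 < e" for e
  proof -
    \<comment> \<open>Half of the tolerance is reserved for the constant term
      \<open>p 0\<close>.\<close>
    obtain p where p: "real_polynomial_function p" "\<And>x. x \<in> {-M..M} \<Longrightarrow> \<bar>f x - p x\<bar> < e / 2"
      using Stone_Weierstrass_real_polynomial_function[of "{-M..M}" f "e/2"] e continuous_on_subset[OF f(1)] by auto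
    obtain c d where cd: "c \<in> carrier A" "d \<in> carrier A" "c \<ominus> d \<in> J"
      and ch: "\<And>\<xi>. \<xi> \<in> chars A \<Longrightarrow> \<xi> c = complex_of_real (p (Re (\<xi> a)) - p 0) \<and> \<xi> d = complex_of_real (p (Re (\<xi> g)) - p 0)"
      using polynomial_calculus[OF J a g ag p(1)] by meson
    have "\<bar>p 0\<bar> < e / 2"
      using p(2)[of 0] M0 f(2) by simp
    then have "\<bar>(p x - p 0) - f x\<bar> \<le> e" if "x \<in> {-M..M}" for x
      using p(2)[OF that] by linarith
    then have "cmod (complex_of_real (p x - p 0) - complex_of_real (f x)) \<le> e" if "x \<in> {-M..M}" for x
      using that by (simp only: norm_of_real flip: of_real_diff)
    then have "cmod (\<xi> c - complex_of_real (f (Re (\<xi> a)))) \<le> e \<and> cmod (\<xi> d - complex_of_real (f (Re (\<xi> g)))) \<le> e"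
      if "\<xi> \<in> chars A" for \<xi>
      using ch[OF that] range[OF that] by presburger
    with cd show ?thesis
      by blast
  qed
  then have "\<exists>c d. c \<in> carrier A \<and> d \<in> carrier A \<and> c \<ominus> d \<in> J \<and>
    (\<forall>\<xi>\<in>chars A. cmod (\<xi> c - complex_of_real (f (Re (\<xi> a)))) \<le> inverse (real (Suc n)) \<and>
      cmod (\<xi> d - complex_of_real (f (Re (\<xi> g)))) \<le> inverse (real (Suc n)))" for n
    by simp
  then obtain C D where CD: "\<And>n. C n \<in> carrier A" "\<And>n. D n \<in> carrier A" "\<And>n. C n \<ominus> D n \<in> J"
    and Cch: "\<And>n \<xi>. \<xi> \<in> chars A \<Longrightarrow> cmod (\<xi> (C n) - complex_of_real (f (Re (\<xi> a)))) \<le> inverse (real (Suc n))"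
    and Dch: "\<And>n \<xi>. \<xi> \<in> chars A \<Longrightarrow> cmod (\<xi> (D n) - complex_of_real (f (Re (\<xi> g)))) \<le> inverse (real (Suc n))"
    by metis
  obtain c where c: "c \<in> carrier A" "(\<lambda>n. cnorm A (C n \<ominus> c)) \<longlonglongrightarrow> 0" "\<forall>\<xi>\<in>chars A. \<xi> c = complex_of_real (f (Re (\<xi> a)))"
    using uniform_limit_of_elements[of C, OF CD(1) Cch] by blast
  obtain d where d: "d \<in> carrier A" "(\<lambda>n. cnorm A (D n \<ominus> d)) \<longlonglongrightarrow> 0" "\<forall>\<xi>\<in>chars A. \<xi> d = complex_of_real (f (Re (\<xi> g)))"
    using uniform_limit_of_elements[of D, OF CD(2) Dch] by blast
  have "(\<lambda>n. cnorm A ((C n \<ominus> D n) \<ominus> (c \<ominus> d))) \<longlonglongrightarrow> 0"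
  proof (rule tendsto_sandwich[OF always_eventually always_eventually])
    show "\<forall>n. 0 \<le> cnorm A ((C n \<ominus> D n) \<ominus> (c \<ominus> d))"
      using CD c d by (auto intro: cnorm_nonneg)
    show "\<forall>n. cnorm A ((C n \<ominus> D n) \<ominus> (c \<ominus> d)) \<le> cnorm A (C n \<ominus> c) + cnorm A (D n \<ominus> d)"
    proof
      fix n
      have "(C n \<ominus> D n) \<ominus> (c \<ominus> d) = (C n \<ominus> c) \<ominus> (D n \<ominus> d)"
        using CD c d by (intro chars_eqI) auto
      then show "cnorm A ((C n \<ominus> D n) \<ominus> (c \<ominus> d)) \<le> cnorm A (C n \<ominus> c) + cnorm A (D n \<ominus> d)"
        using cnorm_diff_le[of "C n \<ominus> c" "D n \<ominus> d"] CD c d by simp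
    qed
    show "(\<lambda>n. cnorm A (C n \<ominus> c) + cnorm A (D n \<ominus> d)) \<longlonglongrightarrow> 0"
      using tendsto_add[OF c(2) d(2)] by simp
  qed auto
  then have "c \<ominus> d \<in> J"
    using c d by (intro closed_ideal_rules(8)[OF J CD(3)]) auto
  show ?thesis
    by (rule that[OF c(1) d(1) \<open>c \<ominus> d \<in> J\<close>]) (use c(3) d(3) in simp_all)
qed

text \<open>The calculus modulo the whole algebra, with \<open>g = a\<close>.\<close>

lemma functional_calculus:
  assumes a: "a \<in> carrier A" "star A a = a" and f: "continuous_on UNIV f" "f 0 = (0::real)"
  obtains c where "c \<in> carrier A" "star A c = c" "\<And>\<xi>. \<xi> \<in> chars A \<Longrightarrow> \<xi> c = complex_of_real (f (Re (\<xi> a)))"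
proof -
  have J: "closed_ideal A (carrier A)"
    by (auto simp: closed_ideal_def linear_subspace_def norm_closed_def)
  have aa: "a \<ominus> a \<in> carrier A"
    using a by simp
  obtain c d where c: "c \<in> carrier A" "\<And>\<xi>. \<xi> \<in> chars A \<Longrightarrow> \<xi> c = complex_of_real (f (Re (\<xi> a)))"
    and "d \<in> carrier A" "c \<ominus> d \<in> carrier A" "\<And>\<xi>. \<xi> \<in> chars A \<Longrightarrow> \<xi> d = complex_of_real (f (Re (\<xi> a)))"
    by (rule functional_calculus_modulo[OF J a a aa f]) (rule that; assumption)
  have "star A c = c"
    using c(1) by (intro chars_eqI) (simp_all add: c(2))
  with c show ?thesis
    by (rule_tac that)
qed

text \<open>The calculus is carried out inside \<open>B\<close>. Characters of \<open>A\<close>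
  restrict to characters of \<open>B\<close>, so they cannot tell the result from that of the
  calculus in \<open>A\<close>.\<close>

lemma functional_calculus_subalg:
  assumes B: "cstar_subalgebra A B" and a: "a \<in> B" "star A a = a" and f: "continuous_on UNIV f" "f 0 = (0::real)"
  obtains c where "c \<in> B" "star A c = c" "\<And>\<xi>. \<xi> \<in> chars A \<Longrightarrow> \<xi> c = complex_of_real (f (Re (\<xi> a)))"
proof -
  interpret B: comm_cstar "subalg A B"
    by (rule comm_cstar_subalg[OF B])
  have BA: "B \<subseteq> carrier A"
    using B by (auto simp: cstar_subalgebra_def linear_subspace_def)
  show ?thesis
    by (rule B.functional_calculus[OF _ _ f, of a]) (use a chars_subalg[OF _ BA] in \<open>auto intro: that\<close>)
qed

lemma square_root:
  assumes a: "a \<in> carrier A" and pos: "\<And>\<xi>. \<xi> \<in> chars A \<Longrightarrow> \<xi> a = complex_of_real (Re (\<xi> a)) \<and> 0 \<le> Re (\<xi> a)"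
  obtains s where "s \<in> carrier A" "star A s = s" "s \<otimes> s = a" "\<And>\<xi>. \<xi> \<in> chars A \<Longrightarrow> \<xi> s = complex_of_real (sqrt (Re (\<xi> a)))"
proof -
  have h: "star A a = a"
  proof (rule chars_eqI)
    fix \<xi> assume \<xi>: "\<xi> \<in> chars A"
    show "\<xi> (star A a) = \<xi> a"
      using pos[OF \<xi>] by (simp only: chars_simps(3)[OF \<xi> a] complex_eq_iff) simp
  qed (use a in auto)
  obtain s where s: "s \<in> carrier A" "star A s = s" "\<And>\<xi>. \<xi> \<in> chars A \<Longrightarrow> \<xi> s = complex_of_real (sqrt (Re (\<xi> a)))"
    using functional_calculus[OF a h, of sqrt] continuous_on_real_sqrt[OF continuous_on_id] by auto
  have "s \<otimes> s = a"
  proof (rule chars_eqI)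
    fix \<xi> assume \<xi>: "\<xi> \<in> chars A"
    have "\<xi> (s \<otimes> s) = complex_of_real (sqrt (Re (\<xi> a)) * sqrt (Re (\<xi> a)))"
      by (simp only: chars_simps(2)[OF \<xi> s(1) s(1)] s(3)[OF \<xi>] of_real_mult)
    also have "\<dots> = complex_of_real (Re (\<xi> a))"
      using pos[OF \<xi>] by (simp only: real_sqrt_mult_self abs_of_nonneg)
    finally have "\<xi> (s \<otimes> s) = complex_of_real (Re (\<xi> a))" .
    then show "\<xi> (s \<otimes> s) = \<xi> a"
      using pos[OF \<xi>] by simp
  qed (use s a in auto)
  with s show ?thesis
    by (rule_tac that)
qed

end

section \<open>Quotients\<close>

locale comm_cstar_ideal = comm_cstar +
  fixes J
  assumes J: "closed_ideal A J"
begin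

lemmas J_carrier = closed_ideal_rules(1)[OF J]
lemmas J_rules [simp] = closed_ideal_rules(2-7)[OF J]
lemmas J_limit = closed_ideal_rules(8)[OF J]

definition q :: "'a \<Rightarrow> 'a set" where
  "q x = J +> x"

text \<open>The quotient norm as a function of representatives. Estimates are made on elements of
  \<open>A\<close> and transferred to cosets only when the quotient algebra is assembled.\<close>

definition qn :: "'a \<Rightarrow> real" where
  "qn x = (INF y\<in>q x. cnorm A y)"

lemma mem_q: "x \<in> carrier A \<Longrightarrow> y \<in> q x \<longleftrightarrow> y \<in> carrier A \<and> y \<ominus> x \<in> J"
proof
  assume x: "x \<in> carrier A"
  {
    assume "y \<in> q x"
    then obtain j where j: "j \<in> J" "y = j \<oplus> x"
      by (auto simp: q_def a_r_coset_def')
    moreover have "(j \<oplus> x) \<ominus> x = j"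
      using j x J_carrier by (intro chars_eqI) auto
    ultimately show "y \<in> carrier A \<and> y \<ominus> x \<in> J"
      using x J_carrier by auto
  }
  assume y: "y \<in> carrier A \<and> y \<ominus> x \<in> J"
  then have "y = (y \<ominus> x) \<oplus> x"
    using x by (intro chars_eqI) auto
  then show "y \<in> q x"
    using y unfolding q_def a_r_coset_def' by blast
qed

lemma q_eqI:
  assumes "x \<in> carrier A" "y \<in> carrier A" "x \<ominus> y \<in> J"
  shows "q x = q y"
proof -
  have "z \<ominus> x \<in> J \<longleftrightarrow> z \<ominus> y \<in> J" if z: "z \<in> carrier A" for z
  proof -
    have 1: "z \<ominus> y = (z \<ominus> x) \<oplus> (x \<ominus> y)" and 2: "z \<ominus> x = (z \<ominus> y) \<ominus> (x \<ominus> y)"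
      using z assms by (intro chars_eqI; simp)+
    show ?thesis
      using J_rules(2)[OF _ assms(3), of "z \<ominus> x"] J_rules(6)[OF _ assms(3), of "z \<ominus> y"] 1 2 by argo
  qed
  then show ?thesis
    using assms by (auto simp: mem_q)
qed

lemma self_mem_q: "x \<in> carrier A \<Longrightarrow> x \<in> q x"
  by (simp add: mem_q)

lemma q_nonempty: "x \<in> carrier A \<Longrightarrow> q x \<noteq> {}"
  using self_mem_q by blast

lemma diff_zero [simp]: "x \<in> carrier A \<Longrightarrow> x \<ominus> \<zero> = x"
  by (intro chars_eqI) auto

lemma q_eq_iff: "\<lbrakk>x \<in> carrier A; y \<in> carrier A\<rbrakk> \<Longrightarrow> q x = q y \<longleftrightarrow> x \<ominus> y \<in> J"
  by (metis q_eqI mem_q self_mem_q)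

lemma q_zero: "q \<zero> = J"
  using J_carrier by (auto simp: mem_q)

lemma qn_nonneg: "x \<in> carrier A \<Longrightarrow> 0 \<le> qn x"
  unfolding qn_def using q_nonempty by (intro cINF_greatest) (auto simp: mem_q cnorm_nonneg)

lemma qn_le: "\<lbrakk>x \<in> carrier A; y \<in> carrier A; y \<ominus> x \<in> J\<rbrakk> \<Longrightarrow> qn x \<le> cnorm A y"
  unfolding qn_def by (intro cINF_lower bdd_belowI[of _ 0]) (auto simp: mem_q cnorm_nonneg)

lemma qn_le_cnorm: "x \<in> carrier A \<Longrightarrow> qn x \<le> cnorm A x"
  by (rule qn_le) auto

lemma qn_lift:
  assumes "x \<in> carrier A" "qn x < r"
  obtains y where "y \<in> carrier A" "y \<ominus> x \<in> J" "cnorm A y < r"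
proof -
  have "q x \<noteq> {}" "bdd_below (cnorm A ` q x)"
    using assms(1) q_nonempty by (auto simp: mem_q cnorm_nonneg intro!: bdd_belowI[of _ 0])
  then obtain y where "y \<in> q x" "cnorm A y < r"
    using assms(2) unfolding qn_def by (auto simp: cINF_less_iff)
  then show ?thesis
    using that assms by (auto simp: mem_q)
qed

text \<open>Lets \<open>qn x\<close> be replaced by any larger \<open>r\<close>, for which
  \<open>qn_lift\<close> supplies an actual representative.\<close>

lemma qn_limit:
  assumes "\<And>r. qn x < r \<Longrightarrow> z \<le> k * r" "0 \<le> k"
  shows "z \<le> k * qn x"
proof (cases "k = 0")
  case True
  then show ?thesis
    using assms(1)[of "qn x + 1"] by simp
next
  case False
  then have "z / k \<le> r" if "qn x < r" for r
    using assms(1)[OF that] assms(2) by (simp add: divide_simps mult.commute)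
  then have "z / k \<le> qn x"
    by (rule dense_ge)
  then show ?thesis
    using False assms(2) by (simp add: divide_simps mult.commute)
qed

lemma qn_triangle:
  assumes x: "x \<in> carrier A" and y: "y \<in> carrier A"
  shows "qn (x \<oplus> y) \<le> qn x + qn y"
proof -
  have bound: "qn (x \<oplus> y) \<le> r + s" if r: "qn x < r" and s: "qn y < s" for r s
  proof -
    obtain x' where x': "x' \<in> carrier A" "x' \<ominus> x \<in> J" "cnorm A x' < r"
      using qn_lift[OF x r] by blast
    obtain y' where y': "y' \<in> carrier A" "y' \<ominus> y \<in> J" "cnorm A y' < s"
      using qn_lift[OF y s] by blast
    have "(x' \<oplus> y') \<ominus> (x \<oplus> y) = (x' \<ominus> x) \<oplus> (y' \<ominus> y)"
      using x y x' y' by (intro chars_eqI) auto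
    then have "qn (x \<oplus> y) \<le> cnorm A (x' \<oplus> y')"
      using x y x' y' by (intro qn_le) auto
    also have "\<dots> \<le> r + s"
      using cnorm_triangle[of x' y'] x' y' by simp
    finally show ?thesis .
  qed
  have "qn (x \<oplus> y) - s \<le> qn x" if s: "qn y < s" for s
  proof (rule dense_ge)
    show "qn (x \<oplus> y) - s \<le> r" if "qn x < r" for r
      using bound[OF that s] by simp
  qed
  then have "qn (x \<oplus> y) - qn x \<le> s" if "qn y < s" for s
    using that by (simp add: algebra_simps)
  then have "qn (x \<oplus> y) - qn x \<le> qn y"
    by (rule dense_ge)
  then show ?thesis
    by simp
qed

lemma qn_smult:
  assumes x: "x \<in> carrier A"
  shows "qn (c \<odot> x) = cmod c * qn x"
proof -
  have le: "qn (c \<odot> x) \<le> cmod c * qn x" if x: "x \<in> carrier A" for c x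
  proof (rule qn_limit)
    fix r assume "qn x < r"
    then obtain y where y: "y \<in> carrier A" "y \<ominus> x \<in> J" "cnorm A y < r"
      using qn_lift[OF x] by blast
    have "c \<odot> y \<ominus> c \<odot> x = c \<odot> (y \<ominus> x)"
      using x y by (simp add: smult_diff)
    then have "qn (c \<odot> x) \<le> cnorm A (c \<odot> y)"
      using x y by (intro qn_le) auto
    also have "\<dots> \<le> cmod c * r"
      using y by (simp add: cnorm_smult mult_left_mono)
    finally show "qn (c \<odot> x) \<le> cmod c * r" .
  qed auto
  show ?thesis
  proof (cases "c = 0")
    case True
    then show ?thesis
      using qn_nonneg[of \<zero>] qn_le_cnorm[of \<zero>] x by simp
  next
    case False
    have "qn x = qn ((1 / c) \<odot> (c \<odot> x))"
      using x False by (simp add: smult_one flip: smult_smult)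
    also have "\<dots> \<le> cmod (1 / c) * qn (c \<odot> x)"
      using x by (intro le) auto
    finally have "cmod c * qn x \<le> qn (c \<odot> x)"
      using False by (simp add: norm_divide divide_simps mult.commute)
    then show ?thesis
      using le[OF x, of c] by simp
  qed
qed

lemma qn_mult:
  assumes x: "x \<in> carrier A" and y: "y \<in> carrier A"
  shows "qn (x \<otimes> y) \<le> qn x * qn y"
proof (rule qn_limit)
  fix s assume s: "qn y < s"
  have s0: "0 \<le> s"
    using s qn_nonneg[OF y] by simp
  have "qn (x \<otimes> y) \<le> s * qn x"
  proof (rule qn_limit)
    fix r assume r: "qn x < r"
    obtain x' where x': "x' \<in> carrier A" "x' \<ominus> x \<in> J" "cnorm A x' < r"
      using qn_lift[OF x r] by blast
    obtain y' where y': "y' \<in> carrier A" "y' \<ominus> y \<in> J" "cnorm A y' < s"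
      using qn_lift[OF y s] by blast
    have "x' \<otimes> y' \<ominus> x \<otimes> y = x' \<otimes> (y' \<ominus> y) \<oplus> (x' \<ominus> x) \<otimes> y"
      using x y x' y' by (intro chars_eqI) (auto simp: algebra_simps)
    then have "qn (x \<otimes> y) \<le> cnorm A (x' \<otimes> y')"
      using x y x' y' by (intro qn_le) auto
    also have "\<dots> \<le> cnorm A x' * cnorm A y'"
      using x' y' by (intro cnorm_mult)
    also have "\<dots> \<le> r * s"
      using x' y' cnorm_nonneg[of x'] cnorm_nonneg[of y'] by (intro mult_mono) auto
    finally show "qn (x \<otimes> y) \<le> s * r"
      by (simp add: mult.commute)
  qed (rule s0)
  then show "qn (x \<otimes> y) \<le> qn x * s"
    by (simp add: mult.commute)
qed (rule qn_nonneg[OF x])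

lemma qn_eq_zero_iff:
  assumes x: "x \<in> carrier A"
  shows "qn x = 0 \<longleftrightarrow> x \<in> J"
proof
  assume "x \<in> J"
  then have "\<zero> \<ominus> x \<in> J"
    by simp
  then show "qn x = 0"
    using qn_le[of x \<zero>] qn_nonneg[OF x] x by simp
next
  assume 0: "qn x = 0"
  have "\<exists>y. y \<in> carrier A \<and> y \<ominus> x \<in> J \<and> cnorm A y < inverse (real (Suc n))" for n
    using qn_lift[OF x, of "inverse (real (Suc n))"] 0 by auto
  then obtain Y where Y: "\<And>n. Y n \<in> carrier A" "\<And>n. Y n \<ominus> x \<in> J" "\<And>n. cnorm A (Y n) < inverse (real (Suc n))"
    by metis
  \<comment> \<open>The element \<open>x - Y n\<close> lies in \<open>J\<close>, and its distance
    from \<open>x\<close> is the norm of \<open>Y n\<close>, which tends to 0.\<close>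
  have eq: "(- 1) \<odot> (Y n \<ominus> x) \<ominus> x = (- 1) \<odot> Y n" for n
    using x Y(1) by (intro chars_eqI) auto
  have "(\<lambda>n. cnorm A ((- 1) \<odot> (Y n \<ominus> x) \<ominus> x)) \<longlonglongrightarrow> 0"
    unfolding eq
    by (rule tendsto_sandwich[OF always_eventually always_eventually tendsto_const LIMSEQ_inverse_real_of_nat])
      (use Y in \<open>auto simp: cnorm_smult cnorm_nonneg intro: less_imp_le\<close>)
  then show "x \<in> J"
    by (rule J_limit[of "\<lambda>n. (- 1) \<odot> (Y n \<ominus> x)", rotated 2]) (use x Y in auto)
qed

text \<open>Multiplying \<open>j\<^sup>*\<close> by a cut-off of \<open>j\<^sup>*j\<close>, which lies in \<open>J\<close>, approximates \<open>j\<^sup>*\<close> within \<open>J\<close>.\<close>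

lemma J_star [simp]:
  assumes j: "j \<in> J"
  shows "star A j \<in> J"
proof -
  have jc: "j \<in> carrier A"
    using j by (rule J_carrier)
  have "\<exists>c\<in>J. cnorm A (star A j \<otimes> c \<ominus> star A j) \<le> e" if e: "0 < e" for e
  proof -
    \<comment> \<open>Vanishes at 0 and equals 1 from \<open>e^2\<close> on. At a character with
      \<open>t = cmod (\<xi> j)\<close> the error is \<open>t (1 - f (t^2))\<close>, which is 0 for
      \<open>t \<ge> e\<close> and at most \<open>t\<close> otherwise.\<close>
    define f where "f t = min 1 (\<bar>t\<bar> / e\<^sup>2)" for t
    have f: "continuous_on UNIV f" "f 0 = 0"
      unfolding f_def using e by (auto intro!: continuous_intros)
    have h: "star A j \<otimes> j \<in> carrier A" "star A (star A j \<otimes> j) = star A j \<otimes> j" "star A j \<otimes> j \<ominus> \<zero> \<in> J"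
      using j jc by (auto simp: star_mult star_star)
    obtain c d where cd: "c \<in> carrier A" "d \<in> carrier A" "c \<ominus> d \<in> J"
      "\<And>\<xi>. \<xi> \<in> chars A \<Longrightarrow> \<xi> c = complex_of_real (f (Re (\<xi> (star A j \<otimes> j))))"
      "\<And>\<xi>. \<xi> \<in> chars A \<Longrightarrow> \<xi> d = complex_of_real (f (Re (\<xi> \<zero>)))"
      using functional_calculus_modulo[OF J h(1,2) _ _ h(3) f] by (metis zero_closed star_zero)
    \<comment> \<open>The calculus was compared with that of 0, so the congruence
      \<open>c \<ominus> d \<in> J\<close> says that \<open>c\<close> lies in
      \<open>J\<close>.\<close>
    have "d = \<zero>"
      using cd(2) by (intro chars_eqI) (auto simp: cd(5) f)
    then have "c \<in> J"
      using cd by simp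
    moreover have "cnorm A (star A j \<otimes> c \<ominus> star A j) \<le> e"
    proof (rule cnorm_le_of_chars)
      fix \<xi> assume \<xi>: "\<xi> \<in> chars A"
      define t where "t = cmod (\<xi> j)"
      have "\<xi> c = complex_of_real (f (t\<^sup>2))"
        unfolding cd(4)[OF \<xi>] using \<xi> jc by (simp add: t_def cmod_power2 mult.commute flip: power2_eq_square)
      then have "\<xi> (star A j \<otimes> c \<ominus> star A j) = cnj (\<xi> j) * complex_of_real (f (t\<^sup>2) - 1)"
        using \<xi> jc cd by (simp add: algebra_simps)
      then have "cmod (\<xi> (star A j \<otimes> c \<ominus> star A j)) = t * \<bar>f (t\<^sup>2) - 1\<bar>"
        by (simp only: norm_mult complex_mod_cnj norm_of_real t_def)
      also have "\<dots> \<le> e"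
      proof (cases "e \<le> t")
        case True
        then have "e\<^sup>2 \<le> t\<^sup>2"
          using e by (intro power_mono) auto
        then have "f (t\<^sup>2) = 1"
          using e by (simp add: f_def divide_simps)
        then show ?thesis
          using e by simp
      next
        case False
        have "0 \<le> f (t\<^sup>2)" "f (t\<^sup>2) \<le> 1" "0 \<le> t"
          by (auto simp: f_def t_def)
        then have "t * \<bar>f (t\<^sup>2) - 1\<bar> \<le> t * 1"
          by (intro mult_left_mono) auto
        then show ?thesis
          using False by simp
      qed
      finally show "cmod (\<xi> (star A j \<otimes> c \<ominus> star A j)) \<le> e" .
    qed (use cd jc e in auto)
    ultimately show ?thesis
      by blast
  qed
  then have "\<exists>c. c \<in> J \<and> cnorm A (star A j \<otimes> c \<ominus> star A j) \<le> inverse (real (Suc n))" for n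
    by (metis inverse_positive_iff_positive of_nat_0_less_iff zero_less_Suc)
  then obtain C where C: "\<And>n. C n \<in> J" "\<And>n. cnorm A (star A j \<otimes> C n \<ominus> star A j) \<le> inverse (real (Suc n))"
    by metis
  have "(\<lambda>n. cnorm A (star A j \<otimes> C n \<ominus> star A j)) \<longlonglongrightarrow> 0"
    by (rule tendsto_sandwich[OF always_eventually always_eventually tendsto_const LIMSEQ_inverse_real_of_nat])
      (use C J_carrier jc in \<open>auto simp: cnorm_nonneg\<close>)
  then show ?thesis
    by (rule J_limit[of "\<lambda>n. star A j \<otimes> C n", rotated 2]) (use C jc in auto)
qed

text \<open>Cutting \<open>b\<close> down to norm \<open>r\<close> changes it by \<open>b \<psi>(b\<^sup>*b)\<close>, where \<open>\<psi>\<close> vanishes up to \<open>r\<^sup>2\<close>.\<close>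

lemma norm_lift:
  assumes B: "cstar_subalgebra A B" and b: "b \<in> B" and r: "0 < r" and less: "qn (star A b \<otimes> b) < r\<^sup>2"
  obtains c where "c \<in> B" "c \<ominus> b \<in> J" "cnorm A c \<le> r"
proof -
  have Bc: "x \<in> carrier A" if "x \<in> B" for x
    using B that by (auto simp: cstar_subalgebra_def linear_subspace_def)
  define h where "h = star A b \<otimes> b"
  have hB: "h \<in> B"
    using B b by (auto simp: cstar_subalgebra_def h_def)
  have h: "h \<in> carrier A" "star A h = h"
    using Bc[OF b] by (auto simp: h_def star_mult star_star)
  obtain g0 where g0: "g0 \<in> carrier A" "g0 \<ominus> h \<in> J" "cnorm A g0 < r\<^sup>2"
    using qn_lift[OF h(1)] less unfolding h_def by blast
  \<comment> \<open>The hermitian part of a small representative of \<open>h\<close>: still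
    congruent to \<open>h\<close> because \<open>J\<close> is closed under \<open>star\<close>, and
    still of norm below \<open>r^2\<close>.\<close>
  define g where "g = (1/2) \<odot> (g0 \<oplus> star A g0)"
  have g: "g \<in> carrier A" "star A g = g"
    using g0 by (auto simp: g_def star_smult star_add star_star a_comm)
  have "cnorm A g \<le> 1/2 * (cnorm A g0 + cnorm A (star A g0))"
    using g0 cnorm_triangle[of g0 "star A g0"] by (simp add: g_def cnorm_smult)
  then have gr: "cnorm A g < r\<^sup>2"
    using g0 by simp
  have "h \<ominus> g = (- 1/2) \<odot> ((g0 \<ominus> h) \<oplus> star A (g0 \<ominus> h))"
  proof (rule chars_eqI)
    fix \<xi> assume \<xi>: "\<xi> \<in> chars A"
    have "cnj (\<xi> h) = \<xi> h"
      using chars_simps(3)[OF \<xi> h(1)] h(2) by simp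
    then show "\<xi> (h \<ominus> g) = \<xi> ((- 1/2) \<odot> ((g0 \<ominus> h) \<oplus> star A (g0 \<ominus> h)))"
      using \<xi> h g0 by (simp add: g_def algebra_simps)
  qed (use h g g0 in auto)
  then have hg: "h \<ominus> g \<in> J"
    using J_rules(3)[OF J_rules(2)[OF g0(2) J_star[OF g0(2)]], of "- 1/2"] by simp
  \<comment> \<open>Chosen so that \<open>1 - \<psi> (t^2) = r / max r t\<close> for
    \<open>t \<ge> 0\<close>, the factor that shrinks a number of modulus \<open>t\<close> to
    modulus at most \<open>r\<close>.\<close>
  define \<psi> where "\<psi> t = 1 - r / max r (sqrt t)" for t
  have mpos: "0 < max r (sqrt t)" for t
    using r by simp
  have "continuous_on UNIV \<psi>"
    unfolding \<psi>_def using mpos by (intro continuous_intros) (metis less_irrefl)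
  moreover have small: "\<psi> t = 0" if "t \<le> r\<^sup>2" for t
  proof -
    have "sqrt t \<le> r"
      using real_sqrt_le_mono[OF that] r by simp
    then show ?thesis
      using r by (simp add: \<psi>_def max_def)
  qed
  moreover have "\<psi> 0 = 0"
    by (rule small) simp
  ultimately have \<psi>: "continuous_on UNIV \<psi>" "\<psi> 0 = 0"
    by auto
  \<comment> \<open>The same function of \<open>h\<close> is formed twice: modulo \<open>J\<close>,
    where comparison with \<open>g\<close> puts it into \<open>J\<close>, and inside
    \<open>B\<close>. Characters identify the two, so the correction lies in both \<open>J\<close>
    and \<open>B\<close>.\<close>
  obtain c1 d1 where cd: "c1 \<in> carrier A" "d1 \<in> carrier A" "c1 \<ominus> d1 \<in> J"
    "\<And>\<xi>. \<xi> \<in> chars A \<Longrightarrow> \<xi> c1 = complex_of_real (\<psi> (Re (\<xi> h)))"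
    "\<And>\<xi>. \<xi> \<in> chars A \<Longrightarrow> \<xi> d1 = complex_of_real (\<psi> (Re (\<xi> g)))"
    by (rule functional_calculus_modulo[OF J h g hg \<psi>]) (rule that; assumption)
  obtain c2 where c2: "c2 \<in> B" "star A c2 = c2" "\<And>\<xi>. \<xi> \<in> chars A \<Longrightarrow> \<xi> c2 = complex_of_real (\<psi> (Re (\<xi> h)))"
    by (rule functional_calculus_subalg[OF B hB h(2) \<psi>]) (rule that; assumption)
  have "d1 = \<zero>"
  proof (rule chars_eqI)
    fix \<xi> assume \<xi>: "\<xi> \<in> chars A"
    have "Re (\<xi> g) \<le> r\<^sup>2"
      using complex_Re_le_cmod[of "\<xi> g"] chars_cnorm_le[OF \<xi> g(1)] gr by simp
    then show "\<xi> d1 = \<xi> \<zero>"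
      using small cd(5)[OF \<xi>] \<xi> by simp
  qed (use cd in auto)
  then have "c1 \<in> J"
    using cd by simp
  moreover have "c1 = c2"
    using cd(1) Bc[OF c2(1)] by (intro chars_eqI) (simp_all add: cd(4) c2(3))
  ultimately have c2J: "c2 \<in> J"
    by simp
  define c where "c = b \<oplus> (- 1) \<odot> (b \<otimes> c2)"
  note bc = Bc[OF b] and c2c = Bc[OF c2(1)]
  have "c \<in> B"
    using B b c2 by (auto simp: cstar_subalgebra_def linear_subspace_def c_def)
  moreover have "c \<ominus> b = (- 1) \<odot> (b \<otimes> c2)"
    using bc c2c by (intro chars_eqI) (auto simp: c_def)
  then have "c \<ominus> b \<in> J"
    using bc c2J by simp
  moreover have "cnorm A c \<le> r"
  proof (rule cnorm_le_of_chars)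
    fix \<xi> assume \<xi>: "\<xi> \<in> chars A"
    define t where "t = cmod (\<xi> b)"
    have "Re (\<xi> h) = t\<^sup>2"
      using \<xi> bc by (simp add: h_def t_def cmod_power2 flip: power2_eq_square)
    then have "\<xi> c2 = complex_of_real (\<psi> (t\<^sup>2))"
      using c2(3)[OF \<xi>] by simp
    then have "\<xi> c = \<xi> b * complex_of_real (1 - \<psi> (t\<^sup>2))"
      using \<xi> bc c2c by (simp add: c_def algebra_simps)
    also have "1 - \<psi> (t\<^sup>2) = r / max r t"
      by (simp add: \<psi>_def t_def)
    finally have "cmod (\<xi> c) = t * \<bar>r / max r t\<bar>"
      by (simp only: norm_mult norm_of_real t_def)
    also have "\<dots> \<le> r"
      using r by (auto simp: max_def divide_simps t_def)
    finally show "cmod (\<xi> c) \<le> r" .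
  qed (use bc c2c r in \<open>auto simp: c_def\<close>)
  ultimately show ?thesis
    using that by blast
qed

lemma carrier_subalgebra: "cstar_subalgebra A (carrier A)"
  by (auto simp: cstar_subalgebra_def linear_subspace_def norm_closed_def)

text \<open>One direction multiplies out a nearly optimal representative of \<open>a\<close>. For
  the other, \<open>norm_lift\<close> with the whole algebra as \<open>B\<close> lifts
  \<open>a\<close> with norm close to the square root of
  \<open>qn (star A a \<otimes> a)\<close>.\<close>

lemma qn_star_mult:
  assumes a: "a \<in> carrier A"
  shows "qn (star A a \<otimes> a) = (qn a)\<^sup>2"
proof (rule antisym)
  show "qn (star A a \<otimes> a) \<le> (qn a)\<^sup>2"
  proof (rule ccontr)
    assume "\<not> ?thesis"
    then have "qn a < sqrt (qn (star A a \<otimes> a))"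
      using qn_nonneg[OF a] by (simp add: real_less_rsqrt)
    then obtain a' where a': "a' \<in> carrier A" "a' \<ominus> a \<in> J" "cnorm A a' < sqrt (qn (star A a \<otimes> a))"
      using qn_lift[OF a] by blast
    have "star A a' \<otimes> a' \<ominus> star A a \<otimes> a = star A a' \<otimes> (a' \<ominus> a) \<oplus> star A (a' \<ominus> a) \<otimes> a"
      using a a' by (intro chars_eqI) (auto simp: algebra_simps)
    then have "qn (star A a \<otimes> a) \<le> cnorm A (star A a' \<otimes> a')"
      using a a' by (intro qn_le) auto
    also have "\<dots> = (cnorm A a')\<^sup>2"
      using a' by (simp add: cnorm_star_mult)
    also have "\<dots> < (sqrt (qn (star A a \<otimes> a)))\<^sup>2"
      using a' cnorm_nonneg[of a'] by (intro power_strict_mono) auto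
    finally show False
      using qn_nonneg[of "star A a \<otimes> a"] a by simp
  qed
  show "(qn a)\<^sup>2 \<le> qn (star A a \<otimes> a)"
  proof (rule ccontr)
    assume "\<not> ?thesis"
    then obtain m where m: "qn (star A a \<otimes> a) < m" "m < (qn a)\<^sup>2"
      using dense by (meson not_le)
    have m0: "0 < m"
      using m qn_nonneg[of "star A a \<otimes> a"] a by simp
    then obtain c where c: "c \<in> carrier A" "c \<ominus> a \<in> J" "cnorm A c \<le> sqrt m"
      using norm_lift[OF carrier_subalgebra a, of "sqrt m"] m by auto
    have "qn a \<le> sqrt m"
      using qn_le[OF a c(1,2)] c(3) by simp
    then have "(qn a)\<^sup>2 \<le> (sqrt m)\<^sup>2"
      using qn_nonneg[OF a] by (intro power_mono)
    then show False
      using m m0 by simp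
  qed
qed

text \<open>Nearly optimal lifts exist within \<open>B\<close>, so \<open>B/(J \<inter> B)\<close>
  sits isometrically in \<open>A/J\<close>. This is what makes the image of \<open>B\<close>
  closed.\<close>

lemma norm_lift_subalgebra:
  assumes "cstar_subalgebra A B" "b \<in> B" "qn b < r"
  obtains c where "c \<in> B" "c \<ominus> b \<in> J" "cnorm A c \<le> r"
proof -
  have b: "b \<in> carrier A"
    using assms by (auto simp: cstar_subalgebra_def linear_subspace_def)
  have "0 < r" "(qn b)\<^sup>2 < r\<^sup>2"
    using assms(3) qn_nonneg[OF b] by (auto intro: power_strict_mono)
  then show ?thesis
    using norm_lift[OF assms(1,2), of r] that by (auto simp: qn_star_mult b)
qed

text \<open>Along a subsequence with increments below \<open>(1/2) ^ n\<close> the increments are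
  lifted one after another to elements of \<open>B\<close> of that size, so the lifts converge in
  \<open>B\<close>. A Cauchy sequence follows its subsequence.\<close>

lemma lift_limit:
  assumes B: "cstar_subalgebra A B" and Y: "\<And>n. Y n \<in> B"
    and cauchy: "\<And>e. 0 < e \<Longrightarrow> \<exists>N. \<forall>m\<ge>N. \<forall>n\<ge>N. qn (Y m \<ominus> Y n) < e"
  obtains c where "c \<in> B" "(\<lambda>n. qn (Y n \<ominus> c)) \<longlonglongrightarrow> 0"
proof -
  have Bc [simp]: "x \<in> carrier A" if "x \<in> B" for x
    using B that by (auto simp: cstar_subalgebra_def linear_subspace_def)
  have Bcl: "x \<oplus> y \<in> B" "x \<ominus> y \<in> B" if "x \<in> B" "y \<in> B" for x y
    using B that by (auto simp: cstar_subalgebra_def linear_subspace_def minus_eq_smult)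
  have "\<exists>N. \<forall>m\<ge>N. \<forall>m'\<ge>N. qn (Y m \<ominus> Y m') < (1/2) ^ n" for n
    by (rule cauchy) simp
  then obtain K where K: "\<And>n m m'. m \<ge> K n \<Longrightarrow> m' \<ge> K n \<Longrightarrow> qn (Y m \<ominus> Y m') < (1/2) ^ n"
    by metis
  \<comment> \<open>Summing makes the indices monotone while keeping
    \<open>k n \<ge> K n\<close>.\<close>
  define k where "k n = (\<Sum>i\<le>n. K i)" for n
  have k: "K n \<le> k n" "k n \<le> k (Suc n)" for n
    by (auto simp: k_def intro: member_le_sum)
  have "\<exists>c. \<forall>n. (c n \<in> B \<and> c n \<ominus> Y (k n) \<in> J) \<and> cnorm A (c (Suc n) \<ominus> c n) \<le> (1/2) ^ n"
  proof (rule dependent_nat_choice)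
    show "\<exists>x. x \<in> B \<and> x \<ominus> Y (k 0) \<in> J"
      using Y by (intro exI[of _ "Y (k 0)"]) auto
    fix x n assume x: "x \<in> B \<and> x \<ominus> Y (k n) \<in> J"
    let ?b = "Y (k (Suc n)) \<ominus> Y (k n)"
    have "qn ?b < (1/2) ^ n"
      using k[of n] by (intro K) auto
    then obtain d where d: "d \<in> B" "d \<ominus> ?b \<in> J" "cnorm A d \<le> (1/2) ^ n"
      using norm_lift_subalgebra[OF B, of ?b] Bcl Y by blast
    have "(x \<oplus> d) \<ominus> Y (k (Suc n)) = (x \<ominus> Y (k n)) \<oplus> (d \<ominus> ?b)" "(x \<oplus> d) \<ominus> x = d"
      using x d Y by (intro chars_eqI; simp)+
    then show "\<exists>y. (y \<in> B \<and> y \<ominus> Y (k (Suc n)) \<in> J) \<and> cnorm A (y \<ominus> x) \<le> (1/2) ^ n"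
      using x d Bcl by (intro exI[of _ "x \<oplus> d"]) auto
  qed
  then obtain c where c: "\<And>n. c n \<in> B" "\<And>n. c n \<ominus> Y (k n) \<in> J"
    and step: "\<And>n. cnorm A (c (Suc n) \<ominus> c n) \<le> (1/2) ^ n"
    by blast
  have step': "cnorm A (c (Suc n) \<ominus> c n) \<le> - 2 * (1/2) ^ Suc n - (- 2 * (1/2) ^ n)" for n
    using step[of n] by simp
  have "(\<lambda>n. - 2 * (1/2) ^ n :: real) \<longlonglongrightarrow> - 2 * 0"
    by (intro tendsto_intros LIMSEQ_realpow_zero) auto
  then have "convergent (\<lambda>n. - 2 * (1/2) ^ n :: real)"
    by (auto simp: convergent_def)
  from complete_telescoping[of c, OF _ step' this] c
  obtain x where x: "x \<in> carrier A" "(\<lambda>n. cnorm A (c n \<ominus> x)) \<longlonglongrightarrow> 0"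
    by auto
  have xB: "x \<in> B"
    using B c x unfolding cstar_subalgebra_def norm_closed_def by blast
  have "(\<lambda>n. qn (Y n \<ominus> x)) \<longlonglongrightarrow> 0"
  proof (rule LIMSEQ_I)
    fix e :: real assume e: "0 < e"
    have "eventually (\<lambda>n. cnorm A (c n \<ominus> x) < e / 2) sequentially"
      using order_tendstoD(2)[OF x(2), of "e/2"] e by simp
    moreover have "eventually (\<lambda>n. (1/2) ^ n < e / 2) sequentially"
      using order_tendstoD(2)[OF LIMSEQ_realpow_zero[of "1/2"], of "e/2"] e by simp
    ultimately obtain n where n: "cnorm A (c n \<ominus> x) < e / 2" "(1/2) ^ n < e / 2"
      using eventually_happens[OF eventually_conj] by fastforce
    have "norm (qn (Y m \<ominus> x) - 0) < e" if m: "m \<ge> k n" for m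
    proof -
      have "Y m \<ominus> x = (Y m \<ominus> Y (k n)) \<oplus> (Y (k n) \<ominus> x)"
        using Y x by (intro chars_eqI) auto
      then have "qn (Y m \<ominus> x) \<le> qn (Y m \<ominus> Y (k n)) + qn (Y (k n) \<ominus> x)"
        using qn_triangle[of "Y m \<ominus> Y (k n)" "Y (k n) \<ominus> x"] Y x by simp
      moreover have "qn (Y m \<ominus> Y (k n)) < (1/2) ^ n"
        using k[of n] m by (intro K) auto
      moreover have "(c n \<ominus> x) \<ominus> (Y (k n) \<ominus> x) = c n \<ominus> Y (k n)"
        using Y x c by (intro chars_eqI) auto
      then have "qn (Y (k n) \<ominus> x) \<le> cnorm A (c n \<ominus> x)"
        using Y x c by (intro qn_le) auto
      ultimately show ?thesis
        using n qn_nonneg[of "Y m \<ominus> x"] Y x by simp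
    qed
    then show "\<exists>no. \<forall>m\<ge>no. norm (qn (Y m \<ominus> x) - 0) < e"
      by blast
  qed
  with xB show ?thesis
    using that by blast
qed

section \<open>The quotient algebra and the image of a subalgebra\<close>

abbreviation Q :: "'a set cstar" where
  "Q \<equiv> quotient_cstar A J"

lemma Q_carrier: "carrier Q = q ` carrier A"
  by (auto simp: quotient_cstar_def A_RCOSETS_def' q_def)

lemma Q_zero: "\<zero>\<^bsub>Q\<^esub> = q \<zero>"
  by (simp add: quotient_cstar_def q_zero)

lemma q_closed [simp]: "x \<in> carrier A \<Longrightarrow> q x \<in> carrier Q"
  by (simp add: Q_carrier)

lemma q_add:
  assumes x: "x \<in> carrier A" and y: "y \<in> carrier A"
  shows "q x \<oplus>\<^bsub>Q\<^esub> q y = q (x \<oplus> y)"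
proof -
  have "z \<in> q (x \<oplus> y) \<longleftrightarrow> (\<exists>u\<in>q x. \<exists>v\<in>q y. z = u \<oplus> v)" for z
  proof
    assume "z \<in> q (x \<oplus> y)"
    then have z: "z \<in> carrier A" "z \<ominus> (x \<oplus> y) \<in> J"
      using x y by (auto simp: mem_q)
    have "z = (z \<ominus> y) \<oplus> y" "z \<ominus> y \<ominus> x = z \<ominus> (x \<oplus> y)"
      using x y z by (intro chars_eqI; simp)+
    then show "\<exists>u\<in>q x. \<exists>v\<in>q y. z = u \<oplus> v"
      using x y z by (intro bexI[of _ "z \<ominus> y"] bexI[of _ y]) (auto simp: mem_q)
  next
    assume "\<exists>u\<in>q x. \<exists>v\<in>q y. z = u \<oplus> v"
    then obtain u v where uv: "u \<in> carrier A" "u \<ominus> x \<in> J" "v \<in> carrier A" "v \<ominus> y \<in> J" "z = u \<oplus> v"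
      using x y by (auto simp: mem_q)
    have "z \<ominus> (x \<oplus> y) = (u \<ominus> x) \<oplus> (v \<ominus> y)"
      unfolding uv(5) using x y uv by (intro chars_eqI) auto
    then show "z \<in> q (x \<oplus> y)"
      using x y uv by (auto simp: mem_q)
  qed
  then show ?thesis
    by (auto simp: quotient_cstar_def set_add_def')
qed

lemma q_mult:
  assumes x: "x \<in> carrier A" and y: "y \<in> carrier A"
  shows "q x \<otimes>\<^bsub>Q\<^esub> q y = q (x \<otimes> y)"
proof -
  have "q (u \<otimes> v) = q (x \<otimes> y)" if "u \<in> q x" "v \<in> q y" for u v
  proof (rule q_eqI)
    have uv: "u \<in> carrier A" "u \<ominus> x \<in> J" "v \<in> carrier A" "v \<ominus> y \<in> J"
      using x y that by (auto simp: mem_q)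
    have "u \<otimes> v \<ominus> x \<otimes> y = u \<otimes> (v \<ominus> y) \<oplus> (u \<ominus> x) \<otimes> y"
      using x y uv by (intro chars_eqI) (auto simp: algebra_simps)
    then show "u \<otimes> v \<ominus> x \<otimes> y \<in> J"
      using x y uv by simp
  qed (use x y that in \<open>auto simp: mem_q\<close>)
  then have "(\<Union>u\<in>q x. \<Union>v\<in>q y. q (u \<otimes> v)) = q (x \<otimes> y)"
    using x y by (intro SUP_eq_const q_nonempty)
  then show ?thesis
    by (simp add: quotient_cstar_def rcoset_mult_def flip: q_def)
qed

lemma q_smult:
  assumes x: "x \<in> carrier A"
  shows "c \<odot>\<^bsub>Q\<^esub> q x = q (c \<odot> x)"
proof -
  have "q (c \<odot> u) = q (c \<odot> x)" if "u \<in> q x" for u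
    using x that by (intro q_eqI) (auto simp: mem_q simp flip: smult_diff)
  then have "(\<Union>u\<in>q x. q (c \<odot> u)) = q (c \<odot> x)"
    using x by (intro SUP_eq_const q_nonempty)
  then show ?thesis
    by (simp add: quotient_cstar_def flip: q_def)
qed

lemma q_star:
  assumes x: "x \<in> carrier A"
  shows "star Q (q x) = q (star A x)"
proof -
  have "q (star A u) = q (star A x)" if "u \<in> q x" for u
    using x that by (intro q_eqI) (auto simp: mem_q simp flip: star_diff)
  then have "(\<Union>u\<in>q x. q (star A u)) = q (star A x)"
    using x by (intro SUP_eq_const q_nonempty)
  then show ?thesis
    by (simp add: quotient_cstar_def flip: q_def)
qed

lemma q_norm: "cnorm Q (q x) = qn x"
  by (simp add: quotient_cstar_def qn_def)

lemma abelian_group_Q: "abelian_group Q"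
proof (rule abelian_groupI)
  fix X assume "X \<in> carrier Q"
  then obtain x where x: "x \<in> carrier A" "X = q x"
    by (auto simp: Q_carrier)
  then show "\<exists>Y\<in>carrier Q. Y \<oplus>\<^bsub>Q\<^esub> X = \<zero>\<^bsub>Q\<^esub>"
    by (intro bexI[of _ "q (\<ominus> x)"]) (auto simp: q_add Q_zero l_neg)
qed (auto simp: Q_carrier q_add Q_zero a_ac)

lemma q_diff:
  assumes x: "x \<in> carrier A" and y: "y \<in> carrier A"
  shows "q x \<ominus>\<^bsub>Q\<^esub> q y = q (x \<ominus> y)"
proof -
  have "\<ominus>\<^bsub>Q\<^esub> q y = q (\<ominus> y)"
    using y by (intro abelian_group.minus_equality[OF abelian_group_Q]) (auto simp: q_add Q_zero l_neg)
  then show ?thesis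
    using x y by (simp add: a_minus_def q_add)
qed

text \<open>With \<open>B\<close> the whole algebra this is completeness of the quotient; for a
  general subalgebra it yields that the image is closed.\<close>

lemma image_limit:
  assumes B: "cstar_subalgebra A B" and X: "\<And>n :: nat. X n \<in> q ` B"
    and cauchy: "\<And>e. 0 < e \<Longrightarrow> \<exists>N. \<forall>m\<ge>N. \<forall>n\<ge>N. cnorm Q (X m \<ominus>\<^bsub>Q\<^esub> X n) < e"
  shows "\<exists>x\<in>q ` B. (\<lambda>n. cnorm Q (X n \<ominus>\<^bsub>Q\<^esub> x)) \<longlonglongrightarrow> 0"
proof -
  have Bc: "x \<in> carrier A" if "x \<in> B" for x
    using B that by (auto simp: cstar_subalgebra_def linear_subspace_def)
  have "\<exists>y. y \<in> B \<and> X n = q y" for n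
    using X[of n] by auto
  then obtain Y where Y: "\<And>n. Y n \<in> B" "\<And>n. X n = q (Y n)"
    by metis
  have eq: "cnorm Q (X n \<ominus>\<^bsub>Q\<^esub> q y) = qn (Y n \<ominus> y)" if "y \<in> B" for n y
    using Y Bc that by (simp add: q_diff q_norm)
  have "cnorm Q (X m \<ominus>\<^bsub>Q\<^esub> X n) = qn (Y m \<ominus> Y n)" for m n
    using eq[OF Y(1)[of n], of m] by (simp flip: Y(2))
  with cauchy have "\<And>e. 0 < e \<Longrightarrow> \<exists>N. \<forall>m\<ge>N. \<forall>n\<ge>N. qn (Y m \<ominus> Y n) < e"
    by simp
  then obtain c where c: "c \<in> B" "(\<lambda>n. qn (Y n \<ominus> c)) \<longlonglongrightarrow> 0"
    using lift_limit[of B Y, OF B Y(1)] by metis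
  show ?thesis
    by (rule bexI[of _ "q c"]) (use c in \<open>auto simp: eq\<close>)
qed

lemma cstar_algebra_Q: "cstar_algebra Q"
proof -
  have complete_Q: "\<exists>x\<in>carrier Q. (\<lambda>n. cnorm Q (X n \<ominus>\<^bsub>Q\<^esub> x)) \<longlonglongrightarrow> 0"
    if "\<And>n :: nat. X n \<in> carrier Q" "\<And>e. 0 < e \<Longrightarrow> \<exists>N. \<forall>m\<ge>N. \<forall>n\<ge>N. cnorm Q (X m \<ominus>\<^bsub>Q\<^esub> X n) < e" for X
    using image_limit[OF carrier_subalgebra, of X] that by (simp add: Q_carrier)
  have norm_zero: "cnorm Q X = 0 \<longleftrightarrow> X = \<zero>\<^bsub>Q\<^esub>" if X: "X \<in> carrier Q" for X
  proof -
    obtain x where "x \<in> carrier A" "X = q x"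
      using X by (auto simp: Q_carrier)
    then show ?thesis
      using q_eq_iff[of x \<zero>] by (simp add: Q_zero q_norm qn_eq_zero_iff)
  qed
  \<comment> \<open>Subgoals 23 and 18 are completeness and definiteness of the norm; the rest is
    inherited through representatives.\<close>
  show ?thesis
    by (rule cstar_algebra.intro[OF abelian_group_Q], rule cstar_algebra_axioms.intro, rule_tac [23] complete_Q, rule_tac [18] norm_zero)
      (auto simp: Q_carrier Q_zero q_add q_mult q_smult q_star q_norm distrib_left distrib_right mult_assoc
         smult_add_left smult_add_right smult_smult
         smult_one smult_mult_left smult_mult_right star_star star_add star_mult star_smult
         qn_nonneg qn_triangle qn_smult qn_mult qn_star_mult qn_eq_zero_iff)
qed

lemma comm_cstar_Q: "comm_cstar Q"
proof -
  have "abelian Q"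
    by (auto simp: abelian_def Q_carrier q_mult mult_comm)
  then show ?thesis
    using cstar_algebra_Q by (simp add: comm_cstar_def comm_cstar_axioms_def)
qed

lemma cstar_subalgebra_image:
  assumes B: "cstar_subalgebra A B"
  shows "cstar_subalgebra Q (q ` B)"
proof -
  interpret Q: cstar_algebra Q
    by (rule cstar_algebra_Q)
  have cl: "B \<subseteq> carrier A" "\<zero> \<in> B" "\<And>x y. x \<in> B \<Longrightarrow> y \<in> B \<Longrightarrow> x \<oplus> y \<in> B"
    "\<And>c x. x \<in> B \<Longrightarrow> c \<odot> x \<in> B" "\<And>x y. x \<in> B \<Longrightarrow> y \<in> B \<Longrightarrow> x \<otimes> y \<in> B"
    "\<And>x. x \<in> B \<Longrightarrow> star A x \<in> B"
    using B by (auto simp: cstar_subalgebra_def linear_subspace_def)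
  have c: "x \<in> carrier A" if "x \<in> B" for x
    using cl(1) that by blast
  have "norm_closed Q (q ` B)"
    unfolding norm_closed_def
  proof (intro allI ballI impI)
    fix X x assume x: "x \<in> carrier Q" and X: "(\<forall>n :: nat. X n \<in> q ` B) \<and> (\<lambda>n. cnorm Q (X n \<ominus>\<^bsub>Q\<^esub> x)) \<longlonglongrightarrow> 0"
    have XQ: "X n \<in> carrier Q" for n
    proof -
      have "q ` B \<subseteq> carrier Q"
        using cl(1) by (auto simp: Q_carrier)
      then show ?thesis
        using X by blast
    qed
    have "\<exists>N. \<forall>m\<ge>N. \<forall>n\<ge>N. cnorm Q (X m \<ominus>\<^bsub>Q\<^esub> X n) < e" if e: "0 < e" for e
    proof -
      have "eventually (\<lambda>n. cnorm Q (X n \<ominus>\<^bsub>Q\<^esub> x) < e / 2) sequentially"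
        using order_tendstoD(2)[of _ 0 sequentially "e/2"] X e by simp
      then obtain N where N: "\<And>n. n \<ge> N \<Longrightarrow> cnorm Q (X n \<ominus>\<^bsub>Q\<^esub> x) < e / 2"
        by (auto simp: eventually_sequentially)
      have "cnorm Q (X m \<ominus>\<^bsub>Q\<^esub> X n) < e" if "m \<ge> N" "n \<ge> N" for m n
        using Q.cnorm_diff_triangle[OF XQ[of m] x XQ[of n]] Q.cnorm_diff_commute[OF x XQ[of n]] N[OF that(1)] N[OF that(2)]
        by simp
      then show ?thesis
        by blast
    qed
    then obtain y where y: "y \<in> q ` B" "(\<lambda>n. cnorm Q (X n \<ominus>\<^bsub>Q\<^esub> y)) \<longlonglongrightarrow> 0"
      using image_limit[OF B, of X] X by blast
    then have "x = y"
      using Q.limit_unique[of X x y] X XQ x c by (auto simp: Q_carrier)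
    then show "x \<in> q ` B"
      using y by simp
  qed
  then show ?thesis
    unfolding cstar_subalgebra_def linear_subspace_def
    by (auto simp: cl c Q_zero q_add q_mult q_smult q_star)
qed

text \<open>The quotient map is contractive, so the image under \<open>q\<close> of a filter that
  forms an approximate unit of \<open>A\<close> forms one of the quotient.\<close>

lemma cstar_inclusion_quotient:
  assumes B: "cstar_inclusion A B"
  shows "cstar_inclusion Q (q ` B)"
proof -
  have sub: "cstar_subalgebra A B" and au: "has_approximate_unit_in A B"
    using B by (auto simp: cstar_inclusion_def)
  obtain F where F: "F \<noteq> bot"
    "\<forall>\<^sub>F e in F. e \<in> B \<and> cnorm A e \<le> 1 \<and> (\<exists>y\<in>carrier A. e = star A y \<otimes> y)"
    "\<And>a. a \<in> carrier A \<Longrightarrow> ((\<lambda>e. cnorm A (e \<otimes> a \<ominus> a)) \<longlongrightarrow> 0) F"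
    "\<And>a. a \<in> carrier A \<Longrightarrow> ((\<lambda>e. cnorm A (a \<otimes> e \<ominus> a)) \<longlongrightarrow> 0) F"
    using au unfolding has_approximate_unit_in_def by blast
  have Bc: "x \<in> carrier A" if "x \<in> B" for x
    using sub that by (auto simp: cstar_subalgebra_def linear_subspace_def)
  have "filtermap q F \<noteq> bot"
    using F(1) by (simp add: filtermap_bot_iff)
  moreover have "\<forall>\<^sub>F e in filtermap q F. e \<in> q ` B \<and> cnorm Q e \<le> 1 \<and> (\<exists>y\<in>carrier Q. e = star Q y \<otimes>\<^bsub>Q\<^esub> y)"
    unfolding eventually_filtermap using F(2)
  proof eventually_elim
    case (elim e)
    then obtain y where y: "y \<in> carrier A" "e = star A y \<otimes> y"
      by auto
    have "q e = star Q (q y) \<otimes>\<^bsub>Q\<^esub> q y"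
      using y by (simp add: q_star q_mult)
    moreover have "cnorm Q (q e) \<le> 1"
      using elim qn_le_cnorm[of e] Bc by (force simp: q_norm)
    ultimately show ?case
      using elim q_closed[OF y(1)] by blast
  qed
  moreover have "((\<lambda>e. cnorm Q (e \<otimes>\<^bsub>Q\<^esub> a \<ominus>\<^bsub>Q\<^esub> a)) \<longlongrightarrow> 0) (filtermap q F) \<and>
      ((\<lambda>e. cnorm Q (a \<otimes>\<^bsub>Q\<^esub> e \<ominus>\<^bsub>Q\<^esub> a)) \<longlongrightarrow> 0) (filtermap q F)" if a: "a \<in> carrier Q" for a
  proof -
    obtain x where x: "x \<in> carrier A" "a = q x"
      using a by (auto simp: Q_carrier)
    have eB: "\<forall>\<^sub>F e in F. e \<in> B"
      using F(2) by (rule eventually_mono) auto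
    have "((\<lambda>e. cnorm Q (q e \<otimes>\<^bsub>Q\<^esub> a \<ominus>\<^bsub>Q\<^esub> a)) \<longlongrightarrow> 0) F"
    proof (rule tendsto_sandwich[OF _ _ tendsto_const F(3)[OF x(1)]])
      show "\<forall>\<^sub>F e in F. 0 \<le> cnorm Q (q e \<otimes>\<^bsub>Q\<^esub> a \<ominus>\<^bsub>Q\<^esub> a)"
        using eB by (rule eventually_mono) (use x Bc in \<open>auto simp: q_mult q_diff q_norm qn_nonneg\<close>)
      show "\<forall>\<^sub>F e in F. cnorm Q (q e \<otimes>\<^bsub>Q\<^esub> a \<ominus>\<^bsub>Q\<^esub> a) \<le> cnorm A (e \<otimes> x \<ominus> x)"
        using eB by (rule eventually_mono) (use x Bc in \<open>auto simp: q_mult q_diff q_norm qn_le_cnorm\<close>)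
    qed
    moreover have "((\<lambda>e. cnorm Q (a \<otimes>\<^bsub>Q\<^esub> q e \<ominus>\<^bsub>Q\<^esub> a)) \<longlongrightarrow> 0) F"
    proof (rule tendsto_sandwich[OF _ _ tendsto_const F(4)[OF x(1)]])
      show "\<forall>\<^sub>F e in F. 0 \<le> cnorm Q (a \<otimes>\<^bsub>Q\<^esub> q e \<ominus>\<^bsub>Q\<^esub> a)"
        using eB by (rule eventually_mono) (use x Bc in \<open>auto simp: q_mult q_diff q_norm qn_nonneg\<close>)
      show "\<forall>\<^sub>F e in F. cnorm Q (a \<otimes>\<^bsub>Q\<^esub> q e \<ominus>\<^bsub>Q\<^esub> a) \<le> cnorm A (x \<otimes> e \<ominus> x)"
        using eB by (rule eventually_mono) (use x Bc in \<open>auto simp: q_mult q_diff q_norm qn_le_cnorm\<close>)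
    qed
    ultimately show ?thesis
      by (simp add: filterlim_filtermap)
  qed
  ultimately have "has_approximate_unit_in Q (q ` B)"
    unfolding has_approximate_unit_in_def by blast
  then show ?thesis
    using cstar_algebra_Q cstar_subalgebra_image[OF sub] by (simp add: cstar_inclusion_def)
qed

lemma q_zero_iff: "x \<in> carrier A \<Longrightarrow> q x = \<zero>\<^bsub>Q\<^esub> \<longleftrightarrow> x \<in> J"
  using q_eq_iff[of x \<zero>] by (simp add: Q_zero)

text \<open>A character of \<open>A/J\<close> that does not vanish at the coset of \<open>a\<close>,
  composed with the quotient map.\<close>

lemma character_separating_from_ideal:
  assumes a: "a \<in> carrier A" "a \<notin> J"
  obtains \<xi> where "\<xi> \<in> chars A" "\<xi> a \<noteq> 0" "\<And>x. x \<in> J \<Longrightarrow> \<xi> x = 0"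
proof -
  interpret Q: comm_cstar Q
    by (rule comm_cstar_Q)
  obtain \<eta> where \<eta>: "\<eta> \<in> chars Q" "\<eta> (q a) \<noteq> 0"
    using Q.chars_eqI[of "q a" "\<zero>\<^bsub>Q\<^esub>"] a by (auto simp: q_zero_iff)
  have "(\<lambda>x. \<eta> (q x)) \<in> chars A"
    unfolding chars_def using \<eta>(1)
    by (auto simp flip: q_add q_mult q_star q_smult)
  moreover have "\<eta> (q x) = 0" if "x \<in> J" for x
    using that J_carrier[OF that] \<eta>(1) q_zero_iff[of x] by simp
  ultimately show ?thesis
    using that[of "\<lambda>x. \<eta> (q x)"] \<eta>(2) by simp
qed

end

section \<open>Positive complex matrices\<close>

text \<open>Matrices are functions of two indices whose entries below \<open>n\<close> count, to
  match \<open>matrix_positive\<close>.\<close>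

definition mat_vec :: "nat \<Rightarrow> (nat \<Rightarrow> nat \<Rightarrow> complex) \<Rightarrow> (nat \<Rightarrow> complex) \<Rightarrow> nat \<Rightarrow> complex" where
  "mat_vec n M v i = (\<Sum>j<n. M i j * v j)"

definition mat_mult :: "nat \<Rightarrow> (nat \<Rightarrow> nat \<Rightarrow> complex) \<Rightarrow> (nat \<Rightarrow> nat \<Rightarrow> complex) \<Rightarrow> nat \<Rightarrow> nat \<Rightarrow> complex" where
  "mat_mult n M N i j = (\<Sum>k<n. M i k * N k j)"

definition vec_norm :: "nat \<Rightarrow> (nat \<Rightarrow> complex) \<Rightarrow> real" where
  "vec_norm n v = L2_set (\<lambda>i. cmod (v i)) {..<n}"

definition op_bound :: "nat \<Rightarrow> (nat \<Rightarrow> nat \<Rightarrow> complex) \<Rightarrow> real \<Rightarrow> bool" where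
  "op_bound n M r \<longleftrightarrow> (\<forall>v. vec_norm n (mat_vec n M v) \<le> r * vec_norm n v)"

lemma mat_vec_mult: "mat_vec n (mat_mult n M N) v = mat_vec n M (mat_vec n N v)"
proof
  fix i
  have "mat_vec n (mat_mult n M N) v i = (\<Sum>j<n. \<Sum>k<n. M i k * N k j * v j)"
    by (simp add: mat_vec_def mat_mult_def sum_distrib_right)
  also have "\<dots> = (\<Sum>k<n. \<Sum>j<n. M i k * N k j * v j)"
    by (rule sum.swap)
  also have "\<dots> = mat_vec n M (mat_vec n N v) i"
    by (simp add: mat_vec_def sum_distrib_left mult.assoc)
  finally show "mat_vec n (mat_mult n M N) v i = mat_vec n M (mat_vec n N v) i" .
qed

lemma vec_norm_nonneg [simp]: "0 \<le> vec_norm n v"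
  by (simp add: vec_norm_def)

lemma vec_norm_add: "vec_norm n (\<lambda>i. u i + v i) \<le> vec_norm n u + vec_norm n v"
  unfolding vec_norm_def
  by (rule order_trans[OF L2_set_mono L2_set_triangle_ineq]) (auto intro: norm_triangle_ineq)

lemma vec_norm_scale: "vec_norm n (\<lambda>i. c * v i) = cmod c * vec_norm n v"
  by (simp add: vec_norm_def norm_mult L2_set_right_distrib)

lemma cmod_le_vec_norm: "i < n \<Longrightarrow> cmod (v i) \<le> vec_norm n v"
  unfolding vec_norm_def by (rule member_le_L2_set) auto

lemma vec_norm_square: "(vec_norm n v)\<^sup>2 = (\<Sum>i<n. (cmod (v i))\<^sup>2)"
  by (simp add: vec_norm_def L2_set_def sum_nonneg)

lemma op_bound_mult: "\<lbrakk>op_bound n M r; op_bound n N s; 0 \<le> r\<rbrakk> \<Longrightarrow> op_bound n (mat_mult n M N) (r * s)"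
  unfolding op_bound_def mat_vec_mult by (metis mult.assoc mult_left_mono order_trans)

lemma op_bound_add:
  assumes "op_bound n M r" "op_bound n N s"
  shows "op_bound n (\<lambda>i j. M i j + N i j) (r + s)"
proof -
  have "mat_vec n (\<lambda>i j. M i j + N i j) v = (\<lambda>i. mat_vec n M v i + mat_vec n N v i)" for v
    by (auto simp: mat_vec_def sum.distrib distrib_right)
  then have "vec_norm n (mat_vec n (\<lambda>i j. M i j + N i j) v) \<le> vec_norm n (mat_vec n M v) + vec_norm n (mat_vec n N v)" for v
    by (simp add: vec_norm_add)
  moreover have "vec_norm n (mat_vec n M v) + vec_norm n (mat_vec n N v) \<le> (r + s) * vec_norm n v" for v
    using assms unfolding op_bound_def distrib_right by (intro add_mono) auto
  ultimately show ?thesis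
    unfolding op_bound_def by (meson order_trans)
qed

lemma op_bound_scale:
  assumes "op_bound n M r"
  shows "op_bound n (\<lambda>i j. c * M i j) (cmod c * r)"
proof -
  have "mat_vec n (\<lambda>i j. c * M i j) v = (\<lambda>i. c * mat_vec n M v i)" for v
    by (auto simp: mat_vec_def sum_distrib_left mult.assoc)
  then show ?thesis
    using assms unfolding op_bound_def by (simp add: vec_norm_scale mult.assoc mult_left_mono)
qed

lemma mat_vec_unit: "j < n \<Longrightarrow> mat_vec n M (\<lambda>k. if k = j then 1 else 0) i = M i j"
  by (simp add: mat_vec_def if_distrib sum.delta cong: if_cong)

lemma vec_norm_unit: "j < n \<Longrightarrow> vec_norm n (\<lambda>k. if k = j then 1 else 0) = 1"
proof -
  assume "j < n"
  moreover have "(\<Sum>i<n. (cmod (if i = j then 1 else 0))\<^sup>2) = (\<Sum>i<n. if i = j then 1 else 0)"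
    by (intro sum.cong) auto
  ultimately show ?thesis
    by (simp add: vec_norm_def L2_set_def)
qed

lemma op_bound_entry:
  assumes "op_bound n M r" "i < n" "j < n"
  shows "cmod (M i j) \<le> r"
proof -
  let ?e = "\<lambda>k. if k = j then 1 else 0 :: complex"
  have "cmod (mat_vec n M ?e i) \<le> r * vec_norm n ?e"
    using assms(1) cmod_le_vec_norm[OF assms(2), of "mat_vec n M ?e"] unfolding op_bound_def
    by (meson order_trans)
  then show ?thesis
    using assms by (simp add: mat_vec_unit vec_norm_unit)
qed

definition form :: "nat \<Rightarrow> (nat \<Rightarrow> nat \<Rightarrow> complex) \<Rightarrow> (nat \<Rightarrow> complex) \<Rightarrow> (nat \<Rightarrow> complex) \<Rightarrow> complex" where
  "form n M u v = (\<Sum>i<n. cnj (u i) * mat_vec n M v i)"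

definition psd :: "nat \<Rightarrow> (nat \<Rightarrow> nat \<Rightarrow> complex) \<Rightarrow> bool" where
  "psd n M \<longleftrightarrow> (\<forall>v. Im (form n M v v) = 0 \<and> 0 \<le> Re (form n M v v))"

lemma form_add_scale:
  "form n M (\<lambda>i. u i + c * v i) (\<lambda>i. u i + c * v i)
     = form n M u u + c * form n M u v + cnj c * form n M v u + c * cnj c * form n M v v"
proof -
  have 1: "mat_vec n M (\<lambda>i. u i + c * v i) i = mat_vec n M u i + c * mat_vec n M v i" for i
    by (simp add: mat_vec_def distrib_left sum.distrib sum_distrib_left mult.left_commute)
  have "form n M (\<lambda>i. u i + c * v i) (\<lambda>i. u i + c * v i)
      = (\<Sum>i<n. cnj (u i) * mat_vec n M u i + c * (cnj (u i) * mat_vec n M v i)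
          + cnj c * (cnj (v i) * mat_vec n M u i) + c * cnj c * (cnj (v i) * mat_vec n M v i))"
    unfolding form_def 1 by (intro sum.cong) (auto simp: algebra_simps)
  then show ?thesis
    by (simp add: sum.distrib form_def flip: sum_distrib_left)
qed

text \<open>Polarization: the quadratic form is real at \<open>u + c v\<close> for
  \<open>c = 1\<close> and \<open>c = \<i>\<close>.\<close>

lemma psd_form_commute:
  assumes "psd n M"
  shows "form n M v u = cnj (form n M u v)"
proof -
  have im: "Im (form n M w w) = 0" for w
    using assms by (simp add: psd_def)
  have "Im (c * form n M u v + cnj c * form n M v u) = 0" if "c * cnj c = 1" for c
    using im[of "\<lambda>i. u i + c * v i"] im[of u] im[of v] that unfolding form_add_scale by simp
  from this[of 1] this[of "\<i>"] show ?thesis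
    by (simp add: complex_eq_iff)
qed

lemma psd_hermitian:
  assumes "psd n M" "i < n" "j < n"
  shows "M j i = cnj (M i j)"
proof -
  have "form n M (\<lambda>k. if k = i' then 1 else 0) (\<lambda>k. if k = j' then 1 else 0) = M i' j'" if "i' < n" "j' < n" for i' j'
    using that by (simp add: form_def mat_vec_unit if_distrib if_distribR sum.delta cong: if_cong)
  then show ?thesis
    using psd_form_commute[OF assms(1)] assms(2,3) by metis
qed

lemma form_le:
  assumes "\<And>i j. \<lbrakk>i < n; j < n\<rbrakk> \<Longrightarrow> cmod (M i j) \<le> m"
  shows "cmod (form n M v v) \<le> (m * real n * real n) * (vec_norm n v)\<^sup>2"
proof -
  have "cmod (form n M v v) \<le> (\<Sum>i<n. \<Sum>j<n. cmod (v i) * (cmod (M i j) * cmod (v j)))"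
    unfolding form_def mat_vec_def
    by (intro order_trans[OF norm_sum] sum_mono)
      (auto simp: norm_mult sum_distrib_left intro!: mult_left_mono order_trans[OF norm_sum])
  also have "\<dots> \<le> (\<Sum>i<n. \<Sum>j<n. vec_norm n v * (m * vec_norm n v))"
  proof (intro sum_mono)
    fix i j assume ij: "i \<in> {..<n}" "j \<in> {..<n}"
    then have "0 \<le> m"
      using assms[of i j] norm_ge_zero[of "M i j"] by (simp del: norm_ge_zero)
    then show "cmod (v i) * (cmod (M i j) * cmod (v j)) \<le> vec_norm n v * (m * vec_norm n v)"
      using ij assms by (intro mult_mono cmod_le_vec_norm) auto
  qed
  also have "\<dots> = (m * real n * real n) * (vec_norm n v)\<^sup>2"
    by (simp add: power2_eq_square)
  finally show ?thesis .
qed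

text \<open>An argument without diagonalization. Nonnegativity of the form at
  \<open>v - M v / c\<close> shows that the squared norm of \<open>M v\<close> is at most
  \<open>c\<close> times the form at \<open>v\<close>, and this is the estimate needed when the
  squared norm of \<open>v - M v / c\<close> is expanded.\<close>

lemma op_bound_one_minus_psd:
  assumes M: "psd n M" and c: "0 < c" and le: "\<And>v. Re (form n M v v) \<le> c * (vec_norm n v)\<^sup>2"
  shows "op_bound n (\<lambda>i j. (if i = j then 1 else 0) - M i j / complex_of_real c) 1"
  unfolding op_bound_def
proof
  fix v
  define w where "w = mat_vec n M v"
  let ?t = "complex_of_real (- 1 / c)"
  let ?x = "\<lambda>i. v i + ?t * w i"
  have T: "mat_vec n (\<lambda>i j. (if i = j then 1 else 0) - M i j / complex_of_real c) v i = ?x i" if "i < n" for i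
  proof -
    have "mat_vec n (\<lambda>i j. (if i = j then 1 else 0) - M i j / complex_of_real c) v i
        = (\<Sum>j<n. if i = j then v j else 0) - (\<Sum>j<n. M i j * v j / complex_of_real c)"
      unfolding mat_vec_def sum_subtractf[symmetric] by (intro sum.cong) (auto simp: algebra_simps)
    then show ?thesis
      using that by (simp add: w_def mat_vec_def sum_divide_distrib)
  qed
  have ww: "form n M w v = complex_of_real ((vec_norm n w)\<^sup>2)"
    by (simp add: form_def vec_norm_square flip: w_def)
      (simp add: mult.commute complex_norm_square[symmetric] flip: of_real_power)
  have "0 \<le> Re (form n M ?x ?x)"
    using M by (simp add: psd_def)
  also have "form n M ?x ?x = form n M v v + ?t * cnj (form n M w v) + cnj ?t * form n M w v + ?t * cnj ?t * form n M w w"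
    unfolding form_add_scale psd_form_commute[OF M, of v w] ..
  finally have "0 \<le> Re (form n M v v) - 2 / c * (vec_norm n w)\<^sup>2 + 1 / c\<^sup>2 * Re (form n M w w)"
    by (simp add: ww power2_eq_square)
  also have "\<dots> \<le> Re (form n M v v) - 2 / c * (vec_norm n w)\<^sup>2 + 1 / c\<^sup>2 * (c * (vec_norm n w)\<^sup>2)"
    by (intro add_left_mono mult_left_mono le) auto
  also have "\<dots> = Re (form n M v v) - (vec_norm n w)\<^sup>2 / c"
    using c by (simp add: power2_eq_square field_simps)
  finally have key: "(vec_norm n w)\<^sup>2 / c \<le> Re (form n M v v)"
    by simp
  have "(vec_norm n ?x)\<^sup>2 = (\<Sum>i<n. (cmod (v i))\<^sup>2 - 2 / c * Re (cnj (v i) * w i) + (cmod (w i))\<^sup>2 / c\<^sup>2)"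
    unfolding vec_norm_square
  proof (intro sum.cong refl)
    fix i
    have "complex_of_real ((cmod (v i + ?t * w i))\<^sup>2) = (v i + ?t * w i) * cnj (v i + ?t * w i)"
      by (rule complex_norm_square)
    then have "(cmod (v i + ?t * w i))\<^sup>2 = Re ((v i + ?t * w i) * cnj (v i + ?t * w i))"
      by (metis Re_complex_of_real)
    also have "\<dots> = (cmod (v i))\<^sup>2 - 2 / c * Re (cnj (v i) * w i) + (cmod (w i))\<^sup>2 / c\<^sup>2"
      using c unfolding cmod_power2 by (simp add: power2_eq_square field_simps)
    finally show "(cmod (v i + ?t * w i))\<^sup>2 = (cmod (v i))\<^sup>2 - 2 / c * Re (cnj (v i) * w i) + (cmod (w i))\<^sup>2 / c\<^sup>2" .
  qed
  also have "\<dots> = (vec_norm n v)\<^sup>2 - 2 / c * Re (form n M v v) + (vec_norm n w)\<^sup>2 / c\<^sup>2"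
    by (simp only: sum.distrib sum_subtractf vec_norm_square form_def w_def sum_divide_distrib[symmetric]
        sum_distrib_left[symmetric] Re_sum[symmetric])
  also have "\<dots> \<le> (vec_norm n v)\<^sup>2"
  proof -
    have "(vec_norm n w)\<^sup>2 / c\<^sup>2 \<le> 1 / c * Re (form n M v v)"
      using mult_left_mono[OF key, of "1 / c"] c by (simp add: power2_eq_square)
    moreover have "0 \<le> 1 / c * Re (form n M v v)"
      using c M by (simp add: psd_def)
    ultimately show ?thesis
      by simp
  qed
  finally have "vec_norm n ?x \<le> vec_norm n v"
    by (rule power2_le_imp_le) simp
  moreover have "vec_norm n (mat_vec n (\<lambda>i j. (if i = j then 1 else 0) - M i j / complex_of_real c) v) = vec_norm n ?x"
    unfolding vec_norm_def by (intro L2_set_cong) (auto simp: T)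
  ultimately show "vec_norm n (mat_vec n (\<lambda>i j. (if i = j then 1 else 0) - M i j / complex_of_real c) v) \<le> 1 * vec_norm n v"
    by simp
qed

text \<open>The matrix version of the iteration in \<open>approximate_sqrt\<close>; a fixed point
  \<open>F\<close> satisfies \<open>(1 - F)^2 = 1 - T\<close>.\<close>

primrec sqrt_iter :: "nat \<Rightarrow> (nat \<Rightarrow> nat \<Rightarrow> complex) \<Rightarrow> nat \<Rightarrow> nat \<Rightarrow> nat \<Rightarrow> complex" where
  "sqrt_iter n T 0 = (\<lambda>i j. 0)"
| "sqrt_iter n T (Suc m) = (\<lambda>i j. (1 / 2) * (T i j + mat_mult n (sqrt_iter n T m) (sqrt_iter n T m) i j))"

lemma sqrt_iter_bound:
  assumes T: "op_bound n T 1"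
  shows "op_bound n (sqrt_iter n T m) (sqrt_bound m)"
    and "op_bound n (\<lambda>i j. sqrt_iter n T (Suc m) i j - sqrt_iter n T m i j) (sqrt_bound (Suc m) - sqrt_bound m)"
proof -
  have half: "op_bound n (\<lambda>i j. (1 / 2) * M i j) (1 / 2 * r)" if "op_bound n M r" for M r
    using op_bound_scale[OF that, of "1/2"] by simp
  show b: "op_bound n (sqrt_iter n T m) (sqrt_bound m)" for m
  proof (induction m)
    case 0
    then show ?case
      by (simp add: op_bound_def mat_vec_def vec_norm_def L2_set_def)
  next
    case (Suc m)
    have "op_bound n (\<lambda>i j. T i j + mat_mult n (sqrt_iter n T m) (sqrt_iter n T m) i j) (1 + sqrt_bound m * sqrt_bound m)"
      using sqrt_bound_range[of m] by (intro op_bound_add op_bound_mult T Suc) auto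
    from half[OF this] show ?case
      by (simp add: power2_eq_square)
  qed
  show "op_bound n (\<lambda>i j. sqrt_iter n T (Suc m) i j - sqrt_iter n T m i j) (sqrt_bound (Suc m) - sqrt_bound m)"
  proof (induction m)
    case 0
    from half[OF T] show ?case
      by (simp add: mat_mult_def)
  next
    case (Suc m)
    let ?q = "sqrt_iter n T" and ?r = "sqrt_bound"
    \<comment> \<open>The difference of the squares of consecutive iterates \<open>q'\<close> and
      \<open>q\<close> is factored as \<open>q' D + D q\<close>, keeping the order of the matrix
      factors.\<close>
    define D where "D = (\<lambda>i j. ?q (Suc m) i j - ?q m i j)"
    have "op_bound n (\<lambda>i j. mat_mult n (?q (Suc m)) D i j + mat_mult n D (?q m) i j)
        (?r (Suc m) * (?r (Suc m) - ?r m) + (?r (Suc m) - ?r m) * ?r m)"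
      using Suc sqrt_bound_range[of "Suc m"] sqrt_bound_mono[of m] unfolding D_def[symmetric]
      by (intro op_bound_add op_bound_mult b) auto
    from half[OF this]
    have *: "op_bound n (\<lambda>i j. (1 / 2) * (mat_mult n (?q (Suc m)) D i j + mat_mult n D (?q m) i j))
      (1 / 2 * (?r (Suc m) * (?r (Suc m) - ?r m) + (?r (Suc m) - ?r m) * ?r m))" .
    have 1: "1 / 2 * (?r (Suc m) * (?r (Suc m) - ?r m) + (?r (Suc m) - ?r m) * ?r m) = ?r (Suc (Suc m)) - ?r (Suc m)"
      unfolding sqrt_bound_step[symmetric] by (simp only: algebra_simps)
    have "mat_mult n (?q (Suc m)) D i j + mat_mult n D (?q m) i j
        = mat_mult n (?q (Suc m)) (?q (Suc m)) i j - mat_mult n (?q m) (?q m) i j" for i j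
      by (simp add: mat_mult_def D_def right_diff_distrib left_diff_distrib sum_subtractf del: sqrt_iter.simps)
    then have 2: "(\<lambda>i j. (1 / 2) * (mat_mult n (?q (Suc m)) D i j + mat_mult n D (?q m) i j))
        = (\<lambda>i j. ?q (Suc (Suc m)) i j - ?q (Suc m) i j)"
      by (simp only: sqrt_iter.simps(2)[of n T "Suc m"]) (subst (3) sqrt_iter.simps(2), simp add: algebra_simps)
    show ?case
      using * unfolding 1 2 .
  qed
qed

text \<open>The rate \<open>r - sqrt_bound m\<close> is the same for all \<open>T\<close> of norm at
  most 1. Applied at every character, it makes the convergence uniform over the characters. The
  limit is stated by existence so that one can be chosen for each character.\<close>

lemma sqrt_iter_limit:
  assumes T: "op_bound n T 1" and r: "sqrt_bound \<longlonglongrightarrow> r"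
  shows "\<exists>F. (\<forall>m. \<forall>i<n. \<forall>j<n. cmod (sqrt_iter n T m i j - F i j) \<le> r - sqrt_bound m) \<and>
     (\<forall>i<n. \<forall>j<n. 2 * F i j = T i j + mat_mult n F F i j) \<and>
     ((\<forall>i<n. \<forall>j<n. T j i = cnj (T i j)) \<longrightarrow> (\<forall>i<n. \<forall>j<n. F j i = cnj (F i j)))"
proof -
  let ?q = "sqrt_iter n T"
  have le: "cmod (?q (m + k) i j - ?q m i j) \<le> sqrt_bound (m + k) - sqrt_bound m" if "i < n" "j < n" for i j m k
  proof (induction k)
    case (Suc k)
    have "cmod (?q (m + Suc k) i j - ?q m i j)
        \<le> cmod (?q (Suc (m + k)) i j - ?q (m + k) i j) + cmod (?q (m + k) i j - ?q m i j)"
      by (metis add_Suc_right norm_diff_triangle_le order_refl)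
    also have "\<dots> \<le> (sqrt_bound (Suc (m + k)) - sqrt_bound (m + k)) + (sqrt_bound (m + k) - sqrt_bound m)"
      using op_bound_entry[OF sqrt_iter_bound(2)[OF T] that] Suc by (intro add_mono)
    finally show ?case
      by simp
  qed simp
  have inc: "incseq sqrt_bound"
    by (rule incseq_SucI) (rule sqrt_bound_mono)
  have le_r: "sqrt_bound m \<le> r" for m
    using incseq_le[OF inc r] .
  have "Cauchy (\<lambda>m. ?q m i j)" if ij: "i < n" "j < n" for i j
  proof (rule metric_CauchyI)
    fix e :: real assume "0 < e"
    then obtain N where N: "\<And>m. m \<ge> N \<Longrightarrow> r - e / 2 < sqrt_bound m"
      using order_tendstoD(1)[OF r, of "r - e/2"] by (auto simp: eventually_sequentially)
    have near: "cmod (?q m i j - ?q N i j) < e / 2" if "m \<ge> N" for m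
      using le[OF ij, of N "m - N"] that N[of N] le_r[of m] by simp
    have "dist (?q m i j) (?q m' i j) < e" if "m \<ge> N" "m' \<ge> N" for m m'
      using near[OF that(1)] near[OF that(2)] unfolding dist_norm
      by (metis dist_norm dist_triangle_half_l)
    then show "\<exists>N. \<forall>m\<ge>N. \<forall>m'\<ge>N. dist (?q m i j) (?q m' i j) < e"
      by blast
  qed
  then have conv: "(\<lambda>m. ?q m i j) \<longlonglongrightarrow> lim (\<lambda>m. ?q m i j)" if "i < n" "j < n" for i j
    using that Cauchy_convergent convergent_LIMSEQ_iff by blast
  define F where "F i j = lim (\<lambda>m. ?q m i j)" for i j
  note conv = conv[folded F_def]
  have bound: "cmod (?q m i j - F i j) \<le> r - sqrt_bound m" if ij: "i < n" "j < n" for m i j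
  proof -
    have "cmod (?q m i j - ?q k i j) \<le> r - sqrt_bound m" if "k \<ge> m" for k
      using le[OF ij, of m "k - m"] that le_r[of k] by (simp add: norm_minus_commute)
    then have "eventually (\<lambda>k. cmod (?q m i j - ?q k i j) \<le> r - sqrt_bound m) sequentially"
      by (auto simp: eventually_sequentially)
    then show ?thesis
      by (intro tendsto_upperbound[OF tendsto_norm[OF tendsto_diff[OF tendsto_const conv[OF ij]]]]) auto
  qed
  have fixpoint: "2 * F i j = T i j + mat_mult n F F i j" if ij: "i < n" "j < n" for i j
  proof -
    have "(\<lambda>m. (1/2) * (T i j + (\<Sum>k<n. ?q m i k * ?q m k j))) \<longlonglongrightarrow> (1/2) * (T i j + (\<Sum>k<n. F i k * F k j))"
      using ij conv by (intro tendsto_intros) auto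
    moreover have "(\<lambda>m. (1/2) * (T i j + (\<Sum>k<n. ?q m i k * ?q m k j))) \<longlonglongrightarrow> F i j"
      using LIMSEQ_Suc[OF conv[OF ij]] by (simp add: mat_mult_def)
    ultimately have "(1/2) * (T i j + (\<Sum>k<n. F i k * F k j)) = F i j"
      by (rule LIMSEQ_unique)
    then show ?thesis
      by (simp add: mat_mult_def field_simps)
  qed
  have herm: "F j i = cnj (F i j)" if H: "\<forall>i<n. \<forall>j<n. T j i = cnj (T i j)" and ij: "i < n" "j < n" for i j
  proof -
    have q_herm: "?q m j i = cnj (?q m i j)" if "i < n" "j < n" for m i j
      using that
    proof (induction m arbitrary: i j)
      case (Suc m)
      have "mat_mult n (?q m) (?q m) j i = (\<Sum>k<n. cnj (?q m i k * ?q m k j))"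
        unfolding mat_mult_def
      proof (intro sum.cong refl)
        fix k assume "k \<in> {..<n}"
        then show "?q m j k * ?q m k i = cnj (?q m i k * ?q m k j)"
          using Suc.IH[of k j] Suc.IH[of i k] Suc.prems by simp
      qed
      moreover have "T j i = cnj (T i j)"
        using H Suc.prems by blast
      ultimately have "?q (Suc m) j i = (1/2) * (cnj (T i j) + (\<Sum>k<n. cnj (?q m i k * ?q m k j)))"
        by (simp only: sqrt_iter.simps)
      also have "\<dots> = cnj (?q (Suc m) i j)"
        by (simp add: mat_mult_def)
      finally show ?case .
    qed simp
    have "(\<lambda>m. cnj (?q m i j)) \<longlonglongrightarrow> F j i"
      using conv[OF ij(2,1)] unfolding q_herm[OF ij] .
    moreover have "(\<lambda>m. cnj (?q m i j)) \<longlonglongrightarrow> cnj (F i j)"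
      by (intro tendsto_cnj conv ij)
    ultimately show ?thesis
      using LIMSEQ_unique by blast
  qed
  show ?thesis
    by (rule exI[of _ F], intro conjI allI impI) (rule bound fixpoint herm; assumption)+
qed

lemma chars_finsum:
  assumes "cstar_algebra A" "\<xi> \<in> chars A" "finite K" "\<And>k. k \<in> K \<Longrightarrow> f k \<in> carrier A"
  shows "\<xi> (finsum A f K) = (\<Sum>k\<in>K. \<xi> (f k))"
proof -
  interpret cstar_algebra A
    by fact
  show ?thesis
    using assms(3,4)
  proof (induction K rule: finite_induct)
    case (insert k K)
    then have "finsum A f K \<in> carrier A"
      by (intro finsum_closed) auto
    with insert show ?case
      using assms(2) by (simp add: finsum_insert Pi_def)
  qed (use assms(2) in simp)
qed

section \<open>Square roots of positive matrices over a commutative algebra\<close>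

context comm_cstar
begin

text \<open>The functions on the characters that are Gelfand transforms. Closure properties of this
  predicate replace the bookkeeping of the elements themselves.\<close>

definition rep :: "(('a \<Rightarrow> complex) \<Rightarrow> complex) \<Rightarrow> bool" where
  "rep F \<longleftrightarrow> (\<exists>x\<in>carrier A. \<forall>\<xi>\<in>chars A. \<xi> x = F \<xi>)"

lemma rep_elem: "x \<in> carrier A \<Longrightarrow> rep (\<lambda>\<xi>. \<xi> x)"
  by (auto simp: rep_def)

lemma rep_add: "\<lbrakk>rep F; rep G\<rbrakk> \<Longrightarrow> rep (\<lambda>\<xi>. F \<xi> + G \<xi>)"
proof -
  assume "rep F" "rep G"
  then obtain x y where "x \<in> carrier A" "y \<in> carrier A" "\<forall>\<xi>\<in>chars A. \<xi> x = F \<xi>" "\<forall>\<xi>\<in>chars A. \<xi> y = G \<xi>"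
    by (auto simp: rep_def)
  then show ?thesis
    unfolding rep_def by (intro bexI[of _ "x \<oplus> y"]) auto
qed

lemma rep_mult: "\<lbrakk>rep F; rep G\<rbrakk> \<Longrightarrow> rep (\<lambda>\<xi>. F \<xi> * G \<xi>)"
proof -
  assume "rep F" "rep G"
  then obtain x y where "x \<in> carrier A" "y \<in> carrier A" "\<forall>\<xi>\<in>chars A. \<xi> x = F \<xi>" "\<forall>\<xi>\<in>chars A. \<xi> y = G \<xi>"
    by (auto simp: rep_def)
  then show ?thesis
    unfolding rep_def by (intro bexI[of _ "x \<otimes> y"]) auto
qed

lemma rep_scale: "rep F \<Longrightarrow> rep (\<lambda>\<xi>. c * F \<xi>)"
proof -
  assume "rep F"
  then obtain x where "x \<in> carrier A" "\<forall>\<xi>\<in>chars A. \<xi> x = F \<xi>"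
    by (auto simp: rep_def)
  then show ?thesis
    unfolding rep_def by (intro bexI[of _ "c \<odot> x"]) auto
qed

lemma rep_zero: "rep (\<lambda>\<xi>. 0)"
  unfolding rep_def by (intro bexI[of _ \<zero>]) auto

lemma rep_sum: "(\<And>k. k \<in> K \<Longrightarrow> rep (F k)) \<Longrightarrow> rep (\<lambda>\<xi>. \<Sum>k\<in>K. F k \<xi>)"
  by (induction K rule: infinite_finite_induct) (auto simp: rep_zero rep_add)

lemma rep_approx: "(\<And>e. 0 < e \<Longrightarrow> \<exists>G. rep G \<and> (\<forall>\<xi>\<in>chars A. cmod (G \<xi> - F \<xi>) \<le> e)) \<Longrightarrow> rep F"
proof -
  assume *: "\<And>e. 0 < e \<Longrightarrow> \<exists>G. rep G \<and> (\<forall>\<xi>\<in>chars A. cmod (G \<xi> - F \<xi>) \<le> e)"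
  have "\<exists>x\<in>carrier A. \<forall>\<xi>\<in>chars A. cmod (\<xi> x - F \<xi>) \<le> e" if "0 < e" for e
    using *[OF that] unfolding rep_def by metis
  then show ?thesis
    unfolding rep_def by (rule element_of_approximations)
qed

text \<open>The root is \<open>Y = sqrt c (1 - F)\<close>, where at each character \<open>F\<close>
  is the limit of the iteration with \<open>T = 1 - X / c\<close>. The entries of \<open>F\<close>
  are uniform limits of polynomials in \<open>e\<close> and the entries of \<open>X\<close>, so they
  come from elements of the algebra.\<close>

theorem matrix_positive_of_psd:
  assumes e: "is_unit A e" and X: "\<And>i j. \<lbrakk>i < n; j < n\<rbrakk> \<Longrightarrow> X i j \<in> carrier A"
    and psd: "\<And>\<xi>. \<xi> \<in> chars A \<Longrightarrow> psd n (\<lambda>i j. \<xi> (X i j))"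
  shows "matrix_positive A n X"
proof -
  have ec: "e \<in> carrier A"
    using e by (simp add: is_unit_def)
  define m where "m = (\<Sum>i<n. \<Sum>j<n. cnorm A (X i j))"
  have Xm: "cnorm A (X i j) \<le> m" if "i < n" "j < n" for i j
  proof -
    have "cnorm A (X i j) \<le> (\<Sum>j<n. cnorm A (X i j))"
      using that X by (intro member_le_sum) (auto simp: cnorm_nonneg)
    also have "\<dots> \<le> m"
      unfolding m_def using that X by (intro member_le_sum[of i]) (auto intro!: sum_nonneg cnorm_nonneg)
    finally show ?thesis .
  qed
  have m0: "0 \<le> m"
    unfolding m_def using X by (auto intro!: sum_nonneg cnorm_nonneg)
  \<comment> \<open>Dominates the quadratic form by \<open>form_le\<close>; the summand 1 keeps it
    positive when \<open>n\<close> or \<open>m\<close> is 0.\<close>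
  define c where "c = m * real n * real n + 1"
  have c: "0 < c"
    using m0 by (simp add: c_def add_nonneg_pos)
  \<comment> \<open>The value \<open>\<xi> e\<close> stands in for 1, so that the entries of
    \<open>T\<close> are values of elements of the algebra and vanish at the zero
    functional.\<close>
  define T where "T \<xi> i j = (if i = j then \<xi> e else 0) - \<xi> (X i j) / complex_of_real c" for \<xi> i j
  have zero_char: "\<xi> x = 0" if "\<xi> \<in> chars A" "\<xi> e = 0" "x \<in> carrier A" for \<xi> x
  proof -
    have "\<xi> x = \<xi> (e \<otimes> x)"
      using e that by (simp add: is_unit_def)
    then show ?thesis
      using that ec by simp
  qed
  have one: "\<xi> e = 1" if "\<xi> \<in> chars A" "\<xi> e \<noteq> 0" for \<xi>
  proof -
    have "\<xi> e = \<xi> (e \<otimes> e)"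
      using e by (simp add: is_unit_def)
    then show ?thesis
      using that ec by simp
  qed
  have T: "op_bound n (T \<xi>) 1" if \<xi>: "\<xi> \<in> chars A" for \<xi>
  proof (cases "\<xi> e = 0")
    case True
    have "mat_vec n (T \<xi>) v i = 0" if "i < n" for v i
      using that True X by (auto simp: mat_vec_def T_def zero_char[OF \<xi>] intro!: sum.neutral)
    then have "vec_norm n (mat_vec n (T \<xi>) v) = 0" for v
      by (simp add: vec_norm_def L2_set_def)
    then show ?thesis
      by (simp add: op_bound_def)
  next
    case False
    have "Re (form n (\<lambda>i j. \<xi> (X i j)) v v) \<le> c * (vec_norm n v)\<^sup>2" for v
    proof -
      have "Re (form n (\<lambda>i j. \<xi> (X i j)) v v) \<le> cmod (form n (\<lambda>i j. \<xi> (X i j)) v v)"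
        by (rule complex_Re_le_cmod)
      also have "\<dots> \<le> (m * real n * real n) * (vec_norm n v)\<^sup>2"
        using chars_cnorm_le[OF \<xi>] X Xm by (intro form_le) (meson order_trans)
      also have "\<dots> \<le> c * (vec_norm n v)\<^sup>2"
        by (intro mult_right_mono) (auto simp: c_def)
      finally show ?thesis .
    qed
    from op_bound_one_minus_psd[OF psd[OF \<xi>] c this] show ?thesis
      unfolding T_def[abs_def] one[OF \<xi> False] .
  qed
  obtain r where r: "sqrt_bound \<longlonglongrightarrow> r"
    using convergent_sqrt_bound by (auto simp: convergent_def)
  have "\<exists>F. \<forall>\<xi>\<in>chars A. (\<forall>m. \<forall>i<n. \<forall>j<n. cmod (sqrt_iter n (T \<xi>) m i j - F \<xi> i j) \<le> r - sqrt_bound m) \<and>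
     (\<forall>i<n. \<forall>j<n. 2 * F \<xi> i j = T \<xi> i j + mat_mult n (F \<xi>) (F \<xi>) i j) \<and>
     ((\<forall>i<n. \<forall>j<n. T \<xi> j i = cnj (T \<xi> i j)) \<longrightarrow> (\<forall>i<n. \<forall>j<n. F \<xi> j i = cnj (F \<xi> i j)))"
    by (rule bchoice) (use sqrt_iter_limit[OF T r] in blast)
  then obtain F where F: "\<forall>\<xi>\<in>chars A. (\<forall>m. \<forall>i<n. \<forall>j<n. cmod (sqrt_iter n (T \<xi>) m i j - F \<xi> i j) \<le> r - sqrt_bound m) \<and>
     (\<forall>i<n. \<forall>j<n. 2 * F \<xi> i j = T \<xi> i j + mat_mult n (F \<xi>) (F \<xi>) i j) \<and>
     ((\<forall>i<n. \<forall>j<n. T \<xi> j i = cnj (T \<xi> i j)) \<longrightarrow> (\<forall>i<n. \<forall>j<n. F \<xi> j i = cnj (F \<xi> i j)))"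
    by blast
  have F1: "\<And>\<xi> m i j. \<xi> \<in> chars A \<Longrightarrow> i < n \<Longrightarrow> j < n \<Longrightarrow> cmod (sqrt_iter n (T \<xi>) m i j - F \<xi> i j) \<le> r - sqrt_bound m"
    and F2: "\<And>\<xi> i j. \<xi> \<in> chars A \<Longrightarrow> i < n \<Longrightarrow> j < n \<Longrightarrow> 2 * F \<xi> i j = T \<xi> i j + mat_mult n (F \<xi>) (F \<xi>) i j"
    and F3: "\<And>\<xi>. \<xi> \<in> chars A \<Longrightarrow> (\<forall>i<n. \<forall>j<n. T \<xi> j i = cnj (T \<xi> i j)) \<Longrightarrow> (\<forall>i<n. \<forall>j<n. F \<xi> j i = cnj (F \<xi> i j))"
    using F by blast+
  have T_herm: "T \<xi> j i = cnj (T \<xi> i j)" if "\<xi> \<in> chars A" "i < n" "j < n" for \<xi> i j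
    using psd_hermitian[OF psd[OF that(1)] that(2,3)] one[OF that(1)] by (cases "\<xi> e = 0") (auto simp: T_def)
  have F_herm: "F \<xi> j i = cnj (F \<xi> i j)" if "\<xi> \<in> chars A" "i < n" "j < n" for \<xi> i j
    using F3[OF that(1)] T_herm that by blast
  have rep_T: "rep (\<lambda>\<xi>. T \<xi> i j)" if ij: "i < n" "j < n" for i j
  proof -
    have "rep (\<lambda>\<xi>. (if i = j then 1 else 0) * \<xi> e + (- 1 / complex_of_real c) * \<xi> (X i j))"
      using X ij ec by (intro rep_add rep_scale rep_elem) auto
    also have "(\<lambda>\<xi>. (if i = j then 1 else 0) * \<xi> e + (- 1 / complex_of_real c) * \<xi> (X i j)) = (\<lambda>\<xi>. T \<xi> i j)"
      by (auto simp: T_def)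
    finally show ?thesis .
  qed
  have rep_iter: "rep (\<lambda>\<xi>. sqrt_iter n (T \<xi>) m i j)" if "i < n" "j < n" for m i j
    using that
  proof (induction m arbitrary: i j)
    case 0
    then show ?case
      by (simp add: rep_zero)
  next
    case (Suc m)
    then show ?case
      unfolding sqrt_iter.simps mat_mult_def by (intro rep_add rep_scale rep_sum rep_mult rep_T) auto
  qed
  have rep_F: "rep (\<lambda>\<xi>. F \<xi> i j)" if ij: "i < n" "j < n" for i j
  proof (rule rep_approx)
    fix d :: real assume "0 < d"
    then obtain m where "r - d < sqrt_bound m"
      using order_tendstoD(1)[OF r, of "r - d"] by (auto simp: eventually_sequentially)
    then have "cmod (sqrt_iter n (T \<xi>) m i j - F \<xi> i j) \<le> d" if "\<xi> \<in> chars A" for \<xi>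
      using F1[OF that ij, of m] by simp
    then show "\<exists>G. rep G \<and> (\<forall>\<xi>\<in>chars A. cmod (G \<xi> - F \<xi> i j) \<le> d)"
      using rep_iter[OF ij, of m] by blast
  qed
  define S where "S \<xi> i j = (if i = j then \<xi> e else 0) - F \<xi> i j" for \<xi> i j
  have "rep (\<lambda>\<xi>. complex_of_real (sqrt c) * S \<xi> i j)" if ij: "i < n" "j < n" for i j
  proof -
    have "rep (\<lambda>\<xi>. complex_of_real (sqrt c) * ((if i = j then 1 else 0) * \<xi> e + (- 1) * F \<xi> i j))"
      using ij ec by (intro rep_add rep_scale rep_elem rep_F) auto
    also have "(\<lambda>\<xi>. complex_of_real (sqrt c) * ((if i = j then 1 else 0) * \<xi> e + (- 1) * F \<xi> i j))
        = (\<lambda>\<xi>. complex_of_real (sqrt c) * S \<xi> i j)"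
      by (auto simp: S_def)
    finally show ?thesis .
  qed
  then have "\<exists>y. i < n \<longrightarrow> j < n \<longrightarrow> y \<in> carrier A \<and> (\<forall>\<xi>\<in>chars A. \<xi> y = complex_of_real (sqrt c) * S \<xi> i j)" for i j
    unfolding rep_def by metis
  then obtain Y where Y: "\<And>i j. i < n \<Longrightarrow> j < n \<Longrightarrow> Y i j \<in> carrier A"
    and Y_char: "\<And>i j \<xi>. i < n \<Longrightarrow> j < n \<Longrightarrow> \<xi> \<in> chars A \<Longrightarrow> \<xi> (Y i j) = complex_of_real (sqrt c) * S \<xi> i j"
    by metis
  have "X i j = (\<Oplus>k\<in>{..<n}. star A (Y k i) \<otimes> Y k j)" if ij: "i < n" "j < n" for i j
  proof (rule chars_eqI)
    show "(\<Oplus>k\<in>{..<n}. star A (Y k i) \<otimes> Y k j) \<in> carrier A"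
      using Y ij by (intro finsum_closed) auto
    fix \<xi> assume \<xi>: "\<xi> \<in> chars A"
    have S_herm: "cnj (S \<xi> k i) = S \<xi> i k" if "k < n" for k
      using F_herm[OF \<xi> that ij(1)] one[OF \<xi>] by (cases "\<xi> e = 0") (auto simp: S_def)
    have "\<xi> (\<Oplus>k\<in>{..<n}. star A (Y k i) \<otimes> Y k j) = (\<Sum>k<n. \<xi> (star A (Y k i) \<otimes> Y k j))"
      using Y ij by (intro chars_finsum[OF cstar_algebra_axioms \<xi>]) auto
    also have "\<dots> = (\<Sum>k<n. complex_of_real c * (S \<xi> i k * S \<xi> k j))"
    proof (intro sum.cong refl)
      fix k assume "k \<in> {..<n}"
      then have k: "k < n"
        by simp
      have cc: "complex_of_real (sqrt c) * complex_of_real (sqrt c) = complex_of_real c"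
        using c by (simp flip: of_real_mult)
      have "\<xi> (star A (Y k i) \<otimes> Y k j) = (complex_of_real (sqrt c) * complex_of_real (sqrt c)) * (S \<xi> i k * S \<xi> k j)"
        using \<xi> Y[OF k ij(1)] Y[OF k ij(2)] Y_char[OF k ij(1) \<xi>] Y_char[OF k ij(2) \<xi>] S_herm[OF k] by simp
      then show "\<xi> (star A (Y k i) \<otimes> Y k j) = complex_of_real c * (S \<xi> i k * S \<xi> k j)"
        unfolding cc .
    qed
    also have "\<dots> = complex_of_real c * (\<Sum>k<n. S \<xi> i k * S \<xi> k j)"
      by (simp add: sum_distrib_left)
    also have "(\<Sum>k<n. S \<xi> i k * S \<xi> k j) = \<xi> (X i j) / complex_of_real c"
    proof (cases "\<xi> e = 0")
      case True
      have "S \<xi> i' j' = 0" if "i' < n" "j' < n" for i' j'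
        using Y_char[OF that \<xi>] zero_char[OF \<xi> True Y[OF that]] c by simp
      then show ?thesis
        using ij zero_char[OF \<xi> True X[OF ij]] by simp
    next
      case False
      \<comment> \<open>Entry by entry \<open>(1 - F)^2 = 1 - 2 F + F^2 = 1 - T = X / c\<close>, by
        the fixed point equation.\<close>
      have "(\<Sum>k<n. S \<xi> i k * S \<xi> k j) = (\<Sum>k<n. (if i = k then (if k = j then 1 else 0) else 0)
          - (if i = k then F \<xi> k j else 0) - (if k = j then F \<xi> i k else 0) + F \<xi> i k * F \<xi> k j)"
        by (intro sum.cong refl) (auto simp: S_def one[OF \<xi> False] algebra_simps)
      also have "\<dots> = (if i = j then 1 else 0) - F \<xi> i j - F \<xi> i j + mat_mult n (F \<xi>) (F \<xi>) i j"
        using ij by (simp add: sum.distrib sum_subtractf mat_mult_def)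
      also have "\<dots> = \<xi> (X i j) / complex_of_real c"
        using F2[OF \<xi> ij] one[OF \<xi> False] by (auto simp: T_def algebra_simps)
      finally show ?thesis .
    qed
    finally show "\<xi> (X i j) = \<xi> (\<Oplus>k\<in>{..<n}. star A (Y k i) \<otimes> Y k j)"
      using c by simp
  qed (use X ij in auto)
  then show ?thesis
    unfolding matrix_positive_def using Y by blast
qed

end

section \<open>The algebra of bounded functions\<close>

text \<open>Functions of two variables, so that the elements have the type required by the definition of injectivity.\<close>

definition linf :: "('x \<Rightarrow> 'x \<Rightarrow> complex) cstar" where
  "linf = \<lparr>carrier = {f. \<exists>C. \<forall>p q. cmod (f p q) \<le> C},
     monoid.mult = (\<lambda>f g p q. f p q * g p q), one = (\<lambda>_ _. 1), zero = (\<lambda>_ _. 0),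
     add = (\<lambda>f g p q. f p q + g p q), module.smult = (\<lambda>c f p q. c * f p q),
     star = (\<lambda>f p q. cnj (f p q)), cnorm = (\<lambda>f. SUP z. cmod (f (fst z) (snd z)))\<rparr>"

lemma linf_simps [simp]:
  "f \<otimes>\<^bsub>linf\<^esub> g = (\<lambda>p q. f p q * g p q)"
  "\<zero>\<^bsub>linf\<^esub> = (\<lambda>p q. 0)"
  "f \<oplus>\<^bsub>linf\<^esub> g = (\<lambda>p q. f p q + g p q)"
  "c \<odot>\<^bsub>linf\<^esub> f = (\<lambda>p q. c * f p q)"
  "star linf f = (\<lambda>p q. cnj (f p q))"
  by (simp_all add: linf_def)

lemma linf_carrierI: "(\<And>p q. cmod (f p q) \<le> C) \<Longrightarrow> f \<in> carrier linf"
  by (auto simp: linf_def)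

lemma linf_carrierE:
  assumes "f \<in> carrier linf"
  obtains C where "0 \<le> C" "\<And>p q. cmod (f p q) \<le> C"
proof -
  obtain C where C: "\<And>p q. cmod (f p q) \<le> C"
    using assms by (auto simp: linf_def)
  moreover have "0 \<le> C"
    using C norm_ge_zero order_trans by blast
  ultimately show ?thesis
    using that by blast
qed

lemma linf_norm_le_iff:
  assumes "f \<in> carrier linf"
  shows "cnorm linf f \<le> r \<longleftrightarrow> (\<forall>p q. cmod (f p q) \<le> r)"
proof -
  have "bdd_above (range (\<lambda>z. cmod (f (fst z) (snd z))))"
    using assms by (auto simp: linf_def bdd_above_def)
  from cSUP_le_iff[OF UNIV_not_empty this, of r] show ?thesis
    by (simp add: linf_def split_paired_all)
qed

lemma linf_le_norm: "f \<in> carrier linf \<Longrightarrow> cmod (f p q) \<le> cnorm linf f"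
  using linf_norm_le_iff[of f "cnorm linf f"] by auto

lemma linf_norm_nonneg: "f \<in> carrier linf \<Longrightarrow> 0 \<le> cnorm linf f"
  by (rule order_trans[OF norm_ge_zero linf_le_norm])

lemma linf_closed:
  "\<lbrakk>f \<in> carrier linf; g \<in> carrier linf\<rbrakk> \<Longrightarrow> (\<lambda>p q. f p q * g p q) \<in> carrier linf"
  "\<lbrakk>f \<in> carrier linf; g \<in> carrier linf\<rbrakk> \<Longrightarrow> (\<lambda>p q. f p q + g p q) \<in> carrier linf"
  "f \<in> carrier linf \<Longrightarrow> (\<lambda>p q. c * f p q) \<in> carrier linf"
  "f \<in> carrier linf \<Longrightarrow> (\<lambda>p q. cnj (f p q)) \<in> carrier linf"
  "(\<lambda>p q. c) \<in> carrier linf"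
proof -
  show "(\<lambda>p q. c) \<in> carrier linf"
    by (rule linf_carrierI[of _ "cmod c"]) simp
  show "f \<in> carrier linf \<Longrightarrow> (\<lambda>p q. cnj (f p q)) \<in> carrier linf"
    by (auto simp: linf_def)
  show "(\<lambda>p q. c * f p q) \<in> carrier linf" if f: "f \<in> carrier linf"
  proof -
    obtain C where "\<And>p q. cmod (f p q) \<le> C"
      using f linf_carrierE by blast
    then show ?thesis
      by (intro linf_carrierI[of _ "cmod c * C"]) (simp add: norm_mult mult_left_mono)
  qed
  show "(\<lambda>p q. f p q * g p q) \<in> carrier linf" "(\<lambda>p q. f p q + g p q) \<in> carrier linf"
    if fg: "f \<in> carrier linf" "g \<in> carrier linf"
  proof -
    obtain C where C: "0 \<le> C" "\<And>p q. cmod (f p q) \<le> C"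
      using fg linf_carrierE by blast
    obtain D where D: "0 \<le> D" "\<And>p q. cmod (g p q) \<le> D"
      using fg linf_carrierE by blast
    show "(\<lambda>p q. f p q * g p q) \<in> carrier linf"
      using C D by (intro linf_carrierI[of _ "C * D"]) (simp add: norm_mult mult_mono)
    show "(\<lambda>p q. f p q + g p q) \<in> carrier linf"
      using C D by (intro linf_carrierI[of _ "C + D"]) (meson add_mono norm_triangle_ineq order_trans)
  qed
qed

lemma abelian_group_linf: "abelian_group linf"
proof (rule abelian_groupI)
  fix f :: "'x \<Rightarrow> 'x \<Rightarrow> complex" assume "f \<in> carrier linf"
  then show "\<exists>g\<in>carrier linf. g \<oplus>\<^bsub>linf\<^esub> f = \<zero>\<^bsub>linf\<^esub>"
    by (intro bexI[of _ "\<lambda>p q. (- 1) * f p q"] linf_closed) auto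
qed (auto simp: linf_closed fun_eq_iff)

lemma linf_diff:
  assumes "f \<in> carrier linf" "g \<in> carrier linf"
  shows "f \<ominus>\<^bsub>linf\<^esub> g = (\<lambda>p q. f p q - g p q)"
proof -
  have "\<ominus>\<^bsub>linf\<^esub> g = (\<lambda>p q. (- 1) * g p q)"
    by (rule abelian_group.minus_equality[OF abelian_group_linf]) (use assms linf_closed(3)[OF assms(2), of "- 1"] in simp_all)
  then show ?thesis
    by (simp add: a_minus_def)
qed

lemma linf_complete:
  fixes X :: "nat \<Rightarrow> 'x \<Rightarrow> 'x \<Rightarrow> complex"
  assumes X: "\<And>n. X n \<in> carrier linf"
    and C: "\<And>e. 0 < e \<Longrightarrow> \<exists>N. \<forall>m\<ge>N. \<forall>n\<ge>N. cnorm linf (X m \<ominus>\<^bsub>linf\<^esub> X n) < e"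
  shows "\<exists>x\<in>carrier linf. (\<lambda>n. cnorm linf (X n \<ominus>\<^bsub>linf\<^esub> x)) \<longlonglongrightarrow> 0"
proof -
  have near: "cmod (X m p q - X n p q) \<le> cnorm linf (X m \<ominus>\<^bsub>linf\<^esub> X n)" for m n p q
    using linf_le_norm[of "\<lambda>p q. X m p q - X n p q" p q] abelian_group.minus_closed[OF abelian_group_linf X X, of m n]
    by (simp add: linf_diff X)
  have "Cauchy (\<lambda>n. X n p q)" for p q
  proof (rule metric_CauchyI)
    fix e :: real assume "0 < e"
    then show "\<exists>N. \<forall>m\<ge>N. \<forall>n\<ge>N. dist (X m p q) (X n p q) < e"
      using C near unfolding dist_norm by (meson le_less_trans)
  qed
  then have conv: "(\<lambda>n. X n p q) \<longlonglongrightarrow> lim (\<lambda>n. X n p q)" for p q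
    using Cauchy_convergent convergent_LIMSEQ_iff by blast
  define x where "x p q = lim (\<lambda>n. X n p q)" for p q
  note conv = conv[folded x_def]
  have unif: "\<exists>N. \<forall>n\<ge>N. \<forall>p q. cmod (X n p q - x p q) \<le> e" if e: "0 < e" for e
  proof -
    obtain N where N: "\<And>m n. m \<ge> N \<Longrightarrow> n \<ge> N \<Longrightarrow> cnorm linf (X m \<ominus>\<^bsub>linf\<^esub> X n) < e"
      using C[OF e] by blast
    have "cmod (X n p q - x p q) \<le> e" if n: "n \<ge> N" for n p q
    proof -
      have "eventually (\<lambda>m. cmod (X n p q - X m p q) \<le> e) sequentially"
        using N[OF n] near[of n p q] by (intro eventually_sequentiallyI[of N]) (meson less_imp_le order_trans)
      then show ?thesis
        by (intro tendsto_upperbound[OF tendsto_norm[OF tendsto_diff[OF tendsto_const conv]]]) auto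
    qed
    then show ?thesis
      by blast
  qed
  have xc: "x \<in> carrier linf"
  proof -
    obtain N where N: "\<And>p q. cmod (X N p q - x p q) \<le> 1"
      using unif[of 1] by auto
    have "cmod (x p q) \<le> cnorm linf (X N) + 1" for p q
      using N[of p q] linf_le_norm[OF X[of N], of p q] norm_triangle_ineq4[of "X N p q" "X N p q - x p q"] by simp
    then show ?thesis
      by (rule linf_carrierI)
  qed
  have "(\<lambda>n. cnorm linf (X n \<ominus>\<^bsub>linf\<^esub> x)) \<longlonglongrightarrow> 0"
  proof (rule LIMSEQ_I)
    fix e :: real assume e: "0 < e"
    then obtain N where N: "\<And>n p q. n \<ge> N \<Longrightarrow> cmod (X n p q - x p q) \<le> e / 2"
      using unif[of "e/2"] by auto
    have "norm (cnorm linf (X n \<ominus>\<^bsub>linf\<^esub> x) - 0) < e" if n: "n \<ge> N" for n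
    proof -
      have c: "X n \<ominus>\<^bsub>linf\<^esub> x \<in> carrier linf"
        using abelian_group.minus_closed[OF abelian_group_linf X xc] .
      then have "cnorm linf (X n \<ominus>\<^bsub>linf\<^esub> x) \<le> e / 2"
        unfolding linf_norm_le_iff[OF c] using N[OF n] X xc by (simp add: linf_diff)
      then show ?thesis
        using e linf_norm_nonneg[OF c] by simp
    qed
    then show "\<exists>N. \<forall>n\<ge>N. norm (cnorm linf (X n \<ominus>\<^bsub>linf\<^esub> x) - 0) < e"
      by blast
  qed
  with xc show ?thesis
    by blast
qed

lemma cstar_algebra_linf: "cstar_algebra linf"
proof -
  have norm_mult_le: "cnorm linf (f \<otimes>\<^bsub>linf\<^esub> g) \<le> cnorm linf f * cnorm linf g"
    if "f \<in> carrier linf" "g \<in> carrier linf" for f g :: "'x \<Rightarrow> 'x \<Rightarrow> complex"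
    using that by (simp add: linf_norm_le_iff linf_closed norm_mult mult_mono linf_le_norm linf_norm_nonneg)
  have norm_add_le: "cnorm linf (f \<oplus>\<^bsub>linf\<^esub> g) \<le> cnorm linf f + cnorm linf g"
    if "f \<in> carrier linf" "g \<in> carrier linf" for f g :: "'x \<Rightarrow> 'x \<Rightarrow> complex"
    using that by (simp add: linf_norm_le_iff linf_closed) (meson add_mono linf_le_norm norm_triangle_ineq order_trans)
  have zero: "cnorm linf f = 0 \<longleftrightarrow> f = \<zero>\<^bsub>linf\<^esub>" if "f \<in> carrier linf" for f :: "'x \<Rightarrow> 'x \<Rightarrow> complex"
  proof -
    have "cnorm linf f = 0 \<longleftrightarrow> cnorm linf f \<le> 0"
      using linf_norm_nonneg[OF that] by auto
    then show ?thesis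
      using that by (simp add: linf_norm_le_iff fun_eq_iff)
  qed
  have smult_le: "cnorm linf (c \<odot>\<^bsub>linf\<^esub> f) \<le> cmod c * cnorm linf f" if "f \<in> carrier linf" for c and f :: "'x \<Rightarrow> 'x \<Rightarrow> complex"
    using that by (simp add: linf_norm_le_iff linf_closed norm_mult mult_left_mono linf_le_norm)
  have smult: "cnorm linf (c \<odot>\<^bsub>linf\<^esub> f) = cmod c * cnorm linf f" if f: "f \<in> carrier linf" for c and f :: "'x \<Rightarrow> 'x \<Rightarrow> complex"
  proof (cases "c = 0")
    case True
    have "cnorm linf (\<lambda>p q :: 'x. 0) = 0"
      using zero[of "\<lambda>p q. 0"] linf_closed(5)[of 0] by simp
    then show ?thesis
      using True by simp
  next
    case False
    have cf: "c \<odot>\<^bsub>linf\<^esub> f \<in> carrier linf"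
      using f linf_closed(3) by simp
    have "cnorm linf ((1 / c) \<odot>\<^bsub>linf\<^esub> (c \<odot>\<^bsub>linf\<^esub> f)) \<le> cmod (1 / c) * cnorm linf (c \<odot>\<^bsub>linf\<^esub> f)"
      by (rule smult_le[OF cf])
    then have "cmod c * cnorm linf f \<le> cnorm linf (c \<odot>\<^bsub>linf\<^esub> f)"
      using False by (simp add: norm_divide divide_simps mult.commute)
    then show ?thesis
      using smult_le[OF f, of c] by simp
  qed
  have cstar: "cnorm linf (star linf f \<otimes>\<^bsub>linf\<^esub> f) = (cnorm linf f)\<^sup>2" if f: "f \<in> carrier linf" for f :: "'x \<Rightarrow> 'x \<Rightarrow> complex"
  proof (rule antisym)
    have c: "(\<lambda>p q. cnj (f p q) * f p q) \<in> carrier linf"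
      using f by (intro linf_closed)
    show "cnorm linf (star linf f \<otimes>\<^bsub>linf\<^esub> f) \<le> (cnorm linf f)\<^sup>2"
      using f by (simp add: linf_norm_le_iff c norm_mult power2_eq_square mult_mono linf_le_norm linf_norm_nonneg)
    have "cmod (f p q) \<le> sqrt (cnorm linf (\<lambda>p q. cnj (f p q) * f p q))" for p q
    proof (rule real_le_rsqrt)
      show "(cmod (f p q))\<^sup>2 \<le> cnorm linf (\<lambda>p q. cnj (f p q) * f p q)"
        using linf_le_norm[OF c, of p q] by (simp add: norm_mult power2_eq_square)
    qed
    then have "cnorm linf f \<le> sqrt (cnorm linf (\<lambda>p q. cnj (f p q) * f p q))"
      using f by (simp add: linf_norm_le_iff)
    then have "(cnorm linf f)\<^sup>2 \<le> (sqrt (cnorm linf (\<lambda>p q. cnj (f p q) * f p q)))\<^sup>2"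
      using linf_norm_nonneg[OF f] by (intro power_mono)
    then show "(cnorm linf f)\<^sup>2 \<le> cnorm linf (star linf f \<otimes>\<^bsub>linf\<^esub> f)"
      using linf_norm_nonneg[OF c] by simp
  qed
  \<comment> \<open>Subgoals 18 to 23 are definiteness, the triangle inequality, homogeneity,
    submultiplicativity, the C*-identity and completeness.\<close>
  show ?thesis
    by (rule cstar_algebra.intro[OF abelian_group_linf], rule cstar_algebra_axioms.intro,
        rule_tac [23] linf_complete, rule_tac [22] cstar, rule_tac [21] norm_mult_le, rule_tac [20] smult,
        rule_tac [19] norm_add_le, rule_tac [18] zero)
      (auto simp: linf_closed linf_norm_nonneg fun_eq_iff algebra_simps)
qed

lemma comm_cstar_linf: "comm_cstar linf"
  using cstar_algebra_linf
  by (simp add: comm_cstar_def comm_cstar_axioms_def abelian_def mult.commute)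

lemma is_unit_linf: "is_unit linf e \<longleftrightarrow> e = (\<lambda>p q. 1)"
proof
  assume "is_unit linf e"
  then have "e \<otimes>\<^bsub>linf\<^esub> (\<lambda>p q. 1) = (\<lambda>p q. 1)"
    unfolding is_unit_def using linf_closed(5)[of 1] by blast
  then show "e = (\<lambda>p q. 1)"
    by simp
qed (simp add: is_unit_def linf_closed)

lemma finsum_linf:
  assumes "finite K" "\<And>k. k \<in> K \<Longrightarrow> f k \<in> carrier linf"
  shows "finsum linf f K = (\<lambda>p q. \<Sum>k\<in>K. f k p q)"
proof -
  interpret cstar_algebra linf
    by (rule cstar_algebra_linf)
  show ?thesis
    using assms
    by (induction K rule: finite_induct) (auto simp: finsum_insert Pi_def finsum_empty)
qed

section \<open>Positive maps into commutative algebras\<close>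

lemma linear_map_onD:
  assumes "linear_map_on A S C \<phi>"
  shows "x \<in> S \<Longrightarrow> \<phi> x \<in> carrier C" and "\<lbrakk>x \<in> S; y \<in> S\<rbrakk> \<Longrightarrow> \<phi> (x \<oplus>\<^bsub>A\<^esub> y) = \<phi> x \<oplus>\<^bsub>C\<^esub> \<phi> y"
    and "x \<in> S \<Longrightarrow> \<phi> (c \<odot>\<^bsub>A\<^esub> x) = c \<odot>\<^bsub>C\<^esub> \<phi> x"
  using assms by (auto simp: linear_map_on_def)

lemma linear_map_on_sum:
  assumes lin: "linear_map_on linf S I \<phi>" and S: "linear_subspace linf S" and I: "cstar_algebra I"
    and \<xi>: "\<xi> \<in> chars I" and K: "finite K" "\<And>k. k \<in> K \<Longrightarrow> x k \<in> S"
  shows "(\<lambda>p q. \<Sum>k\<in>K. c k * x k p q) \<in> S \<and> \<xi> (\<phi> (\<lambda>p q. \<Sum>k\<in>K. c k * x k p q)) = (\<Sum>k\<in>K. c k * \<xi> (\<phi> (x k)))"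
  using K
proof (induction K rule: finite_induct)
  case empty
  have z: "(\<lambda>p q. 0) \<in> S"
    using S by (simp add: linear_subspace_def)
  have "\<phi> (0 \<odot>\<^bsub>linf\<^esub> (\<lambda>p q. 0)) = 0 \<odot>\<^bsub>I\<^esub> \<phi> (\<lambda>p q. 0)" "\<phi> (\<lambda>p q. 0) \<in> carrier I"
    using lin z unfolding linear_map_on_def by blast+
  then have "\<xi> (\<phi> (\<lambda>p q. 0)) = 0"
    using chars_simps(4)[OF \<xi>, of "\<phi> (\<lambda>p q. 0)" 0] by simp
  with z show ?case
    by simp
next
  case (insert k K)
  let ?s = "\<lambda>p q. \<Sum>k\<in>K. c k * x k p q"
  have s: "?s \<in> S" "\<xi> (\<phi> ?s) = (\<Sum>k\<in>K. c k * \<xi> (\<phi> (x k)))" and xk: "x k \<in> S"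
    using insert by auto
  have cx: "c k \<odot>\<^bsub>linf\<^esub> x k \<in> S"
    using S xk unfolding linear_subspace_def by blast
  have "c k \<odot>\<^bsub>linf\<^esub> x k \<oplus>\<^bsub>linf\<^esub> ?s \<in> S"
    using S cx s(1) unfolding linear_subspace_def by blast
  moreover have "\<xi> (\<phi> (c k \<odot>\<^bsub>linf\<^esub> x k \<oplus>\<^bsub>linf\<^esub> ?s)) = c k * \<xi> (\<phi> (x k)) + \<xi> (\<phi> ?s)"
    unfolding linear_map_onD(2)[OF lin cx s(1)] linear_map_onD(3)[OF lin xk]
      chars_simps(1)[OF \<xi> cstar_algebra.smult_closed[OF I linear_map_onD(1)[OF lin xk]] linear_map_onD(1)[OF lin s(1)]]
      chars_simps(4)[OF \<xi> linear_map_onD(1)[OF lin xk]] ..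
  ultimately show ?case
    using insert s(2) by simp
qed

text \<open>For a vector \<open>v\<close> the combination of the entries of \<open>X\<close> with
  coefficients \<open>cnj (v i) * v j\<close> is pointwise a sum of squared moduli and stays in
  \<open>S\<close>. Hence \<open>pos\<close> makes the matrix of images positive semidefinite at
  every character, and \<open>matrix_positive_of_psd\<close> turns this into positivity over
  \<open>I\<close>.\<close>

lemma cp_map_on_linf:
  assumes I: "comm_cstar I" and e: "is_unit I e" and S: "linear_subspace linf S"
    and lin: "linear_map_on linf S I \<phi>"
    and pos: "\<And>g \<xi>. \<lbrakk>g \<in> S; \<And>p q. Im (g p q) = 0 \<and> 0 \<le> Re (g p q); \<xi> \<in> chars I\<rbrakk> \<Longrightarrow>
      Im (\<xi> (\<phi> g)) = 0 \<and> 0 \<le> Re (\<xi> (\<phi> g))"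
  shows "cp_map_on linf S I \<phi>"
  unfolding cp_map_on_def
proof (intro conjI allI impI)
  interpret I: comm_cstar I
    by fact
  fix n :: nat and X assume "(\<forall>i<n. \<forall>j<n. X i j \<in> S) \<and> matrix_positive linf n X"
  then have X0: "\<forall>i<n. \<forall>j<n. X i j \<in> S" and "matrix_positive linf n X"
    by auto
  then obtain Y where Y0: "\<forall>i<n. \<forall>j<n. Y i j \<in> carrier linf"
    and XY0: "\<forall>i<n. \<forall>j<n. X i j = (\<Oplus>\<^bsub>linf\<^esub>k\<in>{..<n}. star linf (Y k i) \<otimes>\<^bsub>linf\<^esub> Y k j)"
    unfolding matrix_positive_def by (elim exE conjE)
  note X = X0[rule_format] and Y = Y0[rule_format] and XY = XY0[rule_format]
  have X_eq: "X i j p q = (\<Sum>k<n. cnj (Y k i p q) * Y k j p q)" if "i < n" "j < n" for i j p q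
  proof -
    have c: "(\<lambda>p q. cnj (Y k i p q) * Y k j p q) \<in> carrier linf" if "k \<in> {..<n}" for k
      using Y that \<open>i < n\<close> \<open>j < n\<close> by (intro linf_closed) auto
    have "X i j = (\<Oplus>\<^bsub>linf\<^esub>k\<in>{..<n}. (\<lambda>p q. cnj (Y k i p q) * Y k j p q))"
      using XY[OF that] by simp
    also have "\<dots> = (\<lambda>p q. \<Sum>k<n. cnj (Y k i p q) * Y k j p q)"
      by (rule finsum_linf[OF _ c]) auto
    finally show ?thesis
      by simp
  qed
  show "matrix_positive I n (\<lambda>i j. \<phi> (X i j))"
  proof (rule I.matrix_positive_of_psd[OF e])
    show "\<phi> (X i j) \<in> carrier I" if "i < n" "j < n" for i j
      using lin X[OF that] by (auto simp: linear_map_on_def)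
    fix \<xi> assume \<xi>: "\<xi> \<in> chars I"
    show "psd n (\<lambda>i j. \<xi> (\<phi> (X i j)))"
      unfolding psd_def
    proof
      fix v :: "nat \<Rightarrow> complex"
      let ?K = "{..<n} \<times> {..<n}"
      let ?c = "\<lambda>z. cnj (v (fst z)) * v (snd z)" and ?x = "\<lambda>z. X (fst z) (snd z)"
      define g where "g = (\<lambda>p q. \<Sum>z\<in>?K. ?c z * ?x z p q)"
      have g: "g \<in> S" "\<xi> (\<phi> g) = (\<Sum>z\<in>?K. ?c z * \<xi> (\<phi> (?x z)))"
        using linear_map_on_sum[OF lin S I.cstar_algebra_axioms \<xi>, of ?K ?x ?c] X unfolding g_def by auto
      have "form n (\<lambda>i j. \<xi> (\<phi> (X i j))) v v = \<xi> (\<phi> g)"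
        unfolding g(2) by (simp add: form_def mat_vec_def sum_distrib_left sum.cartesian_product case_prod_beta ac_simps)
      moreover have "g p q = (\<Sum>k<n. complex_of_real ((cmod (\<Sum>j<n. v j * Y k j p q))\<^sup>2))" for p q
      proof -
        have "g p q = (\<Sum>i<n. \<Sum>j<n. cnj (v i) * v j * X i j p q)"
          by (simp add: g_def sum.cartesian_product case_prod_beta)
        also have "\<dots> = (\<Sum>i<n. \<Sum>j<n. \<Sum>k<n. cnj (v i * Y k i p q) * (v j * Y k j p q))"
          by (intro sum.cong refl) (simp add: X_eq sum_distrib_left ac_simps)
        also have "\<dots> = (\<Sum>i<n. \<Sum>k<n. \<Sum>j<n. cnj (v i * Y k i p q) * (v j * Y k j p q))"
          by (intro sum.cong refl sum.swap)
        also have "\<dots> = (\<Sum>k<n. \<Sum>i<n. \<Sum>j<n. cnj (v i * Y k i p q) * (v j * Y k j p q))"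
          by (rule sum.swap)
        also have "\<dots> = (\<Sum>k<n. cnj (\<Sum>i<n. v i * Y k i p q) * (\<Sum>j<n. v j * Y k j p q))"
          by (simp only: sum_product cnj_sum)
        also have "\<dots> = (\<Sum>k<n. complex_of_real ((cmod (\<Sum>j<n. v j * Y k j p q))\<^sup>2))"
          by (intro sum.cong refl) (simp only: complex_norm_square mult.commute)
        finally show ?thesis .
      qed
      then have "Im (g p q) = 0 \<and> 0 \<le> Re (g p q)" for p q
        by (simp add: sum_nonneg)
      ultimately show "Im (form n (\<lambda>i j. \<xi> (\<phi> (X i j))) v v) = 0 \<and> 0 \<le> Re (form n (\<lambda>i j. \<xi> (\<phi> (X i j))) v v)"
        using pos[OF g(1) _ \<xi>] by simp
    qed
  qed
qed (rule lin)

lemma cp_map_onD: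
  assumes "cp_map_on A S C \<phi>" "\<forall>i<n. \<forall>j<n. X i j \<in> S" "matrix_positive A n X"
  shows "matrix_positive C n (\<lambda>i j. \<phi> (X i j))"
  using assms unfolding cp_map_on_def by simp

text \<open>Weaker than \<open>star_monomorphism\<close>, because evaluation on a family of
  characters need not be injective.\<close>

definition star_hom :: "'a cstar \<Rightarrow> 'b cstar \<Rightarrow> ('a \<Rightarrow> 'b) \<Rightarrow> bool" where
  "star_hom A F \<rho> \<longleftrightarrow> linear_map_on A (carrier A) F \<rho> \<and>
     (\<forall>x\<in>carrier A. \<forall>y\<in>carrier A. \<rho> (x \<otimes>\<^bsub>A\<^esub> y) = \<rho> x \<otimes>\<^bsub>F\<^esub> \<rho> y) \<and>
     (\<forall>x\<in>carrier A. \<rho> (star A x) = star F (\<rho> x))"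

lemma star_hom_finsum:
  assumes A: "cstar_algebra A" and F: "cstar_algebra F" and \<rho>: "star_hom A F \<rho>"
    and K: "finite K" "\<And>k. k \<in> K \<Longrightarrow> f k \<in> carrier A"
  shows "\<rho> (finsum A f K) = finsum F (\<lambda>k. \<rho> (f k)) K"
proof -
  interpret A: cstar_algebra A
    by fact
  interpret F: cstar_algebra F
    by fact
  have \<rho>': "\<rho> x \<in> carrier F" if "x \<in> carrier A" for x
    using \<rho> that by (auto simp: star_hom_def linear_map_on_def)
  have "\<rho> (0 \<odot>\<^bsub>A\<^esub> \<zero>\<^bsub>A\<^esub>) = 0 \<odot>\<^bsub>F\<^esub> \<rho> \<zero>\<^bsub>A\<^esub>"
    using \<rho> unfolding star_hom_def linear_map_on_def by blast
  then have zero: "\<rho> \<zero>\<^bsub>A\<^esub> = \<zero>\<^bsub>F\<^esub>"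
    using \<rho>'[of "\<zero>\<^bsub>A\<^esub>"] by simp
  show ?thesis
    using K
  proof (induction K rule: finite_induct)
    case empty
    then show ?case
      by (simp add: zero)
  next
    case (insert k K)
    then have "finsum A f K \<in> carrier A"
      by (intro A.finsum_closed) auto
    then have "\<rho> (f k \<oplus>\<^bsub>A\<^esub> finsum A f K) = \<rho> (f k) \<oplus>\<^bsub>F\<^esub> \<rho> (finsum A f K)"
      using \<rho> insert unfolding star_hom_def linear_map_on_def by simp
    then show ?case
      using insert \<rho>' by (simp add: A.finsum_insert F.finsum_insert Pi_def)
  qed
qed

text \<open>Applying \<open>\<rho>\<close> to the entries of \<open>Y\<close> turns a factorization
  of \<open>X\<close> into one of its image.\<close>

lemma cp_map_comp_star_hom:
  assumes A: "cstar_algebra A" and F: "cstar_algebra F" and \<rho>: "star_hom A F \<rho>" and \<psi>: "cp_map F I \<psi>"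
  shows "cp_map A I (\<lambda>a. \<psi> (\<rho> a))"
proof -
  interpret A: cstar_algebra A
    by fact
  have \<rho>': "\<rho> x \<in> carrier F" if "x \<in> carrier A" for x
    using \<rho> that by (auto simp: star_hom_def linear_map_on_def)
  have "matrix_positive I n (\<lambda>i j. \<psi> (\<rho> (X i j)))"
    if X: "\<forall>i<n. \<forall>j<n. X i j \<in> carrier A" and pos: "matrix_positive A n X" for n X
  proof -
    obtain Y where Y0: "\<forall>i<n. \<forall>j<n. Y i j \<in> carrier A"
      and XY0: "\<forall>i<n. \<forall>j<n. X i j = (\<Oplus>\<^bsub>A\<^esub>k\<in>{..<n}. star A (Y k i) \<otimes>\<^bsub>A\<^esub> Y k j)"
      using pos unfolding matrix_positive_def by (elim exE conjE)
    note Y = Y0[rule_format] and XY = XY0[rule_format]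
    have eq: "\<rho> (X i j) = (\<Oplus>\<^bsub>F\<^esub>k\<in>{..<n}. star F (\<rho> (Y k i)) \<otimes>\<^bsub>F\<^esub> \<rho> (Y k j))" if ij: "i < n" "j < n" for i j
    proof -
      have "\<rho> (X i j) = (\<Oplus>\<^bsub>F\<^esub>k\<in>{..<n}. \<rho> (star A (Y k i) \<otimes>\<^bsub>A\<^esub> Y k j))"
        unfolding XY[OF ij] using Y ij by (intro star_hom_finsum[OF A F \<rho>]) auto
      also have "\<dots> = (\<Oplus>\<^bsub>F\<^esub>k\<in>{..<n}. star F (\<rho> (Y k i)) \<otimes>\<^bsub>F\<^esub> \<rho> (Y k j))"
      proof (rule abelian_monoid.finsum_cong')
        show "abelian_monoid F"
          using F by (simp add: cstar_algebra_def abelian_group_def)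
        show "\<rho> (star A (Y k i) \<otimes>\<^bsub>A\<^esub> Y k j) = star F (\<rho> (Y k i)) \<otimes>\<^bsub>F\<^esub> \<rho> (Y k j)" if "k \<in> {..<n}" for k
          using \<rho> Y ij that unfolding star_hom_def by simp
        show "(\<lambda>k. star F (\<rho> (Y k i)) \<otimes>\<^bsub>F\<^esub> \<rho> (Y k j)) \<in> {..<n} \<rightarrow> carrier F"
          using \<rho>' Y ij cstar_algebra.star_closed[OF F] cstar_algebra.mult_closed[OF F] by auto
      qed simp
      finally show ?thesis .
    qed
    have pos_F: "matrix_positive F n (\<lambda>i j. \<rho> (X i j))"
      unfolding matrix_positive_def
    proof (rule exI[of _ "\<lambda>i j. \<rho> (Y i j)"], intro conjI allI impI)
      show "\<rho> (Y i j) \<in> carrier F" if "i < n" "j < n" for i j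
        by (rule \<rho>'[OF Y[OF that]])
    qed (rule eq)
    have "\<forall>i<n. \<forall>j<n. \<rho> (X i j) \<in> carrier F"
      using X \<rho>' by blast
    from cp_map_onD[OF \<psi> this pos_F] show ?thesis .
  qed
  moreover have "linear_map_on A (carrier A) I (\<lambda>a. \<psi> (\<rho> a))"
  proof -
    have l: "linear_map_on A (carrier A) F \<rho>" "linear_map_on F (carrier F) I \<psi>"
      using \<rho> \<psi> by (simp_all add: star_hom_def cp_map_on_def)
    show ?thesis
      unfolding linear_map_on_def by (simp add: Pi_def linear_map_onD[OF l(1)] linear_map_onD[OF l(2)])
  qed
  ultimately show ?thesis
    unfolding cp_map_on_def by blast
qed

lemma cp_map_square:
  assumes A: "cstar_algebra A" and I: "cstar_algebra I" and \<Phi>: "cp_map A I \<Phi>" and x: "x \<in> carrier A"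
  obtains y where "y \<in> carrier I" "\<Phi> (star A x \<otimes>\<^bsub>A\<^esub> x) = star I y \<otimes>\<^bsub>I\<^esub> y"
proof -
  interpret A: cstar_algebra A
    by fact
  interpret I: cstar_algebra I
    by fact
  have one: "{..<1::nat} = {0}"
    by auto
  have "matrix_positive A 1 (\<lambda>i j. star A x \<otimes>\<^bsub>A\<^esub> x)"
    unfolding matrix_positive_def one using x
    by (intro exI[of _ "\<lambda>i j. x"]) (simp add: A.finsum_insert)
  then have "matrix_positive I 1 (\<lambda>i j. \<Phi> (star A x \<otimes>\<^bsub>A\<^esub> x))"
    using cp_map_onD[OF \<Phi>, of 1 "\<lambda>i j. star A x \<otimes>\<^bsub>A\<^esub> x"] x by simp
  then obtain Y where Y: "Y (0::nat) (0::nat) \<in> carrier I"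
    "\<Phi> (star A x \<otimes>\<^bsub>A\<^esub> x) = (\<Oplus>\<^bsub>I\<^esub>k\<in>{0::nat}. star I (Y k 0) \<otimes>\<^bsub>I\<^esub> Y k 0)"
    unfolding matrix_positive_def one by auto
  then show ?thesis
    using that[of "Y 0 0"] by (simp add: I.finsum_insert)
qed

lemma cp_map_positive:
  assumes A: "cstar_algebra A" and I: "cstar_algebra I" and \<Phi>: "cp_map A I \<Phi>" and x: "x \<in> carrier A"
    and \<xi>: "\<xi> \<in> chars I"
  shows "Im (\<xi> (\<Phi> (star A x \<otimes>\<^bsub>A\<^esub> x))) = 0 \<and> 0 \<le> Re (\<xi> (\<Phi> (star A x \<otimes>\<^bsub>A\<^esub> x)))"
proof -
  obtain y where "y \<in> carrier I" "\<Phi> (star A x \<otimes>\<^bsub>A\<^esub> x) = star I y \<otimes>\<^bsub>I\<^esub> y"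
    using cp_map_square[OF A I \<Phi> x] .
  then show ?thesis
    using \<xi> cstar_algebra.star_closed[OF I] by simp
qed

lemma unit_at_char:
  assumes "is_unit I e" "\<xi> \<in> chars I"
  shows "\<xi> e = 0 \<or> \<xi> e = 1"
proof -
  have "\<xi> (e \<otimes>\<^bsub>I\<^esub> e) = \<xi> e" "e \<in> carrier I"
    using assms(1) by (auto simp: is_unit_def)
  then show ?thesis
    using assms(2) by simp
qed

text \<open>A map that is positive relative to a family of characters extends by injectivity, applied to the
  operator system spanned by its domain and the constants inside the bounded functions on the family.\<close>

lemma extension_through_characters:
  fixes I :: "'i cstar" and \<eta> :: "'x \<Rightarrow> 'c \<Rightarrow> complex"
  assumes inj: "injective_cstar TYPE('x \<Rightarrow> 'x \<Rightarrow> complex) I" and I: "comm_cstar I" and e: "is_unit I e"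
    and C: "comm_cstar C" and \<eta>: "\<And>p. \<eta> p \<in> chars C"
    and T: "linear_subspace C T" and T_star: "\<And>t. t \<in> T \<Longrightarrow> star C t \<in> T"
    and lin: "linear_map_on C T I \<phi>"
    and pos: "\<And>t z \<xi>. \<lbrakk>t \<in> T; star C t = t; \<And>p. 0 \<le> Re (\<eta> p t) + z; \<xi> \<in> chars I\<rbrakk> \<Longrightarrow>
      Im (\<xi> (\<phi> t)) = 0 \<and> 0 \<le> Re (\<xi> (\<phi> t)) + z * Re (\<xi> e)"
  obtains \<Psi> where "cp_map C I \<Psi>" "\<And>c. c \<in> carrier C \<Longrightarrow> cnorm I (\<Psi> c) \<le> cnorm C c"
    "\<And>t. t \<in> T \<Longrightarrow> \<Psi> t = \<phi> t" "\<And>c. \<lbrakk>c \<in> carrier C; \<And>p. \<eta> p c = 0\<rbrakk> \<Longrightarrow> \<Psi> c = \<zero>\<^bsub>I\<^esub>"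
    "\<And>u. \<lbrakk>u \<in> carrier C; \<And>p. \<eta> p u = 1\<rbrakk> \<Longrightarrow> \<Psi> u = e"
proof -
  interpret I: comm_cstar I
    by fact
  interpret C: comm_cstar C
    by fact
  interpret L: comm_cstar "linf :: ('x \<Rightarrow> 'x \<Rightarrow> complex) cstar"
    by (rule comm_cstar_linf)
  have Tc: "t \<in> carrier C" if "t \<in> T" for t
    using T that by (auto simp: linear_subspace_def)
  have Tz: "\<zero>\<^bsub>C\<^esub> \<in> T" and Ta: "\<And>s t. s \<in> T \<Longrightarrow> t \<in> T \<Longrightarrow> s \<oplus>\<^bsub>C\<^esub> t \<in> T"
    and Ts: "\<And>c t. t \<in> T \<Longrightarrow> c \<odot>\<^bsub>C\<^esub> t \<in> T"
    using T by (auto simp: linear_subspace_def)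
  have ec [simp]: "e \<in> carrier I"
    using e by (simp add: is_unit_def)
  have e_char: "Im (\<xi> e) = 0" "0 \<le> Re (\<xi> e)" "Re (\<xi> e) \<le> 1" if "\<xi> \<in> chars I" for \<xi>
    using unit_at_char[OF e that] by auto
  note lc [simp] = linear_map_onD(1)[OF lin]
  \<comment> \<open>A function of the operator system is \<open>\<eta> p t + z\<close> with
    \<open>t\<close> not necessarily hermitian and \<open>z\<close> complex, while
    \<open>pos\<close> speaks of hermitian \<open>t\<close> and real \<open>z\<close>. The real part
    is covered by \<open>pos\<close>; the imaginary part vanishes on the family, and
    \<open>pos\<close> for \<open>t2\<close> and its negative makes its image vanish too.\<close>
  have pos': "Im (\<xi> (\<phi> t) + z * \<xi> e) = 0 \<and> 0 \<le> Re (\<xi> (\<phi> t) + z * \<xi> e)"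
    if t: "t \<in> T" and \<xi>: "\<xi> \<in> chars I" and p: "\<And>p. Im (\<eta> p t + z) = 0 \<and> 0 \<le> Re (\<eta> p t + z)" for t z \<xi>
  proof -
    define t1 where "t1 = (1/2) \<odot>\<^bsub>C\<^esub> (t \<oplus>\<^bsub>C\<^esub> star C t)"
    define t2 where "t2 = (- \<i>/2) \<odot>\<^bsub>C\<^esub> (t \<oplus>\<^bsub>C\<^esub> (- 1) \<odot>\<^bsub>C\<^esub> star C t)"
    have t12: "t1 \<in> T" "t2 \<in> T"
      using t by (auto simp: t1_def t2_def Ta Ts T_star)
    have ch1: "\<zeta> t1 = complex_of_real (Re (\<zeta> t))" and ch2: "\<zeta> t2 = complex_of_real (Im (\<zeta> t))" if "\<zeta> \<in> chars C" for \<zeta>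
      using that Tc[OF t] by (auto simp: t1_def t2_def complex_eq_iff)
    have st: "star C t1 = t1" "star C t2 = t2"
      using Tc[OF t12(1)] Tc[OF t12(2)] by (auto intro!: C.chars_eqI simp: ch1 ch2)
    have "t = t1 \<oplus>\<^bsub>C\<^esub> \<i> \<odot>\<^bsub>C\<^esub> t2"
      using Tc[OF t] Tc[OF t12(1)] Tc[OF t12(2)] by (intro C.chars_eqI) (auto simp: ch1 ch2 complex_eq_iff)
    then have "\<phi> t = \<phi> t1 \<oplus>\<^bsub>I\<^esub> \<i> \<odot>\<^bsub>I\<^esub> \<phi> t2"
      using linear_map_onD(2)[OF lin t12(1) Ts[OF t12(2)], of "\<i>"] linear_map_onD(3)[OF lin t12(2), of "\<i>"] by simp
    then have \<xi>t: "\<xi> (\<phi> t) = \<xi> (\<phi> t1) + \<i> * \<xi> (\<phi> t2)"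
      using \<xi> t12 by simp
    have 1: "Im (\<xi> (\<phi> t1)) = 0 \<and> 0 \<le> Re (\<xi> (\<phi> t1)) + Re z * Re (\<xi> e)"
      by (rule pos[OF t12(1) st(1) _ \<xi>]) (use p ch1[OF \<eta>] in simp)
    have 2: "Im (\<xi> (\<phi> t2)) = 0 \<and> 0 \<le> Re (\<xi> (\<phi> t2)) + Im z * Re (\<xi> e)"
      by (rule pos[OF t12(2) st(2) _ \<xi>]) (use p ch2[OF \<eta>] in simp)
    have st2: "star C ((- 1) \<odot>\<^bsub>C\<^esub> t2) = (- 1) \<odot>\<^bsub>C\<^esub> t2"
      using st Tc[OF t12(2)] by (simp add: C.star_smult)
    have "0 \<le> Re (\<eta> p ((- 1) \<odot>\<^bsub>C\<^esub> t2)) + (- Im z)" for p'' p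
      using that(3)[of p] ch2[OF \<eta>, of p] chars_simps(4)[OF \<eta> Tc[OF t12(2)], of p "- 1"] by simp
    from pos[OF Ts[OF t12(2)] st2 this \<xi>]
    have 3: "0 \<le> Re (\<xi> (\<phi> ((- 1) \<odot>\<^bsub>C\<^esub> t2))) + (- Im z) * Re (\<xi> e)"
      by simp
    have "\<xi> (\<phi> ((- 1) \<odot>\<^bsub>C\<^esub> t2)) = - \<xi> (\<phi> t2)"
      using linear_map_onD(3)[OF lin t12(2), of "- 1"] chars_simps(4)[OF \<xi> lc[OF t12(2)], of "- 1"] by simp
    then show ?thesis
      using 1 2 3 e_char[OF \<xi>] by (simp add: \<xi>t)
  qed
  \<comment> \<open>The source of well-definedness of \<open>\<Phi>\<close> below: a function may be
    written as \<open>\<eta> p t + z\<close> in several ways.\<close>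
  have zero_eq: "\<xi> (\<phi> t) + z * \<xi> e = 0"
    if t: "t \<in> T" and \<xi>: "\<xi> \<in> chars I" and p: "\<And>p. \<eta> p t + z = 0" for t z \<xi>
  proof -
    have 1: "Im (\<xi> (\<phi> t) + z * \<xi> e) = 0 \<and> 0 \<le> Re (\<xi> (\<phi> t) + z * \<xi> e)"
      by (rule pos'[OF t \<xi>]) (simp add: p)
    have "\<eta> p ((- 1) \<odot>\<^bsub>C\<^esub> t) + (- z) = - (\<eta> p t + z)" for p
      using chars_simps(4)[OF \<eta> Tc[OF t], of p "- 1"] by simp
    then have "Im (\<xi> (\<phi> ((- 1) \<odot>\<^bsub>C\<^esub> t)) + (- z) * \<xi> e) = 0 \<and> 0 \<le> Re (\<xi> (\<phi> ((- 1) \<odot>\<^bsub>C\<^esub> t)) + (- z) * \<xi> e)"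
      by (intro pos'[OF Ts[OF t] \<xi>]) (simp add: p)
    moreover have "\<xi> (\<phi> ((- 1) \<odot>\<^bsub>C\<^esub> t)) = - \<xi> (\<phi> t)"
      using linear_map_onD(3)[OF lin t, of "- 1"] chars_simps(4)[OF \<xi> lc[OF t], of "- 1"] by simp
    ultimately show ?thesis
      using 1 by (simp add: complex_eq_iff)
  qed
  \<comment> \<open>The functions are constant in the second variable: the type of two-variable
    functions is the one for which injectivity is given.\<close>
  define P where "P g t z \<longleftrightarrow> t \<in> T \<and> g = (\<lambda>p q :: 'x. \<eta> p t + z)" for g t z
  define S where "S = {g. \<exists>t z. P g t z}"
  define \<Phi> where "\<Phi> g = (SOME y. \<exists>t z. P g t z \<and> y = \<phi> t \<oplus>\<^bsub>I\<^esub> z \<odot>\<^bsub>I\<^esub> e)" for g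
  have \<Phi>: "\<Phi> g = \<phi> t \<oplus>\<^bsub>I\<^esub> z \<odot>\<^bsub>I\<^esub> e" if g: "P g t z" for g t z
    unfolding \<Phi>_def
  proof (rule some_equality)
    show "\<exists>t' z'. P g t' z' \<and> \<phi> t \<oplus>\<^bsub>I\<^esub> z \<odot>\<^bsub>I\<^esub> e = \<phi> t' \<oplus>\<^bsub>I\<^esub> z' \<odot>\<^bsub>I\<^esub> e"
      using g by blast
    fix y assume "\<exists>t z. P g t z \<and> y = \<phi> t \<oplus>\<^bsub>I\<^esub> z \<odot>\<^bsub>I\<^esub> e"
    then obtain t' z' where t': "P g t' z'" "y = \<phi> t' \<oplus>\<^bsub>I\<^esub> z' \<odot>\<^bsub>I\<^esub> e"
      by blast
    have tt: "t \<in> T" "t' \<in> T" and eq: "\<eta> p t + z = \<eta> p t' + z'" for p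
      using g t'(1) by (auto simp: P_def fun_eq_iff)
    have d: "t' \<oplus>\<^bsub>C\<^esub> (- 1) \<odot>\<^bsub>C\<^esub> t \<in> T"
      using tt by (intro Ta Ts)
    have 0: "\<eta> p (t' \<oplus>\<^bsub>C\<^esub> (- 1) \<odot>\<^bsub>C\<^esub> t) + (z' - z) = 0" for p
      using eq[of p] \<eta>[of p] Tc[OF tt(1)] Tc[OF tt(2)] by (simp add: algebra_simps)
    have "\<phi> (t' \<oplus>\<^bsub>C\<^esub> (- 1) \<odot>\<^bsub>C\<^esub> t) = \<phi> t' \<oplus>\<^bsub>I\<^esub> (- 1) \<odot>\<^bsub>I\<^esub> \<phi> t"
      using linear_map_onD(2)[OF lin tt(2) Ts[OF tt(1)], of "- 1"] linear_map_onD(3)[OF lin tt(1), of "- 1"] by simp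
    then have "\<xi> y = \<xi> (\<phi> t \<oplus>\<^bsub>I\<^esub> z \<odot>\<^bsub>I\<^esub> e)" if "\<xi> \<in> chars I" for \<xi>
      using zero_eq[OF d that 0] that tt by (simp add: t'(2) algebra_simps)
    then show "y = \<phi> t \<oplus>\<^bsub>I\<^esub> z \<odot>\<^bsub>I\<^esub> e"
      using tt t' by (intro I.chars_eqI) auto
  qed
  have P_add: "P (\<lambda>p q. g p q + g' p q) (t \<oplus>\<^bsub>C\<^esub> t') (z + z')" if "P g t z" "P g' t' z'" for g t z g' t' z'
    using that Ta Tc \<eta> by (simp add: P_def fun_eq_iff)
  have P_smult: "P (\<lambda>p q. c * g p q) (c \<odot>\<^bsub>C\<^esub> t) (c * z)" if "P g t z" for g t z c
    using that Ts Tc \<eta> by (simp add: P_def fun_eq_iff distrib_left)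
  have P_star: "P (\<lambda>p q. cnj (g p q)) (star C t) (cnj z)" if "P g t z" for g t z
    using that T_star Tc \<eta> by (simp add: P_def fun_eq_iff)
  have P_const: "P (\<lambda>p q. z) \<zero>\<^bsub>C\<^esub> z" for z
    using Tz \<eta> by (simp add: P_def)
  have P_T: "P (\<lambda>p q. \<eta> p t) t 0" if "t \<in> T" for t
    using that by (simp add: P_def)
  have P_carrier: "g \<in> carrier linf" if "P g t z" for g t z
  proof (rule linf_carrierI)
    fix p q
    show "cmod (g p q) \<le> cnorm C t + cmod z"
      using that C.chars_cnorm_le[OF \<eta>, of t p] Tc unfolding P_def
      by (auto intro: order_trans[OF norm_triangle_ineq])
  qed
  have \<rho>c: "(\<lambda>p q. \<eta> p c) \<in> carrier linf" if "c \<in> carrier C" for c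
    using C.chars_cnorm_le[OF \<eta> that] by (rule linf_carrierI)
  have sub: "linear_subspace linf S"
    unfolding linear_subspace_def S_def using P_carrier P_add P_smult P_const by (auto simp: subset_iff) blast+
  have sys: "operator_system linf S"
    unfolding operator_system_def using sub P_star P_const[of 1] by (auto simp: S_def is_unit_linf) blast+
  have linS: "linear_map_on linf S I \<Phi>"
    unfolding linear_map_on_def
  proof (intro conjI ballI allI funcsetI)
    fix f assume "f \<in> S"
    then obtain t z where f: "P f t z"
      by (auto simp: S_def)
    then have t: "t \<in> T"
      by (simp add: P_def)
    show "\<Phi> f \<in> carrier I"
      using t by (simp add: \<Phi>[OF f])
    show "\<Phi> (c \<odot>\<^bsub>linf\<^esub> f) = c \<odot>\<^bsub>I\<^esub> \<Phi> f" for c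
      using t \<Phi>[OF P_smult[OF f, of c]] linear_map_onD(3)[OF lin t, of c]
      by (simp add: \<Phi>[OF f] I.smult_add_right flip: I.smult_smult)
    fix g assume "g \<in> S"
    then obtain t' z' where g: "P g t' z'"
      by (auto simp: S_def)
    then have t': "t' \<in> T"
      by (simp add: P_def)
    show "\<Phi> (f \<oplus>\<^bsub>linf\<^esub> g) = \<Phi> f \<oplus>\<^bsub>I\<^esub> \<Phi> g"
      using t t' \<Phi>[OF P_add[OF f g]] linear_map_onD(2)[OF lin t t']
      by (simp add: \<Phi>[OF f] \<Phi>[OF g] I.smult_add_left I.a_ac)
  qed
  have "cp_map_on linf S I \<Phi>"
  proof (rule cp_map_on_linf[OF I e sub linS])
    fix g \<xi> assume g: "g \<in> S" and nn: "\<And>p q. Im (g p q) = 0 \<and> 0 \<le> Re (g p q)" and \<xi>: "\<xi> \<in> chars I"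
    then obtain t z where tz: "P g t z"
      by (auto simp: S_def)
    then have "t \<in> T" "\<And>p. Im (\<eta> p t + z) = 0 \<and> 0 \<le> Re (\<eta> p t + z)"
      using nn by (auto simp: P_def)
    then show "Im (\<xi> (\<Phi> g)) = 0 \<and> 0 \<le> Re (\<xi> (\<Phi> g))"
      using pos'[OF _ \<xi>, of t z] \<xi> by (simp add: \<Phi>[OF tz])
  qed
  then obtain \<psi> where \<psi>: "cp_map linf I \<psi>" and \<psi>\<Phi>: "\<And>g. g \<in> S \<Longrightarrow> \<psi> g = \<Phi> g"
    using inj sys L.cstar_algebra_axioms is_unit_linf unfolding injective_cstar_def unital_def by blast
  have \<psi>lin: "linear_map_on linf (carrier linf) I \<psi>"
    using \<psi> by (simp add: cp_map_on_def)
  note \<psi>c = linear_map_onD(1)[OF \<psi>lin]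
  have \<psi>_const: "\<psi> (\<lambda>p q. z) = z \<odot>\<^bsub>I\<^esub> e" for z
  proof -
    have "\<phi> (0 \<odot>\<^bsub>C\<^esub> \<zero>\<^bsub>C\<^esub>) = 0 \<odot>\<^bsub>I\<^esub> \<phi> \<zero>\<^bsub>C\<^esub>"
      by (rule linear_map_onD(3)[OF lin Tz])
    then have "\<phi> \<zero>\<^bsub>C\<^esub> = \<zero>\<^bsub>I\<^esub>"
      using lc[OF Tz] by simp
    then show ?thesis
      using \<psi>\<Phi>[of "\<lambda>p q. z"] \<Phi>[OF P_const] P_const by (auto simp: S_def)
  qed
  have nonneg: "Im (\<xi> (\<psi> g)) = 0 \<and> 0 \<le> Re (\<xi> (\<psi> g))"
    if \<xi>: "\<xi> \<in> chars I" and g: "g \<in> carrier linf" and nn: "\<And>p q. Im (g p q) = 0 \<and> 0 \<le> Re (g p q)" for \<xi> g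
  proof -
    define s where "s = (\<lambda>p q. complex_of_real (sqrt (Re (g p q))))"
    obtain K where K: "\<And>p q. cmod (g p q) \<le> K"
      using linf_carrierE[OF g] by metis
    have sc: "s \<in> carrier linf"
    proof (rule linf_carrierI)
      fix p q
      have "Re (g p q) \<le> K"
        using complex_Re_le_cmod[of "g p q"] K[of p q] by simp
      then show "cmod (s p q) \<le> sqrt K"
        using nn[of p q] by (simp add: s_def)
    qed
    have "star linf s \<otimes>\<^bsub>linf\<^esub> s = g"
      using nn by (simp add: s_def fun_eq_iff complex_eq_iff flip: of_real_mult)
    then show ?thesis
      using cp_map_positive[OF L.cstar_algebra_axioms I.cstar_algebra_axioms \<psi> sc \<xi>] by simp
  qed
  \<comment> \<open>A positive functional is bounded by its value at 1. Multiplying \<open>g\<close>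
    by the phase \<open>c\<close> makes the value equal to \<open>cmod w\<close>, so only the real
    part \<open>h\<close> of \<open>c g\<close> contributes, and \<open>h \<le> M\<close> gives at
    most \<open>M * Re (\<xi> e)\<close>.\<close>
  have bound: "cmod (\<xi> (\<psi> g)) \<le> M"
    if \<xi>: "\<xi> \<in> chars I" and g: "g \<in> carrier linf" and M: "\<And>p q. cmod (g p q) \<le> M" for \<xi> g M
  proof (cases "\<xi> (\<psi> g) = 0")
    case True
    then show ?thesis
      using order_trans[OF norm_ge_zero M] by simp
  next
    case False
    define w where "w = \<xi> (\<psi> g)"
    define c where "c = cnj w / complex_of_real (cmod w)"
    have w: "w \<noteq> 0"
      using False by (simp add: w_def)
    have c: "cmod c = 1" "c * w = complex_of_real (cmod w)"
      using w by (simp_all add: c_def norm_divide complex_norm_square[symmetric] power2_eq_square mult.commute flip: of_real_mult)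
        (simp add: complex_norm_square[symmetric] mult.commute power2_eq_square divide_simps flip: of_real_mult)
    define h where "h = (\<lambda>p q. complex_of_real (Re (c * g p q)))"
    define k where "k = (\<lambda>p q. complex_of_real (Im (c * g p q)))"
    have le: "\<bar>Re (c * g p q)\<bar> \<le> M" "\<bar>Im (c * g p q)\<bar> \<le> M" for p q
      using abs_Re_le_cmod[of "c * g p q"] abs_Im_le_cmod[of "c * g p q"] M[of p q] c(1) by (simp_all add: norm_mult)
    have hk: "h \<in> carrier linf" "k \<in> carrier linf"
      unfolding h_def k_def by (rule linf_carrierI[of _ M], simp only: norm_of_real le)+
    have hkM: "Re (h p q) \<le> M" "Im (h p q) = 0" "Re (k p q) \<le> M" "Im (k p q) = 0" for p q
      using abs_le_D1[OF le(1)] abs_le_D1[OF le(2)] unfolding h_def k_def by (simp_all only: Re_complex_of_real Im_complex_of_real)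
    have 1: "Im (\<xi> (\<psi> (\<lambda>p q. complex_of_real M + (- 1) * h p q))) = 0 \<and> 0 \<le> Re (\<xi> (\<psi> (\<lambda>p q. complex_of_real M + (- 1) * h p q)))"
      using hk hkM by (intro nonneg[OF \<xi>] linf_closed) simp_all
    have 2: "Im (\<xi> (\<psi> (\<lambda>p q. complex_of_real M + (- 1) * k p q))) = 0"
      using nonneg[OF \<xi>, of "\<lambda>p q. complex_of_real M + (- 1) * k p q"] linf_closed(2)[OF linf_closed(5) linf_closed(3)[OF hk(2)], of "complex_of_real M" "- 1"]
      by (simp add: hkM)
    have comb: "\<xi> (\<psi> (\<lambda>p q. z + y * f p q)) = z * \<xi> e + y * \<xi> (\<psi> f)" if "f \<in> carrier linf" for z y f
      using linear_map_onD(2)[OF \<psi>lin linf_closed(5)[of z] linf_closed(3)[OF that, of y]]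
        linear_map_onD(3)[OF \<psi>lin that, of y] \<psi>c[OF that] \<xi> by (simp add: \<psi>_const)
    have "\<xi> (\<psi> (\<lambda>p q. c * g p q)) = \<xi> (\<psi> (\<lambda>p q. h p q + \<i> * k p q))"
      by (intro arg_cong[where f = "\<lambda>x. \<xi> (\<psi> x)"]) (auto simp: h_def k_def fun_eq_iff complex_eq_iff)
    also have "\<dots> = \<xi> (\<psi> h) + \<i> * \<xi> (\<psi> k)"
      using linear_map_onD(2)[OF \<psi>lin hk(1) linf_closed(3)[OF hk(2), of "\<i>"]] linear_map_onD(3)[OF \<psi>lin hk(2), of "\<i>"]
        \<psi>c[OF hk(1)] \<psi>c[OF hk(2)] \<xi> by simp
    finally have "\<xi> (\<psi> h) + \<i> * \<xi> (\<psi> k) = c * w"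
      using linear_map_onD(3)[OF \<psi>lin g, of c] \<psi>c[OF g] \<xi> by (simp add: w_def)
    then have "Re (\<xi> (\<psi> h)) - Im (\<xi> (\<psi> k)) = cmod w"
      using c(2) by (simp add: complex_eq_iff)
    moreover have "Im (\<xi> (\<psi> k)) = 0"
      using 2 comb[OF hk(2), of "complex_of_real M" "- 1"] e_char[OF \<xi>] by simp
    moreover have "Re (\<xi> (\<psi> h)) \<le> M * Re (\<xi> e)"
      using 1 comb[OF hk(1), of "complex_of_real M" "- 1"] e_char[OF \<xi>] by simp
    moreover have "M * Re (\<xi> e) \<le> M * 1"
      using e_char[OF \<xi>] order_trans[OF norm_ge_zero M] by (intro mult_left_mono) auto
    ultimately show ?thesis
      by (simp add: w_def)
  qed
  have hom: "star_hom C linf (\<lambda>c p q. \<eta> p c)"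
    unfolding star_hom_def linear_map_on_def using \<rho>c \<eta> by (auto simp: fun_eq_iff)
  show ?thesis
  proof (rule that[of "\<lambda>c. \<psi> (\<lambda>p q. \<eta> p c)"])
    show "cp_map C I (\<lambda>c. \<psi> (\<lambda>p q. \<eta> p c))"
      by (rule cp_map_comp_star_hom[OF C.cstar_algebra_axioms L.cstar_algebra_axioms hom \<psi>])
    show "cnorm I (\<psi> (\<lambda>p q. \<eta> p c)) \<le> cnorm C c" if c: "c \<in> carrier C" for c
      using bound[OF _ \<rho>c[OF c], of _ "cnorm C c"] C.chars_cnorm_le[OF \<eta> c] C.cnorm_nonneg[OF c] \<psi>c[OF \<rho>c[OF c]]
      by (intro I.cnorm_le_of_chars) auto
    show "\<psi> (\<lambda>p q. \<eta> p t) = \<phi> t" if t: "t \<in> T" for t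
      using \<psi>\<Phi>[of "\<lambda>p q. \<eta> p t"] \<Phi>[OF P_T[OF t]] P_T[OF t] lc[OF t] by (auto simp: S_def)
    show "\<psi> (\<lambda>p q. \<eta> p c) = \<zero>\<^bsub>I\<^esub>" if "c \<in> carrier C" "\<And>p. \<eta> p c = 0" for c
      using \<psi>_const[of 0] that(2) by simp
    show "\<psi> (\<lambda>p q. \<eta> p u) = e" if "u \<in> carrier C" "\<And>p. \<eta> p u = 1" for u
      using \<psi>_const[of 1] that(2) by (simp add: I.smult_one)
  qed
qed

section \<open>Injective envelopes of commutative algebras\<close>

lemma is_unit_unique: "\<lbrakk>is_unit A e; is_unit A e'\<rbrakk> \<Longrightarrow> e = e'"
  unfolding is_unit_def by metis

lemma (in cstar_algebra) star_unit:
  assumes e: "is_unit A e"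
  shows "star A e = e"
proof -
  have ec: "e \<in> carrier A"
    using e by (simp add: is_unit_def)
  have "star A e \<otimes> x = x \<and> x \<otimes> star A e = x" if x: "x \<in> carrier A" for x
  proof -
    have "star A (e \<otimes> star A x) = star A (star A x)" "star A (star A x \<otimes> e) = star A (star A x)"
      using e x unfolding is_unit_def by auto
    then show ?thesis
      using x ec by (simp add: star_mult star_star)
  qed
  then have "is_unit A (star A e)"
    using ec by (simp add: is_unit_def)
  then show ?thesis
    by (rule is_unit_unique[OF _ e])
qed

text \<open>The bicommutant of a hermitian element replaces the C*-algebra generated by it.\<close>

definition bicommutant :: "'a cstar \<Rightarrow> 'a \<Rightarrow> 'a set" where
  "bicommutant A h = {x \<in> carrier A. \<forall>y\<in>carrier A. y \<otimes>\<^bsub>A\<^esub> h = h \<otimes>\<^bsub>A\<^esub> y \<longrightarrow> x \<otimes>\<^bsub>A\<^esub> y = y \<otimes>\<^bsub>A\<^esub> x}"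

text \<open>Since \<open>h\<close> commutes with itself, every element of the bicommutant commutes
  with \<open>h\<close> and therefore with every other one. Closure under \<open>star\<close> rests
  on \<open>h\<close> being hermitian.\<close>

lemma (in cstar_algebra) bicommutant_subalgebra:
  assumes h: "h \<in> carrier A" "star A h = h"
  shows "cstar_subalgebra A (bicommutant A h)" and "abelian (subalg A (bicommutant A h))"
    and "h \<in> bicommutant A h"
proof -
  let ?B = "bicommutant A h"
  have D: "x \<in> carrier A" "\<And>y. \<lbrakk>y \<in> carrier A; y \<otimes> h = h \<otimes> y\<rbrakk> \<Longrightarrow> x \<otimes> y = y \<otimes> x" if "x \<in> ?B" for x
    using that by (auto simp: bicommutant_def)
  have I: "x \<in> ?B" if "x \<in> carrier A" "\<And>y. \<lbrakk>y \<in> carrier A; y \<otimes> h = h \<otimes> y\<rbrakk> \<Longrightarrow> x \<otimes> y = y \<otimes> x" for x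
    using that by (auto simp: bicommutant_def)
  show hB: "h \<in> ?B"
    using h by (auto intro: I)
  have xh: "x \<otimes> h = h \<otimes> x" if "x \<in> ?B" for x
    using D(2)[OF that h(1)] by simp
  show "abelian (subalg A ?B)"
    using D xh by (auto simp: abelian_def)
  have "norm_closed A ?B"
    unfolding norm_closed_def
  proof (intro allI ballI impI)
    fix X x assume x: "x \<in> carrier A" and X: "(\<forall>n :: nat. X n \<in> ?B) \<and> (\<lambda>n. cnorm A (X n \<ominus> x)) \<longlonglongrightarrow> 0"
    show "x \<in> ?B"
    proof (rule I[OF x])
      fix y assume y: "y \<in> carrier A" "y \<otimes> h = h \<otimes> y"
      have Xc: "X n \<in> carrier A" and Xy: "X n \<otimes> y = y \<otimes> X n" for n
        using D[of "X n"] X y by auto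
      have 0: "(\<lambda>n. cnorm A (X n \<ominus> x) * cnorm A y) \<longlonglongrightarrow> 0"
        using tendsto_mult[OF conjunct2[OF X] tendsto_const[of "cnorm A y"]] by simp
      show "x \<otimes> y = y \<otimes> x"
      proof (rule limit_unique[of "\<lambda>n. X n \<otimes> y"])
        show "(\<lambda>n. cnorm A (X n \<otimes> y \<ominus> x \<otimes> y)) \<longlonglongrightarrow> 0"
        proof (rule tendsto_sandwich[OF always_eventually always_eventually tendsto_const 0])
          show "\<forall>n. cnorm A (X n \<otimes> y \<ominus> x \<otimes> y) \<le> cnorm A (X n \<ominus> x) * cnorm A y"
            using Xc x y cnorm_mult by (simp flip: mult_diff_right)
        qed (use Xc x y in \<open>simp add: cnorm_nonneg\<close>)
        show "(\<lambda>n. cnorm A (X n \<otimes> y \<ominus> y \<otimes> x)) \<longlonglongrightarrow> 0"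
        proof (rule tendsto_sandwich[OF always_eventually always_eventually tendsto_const 0])
          show "\<forall>n. cnorm A (X n \<otimes> y \<ominus> y \<otimes> x) \<le> cnorm A (X n \<ominus> x) * cnorm A y"
            unfolding Xy using Xc x y cnorm_mult[of y "X n \<ominus> x" for n]
            by (simp add: mult.commute[of "cnorm A (X n \<ominus> x)" "cnorm A y" for n] flip: mult_diff_left)
        qed (use Xc x y in \<open>simp add: cnorm_nonneg\<close>)
      qed (use Xc x y in auto)
    qed
  qed
  moreover have "x \<oplus> y \<in> ?B" if xy: "x \<in> ?B" "y \<in> ?B" for x y
    by (rule I) (use D xy in \<open>auto simp: distrib_left distrib_right\<close>)
  moreover have "c \<odot> x \<in> ?B" if xy: "x \<in> ?B" for x c
    by (rule I) (use D xy in \<open>auto simp: smult_mult_left smult_mult_right\<close>)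
  moreover have "x \<otimes> y \<in> ?B" if xy: "x \<in> ?B" "y \<in> ?B" for x y
  proof (rule I)
    fix z assume z: "z \<in> carrier A" "z \<otimes> h = h \<otimes> z"
    have "x \<otimes> y \<otimes> z = x \<otimes> (z \<otimes> y)"
      using D[OF xy(1)] D[OF xy(2)] z by (simp add: mult_assoc)
    also have "\<dots> = z \<otimes> x \<otimes> y"
      using D[OF xy(1)] D(1)[OF xy(2)] z by (simp flip: mult_assoc)
    finally show "x \<otimes> y \<otimes> z = z \<otimes> (x \<otimes> y)"
      using D(1)[OF xy(1)] D(1)[OF xy(2)] z by (simp add: mult_assoc)
  qed (use D xy in auto)
  moreover have "star A x \<in> ?B" if x: "x \<in> ?B" for x
  proof (rule I)
    fix y assume y: "y \<in> carrier A" "y \<otimes> h = h \<otimes> y"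
    have "star A (y \<otimes> h) = star A (h \<otimes> y)"
      using y by simp
    then have "star A y \<otimes> h = h \<otimes> star A y"
      using y(1) h by (simp add: star_mult)
    then have "star A (x \<otimes> star A y) = star A (star A y \<otimes> x)"
      using D(2)[OF x, of "star A y"] y by simp
    then show "star A x \<otimes> y = y \<otimes> star A x"
      using y D(1)[OF x] by (simp add: star_mult star_star)
  qed (use D x in auto)
  moreover have "\<zero> \<in> ?B"
    by (rule I) auto
  ultimately show "cstar_subalgebra A ?B"
    using D(1) by (auto simp: cstar_subalgebra_def linear_subspace_def)
qed

text \<open>Taken relative to a set because for non-unital \<open>B\<close> it is applied to the
  image of \<open>B\<close>, while the envelope is that of the unitization.\<close>

definition rigid :: "'i cstar \<Rightarrow> 'i set \<Rightarrow> bool" where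
  "rigid I R \<longleftrightarrow> (\<forall>\<phi>. cp_map I I \<phi> \<and> unit_preserving I I \<phi> \<and> (\<forall>r\<in>R. \<phi> r = r) \<longrightarrow> (\<forall>x\<in>carrier I. \<phi> x = x))"

text \<open>Conjugation by a unitary that commutes with \<open>R\<close> fixes \<open>R\<close>, so by rigidity the unitary is central.\<close>

lemma (in cstar_algebra) unitary_central:
  assumes e: "is_unit A e" and rigid: "rigid A R" and R: "R \<subseteq> carrier A"
    and u: "u \<in> carrier A" "star A u \<otimes> u = e" "u \<otimes> star A u = e"
    and comm: "\<And>r. r \<in> R \<Longrightarrow> u \<otimes> r = r \<otimes> u"
    and x: "x \<in> carrier A"
  shows "u \<otimes> x = x \<otimes> u"
proof -
  have unit: "e \<in> carrier A" "\<And>x. x \<in> carrier A \<Longrightarrow> e \<otimes> x = x" "\<And>x. x \<in> carrier A \<Longrightarrow> x \<otimes> e = x"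
    using e by (auto simp: is_unit_def)
  define \<phi> where "\<phi> x = u \<otimes> (x \<otimes> star A u)" for x
  have su: "star A u \<in> carrier A"
    using u by simp
  have cancel: "star A u \<otimes> (u \<otimes> y) = y" if "y \<in> carrier A" for y
    using that u su unit by (simp flip: mult_assoc)
  have hom: "star_hom A A \<phi>"
    unfolding star_hom_def linear_map_on_def
    using u su by (auto simp: \<phi>_def distrib_left distrib_right smult_mult_left smult_mult_right star_mult star_star
        mult_assoc cancel)
  have "cp_map A A (\<lambda>x. x)"
    by (simp add: cp_map_on_def linear_map_on_def)
  from cp_map_comp_star_hom[OF cstar_algebra_axioms cstar_algebra_axioms hom this]
  have "cp_map A A \<phi>" .
  moreover have "\<phi> e = e"
    using u su unit by (simp add: \<phi>_def)
  then have "unit_preserving A A \<phi>"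
    unfolding unit_preserving_def using is_unit_unique[OF e] e by metis
  moreover have "\<phi> r = r" if r: "r \<in> R" for r
  proof -
    have rc: "r \<in> carrier A"
      using r R by auto
    have "\<phi> r = (u \<otimes> r) \<otimes> star A u"
      using u su rc by (simp add: \<phi>_def mult_assoc)
    also have "\<dots> = r \<otimes> (u \<otimes> star A u)"
      unfolding comm[OF r] using u su rc by (simp add: mult_assoc)
    finally show ?thesis
      using u rc unit by simp
  qed
  ultimately have "\<phi> x = x"
    using rigid x unfolding rigid_def by blast
  then have "x \<otimes> u = (u \<otimes> (x \<otimes> star A u)) \<otimes> u"
    by (simp add: \<phi>_def)
  also have "\<dots> = u \<otimes> x"
    using u su unit x by (simp add: mult_assoc)
  finally show ?thesis ..
qed

text \<open>Scaled to norm at most 1, \<open>h\<close> becomes the real part of the unitary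
  \<open>h' + \<i> sqrt (1 - h'^2)\<close>, which lies in the bicommutant of \<open>h\<close> and so
  commutes with whatever \<open>h\<close> commutes with. The unitary is central by
  \<open>unitary_central\<close>, and so is its real part.\<close>

lemma (in cstar_algebra) hermitian_central:
  assumes e: "is_unit A e" and rigid: "rigid A R" and R: "R \<subseteq> carrier A"
    and h: "h \<in> carrier A" "star A h = h" and comm: "\<And>r. r \<in> R \<Longrightarrow> h \<otimes> r = r \<otimes> h"
    and x: "x \<in> carrier A"
  shows "h \<otimes> x = x \<otimes> h"
proof -
  let ?B = "bicommutant A h"
  interpret B: comm_cstar "subalg A ?B"
    using cstar_algebra_subalg(1)[OF bicommutant_subalgebra(1)[OF h]] bicommutant_subalgebra(2)[OF h]
    by (simp add: comm_cstar_def comm_cstar_axioms_def)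
  have Bc: "y \<in> carrier A" if "y \<in> ?B" for y
    using that by (simp add: bicommutant_def)
  have ec: "e \<in> carrier A" "\<And>x. x \<in> carrier A \<Longrightarrow> e \<otimes> x = x" "\<And>x. x \<in> carrier A \<Longrightarrow> x \<otimes> e = x"
    using e by (auto simp: is_unit_def)
  have eB: "e \<in> ?B"
    using ec by (auto simp: bicommutant_def)
  have uB: "is_unit (subalg A ?B) e"
    using eB ec Bc by (simp add: is_unit_def)
  define k where "k = complex_of_real (1 / (cnorm A h + 1))"
  have hn: "0 \<le> cnorm A h"
    using h by (simp add: cnorm_nonneg)
  define h' where "h' = k \<odot> h"
  have h'B: "h' \<in> ?B"
    using B.smult_closed[of h k] bicommutant_subalgebra(3)[OF h] by (simp add: h'_def)
  have h'c: "h' \<in> carrier A" "star A h' = h'"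
    using h by (auto simp: h'_def star_smult k_def)
  have h'n: "cnorm A h' \<le> 1"
  proof -
    have "cmod k = 1 / (cnorm A h + 1)"
      unfolding k_def norm_of_real using hn by simp
    then have "cnorm A h' = cnorm A h / (cnorm A h + 1)"
      using h by (simp add: h'_def cnorm_smult)
    then show ?thesis
      using hn by (simp add: divide_le_eq)
  qed
  \<comment> \<open>Subtracting 1 gives \<open>f 0 = 0\<close>, as the calculus requires;
    \<open>s\<close> adds the unit back. The maximum takes effect outside \<open>[-1, 1]\<close>,
    where \<open>h'\<close> has no values.\<close>
  define f where "f t = sqrt (max 0 (1 - t\<^sup>2)) - 1" for t
  have f: "continuous_on UNIV f" "f 0 = 0"
    unfolding f_def by (auto intro!: continuous_intros)
  obtain c where c: "c \<in> carrier (subalg A ?B)" "star (subalg A ?B) c = c"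
    "\<And>\<xi>. \<xi> \<in> chars (subalg A ?B) \<Longrightarrow> \<xi> c = complex_of_real (f (Re (\<xi> h')))"
    by (rule B.functional_calculus[OF _ _ f, of h']) (use h'B h'c in auto)
  define s where "s = e \<oplus> c"
  have sB: "s \<in> ?B" "star A s = s"
    using B.a_closed[of e c] eB c Bc[of c] ec star_unit[OF e] by (auto simp: s_def star_add)
  have sc: "s \<in> carrier A"
    using sB Bc by blast
  define u where "u = h' \<oplus> \<i> \<odot> s"
  have u: "u \<in> carrier A" "star A u = h' \<oplus> (- \<i>) \<odot> s"
    using sc sB h'c by (auto simp: u_def star_add star_smult)
  have uB': "u \<in> ?B"
    using B.a_closed[of h' "\<i> \<odot> s"] B.smult_closed[of s "\<i>"] sB h'B by (simp add: u_def)
  have suB: "star A u \<in> ?B"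
    using B.star_closed[of u] uB' by simp
  have "star A u \<otimes> u = e"
  proof (rule B.chars_eqI)
    show "star A u \<otimes> u \<in> carrier (subalg A ?B)"
      using B.mult_closed[of "star A u" u] uB' suB by simp
    fix \<xi> assume \<xi>: "\<xi> \<in> chars (subalg A ?B)"
    have \<xi>_simps: "\<xi> (x \<oplus> y) = \<xi> x + \<xi> y" "\<xi> (x \<otimes> y) = \<xi> x * \<xi> y" "\<xi> (star A x) = cnj (\<xi> x)" "\<xi> (b \<odot> x) = b * \<xi> x"
      if "x \<in> ?B" "y \<in> ?B" for x y b
      using chars_simps(1,2)[OF \<xi>, of x y] chars_simps(3)[OF \<xi>, of x] chars_simps(4)[OF \<xi>, of x b] that by simp_all
    define t where "t = Re (\<xi> h')"
    have \<xi>h: "\<xi> h' = complex_of_real t"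
      using chars_herm_of_real[OF \<xi>, of h'] h'B h'c by (simp add: t_def)
    have t: "\<bar>t\<bar> \<le> 1"
      using B.chars_cnorm_le[OF \<xi>, of h'] h'B h'n \<xi>h by simp
    have isB: "\<i> \<odot> s \<in> ?B"
      using B.smult_closed[of s "\<i>"] sB by simp
    have \<xi>u: "\<xi> (star A u \<otimes> u) = cnj (\<xi> h' + \<i> * \<xi> s) * (\<xi> h' + \<i> * \<xi> s)"
      using \<xi>_simps(2)[OF suB uB'] \<xi>_simps(3)[OF uB' uB'] \<xi>_simps(1)[OF h'B isB] \<xi>_simps(4)[OF sB(1) sB(1)]
      by (simp add: u_def)
    show "\<xi> (star A u \<otimes> u) = \<xi> e"
    proof (cases "\<xi> e = 0")
      case True
      have "\<xi> y = 0" if "y \<in> ?B" for y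
        using \<xi>_simps(2)[OF eB that] True ec(2)[OF Bc[OF that]] by simp
      then show ?thesis
        using \<xi>u h'B sB True by simp
    next
      case False
      then have "\<xi> e = 1"
        using unit_at_char[OF uB \<xi>] by simp
      moreover have "\<xi> s = \<xi> e + \<xi> c"
        using \<xi>_simps(1)[OF eB, of c] c(1) by (simp add: s_def)
      ultimately have \<xi>s: "\<xi> s = complex_of_real (sqrt (max 0 (1 - t\<^sup>2)))"
        using c(3)[OF \<xi>] by (simp add: f_def t_def)
      have t2: "t\<^sup>2 \<le> 1"
        using t by (simp add: abs_square_le_1)
      then have "t * t + sqrt (max 0 (1 - t\<^sup>2)) * sqrt (max 0 (1 - t\<^sup>2)) = 1"
        by (simp add: power2_eq_square)
      then show ?thesis
        unfolding \<xi>u \<xi>h \<xi>s \<open>\<xi> e = 1\<close> by (simp add: complex_eq_iff algebra_simps)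
    qed
  qed (use eB in simp)
  then have uu: "star A u \<otimes> u = e" .
  have uu': "u \<otimes> star A u = e"
    using uu B.mult_comm[of u "star A u"] uB' suB by simp
  have u_comm: "u \<otimes> y = y \<otimes> u" if y: "y \<in> carrier A" for y
  proof (rule unitary_central[OF e rigid R u(1) uu uu' _ y])
    fix r assume r: "r \<in> R"
    then show "u \<otimes> r = r \<otimes> u"
      using uB' comm[OF r] R by (auto simp: bicommutant_def)
  qed
  have su_comm: "star A u \<otimes> x = x \<otimes> star A u"
  proof -
    have "star A (u \<otimes> star A x) = star A (star A x \<otimes> u)"
      using u_comm[of "star A x"] x by simp
    then show ?thesis
      using u(1) x by (simp add: star_mult star_star)
  qed
  have "u \<oplus> star A u = (1 \<odot> h' \<oplus> 1 \<odot> h') \<oplus> (\<i> \<odot> s \<oplus> (- \<i>) \<odot> s)"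
    unfolding u(2) unfolding u_def using h'c sc by (simp add: a_ac smult_one)
  also have "\<dots> = 2 \<odot> h'"
    using h'c sc by (simp flip: smult_add_left)
  finally have sum: "u \<oplus> star A u = 2 \<odot> h'" .
  have "(u \<oplus> star A u) \<otimes> x = u \<otimes> x \<oplus> star A u \<otimes> x"
    by (rule distrib_right[OF u(1) star_closed[OF u(1)] x])
  also have "\<dots> = x \<otimes> u \<oplus> x \<otimes> star A u"
    unfolding u_comm[OF x] su_comm ..
  also have "\<dots> = x \<otimes> (u \<oplus> star A u)"
    by (rule distrib_left[OF x u(1) star_closed[OF u(1)], symmetric])
  finally have "(2 \<odot> h') \<otimes> x = x \<otimes> (2 \<odot> h')"
    unfolding sum .
  then have "(2 * k) \<odot> (h \<otimes> x) = (2 * k) \<odot> (x \<otimes> h)"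
    using h x by (simp add: h'_def smult_mult_left smult_mult_right smult_smult)
  then have "(1 / (2 * k)) \<odot> ((2 * k) \<odot> (h \<otimes> x)) = (1 / (2 * k)) \<odot> ((2 * k) \<odot> (x \<otimes> h))"
    by simp
  moreover have "k \<noteq> 0"
    using hn unfolding k_def of_real_eq_0_iff by simp
  ultimately show ?thesis
    using h x by (simp add: smult_one flip: smult_smult)
qed

text \<open>Two rounds of \<open>hermitian_central\<close>. The real and imaginary parts of an
  element of \<open>R\<close> commute with \<open>R\<close>, so they are central, and
  \<open>R\<close> is central. Now every hermitian element commutes with \<open>R\<close>, hence is
  central too.\<close>

lemma (in cstar_algebra) abelian_of_rigid:
  assumes e: "is_unit A e" and rigid: "rigid A R" and R: "R \<subseteq> carrier A"
    and R_closed: "\<And>x y. \<lbrakk>x \<in> R; y \<in> R\<rbrakk> \<Longrightarrow> x \<oplus> y \<in> R" "\<And>c x. x \<in> R \<Longrightarrow> c \<odot> x \<in> R" "\<And>x. x \<in> R \<Longrightarrow> star A x \<in> R"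
    and R_comm: "\<And>x y. \<lbrakk>x \<in> R; y \<in> R\<rbrakk> \<Longrightarrow> x \<otimes> y = y \<otimes> x"
  shows "abelian A"
proof -
  define re where "re x = x \<oplus> star A x" for x
  define im where "im x = \<i> \<odot> x \<oplus> (- \<i>) \<odot> star A x" for x
  have herm: "re x \<in> carrier A" "star A (re x) = re x" "im x \<in> carrier A" "star A (im x) = im x"
    if "x \<in> carrier A" for x
    using that by (auto simp: re_def im_def star_add star_star star_smult a_comm)
  have split: "2 \<odot> x = re x \<oplus> (- \<i>) \<odot> im x" if "x \<in> carrier A" for x
  proof -
    have "re x \<oplus> (- \<i>) \<odot> im x = (1 \<odot> x \<oplus> 1 \<odot> x) \<oplus> (1 \<odot> star A x \<oplus> (- 1) \<odot> star A x)"
      using that by (simp add: re_def im_def smult_add_right smult_one a_ac flip: smult_smult)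
    also have "\<dots> = 2 \<odot> x"
      using that by (simp flip: smult_add_left)
    finally show ?thesis ..
  qed
  have central: "x \<otimes> y = y \<otimes> x" if x: "x \<in> carrier A" and y: "y \<in> carrier A"
    and re: "re x \<otimes> y = y \<otimes> re x" and im: "im x \<otimes> y = y \<otimes> im x" for x y
  proof -
    have "2 \<odot> x \<otimes> y = y \<otimes> (2 \<odot> x)"
      unfolding split[OF x] using herm[OF x] y re im
      by (simp add: distrib_left distrib_right smult_mult_left smult_mult_right)
    then have "(1/2) \<odot> (2 \<odot> (x \<otimes> y)) = (1/2) \<odot> (2 \<odot> (y \<otimes> x))"
      using x y by (simp add: smult_mult_left smult_mult_right)
    then show ?thesis
      using x y by (simp add: smult_one flip: smult_smult)
  qed
  have R_central: "r \<otimes> y = y \<otimes> r" if r: "r \<in> R" and y: "y \<in> carrier A" for r y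
  proof (rule central)
    have rc: "r \<in> carrier A" and "re r \<in> R" "im r \<in> R"
      using r R R_closed by (auto simp: re_def im_def)
    then show "re r \<otimes> y = y \<otimes> re r" "im r \<otimes> y = y \<otimes> im r"
      using hermitian_central[OF e rigid R herm(1,2)[OF rc] _ y] hermitian_central[OF e rigid R herm(3,4)[OF rc] _ y] R_comm
      by blast+
  qed (use r y R in auto)
  have "x \<otimes> y = y \<otimes> x" if x: "x \<in> carrier A" and y: "y \<in> carrier A" for x y
  proof (rule central[OF x y])
    show "re x \<otimes> y = y \<otimes> re x" "im x \<otimes> y = y \<otimes> im x"
      using hermitian_central[OF e rigid R herm(1,2)[OF x] _ y] hermitian_central[OF e rigid R herm(3,4)[OF x] _ y]
        R_central herm[OF x] by metis+
  qed
  then show ?thesis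
    by (simp add: abelian_def)
qed

text \<open>The type \<open>'x\<close> indexes the families of characters to which injectivity will be applied.\<close>

definition rigid_envelope :: "'x itself \<Rightarrow> 'b cstar \<Rightarrow> 'i cstar \<Rightarrow> ('b \<Rightarrow> 'i) \<Rightarrow> bool" where
  "rigid_envelope X B I \<iota> \<longleftrightarrow> injective_cstar TYPE('x \<Rightarrow> 'x \<Rightarrow> complex) I \<and> comm_cstar I \<and>
     star_hom B I \<iota> \<and> inj_on \<iota> (carrier B) \<and> unit_preserving B I \<iota> \<and> rigid I (\<iota> ` carrier B)"

text \<open>Commutativity of \<open>I\<close> is the point: the image of \<open>D\<close> is a
  commutative subspace closed under \<open>star\<close>, and \<open>I\<close> is rigid over
  it.\<close>

lemma rigid_envelope_unital:
  fixes D :: "'d cstar" and I :: "'i cstar"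
  assumes env: "injective_envelope_unital D I \<kappa>" and D: "abelian D"
  shows "rigid_envelope TYPE('d + 'i) D I \<kappa>"
proof -
  have inj: "injective_cstar TYPE('d + 'i \<Rightarrow> 'd + 'i \<Rightarrow> complex) I"
    and mono: "star_monomorphism D I \<kappa>" and up: "unit_preserving D I \<kappa>" and rigid: "rigid I (\<kappa> ` carrier D)"
    and cD: "cstar_algebra D"
    using env by (auto simp: injective_envelope_unital_def rigid_def)
  interpret I: cstar_algebra I
    using inj by (simp add: injective_cstar_def)
  interpret D: cstar_algebra D
    by (rule cD)
  obtain e where e: "is_unit I e"
    using inj by (auto simp: injective_cstar_def unital_def)
  have hom: "star_hom D I \<kappa>" and "inj_on \<kappa> (carrier D)"
    using mono by (auto simp: star_monomorphism_def star_hom_def)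
  have lin: "linear_map_on D (carrier D) I \<kappa>"
    and mult: "\<And>x y. \<lbrakk>x \<in> carrier D; y \<in> carrier D\<rbrakk> \<Longrightarrow> \<kappa> x \<otimes>\<^bsub>I\<^esub> \<kappa> y = \<kappa> (x \<otimes>\<^bsub>D\<^esub> y)"
    and star: "\<And>x. x \<in> carrier D \<Longrightarrow> star I (\<kappa> x) = \<kappa> (star D x)"
    using hom by (auto simp: star_hom_def)
  have "abelian I"
  proof (rule I.abelian_of_rigid[OF e rigid])
    show "\<kappa> ` carrier D \<subseteq> carrier I"
      using linear_map_onD(1)[OF lin] by auto
    fix x assume "x \<in> \<kappa> ` carrier D"
    then obtain a where a: "a \<in> carrier D" "x = \<kappa> a"
      by auto
    show "c \<odot>\<^bsub>I\<^esub> x \<in> \<kappa> ` carrier D" for c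
      using a linear_map_onD(3)[OF lin, of a c] D.smult_closed by (metis imageI)
    show "star I x \<in> \<kappa> ` carrier D"
      using a star by auto
    fix y assume "y \<in> \<kappa> ` carrier D"
    then obtain b where b: "b \<in> carrier D" "y = \<kappa> b"
      by auto
    show "x \<oplus>\<^bsub>I\<^esub> y \<in> \<kappa> ` carrier D"
      using a b linear_map_onD(2)[OF lin, of a b] D.a_closed by (metis imageI)
    show "x \<otimes>\<^bsub>I\<^esub> y = y \<otimes>\<^bsub>I\<^esub> x"
      using a b mult D by (simp add: abelian_def)
  qed
  then have "comm_cstar I"
    using I.cstar_algebra_axioms by (simp add: comm_cstar_def comm_cstar_axioms_def)
  with inj hom \<open>inj_on \<kappa> (carrier D)\<close> up rigid show ?thesis
    by (simp add: rigid_envelope_def)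
qed

section \<open>Envelopes of non-unital algebras\<close>

lemma unitization_simps:
  "carrier (unitization B) = carrier B \<times> UNIV"
  "(a, z) \<otimes>\<^bsub>unitization B\<^esub> (b, w) = (a \<otimes>\<^bsub>B\<^esub> b \<oplus>\<^bsub>B\<^esub> z \<odot>\<^bsub>B\<^esub> b \<oplus>\<^bsub>B\<^esub> w \<odot>\<^bsub>B\<^esub> a, z * w)"
  "(a, z) \<oplus>\<^bsub>unitization B\<^esub> (b, w) = (a \<oplus>\<^bsub>B\<^esub> b, z + w)"
  "c \<odot>\<^bsub>unitization B\<^esub> (a, z) = (c \<odot>\<^bsub>B\<^esub> a, c * z)"
  "star (unitization B) (a, z) = (star B a, cnj z)"
  by (simp_all add: unitization_def)

lemma (in cstar_algebra) unit_unitization: "is_unit (unitization A) (\<zero>, 1)"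
  by (auto simp: is_unit_def unitization_simps smult_one)

lemma (in comm_cstar) abelian_unitization: "abelian (unitization A)"
  by (auto simp: abelian_def unitization_simps mult_comm a_ac)

text \<open>For non-unital \<open>B\<close> the envelope is that of the unitization. A
  unit-preserving completely positive map that fixes the image of \<open>B\<close> also fixes
  \<open>\<kappa> (b, z) = \<iota> b + z e\<close>, so rigidity over the unitization gives rigidity
  over \<open>B\<close>. The alternatives differ only in the index type, which reflects the algebra
  whose envelope was taken.\<close>

lemma rigid_envelope_cases:
  fixes B :: "'b cstar" and I :: "'i cstar"
  assumes env: "injective_envelope B I \<iota>" and B: "comm_cstar B"
  shows "rigid_envelope TYPE('b + 'i) B I \<iota> \<or> rigid_envelope TYPE('b \<times> complex + 'i) B I \<iota>"
proof (cases "unital B")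
  case True
  then show ?thesis
    using env rigid_envelope_unital B
    by (auto simp: injective_envelope_def comm_cstar_def comm_cstar_axioms_def)
next
  case False
  interpret B: comm_cstar B
    by fact
  obtain \<kappa> where \<kappa>: "injective_envelope_unital (unitization B) I \<kappa>" and \<iota>: "\<And>b. b \<in> carrier B \<Longrightarrow> \<iota> b = \<kappa> (b, 0)"
    using env False by (auto simp: injective_envelope_def)
  have r: "rigid_envelope TYPE('b \<times> complex + 'i) (unitization B) I \<kappa>"
    by (rule rigid_envelope_unital[OF \<kappa> B.abelian_unitization])
  then have inj: "injective_cstar TYPE('b \<times> complex + 'i \<Rightarrow> 'b \<times> complex + 'i \<Rightarrow> complex) I" and cI: "comm_cstar I"
    and hom: "star_hom (unitization B) I \<kappa>" and injon: "inj_on \<kappa> (carrier (unitization B))"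
    and up: "unit_preserving (unitization B) I \<kappa>" and rigid: "rigid I (\<kappa> ` carrier (unitization B))"
    by (auto simp: rigid_envelope_def)
  have lin: "linear_map_on (unitization B) (carrier (unitization B)) I \<kappa>"
    using hom by (simp add: star_hom_def)
  have e: "is_unit I (\<kappa> (\<zero>\<^bsub>B\<^esub>, 1))"
    using up B.unit_unitization by (simp add: unit_preserving_def)
  have c0: "(b, 0) \<in> carrier (unitization B)" if "b \<in> carrier B" for b
    using that by (simp add: unitization_simps)
  have "star_hom B I \<iota>"
    unfolding star_hom_def linear_map_on_def
  proof (intro conjI ballI allI funcsetI)
    fix x y assume x: "x \<in> carrier B" and y: "y \<in> carrier B"
    show "\<iota> x \<in> carrier I"
      using linear_map_onD(1)[OF lin c0[OF x]] by (simp add: \<iota>[OF x])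
    show "\<iota> (x \<oplus>\<^bsub>B\<^esub> y) = \<iota> x \<oplus>\<^bsub>I\<^esub> \<iota> y"
      using linear_map_onD(2)[OF lin c0[OF x] c0[OF y]] x y by (simp add: \<iota> unitization_simps)
    show "\<iota> (c \<odot>\<^bsub>B\<^esub> x) = c \<odot>\<^bsub>I\<^esub> \<iota> x" for c
      using linear_map_onD(3)[OF lin c0[OF x], of c] x by (simp add: \<iota> unitization_simps)
    have "\<kappa> ((x, 0) \<otimes>\<^bsub>unitization B\<^esub> (y, 0)) = \<kappa> (x, 0) \<otimes>\<^bsub>I\<^esub> \<kappa> (y, 0)"
      using hom c0[OF x] c0[OF y] unfolding star_hom_def by blast
    then show "\<iota> (x \<otimes>\<^bsub>B\<^esub> y) = \<iota> x \<otimes>\<^bsub>I\<^esub> \<iota> y"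
      using x y by (simp add: \<iota> unitization_simps)
    have "\<kappa> (star (unitization B) (x, 0)) = star I (\<kappa> (x, 0))"
      using hom c0[OF x] unfolding star_hom_def by blast
    then show "\<iota> (star B x) = star I (\<iota> x)"
      using x by (simp add: \<iota> unitization_simps)
  qed
  moreover have "inj_on \<iota> (carrier B)"
  proof (rule inj_onI)
    fix x y assume xy: "x \<in> carrier B" "y \<in> carrier B" "\<iota> x = \<iota> y"
    then have "(x, 0 :: complex) = (y, 0)"
      by (intro inj_onD[OF injon _ c0 c0]) (simp_all add: \<iota>)
    then show "x = y"
      by simp
  qed
  \<comment> \<open>Vacuous, as \<open>B\<close> has no unit.\<close>
  moreover have "unit_preserving B I \<iota>"
    using False by (auto simp: unit_preserving_def unital_def)
  moreover have "rigid I (\<iota> ` carrier B)"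
    unfolding rigid_def
  proof (intro allI impI)
    fix \<phi> assume \<phi>: "cp_map I I \<phi> \<and> unit_preserving I I \<phi> \<and> (\<forall>r\<in>\<iota> ` carrier B. \<phi> r = r)"
    have lin\<phi>: "linear_map_on I (carrier I) I \<phi>"
      using \<phi> by (simp add: cp_map_on_def)
    have \<phi>e: "\<phi> (\<kappa> (\<zero>\<^bsub>B\<^esub>, 1)) = \<kappa> (\<zero>\<^bsub>B\<^esub>, 1)"
    proof (rule is_unit_unique[OF _ e])
      show "is_unit I (\<phi> (\<kappa> (\<zero>\<^bsub>B\<^esub>, 1)))"
        using \<phi> e unfolding unit_preserving_def by metis
    qed
    have "\<phi> (\<kappa> (b, z)) = \<kappa> (b, z)" if b: "b \<in> carrier B" for b z
    proof -
      have u: "(\<zero>\<^bsub>B\<^esub>, 1) \<in> carrier (unitization B)"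
        by (simp add: unitization_simps)
      note uz = cstar_algebra.smult_closed
      have zu: "z \<odot>\<^bsub>unitization B\<^esub> (\<zero>\<^bsub>B\<^esub>, 1) \<in> carrier (unitization B)"
        by (simp add: unitization_simps)
      have "\<kappa> (b, z) = \<kappa> ((b, 0) \<oplus>\<^bsub>unitization B\<^esub> z \<odot>\<^bsub>unitization B\<^esub> (\<zero>\<^bsub>B\<^esub>, 1))"
        using b by (simp add: unitization_simps)
      also have "\<dots> = \<iota> b \<oplus>\<^bsub>I\<^esub> z \<odot>\<^bsub>I\<^esub> \<kappa> (\<zero>\<^bsub>B\<^esub>, 1)"
        unfolding linear_map_onD(2)[OF lin c0[OF b] zu] linear_map_onD(3)[OF lin u] \<iota>[OF b] ..
      finally have eq: "\<kappa> (b, z) = \<iota> b \<oplus>\<^bsub>I\<^esub> z \<odot>\<^bsub>I\<^esub> \<kappa> (\<zero>\<^bsub>B\<^esub>, 1)" .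
      have ib: "\<iota> b \<in> carrier I" and ke: "\<kappa> (\<zero>\<^bsub>B\<^esub>, 1) \<in> carrier I"
        using linear_map_onD(1)[OF lin c0[OF b]] linear_map_onD(1)[OF lin u] by (simp_all add: \<iota>[OF b])
      have zke: "z \<odot>\<^bsub>I\<^esub> \<kappa> (\<zero>\<^bsub>B\<^esub>, 1) \<in> carrier I"
        using ke cI by (simp add: comm_cstar_def cstar_algebra.smult_closed)
      have "\<phi> (\<iota> b) = \<iota> b"
        using \<phi> b by blast
      then show ?thesis
        unfolding eq linear_map_onD(2)[OF lin\<phi> ib zke] linear_map_onD(3)[OF lin\<phi> ke] \<phi>e by simp
    qed
    then have "\<forall>r\<in>\<kappa> ` carrier (unitization B). \<phi> r = r"
      by (auto simp: unitization_simps)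
    then show "\<forall>x\<in>carrier I. \<phi> x = x"
      using rigid \<phi> unfolding rigid_def by blast
  qed
  ultimately show ?thesis
    using inj cI by (simp add: rigid_envelope_def)
qed

section \<open>Pseudo-expectations of abelian inclusions\<close>

text \<open>Mentions neither an envelope nor an index type, so it can be passed between inclusions
  whose envelopes live in different types.\<close>

definition essential :: "'a cstar \<Rightarrow> 'a set \<Rightarrow> bool" where
  "essential A B \<longleftrightarrow> (\<forall>K. closed_ideal A K \<and> K \<inter> B \<subseteq> {\<zero>\<^bsub>A\<^esub>} \<longrightarrow> K \<subseteq> {\<zero>\<^bsub>A\<^esub>})"

lemma zero_char: "(\<lambda>_. 0) \<in> chars A"
  unfolding chars_def by (simp del: chars_simps)

text \<open>The parameter \<open>X\<close> records the index type for which injectivity of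
  \<open>I\<close> is available.\<close>

locale abelian_inclusion = comm_cstar A for A :: "'a cstar" (structure) +
  fixes B :: "'a set" and I :: "'i cstar" and \<iota> :: "'a \<Rightarrow> 'i" and X :: "'x itself" and e :: 'i
  assumes inclusion: "cstar_inclusion A B" and envelope: "rigid_envelope X (subalg A B) I \<iota>"
    and unit: "is_unit I e"
begin

sublocale I: comm_cstar I
  using envelope by (simp add: rigid_envelope_def)

lemma injective: "injective_cstar TYPE('x \<Rightarrow> 'x \<Rightarrow> complex) I"
  using envelope by (simp add: rigid_envelope_def)

lemma subalgebra: "cstar_subalgebra A B"
  using inclusion by (simp add: cstar_inclusion_def)

lemma comm_cstar_B: "comm_cstar (subalg A B)"
  by (rule comm_cstar_subalg[OF subalgebra])

lemma B_subset: "B \<subseteq> carrier A"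
  using subalgebra by (simp add: cstar_subalgebra_def linear_subspace_def)

lemma B_carrier: "b \<in> B \<Longrightarrow> b \<in> carrier A"
  using B_subset by auto

lemma B_closed:
  shows "b \<in> B \<Longrightarrow> c \<odot> b \<in> B" and "\<lbrakk>b \<in> B; b' \<in> B\<rbrakk> \<Longrightarrow> b \<oplus> b' \<in> B"
    and "\<lbrakk>b \<in> B; b' \<in> B\<rbrakk> \<Longrightarrow> b \<otimes> b' \<in> B" and "b \<in> B \<Longrightarrow> star A b \<in> B" and "\<lbrakk>b \<in> B; b' \<in> B\<rbrakk> \<Longrightarrow> b \<ominus> b' \<in> B"
  using subalgebra B_carrier by (auto simp: cstar_subalgebra_def linear_subspace_def minus_eq_smult)

lemma \<iota>_linear: "linear_map_on (subalg A B) B I \<iota>"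
  using envelope by (simp add: rigid_envelope_def star_hom_def)

lemma \<iota>_closed [simp]: "b \<in> B \<Longrightarrow> \<iota> b \<in> carrier I"
  using linear_map_onD(1)[OF \<iota>_linear] .

lemma \<iota>_mult: "\<lbrakk>b \<in> B; b' \<in> B\<rbrakk> \<Longrightarrow> \<iota> (b \<otimes> b') = \<iota> b \<otimes>\<^bsub>I\<^esub> \<iota> b'"
  and \<iota>_star: "b \<in> B \<Longrightarrow> \<iota> (star A b) = star I (\<iota> b)"
  and \<iota>_add: "\<lbrakk>b \<in> B; b' \<in> B\<rbrakk> \<Longrightarrow> \<iota> (b \<oplus> b') = \<iota> b \<oplus>\<^bsub>I\<^esub> \<iota> b'"
  and \<iota>_smult: "b \<in> B \<Longrightarrow> \<iota> (c \<odot> b) = c \<odot>\<^bsub>I\<^esub> \<iota> b"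
  using envelope by (simp_all add: rigid_envelope_def star_hom_def linear_map_on_def)

lemma \<iota>_char:
  assumes "\<xi> \<in> chars I"
  shows "(\<lambda>b. \<xi> (\<iota> b)) \<in> chars (subalg A B)"
  unfolding chars_def
  by (simp add: \<iota>_mult \<iota>_star \<iota>_add \<iota>_smult chars_simps[OF assms] del: chars_simps)

lemma \<iota>_zero: "\<lbrakk>b \<in> B; \<iota> b = \<zero>\<^bsub>I\<^esub>\<rbrakk> \<Longrightarrow> b = \<zero>"
proof -
  assume b: "b \<in> B" "\<iota> b = \<zero>\<^bsub>I\<^esub>"
  have z: "\<zero> \<in> B"
    using subalgebra by (simp add: cstar_subalgebra_def linear_subspace_def)
  have "\<iota> \<zero> = \<zero>\<^bsub>I\<^esub>"
  proof (rule I.chars_eqI)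
    fix \<xi> assume \<xi>: "\<xi> \<in> chars I"
    have "\<xi> (\<iota> (0 \<odot> \<zero>)) = 0"
      using chars_simps(4)[OF \<iota>_char[OF \<xi>], of \<zero> 0] z by simp
    then show "\<xi> (\<iota> \<zero>) = \<xi> \<zero>\<^bsub>I\<^esub>"
      using \<xi> by (simp add: smult_zero_left)
  qed (use z in auto)
  then show "b = \<zero>"
    using b z inj_onD[of \<iota> B b \<zero>] envelope by (simp add: rigid_envelope_def)
qed

lemma unit_carrier [simp]: "e \<in> carrier I"
  using unit by (simp add: is_unit_def)

text \<open>A character of \<open>I\<close> takes the value 0 or 1 at \<open>e\<close>; the value 0
  belongs to the zero functional, which later case distinctions split off.\<close>

lemma char_unit_zero: "\<lbrakk>\<xi> \<in> chars I; \<xi> e = 0; x \<in> carrier I\<rbrakk> \<Longrightarrow> \<xi> x = 0"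
  using chars_simps(2)[of \<xi> I e x] unit by (simp add: is_unit_def del: chars_simps)

lemma approximate_unit:
  assumes y: "y \<in> carrier A" and r: "0 < r"
  obtains v where "v \<in> B" "cnorm A (y \<otimes> v \<ominus> y) < r"
proof -
  obtain F where F: "F \<noteq> bot" "\<forall>\<^sub>F v in F. v \<in> B \<and> cnorm A v \<le> 1 \<and> (\<exists>y\<in>carrier A. v = star A y \<otimes> y)"
    and lim: "((\<lambda>v. cnorm A (y \<otimes> v \<ominus> y)) \<longlongrightarrow> 0) F"
    using inclusion y unfolding cstar_inclusion_def has_approximate_unit_in_def by blast
  have "\<forall>\<^sub>F v in F. cnorm A (y \<otimes> v \<ominus> y) < r"
    using order_tendstoD(2)[OF lim r] .
  with F(2) have "\<forall>\<^sub>F v in F. v \<in> B \<and> cnorm A (y \<otimes> v \<ominus> y) < r"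
    by eventually_elim auto
  from eventually_happens'[OF F(1) this] that show ?thesis
    by blast
qed

text \<open>For every nonzero element of \<open>B\<close> the family contains a character of
  \<open>A\<close> that vanishes on \<open>K\<close> but not at that element;
  \<open>K \<inter> B = 0\<close> provides it, and the surjection \<open>g\<close> its index. The
  family detects the order of \<open>B\<close>, so \<open>\<iota>\<close> extends, and the extension
  vanishes on \<open>K\<close> because every member of the family does.\<close>

lemma pseudo_expectation_vanishing:
  fixes g :: "'x \<Rightarrow> 'a"
  assumes g: "surj g" and K: "closed_ideal A K" "K \<inter> B \<subseteq> {\<zero>}"
  obtains \<Phi> where "pseudo_expectation A B I \<iota> \<Phi>" "\<And>k. k \<in> K \<Longrightarrow> \<Phi> k = \<zero>\<^bsub>I\<^esub>"
proof -
  interpret K: comm_cstar_ideal A K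
    by standard (rule K(1))
  interpret B: comm_cstar "subalg A B"
    by (rule comm_cstar_B)
  have "\<exists>\<eta>. \<eta> \<in> chars A \<and> (\<forall>x\<in>K. \<eta> x = 0) \<and> (if g p \<in> B \<and> g p \<noteq> \<zero> then \<eta> (g p) \<noteq> 0 else \<eta> = (\<lambda>_. 0))" for p
  proof (cases "g p \<in> B \<and> g p \<noteq> \<zero>")
    case True
    then have "g p \<in> carrier A" "g p \<notin> K"
      using K(2) B_carrier by auto
    from K.character_separating_from_ideal[OF this] obtain \<eta>
      where "\<eta> \<in> chars A" "\<eta> (g p) \<noteq> 0" "\<And>x. x \<in> K \<Longrightarrow> \<eta> x = 0" by blast
    with True show ?thesis
      by auto
  next
    case False
    then show ?thesis
      using zero_char by auto
  qed
  then obtain \<eta> where \<eta>: "\<And>p. \<eta> p \<in> chars A" "\<And>p x. x \<in> K \<Longrightarrow> \<eta> p x = 0"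
    and \<eta>1: "\<And>p. g p \<in> B \<Longrightarrow> g p \<noteq> \<zero> \<Longrightarrow> \<eta> p (g p) \<noteq> 0" and \<eta>0: "\<And>p. g p = \<zero> \<Longrightarrow> \<eta> p = (\<lambda>_. 0)"
    by metis
  have lin: "linear_map_on A B I \<iota>"
    using \<iota>_linear by (simp add: linear_map_on_def)
  have pos: "Im (\<xi> (\<iota> t)) = 0 \<and> 0 \<le> Re (\<xi> (\<iota> t)) + z * Re (\<xi> e)"
    if t: "t \<in> B" "star A t = t" and p: "\<And>p. 0 \<le> Re (\<eta> p t) + z" and \<xi>: "\<xi> \<in> chars I" for t z \<xi>
  proof
    note \<zeta> = \<iota>_char[OF \<xi>]
    have tB: "t \<in> carrier (subalg A B)" "star (subalg A B) t = t"
      using t by auto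
    show "Im (\<xi> (\<iota> t)) = 0"
      using chars_herm_of_real[OF \<zeta> tB] by (metis Im_complex_of_real)
    \<comment> \<open>The family contains the zero functional, at the index of 0. It forces
      \<open>z\<close> to be nonnegative, which \<open>f\<close> below needs in order to vanish at
      0.\<close>
    obtain p0 where "g p0 = \<zero>"
      using g by (metis surjD)
    then have z: "0 \<le> z"
      using p[of p0] \<eta>0[of p0] by simp
    show "0 \<le> Re (\<xi> (\<iota> t)) + z * Re (\<xi> e)"
    proof (cases "\<xi> e = 0")
      case True
      then show ?thesis
        using char_unit_zero[OF \<xi> True \<iota>_closed[OF t(1)]] by simp
    next
      case False
      then have \<xi>e: "\<xi> e = 1"
        using unit_at_char[OF unit \<xi>] by simp
      \<comment> \<open>The negative part of \<open>t + z\<close>. It vanishes on the whole family,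
        in particular at the index of the element \<open>c\<close> that it defines, so
        \<open>c\<close> is 0.\<close>
      define f where "f x = max 0 (- x - z)" for x :: real
      have f: "continuous_on UNIV f" "f 0 = 0"
        unfolding f_def using z by (auto intro!: continuous_intros)
      obtain c where c: "c \<in> carrier (subalg A B)"
        "\<And>\<zeta>. \<zeta> \<in> chars (subalg A B) \<Longrightarrow> \<zeta> c = complex_of_real (f (Re (\<zeta> t)))"
        using B.functional_calculus[OF tB f] by blast
      have cB: "c \<in> B"
        using c(1) by simp
      obtain p where gp: "g p = c"
        using g by (metis surjD)
      have "\<eta> p c = complex_of_real (f (Re (\<eta> p t)))"
        by (rule c(2)[OF chars_subalg[OF \<eta>(1) B_subset]])
      also have "f (Re (\<eta> p t)) = 0"
        using p[of p] by (simp add: f_def)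
      finally have "c = \<zero>"
        using \<eta>1[of p] gp cB by auto
      then have "\<xi> (\<iota> c) = 0"
        using B.chars_zero[OF \<zeta>] by simp
      then have "f (Re (\<xi> (\<iota> t))) = 0"
        using c(2)[OF \<zeta>] by simp
      then show ?thesis
        using \<xi>e by (simp add: f_def max_def split: if_splits)
    qed
  qed
  have T: "linear_subspace A B"
    using subalgebra by (simp add: cstar_subalgebra_def)
  show ?thesis
  proof (rule extension_through_characters[where \<eta> = \<eta> and T = B and \<phi> = \<iota>, OF injective I.comm_cstar_axioms unit
        comm_cstar_axioms \<eta>(1) T B_closed(4) lin pos])
    fix \<Psi>
    assume \<Psi>: "cp_map A I \<Psi>" "\<And>c. c \<in> carrier A \<Longrightarrow> cnorm I (\<Psi> c) \<le> cnorm A c"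
      "\<And>t. t \<in> B \<Longrightarrow> \<Psi> t = \<iota> t" "\<And>c. \<lbrakk>c \<in> carrier A; \<And>p. \<eta> p c = 0\<rbrakk> \<Longrightarrow> \<Psi> c = \<zero>\<^bsub>I\<^esub>"
    show thesis
    proof (rule that)
      show "pseudo_expectation A B I \<iota> \<Psi>"
        using \<Psi>(1-3) by (simp add: pseudo_expectation_def)
      show "\<Psi> k = \<zero>\<^bsub>I\<^esub>" if "k \<in> K" for k
        by (rule \<Psi>(4)[OF K.J_carrier[OF that] \<eta>(2)[OF that]])
    qed
  qed
qed

lemma essential_if_faithful:
  fixes g :: "'x \<Rightarrow> 'a"
  assumes g: "surj g" and faithful: "\<And>\<Phi>. pseudo_expectation A B I \<iota> \<Phi> \<Longrightarrow> faithful_map A I \<Phi>"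
  shows "essential A B"
  unfolding essential_def
proof (intro allI impI subsetI)
  fix K k assume K: "closed_ideal A K \<and> K \<inter> B \<subseteq> {\<zero>}" and k: "k \<in> K"
  then have K1: "closed_ideal A K" "K \<inter> B \<subseteq> {\<zero>}"
    by auto
  obtain \<Phi> where \<Phi>: "pseudo_expectation A B I \<iota> \<Phi>" "\<And>k. k \<in> K \<Longrightarrow> \<Phi> k = \<zero>\<^bsub>I\<^esub>"
    using pseudo_expectation_vanishing[OF g K1] by blast
  have kc: "k \<in> carrier A"
    using closed_ideal_rules(1)[OF K1(1) k] .
  then have "\<Phi> (star A k \<otimes> k) = \<zero>\<^bsub>I\<^esub>"
    by (intro \<Phi>(2) closed_ideal_rules(5)[OF K1(1) _ k]) simp
  then show "k \<in> {\<zero>}"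
    using faithful[OF \<Phi>(1)] kc by (auto simp: faithful_map_def)
qed

end

locale abelian_pseudo_expectation = abelian_inclusion A B I \<iota> X e
  for A :: "'a cstar" (structure) and B :: "'a set" and I :: "'i cstar" and \<iota> :: "'a \<Rightarrow> 'i"
    and X :: "'x itself" and e :: 'i +
  fixes \<Phi> :: "'a \<Rightarrow> 'i"
  assumes pseudo: "pseudo_expectation A B I \<iota> \<Phi>"
begin

lemma cp: "cp_map A I \<Phi>"
  and contractive: "a \<in> carrier A \<Longrightarrow> cnorm I (\<Phi> a) \<le> cnorm A a"
  and on_B: "b \<in> B \<Longrightarrow> \<Phi> b = \<iota> b"
  using pseudo by (auto simp: pseudo_expectation_def)

lemma linear: "linear_map_on A (carrier A) I \<Phi>"
  using cp by (simp add: cp_map_on_def)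

lemmas \<Phi>_closed [simp] = linear_map_onD(1)[OF linear]

lemma \<Phi>_char:
  assumes "\<xi> \<in> chars I"
  shows "\<lbrakk>x \<in> carrier A; y \<in> carrier A\<rbrakk> \<Longrightarrow> \<xi> (\<Phi> (x \<oplus> y)) = \<xi> (\<Phi> x) + \<xi> (\<Phi> y)"
    and "x \<in> carrier A \<Longrightarrow> \<xi> (\<Phi> (c \<odot> x)) = c * \<xi> (\<Phi> x)"
    and "\<lbrakk>x \<in> carrier A; y \<in> carrier A\<rbrakk> \<Longrightarrow> \<xi> (\<Phi> (x \<ominus> y)) = \<xi> (\<Phi> x) - \<xi> (\<Phi> y)"
  using assms by (simp_all add: linear_map_onD(2,3)[OF linear] minus_eq_smult)

lemma \<Phi>_bound: "\<lbrakk>\<xi> \<in> chars I; x \<in> carrier A\<rbrakk> \<Longrightarrow> cmod (\<xi> (\<Phi> x)) \<le> cnorm A x"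
  using I.chars_cnorm_le[of \<xi> "\<Phi> x"] contractive[of x] by simp

lemma \<Phi>_square:
  assumes \<xi>: "\<xi> \<in> chars I" and x: "x \<in> carrier A"
  shows "Im (\<xi> (\<Phi> (star A x \<otimes> x))) = 0" and "0 \<le> Re (\<xi> (\<Phi> (star A x \<otimes> x)))"
  using cp_map_positive[OF cstar_algebra_axioms I.cstar_algebra_axioms cp x \<xi>] by auto

text \<open>The Cauchy--Schwarz inequality in the degenerate case.\<close>

lemma \<Phi>_null:
  assumes \<xi>: "\<xi> \<in> chars I" and a: "a \<in> carrier A" and b: "b \<in> carrier A" and null: "\<xi> (\<Phi> (star A b \<otimes> b)) = 0"
  shows "\<xi> (\<Phi> (a \<otimes> b)) = 0"
proof -
  define f where "f x = \<xi> (\<Phi> x)" for x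
  have f: "f (x \<oplus> y) = f x + f y" "f (c \<odot> x) = c * f x" if "x \<in> carrier A" "y \<in> carrier A" for x y c
    using \<Phi>_char[OF \<xi>] that by (auto simp: f_def)
  define p where "p = a \<otimes> b"
  have p: "p \<in> carrier A"
    using a b by (simp add: p_def)
  have pos: "Im (f (star A x \<otimes> x)) = 0" "0 \<le> Re (f (star A x \<otimes> x))" if "x \<in> carrier A" for x
    using \<Phi>_square[OF \<xi> that] by (simp_all add: f_def)
  \<comment> \<open>Since \<open>b\<close> is null, the expansion has no quadratic term in
    \<open>l\<close>. What remains is affine in \<open>l\<close> and nonnegative for all
    \<open>l\<close>, so its linear part vanishes.\<close>
  have expand: "f (star A (star A a \<oplus> l \<odot> b) \<otimes> (star A a \<oplus> l \<odot> b)) = f (a \<otimes> star A a) + (l * f p + cnj l * f (star A p))" for l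
  proof -
    have "star A (star A a \<oplus> l \<odot> b) \<otimes> (star A a \<oplus> l \<odot> b) =
        a \<otimes> star A a \<oplus> (l \<odot> p \<oplus> (cnj l \<odot> star A p \<oplus> (l * cnj l) \<odot> (star A b \<otimes> b)))"
      using a b by (intro chars_eqI) (auto simp: p_def algebra_simps)
    then show ?thesis
      using a b p null by (simp add: f) (simp add: f_def)
  qed
  have 1: "Im (f (a \<otimes> star A a) + (l * f p + cnj l * f (star A p))) = 0"
    and 2: "0 \<le> Re (f (a \<otimes> star A a) + (l * f p + cnj l * f (star A p)))" for l
    unfolding expand[symmetric] using a b by (intro pos; simp)+
  have conj: "f (star A p) = cnj (f p)"
    using 1[of 0] 1[of 1] 1[of \<i>] by (simp add: complex_eq_iff)
  define r where "r = Re (f (a \<otimes> star A a))"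
  have bound: "2 * t * (cmod (f p))\<^sup>2 \<le> r" for t :: real
  proof -
    have "f p * cnj (f p) = complex_of_real ((cmod (f p))\<^sup>2)"
      by (rule complex_norm_square[symmetric])
    then have "0 \<le> r - 2 * t * (cmod (f p))\<^sup>2"
      using 2[of "- of_real t * cnj (f p)"] by (simp add: r_def conj cmod_power2 power2_eq_square algebra_simps)
    then show ?thesis
      by simp
  qed
  have "cmod (f p) = 0"
  proof (rule ccontr)
    assume n: "cmod (f p) \<noteq> 0"
    then have "0 < (cmod (f p))\<^sup>2"
      by simp
    then show False
      using bound[of "(r + 1) / (2 * (cmod (f p))\<^sup>2)"] by (simp add: field_simps)
  qed
  then show ?thesis
    by (simp add: f_def p_def)
qed

text \<open>An element \<open>y\<close> of \<open>B\<close> with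
  \<open>\<xi> (\<iota> y) = 0\<close> is null for the functional, so \<open>\<Phi>_null\<close>
  kills every product \<open>x y\<close>. If \<open>\<xi> (\<iota> b)\<close> is nonzero,
  \<open>b\<close> is normalized to \<open>u\<close> with value 1. In place of \<open>u - 1\<close>,
  which need not exist, \<open>v u - v\<close> is used with \<open>v\<close> from an approximate
  unit in \<open>B\<close>.\<close>

lemma \<Phi>_bimodule:
  assumes \<xi>: "\<xi> \<in> chars I" and a: "a \<in> carrier A" and b: "b \<in> B"
  shows "\<xi> (\<Phi> (a \<otimes> b)) = \<xi> (\<Phi> a) * \<xi> (\<iota> b)"
proof -
  define \<eta> where "\<eta> x = \<xi> (\<iota> x)" for x
  have mult: "\<eta> (x \<otimes> y) = \<eta> x * \<eta> y" and star: "\<eta> (star A x) = cnj (\<eta> x)" if "x \<in> B" "y \<in> B" for x y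
    using that \<xi> by (simp_all add: \<eta>_def \<iota>_mult \<iota>_star)
  have null: "\<xi> (\<Phi> (x \<otimes> y)) = 0" if x: "x \<in> carrier A" and y: "y \<in> B" "\<eta> y = 0" for x y
  proof (rule \<Phi>_null[OF \<xi> x B_carrier[OF y(1)]])
    have "\<xi> (\<Phi> (star A y \<otimes> y)) = \<eta> (star A y \<otimes> y)"
      using on_B[OF B_closed(3)[OF B_closed(4)[OF y(1)] y(1)]] by (simp add: \<eta>_def)
    also have "\<dots> = 0"
      using mult[OF B_closed(4)[OF y(1)] y(1)] y(2) by simp
    finally show "\<xi> (\<Phi> (star A y \<otimes> y)) = 0" .
  qed
  show ?thesis
  proof (cases "\<eta> b = 0")
    case True
    then show ?thesis
      using null[OF a b] by (simp add: \<eta>_def)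
  next
    case False
    define u where "u = (1 / \<eta> b) \<odot> b"
    have u: "u \<in> B" "u \<in> carrier A" "\<eta> u = 1" "b = \<eta> b \<odot> u"
      using b False \<xi> B_carrier[OF b] B_closed(1)[OF b]
      by (simp_all add: u_def \<eta>_def \<iota>_smult smult_one flip: smult_smult)
    have "cmod (\<xi> (\<Phi> (a \<otimes> u)) - \<xi> (\<Phi> a)) \<le> 0 + r" if r: "0 < r" for r
    proof -
      \<comment> \<open>The error is at most \<open>cnorm A d * (1 + cnorm A u)\<close> with
        \<open>d = a v - a\<close>, hence this choice.\<close>
      define k where "k = r / (cnorm A u + 1)"
      have n: "0 \<le> cnorm A u"
        by (rule cnorm_nonneg[OF u(2)])
      have k: "0 < k"
        using r n by (simp add: k_def)
      obtain v where v: "v \<in> B" "cnorm A (a \<otimes> v \<ominus> a) < k"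
        using approximate_unit[OF a k] by blast
      note vc = B_carrier[OF v(1)]
      define d where "d = a \<otimes> v \<ominus> a"
      have d: "d \<in> carrier A" "cnorm A d \<le> k"
        using a vc v(2) by (simp_all add: d_def)
      have uv: "v \<otimes> u \<ominus> v \<in> B" "\<eta> (v \<otimes> u \<ominus> v) = 0"
      proof -
        show "v \<otimes> u \<ominus> v \<in> B"
          by (intro B_closed v u)
        have "\<eta> (v \<otimes> u \<ominus> v) = \<eta> (v \<otimes> u) - \<eta> v"
          using \<xi> B_closed(3)[OF v(1) u(1)] B_closed(1)[OF v(1)] v(1) u(2) vc
          by (simp add: \<eta>_def minus_eq_smult \<iota>_add \<iota>_smult)
        then show "\<eta> (v \<otimes> u \<ominus> v) = 0"
          using mult[OF v(1) u(1)] u(3) by simp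
      qed
      have "a \<otimes> u \<ominus> a = (a \<otimes> (v \<otimes> u \<ominus> v) \<ominus> d \<otimes> u) \<oplus> d"
        using a u(2) vc by (intro chars_eqI) (auto simp: d_def algebra_simps)
      then have "\<xi> (\<Phi> (a \<otimes> u \<ominus> a)) = \<xi> (\<Phi> ((a \<otimes> (v \<otimes> u \<ominus> v) \<ominus> d \<otimes> u) \<oplus> d))"
        by simp
      then have "\<xi> (\<Phi> (a \<otimes> u)) - \<xi> (\<Phi> a) = \<xi> (\<Phi> d) - \<xi> (\<Phi> (d \<otimes> u))"
        using null[OF a uv] a u(2) vc d(1) by (simp add: \<Phi>_char[OF \<xi>])
      then have "cmod (\<xi> (\<Phi> (a \<otimes> u)) - \<xi> (\<Phi> a)) \<le> cmod (\<xi> (\<Phi> d)) + cmod (\<xi> (\<Phi> (d \<otimes> u)))"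
        by (simp add: norm_triangle_ineq4)
      also have "\<dots> \<le> cnorm A d + cnorm A d * cnorm A u"
        using \<Phi>_bound[OF \<xi> d(1)] \<Phi>_bound[OF \<xi> mult_closed[OF d(1) u(2)]] cnorm_mult[OF d(1) u(2)] by simp
      also have "\<dots> \<le> k + k * cnorm A u"
        using d(2) n by (intro add_mono mult_right_mono)
      also have "\<dots> = k * (cnorm A u + 1)"
        by (simp add: algebra_simps)
      also have "\<dots> = r"
        using n by (simp add: k_def)
      finally show ?thesis
        by simp
    qed
    then have "cmod (\<xi> (\<Phi> (a \<otimes> u)) - \<xi> (\<Phi> a)) \<le> 0"
      by (rule field_le_epsilon)
    then have eq: "\<xi> (\<Phi> (a \<otimes> u)) = \<xi> (\<Phi> a)"
      by simp
    have "a \<otimes> b = \<eta> b \<odot> (a \<otimes> u)"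
      using smult_mult_right[OF a u(2), of "\<eta> b"] u(4) by simp
    then show ?thesis
      using eq a u(2) by (simp add: \<Phi>_char[OF \<xi>] \<eta>_def)
  qed
qed

text \<open>If \<open>\<Phi>\<close> vanishes at \<open>star A a \<otimes> a\<close>, then by
  \<open>\<Phi>_null\<close> it vanishes at every \<open>c \<otimes> a\<close>, so \<open>a\<close>
  lies in the ideal \<open>N\<close>. An element \<open>b\<close> of \<open>N \<inter> B\<close>
  satisfies \<open>\<iota> (star A b \<otimes> b) = 0\<close> and is therefore 0.\<close>

lemma faithful_if_essential:
  assumes ess: "essential A B"
  shows "faithful_map A I \<Phi>"
proof -
  define N where "N = {a \<in> carrier A. \<forall>c\<in>carrier A. \<Phi> (c \<otimes> a) = \<zero>\<^bsub>I\<^esub>}"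
  have N_iff: "a \<in> N \<longleftrightarrow> a \<in> carrier A \<and> (\<forall>c\<in>carrier A. \<forall>\<xi>\<in>chars I. \<xi> (\<Phi> (c \<otimes> a)) = 0)" for a
  proof -
    have "\<Phi> (c \<otimes> a) = \<zero>\<^bsub>I\<^esub>" if "a \<in> carrier A" "c \<in> carrier A" "\<forall>\<xi>\<in>chars I. \<xi> (\<Phi> (c \<otimes> a)) = 0" for c
    proof (rule I.chars_eqI)
      fix \<xi> assume \<xi>: "\<xi> \<in> chars I"
      show "\<xi> (\<Phi> (c \<otimes> a)) = \<xi> \<zero>\<^bsub>I\<^esub>"
        unfolding I.chars_zero[OF \<xi>] by (rule that(3)[rule_format, OF \<xi>])
    qed (use that(1,2) in simp_all)
    moreover have "\<xi> (\<Phi> (c \<otimes> a)) = 0" if "\<Phi> (c \<otimes> a) = \<zero>\<^bsub>I\<^esub>" "\<xi> \<in> chars I" for c \<xi>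
      unfolding that(1) by (rule I.chars_zero[OF that(2)])
    ultimately show ?thesis
      unfolding N_def by blast
  qed
  have limit: "x \<in> N" if Y: "\<And>n. Y n \<in> N" and x: "x \<in> carrier A" and lim: "(\<lambda>n. cnorm A (Y n \<ominus> x)) \<longlonglongrightarrow> 0" for Y x
    unfolding N_iff
  proof (intro conjI ballI)
    fix c \<xi> assume c: "c \<in> carrier A" and \<xi>: "\<xi> \<in> chars I"
    have Yc: "Y n \<in> carrier A" for n
      using Y[of n] by (simp add: N_def)
    have "cmod (\<xi> (\<Phi> (c \<otimes> x))) \<le> cnorm A c * cnorm A (Y n \<ominus> x)" for n
    proof -
      have "\<xi> (\<Phi> (c \<otimes> (Y n \<ominus> x))) = \<xi> (\<Phi> (c \<otimes> Y n)) - \<xi> (\<Phi> (c \<otimes> x))"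
        using c x Yc by (simp add: mult_diff_left \<Phi>_char[OF \<xi>])
      also have "\<xi> (\<Phi> (c \<otimes> Y n)) = 0"
        using Y[of n] c \<xi> by (simp add: N_def)
      finally have "cmod (\<xi> (\<Phi> (c \<otimes> x))) = cmod (\<xi> (\<Phi> (c \<otimes> (Y n \<ominus> x))))"
        by simp
      also have "\<dots> \<le> cnorm A (c \<otimes> (Y n \<ominus> x))"
        using c x Yc by (intro \<Phi>_bound[OF \<xi>]) simp
      also have "\<dots> \<le> cnorm A c * cnorm A (Y n \<ominus> x)"
        using c x Yc by (intro cnorm_mult) simp_all
      finally show ?thesis .
    qed
    then have "cmod (\<xi> (\<Phi> (c \<otimes> x))) \<le> 0"
      using tendsto_mult_left[OF lim, of "cnorm A c"] by (intro LIMSEQ_le_const) auto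
    then show "\<xi> (\<Phi> (c \<otimes> x)) = 0"
      by simp
  qed (rule x)
  have N: "closed_ideal A N"
    unfolding closed_ideal_def linear_subspace_def norm_closed_def
  proof (intro conjI ballI allI impI)
    show "N \<subseteq> carrier A"
      by (auto simp: N_def)
    have "\<Phi> \<zero> = \<zero>\<^bsub>I\<^esub>"
      using linear_map_onD(3)[OF linear zero_closed, of 0] by simp
    then show "\<zero> \<in> N"
      by (simp add: N_def)
    show "x \<oplus> y \<in> N" if "x \<in> N" "y \<in> N" for x y
      using that by (simp add: N_def distrib_left linear_map_onD(2)[OF linear])
    show "c \<odot> x \<in> N" if "x \<in> N" for x c
      using that by (simp add: N_def linear_map_onD(3)[OF linear] smult_mult_right)
    show "a \<otimes> x \<in> N" if "a \<in> carrier A" "x \<in> N" for a x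
      using that by (simp add: N_def flip: mult_assoc)
    then show "x \<otimes> a \<in> N" if "a \<in> carrier A" "x \<in> N" for a x
      using that mult_comm[of x a] by (simp add: N_def)
    show "x \<in> N" if "x \<in> carrier A" "(\<forall>n. Y n \<in> N) \<and> (\<lambda>n. cnorm A (Y n \<ominus> x)) \<longlonglongrightarrow> 0" for x Y
      using limit[OF _ that(1) conjunct2[OF that(2)]] conjunct1[OF that(2)] by simp
  qed
  have "N \<inter> B \<subseteq> {\<zero>}"
  proof
    fix b assume "b \<in> N \<inter> B"
    then have b: "b \<in> N" "b \<in> B" "b \<in> carrier A"
      by (auto simp: N_def)
    note bb = B_closed(3)[OF B_closed(4)[OF b(2)] b(2)]
    have "\<iota> (star A b \<otimes> b) = \<zero>\<^bsub>I\<^esub>"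
      using on_B[OF bb] b star_closed[OF b(3)] by (simp add: N_def)
    then have "star A b \<otimes> b = \<zero>"
      by (rule \<iota>_zero[OF bb])
    then have "cnorm A b = 0"
      using cnorm_star_mult[OF b(3)] cnorm_eq_zero[of \<zero>] by simp
    then show "b \<in> {\<zero>}"
      using cnorm_eq_zero[OF b(3)] by simp
  qed
  with N ess have N0: "N \<subseteq> {\<zero>}"
    by (simp add: essential_def)
  show ?thesis
    unfolding faithful_map_def
  proof (intro ballI impI)
    fix a assume a: "a \<in> carrier A" and "\<Phi> (star A a \<otimes> a) = \<zero>\<^bsub>I\<^esub>"
    then have "\<xi> (\<Phi> (c \<otimes> a)) = 0" if "\<xi> \<in> chars I" "c \<in> carrier A" for c \<xi>
      using \<Phi>_null[OF that a] that(1) by simp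
    with a have "a \<in> N"
      unfolding N_iff by blast
    with N0 show "a = \<zero>"
      by auto
  qed
qed

lemma \<Phi>_nonneg:
  assumes \<xi>: "\<xi> \<in> chars I" and a: "a \<in> carrier A"
    and pos: "\<And>\<zeta>. \<zeta> \<in> chars A \<Longrightarrow> \<zeta> a = complex_of_real (Re (\<zeta> a)) \<and> 0 \<le> Re (\<zeta> a)"
  shows "Im (\<xi> (\<Phi> a)) = 0" and "0 \<le> Re (\<xi> (\<Phi> a))"
proof -
  obtain s where "s \<in> carrier A" "star A s = s" "s \<otimes> s = a"
    by (rule square_root[OF a]) (use pos in blast)+
  then show "Im (\<xi> (\<Phi> a)) = 0" "0 \<le> Re (\<xi> (\<Phi> a))"
    using \<Phi>_square[OF \<xi>, of s] by auto
qed

text \<open>A substitute for adding the scalar \<open>z\<close>: the element \<open>a + c\<close> is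
  positive, and \<open>c\<close> is no larger than \<open>z\<close>.\<close>

lemma negative_part:
  assumes a: "a \<in> carrier A" "star A a = a" and z: "0 \<le> z"
    and below: "\<And>\<zeta>. \<zeta> \<in> chars A \<Longrightarrow> - z \<le> Re (\<zeta> a)"
  obtains c where "c \<in> carrier A" "star A c = c" "cnorm A c \<le> z"
    "\<And>\<zeta>. \<zeta> \<in> chars A \<Longrightarrow> \<zeta> c = complex_of_real (max 0 (- Re (\<zeta> a)))"
proof -
  have f: "continuous_on UNIV (\<lambda>t. max 0 (- t) :: real)" "max 0 (- 0) = (0 :: real)"
    by (auto intro!: continuous_intros)
  obtain c where c: "c \<in> carrier A" "star A c = c"
    "\<And>\<zeta>. \<zeta> \<in> chars A \<Longrightarrow> \<zeta> c = complex_of_real (max 0 (- Re (\<zeta> a)))"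
    using functional_calculus[OF a f] by blast
  moreover have "cnorm A c \<le> z"
  proof (rule cnorm_le_of_chars[OF c(1) z])
    fix \<zeta> assume \<zeta>: "\<zeta> \<in> chars A"
    show "cmod (\<zeta> c) \<le> z"
      unfolding c(3)[OF \<zeta>] norm_of_real using below[OF \<zeta>] z by simp
  qed
  ultimately show ?thesis
    using that by blast
qed

text \<open>The element \<open>a\<close> is the difference of the positive elements
  \<open>a + c\<close> and \<open>c\<close>.\<close>

lemma \<Phi>_real:
  assumes \<xi>: "\<xi> \<in> chars I" and a: "a \<in> carrier A" "star A a = a"
  shows "Im (\<xi> (\<Phi> a)) = 0"
proof -
  have "- cnorm A a \<le> Re (\<zeta> a)" if "\<zeta> \<in> chars A" for \<zeta>
    using chars_cnorm_le[OF that a(1)] abs_Re_le_cmod[of "\<zeta> a"] by linarith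
  then obtain c where c: "c \<in> carrier A" "star A c = c"
    "\<And>\<zeta>. \<zeta> \<in> chars A \<Longrightarrow> \<zeta> c = complex_of_real (max 0 (- Re (\<zeta> a)))"
    using negative_part[OF a cnorm_nonneg[OF a(1)]] by blast
  have "Im (\<xi> (\<Phi> c)) = 0"
    by (rule \<Phi>_nonneg(1)[OF \<xi> c(1)]) (simp add: c)
  moreover have "Im (\<xi> (\<Phi> (a \<oplus> c))) = 0"
    by (rule \<Phi>_nonneg(1)[OF \<xi>])
      (use a c chars_herm_of_real[OF _ a] in \<open>auto simp: max_def complex_eq_iff\<close>)
  ultimately show ?thesis
    using a c by (simp add: \<Phi>_char[OF \<xi>])
qed

lemma \<Phi>_star:
  assumes a: "a \<in> carrier A"
  shows "\<Phi> (star A a) = star I (\<Phi> a)"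
proof (rule I.chars_eqI)
  fix \<xi> assume \<xi>: "\<xi> \<in> chars I"
  have "Im (\<xi> (\<Phi> (a \<oplus> star A a))) = 0"
    by (rule \<Phi>_real[OF \<xi>]) (use a in \<open>auto simp: star_add star_star a_comm\<close>)
  moreover have "Im (\<xi> (\<Phi> (\<i> \<odot> (a \<ominus> star A a)))) = 0"
    by (rule \<Phi>_real[OF \<xi>]) (use a in \<open>auto intro!: chars_eqI simp: algebra_simps\<close>)
  ultimately show "\<xi> (\<Phi> (star A a)) = \<xi> (star I (\<Phi> a))"
    using a \<xi> by (simp add: \<Phi>_char[OF \<xi>] complex_eq_iff)
qed (use a in auto)

end

section \<open>Pseudo-expectations of essential inclusions as order embeddings\<close>

context abelian_pseudo_expectation
begin

text \<open>If \<open>a + z\<close> were negative somewhere, the elements living where it is \<open>\<le> 0\<close> would form an ideal that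
  meets \<open>B\<close> trivially, because \<open>\<Phi>\<close> is a \<open>B\<close>-bimodule map.\<close>

lemma order_reflect:
  assumes ess: "essential A B" and a: "a \<in> carrier A" "star A a = a"
    and pos: "\<And>\<xi>. \<lbrakk>\<xi> \<in> chars I; \<xi> e = 1\<rbrakk> \<Longrightarrow> 0 < Re (\<xi> (\<Phi> a)) + z"
    and \<zeta>: "\<zeta> \<in> chars A" "y \<in> carrier A" "\<zeta> y \<noteq> 0"
  shows "0 \<le> Re (\<zeta> a) + z"
proof -
  define K where "K = {x \<in> carrier A. \<forall>\<zeta>\<in>chars A. 0 \<le> Re (\<zeta> a) + z \<longrightarrow> \<zeta> x = 0}"
  have KI: "x \<in> K" if "x \<in> carrier A" "\<And>\<zeta>. \<lbrakk>\<zeta> \<in> chars A; 0 \<le> Re (\<zeta> a) + z\<rbrakk> \<Longrightarrow> \<zeta> x = 0" for x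
    using that unfolding K_def by blast
  have KD: "x \<in> carrier A" "\<lbrakk>\<zeta> \<in> chars A; 0 \<le> Re (\<zeta> a) + z\<rbrakk> \<Longrightarrow> \<zeta> x = 0" if "x \<in> K" for x \<zeta>
    using that unfolding K_def by blast+
  have K: "closed_ideal A K"
    unfolding closed_ideal_def linear_subspace_def norm_closed_def
  proof (intro conjI ballI allI impI)
    show "K \<subseteq> carrier A"
      using KD(1) by blast
    show "\<zero> \<in> K"
      by (rule KI) simp_all
    show "x \<oplus> y \<in> K" if "x \<in> K" "y \<in> K" for x y
      by (rule KI) (simp_all add: KD[OF that(1)] KD[OF that(2)])
    show "c \<odot> x \<in> K" if "x \<in> K" for x c
      by (rule KI) (simp_all add: KD[OF that])
    show "x \<otimes> y \<in> K" "y \<otimes> x \<in> K" if "x \<in> carrier A" "y \<in> K" for x y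
      by (rule KI; simp add: that(1) KD[OF that(2)])+
    show "x \<in> K" if x: "x \<in> carrier A" and Y: "(\<forall>n. Y n \<in> K) \<and> (\<lambda>n. cnorm A (Y n \<ominus> x)) \<longlonglongrightarrow> 0" for x Y
    proof (rule KI[OF x])
      fix \<zeta> assume \<zeta>: "\<zeta> \<in> chars A" "0 \<le> Re (\<zeta> a) + z"
      have "cmod (\<zeta> x) \<le> cnorm A (Y n \<ominus> x)" for n
      proof -
        have Yn: "Y n \<in> K"
          using Y by simp
        have "\<zeta> (Y n \<ominus> x) = - \<zeta> x"
          using chars_diff[OF \<zeta>(1) KD(1)[OF Yn] x] KD(2)[OF Yn \<zeta>] by simp
        then have "cmod (\<zeta> x) = cmod (\<zeta> (Y n \<ominus> x))"
          by simp
        also have "\<dots> \<le> cnorm A (Y n \<ominus> x)"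
          using KD(1)[OF Yn] x by (intro chars_cnorm_le[OF \<zeta>(1)]) simp
        finally show ?thesis .
      qed
      then have "cmod (\<zeta> x) \<le> 0"
        using LIMSEQ_le_const[OF conjunct2[OF Y], of "cmod (\<zeta> x)"] by blast
      then show "\<zeta> x = 0"
        by simp
    qed
  qed
  have "K \<inter> B \<subseteq> {\<zero>}"
  proof
    fix b assume "b \<in> K \<inter> B"
    then have bK: "b \<in> K" and b: "b \<in> B" "b \<in> carrier A"
      using B_carrier by auto
    define d where "d = star A b \<otimes> b"
    have d: "d \<in> B" "d \<in> carrier A"
      using B_closed(3)[OF B_closed(4)[OF b(1)] b(1)] B_carrier by (simp_all add: d_def)
    have d_char: "\<zeta> d = complex_of_real ((cmod (\<zeta> b))\<^sup>2)" if "\<zeta> \<in> chars A" for \<zeta>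
      using that b(2) complex_norm_square[of "\<zeta> b"] by (simp add: d_def mult.commute)
    \<comment> \<open>This is \<open>- (a + z) d\<close>, positive because \<open>b\<close> lives
      where \<open>a + z\<close> is negative. The bimodule property turns \<open>\<Phi> w\<close>
      into \<open>- (\<Phi> a + z) \<iota> d\<close>, and the strict inequality in
      \<open>pos\<close> leaves only \<open>\<iota> d = 0\<close>.\<close>
    define w where "w = (- 1) \<odot> (a \<otimes> d \<oplus> complex_of_real z \<odot> d)"
    have w: "w \<in> carrier A"
      using a d by (simp add: w_def)
    have w_char: "\<zeta> w = complex_of_real (- ((Re (\<zeta> a) + z) * (cmod (\<zeta> b))\<^sup>2))" if "\<zeta> \<in> chars A" for \<zeta>
    proof -
      have "\<zeta> w = - (\<zeta> a * \<zeta> d + complex_of_real z * \<zeta> d)"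
        using that a(1) d(2) by (simp add: w_def)
      also have "\<dots> = complex_of_real (- ((Re (\<zeta> a) + z) * (cmod (\<zeta> b))\<^sup>2))"
        unfolding d_char[OF that] by (subst chars_herm_of_real[OF that a]) (simp add: algebra_simps)
      finally show ?thesis .
    qed
    have "\<iota> d = \<zero>\<^bsub>I\<^esub>"
    proof (rule I.chars_eqI)
      fix \<xi> assume \<xi>: "\<xi> \<in> chars I"
      have "\<xi> (\<iota> d) = 0"
      proof (cases "\<xi> e = 0")
        case True
        then show ?thesis
          by (rule char_unit_zero[OF \<xi> _ \<iota>_closed[OF d(1)]])
      next
        case False
        then have "\<xi> e = 1"
          using unit_at_char[OF unit \<xi>] by simp
        then have less: "0 < Re (\<xi> (\<Phi> a)) + z"
          by (rule pos[OF \<xi>])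
        have "0 \<le> Re (\<xi> (\<Phi> w))"
        proof (rule \<Phi>_nonneg(2)[OF \<xi> w])
          fix \<zeta> assume \<zeta>: "\<zeta> \<in> chars A"
          have "(Re (\<zeta> a) + z) * (cmod (\<zeta> b))\<^sup>2 \<le> 0"
          proof (cases "0 \<le> Re (\<zeta> a) + z")
            case True
            then show ?thesis
              using KD(2)[OF bK \<zeta>] by simp
          next
            case False
            then show ?thesis
              by (simp add: mult_nonpos_nonneg)
          qed
          then show "\<zeta> w = complex_of_real (Re (\<zeta> w)) \<and> 0 \<le> Re (\<zeta> w)"
            unfolding w_char[OF \<zeta>] by simp
        qed
        moreover have "\<xi> (\<Phi> w) = - ((\<xi> (\<Phi> a) + complex_of_real z) * \<xi> (\<iota> d))"
          using a d by (simp add: w_def \<Phi>_char[OF \<xi>] \<Phi>_bimodule[OF \<xi> a(1) d(1)] on_B algebra_simps)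
        moreover have "\<xi> (\<iota> d) = complex_of_real ((cmod (\<xi> (\<iota> b)))\<^sup>2)"
          using \<xi> b complex_norm_square[of "\<xi> (\<iota> b)"]
          by (simp add: d_def \<iota>_mult \<iota>_star B_closed mult.commute)
        ultimately have "(Re (\<xi> (\<Phi> a)) + z) * (cmod (\<xi> (\<iota> b)))\<^sup>2 \<le> 0"
          by simp
        with less have "(cmod (\<xi> (\<iota> b)))\<^sup>2 \<le> 0"
          by (simp add: mult_le_0_iff)
        then have "\<xi> (\<iota> b) = 0"
          by simp
        then show ?thesis
          using \<open>\<xi> (\<iota> d) = _\<close> by simp
      qed
      then show "\<xi> (\<iota> d) = \<xi> \<zero>\<^bsub>I\<^esub>"
        using I.chars_zero[OF \<xi>] by simp
    qed (simp_all add: d)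
    then have "d = \<zero>"
      by (rule \<iota>_zero[OF d(1)])
    then have "cnorm A b = 0"
      using cnorm_star_mult[OF b(2)] cnorm_eq_zero[of \<zero>] by (simp add: d_def)
    then show "b \<in> {\<zero>}"
      using cnorm_eq_zero[OF b(2)] by simp
  qed
  with K ess have K0: "K \<subseteq> {\<zero>}"
    by (simp add: essential_def)
  show ?thesis
  proof (rule ccontr)
    assume neg: "\<not> 0 \<le> Re (\<zeta> a) + z"
    \<comment> \<open>The negative part of \<open>a + z\<close>. Its value at 0 need not vanish, so
      the calculus gives \<open>f - f 0\<close>, and the constant is restored after multiplication
      by \<open>y\<close>, at which the character is nonzero.\<close>
    define f where "f t = max 0 (- t - z)" for t :: real
    have f: "continuous_on UNIV (\<lambda>t. f t - f 0)" "f 0 - f 0 = 0"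
      unfolding f_def by (auto intro!: continuous_intros)
    obtain c where c: "c \<in> carrier A" "\<And>\<zeta>. \<zeta> \<in> chars A \<Longrightarrow> \<zeta> c = complex_of_real (f (Re (\<zeta> a)) - f 0)"
      using functional_calculus[OF a f] by blast
    define x where "x = c \<otimes> y \<oplus> complex_of_real (f 0) \<odot> y"
    have x: "x \<in> carrier A"
      using c(1) \<zeta>(2) by (simp add: x_def)
    have x_char: "\<zeta> x = complex_of_real (f (Re (\<zeta> a))) * \<zeta> y" if "\<zeta> \<in> chars A" for \<zeta>
    proof -
      have "\<zeta> x = (\<zeta> c + complex_of_real (f 0)) * \<zeta> y"
        using c(1) \<zeta>(2) that by (simp add: x_def ring_distribs)
      then show ?thesis
        by (simp add: c(2)[OF that])
    qed
    have "x \<in> K"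
    proof (rule KI[OF x])
      fix \<zeta> assume "\<zeta> \<in> chars A" "0 \<le> Re (\<zeta> a) + z"
      then show "\<zeta> x = 0"
        using x_char[of \<zeta>] by (simp add: f_def)
    qed
    then have "\<zeta> x = 0"
      using K0 chars_zero[OF \<zeta>(1)] by auto
    then show False
      using x_char[OF \<zeta>(1)] \<zeta>(3) neg by (simp add: f_def)
  qed
qed

text \<open>For \<open>z \<ge> 0\<close> the negative part of \<open>a\<close> is added, whose norm
  is at most \<open>z\<close>. For \<open>z < 0\<close> all nonzero characters are at least
  \<open>- z\<close> at \<open>a\<close>; this forces \<open>A\<close> to have a unit
  \<open>u\<close>, a function of \<open>a\<close>, which turns out to lie in \<open>B\<close>, and
  then \<open>\<Phi> u = e\<close> because \<open>\<iota>\<close> preserves units.\<close>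

lemma order_push:
  assumes a: "a \<in> carrier A" "star A a = a"
    and pos: "\<And>\<zeta> y. \<lbrakk>\<zeta> \<in> chars A; y \<in> carrier A; \<zeta> y \<noteq> 0\<rbrakk> \<Longrightarrow> 0 \<le> Re (\<zeta> a) + z"
    and \<xi>: "\<xi> \<in> chars I" "\<xi> e = 1"
  shows "0 \<le> Re (\<xi> (\<Phi> a)) + z"
proof (cases "0 \<le> z")
  case True
  have "- z \<le> Re (\<zeta> a)" if "\<zeta> \<in> chars A" for \<zeta>
    using pos[OF that a(1)] True by (cases "\<zeta> a = 0") auto
  then obtain c where c: "c \<in> carrier A" "cnorm A c \<le> z"
    "\<And>\<zeta>. \<zeta> \<in> chars A \<Longrightarrow> \<zeta> c = complex_of_real (max 0 (- Re (\<zeta> a)))"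
    using negative_part[OF a True] by blast
  have "0 \<le> Re (\<xi> (\<Phi> (a \<oplus> c)))"
  proof (rule \<Phi>_nonneg(2)[OF \<xi>(1)])
    fix \<zeta> assume \<zeta>: "\<zeta> \<in> chars A"
    show "\<zeta> (a \<oplus> c) = complex_of_real (Re (\<zeta> (a \<oplus> c))) \<and> 0 \<le> Re (\<zeta> (a \<oplus> c))"
      using c(3)[OF \<zeta>] chars_herm_of_real[OF \<zeta> a] chars_simps(1)[OF \<zeta> a(1) c(1)] by (auto simp: complex_eq_iff)
  qed (use a c in simp)
  moreover have "Re (\<xi> (\<Phi> c)) \<le> z"
    using \<Phi>_bound[OF \<xi>(1) c(1)] c(2) complex_Re_le_cmod[of "\<xi> (\<Phi> c)"] by linarith
  ultimately show ?thesis
    using a(1) c(1) by (simp add: \<Phi>_char[OF \<xi>(1)])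
next
  case False
  \<comment> \<open>Rises from 0 at 0 to 1 at \<open>- z\<close>, so that \<open>u\<close> has the
    value 1 at every nonzero character.\<close>
  define f where "f t = min 1 (max 0 (t / (- z)))" for t :: real
  have f: "continuous_on UNIV f" "f 0 = 0"
    unfolding f_def using False by (auto intro!: continuous_intros)
  obtain u where u: "u \<in> carrier A" "\<And>\<zeta>. \<zeta> \<in> chars A \<Longrightarrow> \<zeta> u = complex_of_real (f (Re (\<zeta> a)))"
    using functional_calculus[OF a f] by blast
  have u1: "\<zeta> u = 1" if "\<zeta> \<in> chars A" "y \<in> carrier A" "\<zeta> y \<noteq> 0" for \<zeta> y
  proof -
    have "1 \<le> Re (\<zeta> a) / (- z)"
      using pos[OF that] False by (subst pos_le_divide_eq) simp_all
    then show ?thesis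
      using u(2)[OF that(1)] by (simp add: f_def)
  qed
  have uy: "u \<otimes> y = y" if y: "y \<in> carrier A" for y
  proof (rule chars_eqI)
    fix \<zeta> assume \<zeta>: "\<zeta> \<in> chars A"
    show "\<zeta> (u \<otimes> y) = \<zeta> y"
      using u1[OF \<zeta> y] chars_simps(2)[OF \<zeta> u(1) y] by (cases "\<zeta> y = 0") simp_all
  qed (use u y in simp_all)
  \<comment> \<open>As \<open>u\<close> is a unit of \<open>A\<close>, an approximate unit in
    \<open>B\<close> approximates \<open>u\<close> itself, and \<open>B\<close> is closed.\<close>
  have "\<exists>v\<in>B. cnorm A (v \<ominus> u) < inverse (real (Suc n))" for n
  proof -
    obtain v where v: "v \<in> B" "cnorm A (u \<otimes> v \<ominus> u) < inverse (real (Suc n))"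
      using approximate_unit[OF u(1), of "inverse (real (Suc n))"] by auto
    then show ?thesis
      using uy[OF B_carrier] by auto
  qed
  then obtain v where v: "\<And>n. v n \<in> B" "\<And>n. cnorm A (v n \<ominus> u) < inverse (real (Suc n))"
    by metis
  have "(\<lambda>n. cnorm A (v n \<ominus> u)) \<longlonglongrightarrow> 0"
  proof (rule tendsto_sandwich[OF always_eventually always_eventually tendsto_const LIMSEQ_inverse_real_of_nat])
    show "\<forall>n. 0 \<le> cnorm A (v n \<ominus> u)"
      using B_carrier[OF v(1)] u(1) by (intro allI cnorm_nonneg) simp
    show "\<forall>n. cnorm A (v n \<ominus> u) \<le> inverse (real (Suc n))"
      using v(2) less_imp_le by blast
  qed
  then have uB: "u \<in> B"
    using subalgebra v(1) u(1) unfolding cstar_subalgebra_def norm_closed_def by blast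
  have "is_unit (subalg A B) u"
    using uB uy B_carrier mult_comm[OF u(1)] by (simp add: is_unit_def)
  then have "is_unit I (\<iota> u)"
    using envelope unfolding rigid_envelope_def unit_preserving_def by blast
  then have "\<iota> u = e"
    using unit by (rule is_unit_unique)
  then have \<Phi>u: "\<xi> (\<Phi> u) = 1"
    using on_B[OF uB] \<xi>(2) by simp
  have "0 \<le> Re (\<xi> (\<Phi> (a \<oplus> complex_of_real z \<odot> u)))"
  proof (rule \<Phi>_nonneg(2)[OF \<xi>(1)])
    fix \<zeta> assume \<zeta>: "\<zeta> \<in> chars A"
    have eq: "\<zeta> (a \<oplus> complex_of_real z \<odot> u) = \<zeta> a + complex_of_real z * \<zeta> u"
      using \<zeta> a(1) u(1) by simp
    show "\<zeta> (a \<oplus> complex_of_real z \<odot> u) = complex_of_real (Re (\<zeta> (a \<oplus> complex_of_real z \<odot> u))) \<and>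
        0 \<le> Re (\<zeta> (a \<oplus> complex_of_real z \<odot> u))"
    proof (cases "\<zeta> a = 0")
      case True
      then show ?thesis
        unfolding eq u(2)[OF \<zeta>] by (simp add: f)
    next
      case False
      then show ?thesis
        unfolding eq using u1[OF \<zeta> a(1)] pos[OF \<zeta> a(1)] chars_herm_of_real[OF \<zeta> a] by (simp add: complex_eq_iff)
    qed
  qed (use a u in simp)
  then show ?thesis
    using a(1) u(1) \<Phi>u by (simp add: \<Phi>_char[OF \<xi>(1)])
qed

text \<open>For a hermitian \<open>d\<close> in the kernel, \<open>order_reflect\<close> applies to
  \<open>d\<close> and its negative with every shift \<open>r > 0\<close>, so all characters vanish
  at \<open>d\<close>. The general case follows from real and imaginary parts, as
  \<open>\<Phi>\<close> respects \<open>star\<close>.\<close>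

lemma inj_on_if_essential:
  assumes ess: "essential A B"
  shows "inj_on \<Phi> (carrier A)"
proof -
  have herm: "d = \<zero>" if d: "d \<in> carrier A" "star A d = d" and z: "\<Phi> d = \<zero>\<^bsub>I\<^esub>" for d
  proof (rule chars_eqI)
    fix \<zeta> assume \<zeta>: "\<zeta> \<in> chars A"
    have nonneg: "0 \<le> Re (\<zeta> x) + 0" if "\<zeta> d \<noteq> 0" "x \<in> carrier A" "star A x = x" "\<Phi> x = \<zero>\<^bsub>I\<^esub>" for x
    proof (rule field_le_epsilon)
      fix r :: real assume "0 < r"
      then have "0 \<le> Re (\<zeta> x) + r"
        using that(4) I.chars_zero by (intro order_reflect[OF ess that(2,3) _ \<zeta> d(1) that(1)]) simp
      then show "0 \<le> Re (\<zeta> x) + 0 + r"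
        by simp
    qed
    have "\<Phi> ((- 1) \<odot> d) = \<zero>\<^bsub>I\<^esub>"
      using linear_map_onD(3)[OF linear d(1), of "- 1"] z by simp
    then have "Re (\<zeta> d) = 0" if "\<zeta> d \<noteq> 0"
      using nonneg[OF that d z] nonneg[OF that, of "(- 1) \<odot> d"] d \<zeta> by (simp add: star_smult)
    then show "\<zeta> d = \<zeta> \<zero>"
      using chars_herm_of_real[OF \<zeta> d] chars_zero[OF \<zeta>] by (cases "\<zeta> d = 0") simp_all
  qed (use d in simp_all)
  show ?thesis
  proof (rule inj_onI)
    fix x y assume x: "x \<in> carrier A" and y: "y \<in> carrier A" and eq: "\<Phi> x = \<Phi> y"
    define d where "d = x \<ominus> y"
    have d: "d \<in> carrier A"
      using x y by (simp add: d_def)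
    have \<Phi>d: "\<xi> (\<Phi> d) = 0" if "\<xi> \<in> chars I" for \<xi>
      using \<Phi>_char(3)[OF that x y] eq by (simp add: d_def)
    have \<Phi>sd: "\<xi> (\<Phi> (star A d)) = 0" if "\<xi> \<in> chars I" for \<xi>
      using \<Phi>_star[OF d] chars_simps(3)[OF that \<Phi>_closed[OF d]] \<Phi>d[OF that] by simp
    have 1: "d \<oplus> star A d = \<zero>"
    proof (rule herm)
      show "\<Phi> (d \<oplus> star A d) = \<zero>\<^bsub>I\<^esub>"
      proof (rule I.chars_eqI)
        fix \<xi> assume \<xi>: "\<xi> \<in> chars I"
        show "\<xi> (\<Phi> (d \<oplus> star A d)) = \<xi> \<zero>\<^bsub>I\<^esub>"
          using d \<Phi>d[OF \<xi>] \<Phi>sd[OF \<xi>] I.chars_zero[OF \<xi>] by (simp add: \<Phi>_char[OF \<xi>])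
      qed (use d in simp_all)
    qed (use d in \<open>simp_all add: star_add star_star a_comm\<close>)
    have 2: "\<i> \<odot> (d \<ominus> star A d) = \<zero>"
    proof (rule herm)
      show "star A (\<i> \<odot> (d \<ominus> star A d)) = \<i> \<odot> (d \<ominus> star A d)"
      proof (rule chars_eqI)
        fix \<zeta> assume \<zeta>: "\<zeta> \<in> chars A"
        show "\<zeta> (star A (\<i> \<odot> (d \<ominus> star A d))) = \<zeta> (\<i> \<odot> (d \<ominus> star A d))"
          using d \<zeta> by (simp add: algebra_simps)
      qed (use d in simp_all)
      show "\<Phi> (\<i> \<odot> (d \<ominus> star A d)) = \<zero>\<^bsub>I\<^esub>"
      proof (rule I.chars_eqI)
        fix \<xi> assume \<xi>: "\<xi> \<in> chars I"
        show "\<xi> (\<Phi> (\<i> \<odot> (d \<ominus> star A d))) = \<xi> \<zero>\<^bsub>I\<^esub>"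
          using d \<Phi>d[OF \<xi>] \<Phi>sd[OF \<xi>] I.chars_zero[OF \<xi>] by (simp add: \<Phi>_char[OF \<xi>])
      qed (use d in simp_all)
    qed (use d in simp_all)
    show "x = y"
    proof (rule chars_eqI[OF x y])
      fix \<zeta> assume \<zeta>: "\<zeta> \<in> chars A"
      have "\<zeta> (d \<oplus> star A d) = 0" "\<zeta> (\<i> \<odot> (d \<ominus> star A d)) = 0"
        unfolding 1 2 using chars_zero[OF \<zeta>] by simp_all
      then have "\<zeta> d = 0"
        using d \<zeta> by (simp add: complex_eq_iff)
      then show "\<zeta> x = \<zeta> y"
        using \<zeta> x y by (simp add: d_def)
    qed
  qed
qed

end

section \<open>Uniqueness and regular ideals\<close>

text \<open>Inequalities pass through \<open>A\<close>: \<open>order_reflect\<close> pulls them back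
  along \<open>\<Phi>1\<close>, and \<open>order_push\<close> sends them on along
  \<open>\<Phi>2\<close>. This makes \<open>\<phi>\<close> positive on \<open>T\<close>, which is
  merely a subspace closed under \<open>star\<close>; injectivity then extends it to all of
  \<open>I\<close>.\<close>

lemma (in abelian_inclusion) unique_if_essential:
  fixes k :: "'x \<Rightarrow> 'i"
  assumes k: "surj k" and ess: "essential A B"
    and \<Phi>1: "pseudo_expectation A B I \<iota> \<Phi>1" and \<Phi>2: "pseudo_expectation A B I \<iota> \<Phi>2" and a: "a \<in> carrier A"
  shows "\<Phi>1 a = \<Phi>2 a"
proof (cases "\<exists>\<xi>\<in>chars I. \<xi> e = 1")
  \<comment> \<open>Here \<open>I\<close> is the zero algebra.\<close>
  case False
  interpret P1: abelian_pseudo_expectation A B I \<iota> X e \<Phi>1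
    by standard (rule \<Phi>1)
  interpret P2: abelian_pseudo_expectation A B I \<iota> X e \<Phi>2
    by standard (rule \<Phi>2)
  show ?thesis
  proof (rule I.chars_eqI)
    fix \<xi> assume \<xi>: "\<xi> \<in> chars I"
    then have "\<xi> e = 0"
      using False unit_at_char[OF unit \<xi>] by blast
    then show "\<xi> (\<Phi>1 a) = \<xi> (\<Phi>2 a)"
      using char_unit_zero[OF \<xi>] a by simp
  qed (use a in simp_all)
next
  case True
  then obtain \<zeta>0 where \<zeta>0: "\<zeta>0 \<in> chars I" "\<zeta>0 e = 1"
    by blast
  interpret P1: abelian_pseudo_expectation A B I \<iota> X e \<Phi>1
    by standard (rule \<Phi>1)
  interpret P2: abelian_pseudo_expectation A B I \<iota> X e \<Phi>2
    by standard (rule \<Phi>2)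
  \<comment> \<open>All members take the value 1 at \<open>e\<close>, so \<open>e\<close>
    corresponds to the constant function 1 and the extension will preserve it. As the surjection
    \<open>k\<close> provides an index for each element of \<open>I\<close>, the family also
    separates elements.\<close>
  have "\<exists>\<zeta>. \<zeta> \<in> chars I \<and> \<zeta> e = 1 \<and> (k p \<in> carrier I \<and> k p \<noteq> \<zero>\<^bsub>I\<^esub> \<longrightarrow> \<zeta> (k p) \<noteq> 0)" for p
  proof (cases "k p \<in> carrier I \<and> k p \<noteq> \<zero>\<^bsub>I\<^esub>")
    case True
    then have "\<not> (\<forall>\<zeta>\<in>chars I. \<zeta> (k p) = \<zeta> \<zero>\<^bsub>I\<^esub>)"
      using I.chars_eqI[of "k p" "\<zero>\<^bsub>I\<^esub>"] I.zero_closed by blast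
    then obtain \<zeta> where \<zeta>: "\<zeta> \<in> chars I" "\<zeta> (k p) \<noteq> 0"
      using I.chars_zero by auto
    moreover have "\<zeta> e = 1"
      using char_unit_zero[OF \<zeta>(1)] unit_at_char[OF unit \<zeta>(1)] \<zeta>(2) True by blast
    ultimately show ?thesis
      by blast
  next
    case False
    then show ?thesis
      using \<zeta>0 by blast
  qed
  then obtain \<zeta> where \<zeta>: "\<And>p. \<zeta> p \<in> chars I" "\<And>p. \<zeta> p e = 1"
    and separating: "\<And>p. k p \<in> carrier I \<Longrightarrow> k p \<noteq> \<zero>\<^bsub>I\<^esub> \<Longrightarrow> \<zeta> p (k p) \<noteq> 0"
    by metis
  have inj: "inj_on \<Phi>1 (carrier A)"
    by (rule P1.inj_on_if_essential[OF ess])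
  define T where "T = \<Phi>1 ` carrier A"
  define \<phi> where "\<phi> t = \<Phi>2 (inv_into (carrier A) \<Phi>1 t)" for t
  have \<phi>: "\<phi> (\<Phi>1 x) = \<Phi>2 x" if "x \<in> carrier A" for x
    using inv_into_f_f[OF inj that] by (simp add: \<phi>_def)
  note lin1 = linear_map_onD[OF P1.linear] and lin2 = linear_map_onD[OF P2.linear]
  have TE: "\<exists>x\<in>carrier A. t = \<Phi>1 x" if "t \<in> T" for t
    using that by (auto simp: T_def)
  have TI: "\<Phi>1 x \<in> T" if "x \<in> carrier A" for x
    using that by (simp add: T_def)
  have T: "linear_subspace I T"
    unfolding linear_subspace_def
  proof (intro conjI ballI allI)
    show "T \<subseteq> carrier I"
      using lin1(1) by (auto simp: T_def)
    have "\<Phi>1 \<zero> = \<zero>\<^bsub>I\<^esub>"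
      using lin1(3)[OF zero_closed, of 0] by simp
    then show "\<zero>\<^bsub>I\<^esub> \<in> T"
      using TI[OF zero_closed] by simp
    fix s assume "s \<in> T"
    then obtain x where x: "x \<in> carrier A" "s = \<Phi>1 x"
      using TE by blast
    show "c \<odot>\<^bsub>I\<^esub> s \<in> T" for c
      using TI[OF smult_closed[OF x(1)], of c] lin1(3)[OF x(1), of c] x(2) by simp
    fix t assume "t \<in> T"
    then obtain y where y: "y \<in> carrier A" "t = \<Phi>1 y"
      using TE by blast
    show "s \<oplus>\<^bsub>I\<^esub> t \<in> T"
      using TI[OF a_closed[OF x(1) y(1)]] lin1(2)[OF x(1) y(1)] x(2) y(2) by simp
  qed
  have T_star: "star I t \<in> T" if t: "t \<in> T" for t
  proof -
    obtain x where "x \<in> carrier A" "t = \<Phi>1 x"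
      using TE[OF t] by blast
    then show ?thesis
      using TI[OF star_closed] P1.\<Phi>_star by simp
  qed
  have lin: "linear_map_on I T I \<phi>"
    unfolding linear_map_on_def
  proof (intro conjI ballI allI funcsetI)
    fix s assume "s \<in> T"
    then obtain x where x: "x \<in> carrier A" "s = \<Phi>1 x"
      using TE by blast
    show "\<phi> s \<in> carrier I"
      using x \<phi> by simp
    show "\<phi> (c \<odot>\<^bsub>I\<^esub> s) = c \<odot>\<^bsub>I\<^esub> \<phi> s" for c
      using \<phi>[OF smult_closed[OF x(1)], of c] \<phi>[OF x(1)] lin1(3)[OF x(1), of c] lin2(3)[OF x(1), of c] x(2) by simp
    fix t assume "t \<in> T"
    then obtain y where y: "y \<in> carrier A" "t = \<Phi>1 y"
      using TE by blast
    show "\<phi> (s \<oplus>\<^bsub>I\<^esub> t) = \<phi> s \<oplus>\<^bsub>I\<^esub> \<phi> t"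
      using \<phi>[OF a_closed[OF x(1) y(1)]] \<phi>[OF x(1)] \<phi>[OF y(1)] lin1(2)[OF x(1) y(1)] lin2(2)[OF x(1) y(1)] x(2) y(2) by simp
  qed
  have pos: "Im (\<xi> (\<phi> t)) = 0 \<and> 0 \<le> Re (\<xi> (\<phi> t)) + z * Re (\<xi> e)"
    if t: "t \<in> T" "star I t = t" and p: "\<And>p. 0 \<le> Re (\<zeta> p t) + z" and \<xi>: "\<xi> \<in> chars I" for t z \<xi>
  proof -
    obtain x where x: "x \<in> carrier A" "t = \<Phi>1 x"
      using TE[OF t(1)] by blast
    have tc: "t \<in> carrier I"
      using x by simp
    have "\<Phi>1 (star A x) = \<Phi>1 x"
      using P1.\<Phi>_star[OF x(1)] x(2) t(2) by simp
    then have sx: "star A x = x"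
      by (rule inj_onD[OF inj]) (use x in simp_all)
    have \<phi>t: "\<phi> t = \<Phi>2 x"
      using \<phi> x by simp
    \<comment> \<open>The inequality spreads from the family to all unital characters: the negative
      part of \<open>t + z e\<close> vanishes on the family, which separates elements, so it is
      0.\<close>
    have all: "0 \<le> Re (\<eta> t) + z" if \<eta>: "\<eta> \<in> chars I" "\<eta> e = 1" for \<eta>
    proof (rule ccontr)
      assume neg: "\<not> ?thesis"
      define s where "s = t \<oplus>\<^bsub>I\<^esub> complex_of_real z \<odot>\<^bsub>I\<^esub> e"
      have s: "s \<in> carrier I" "star I s = s"
        using tc t(2) I.star_unit[OF unit] by (simp_all add: s_def I.star_add I.star_smult)
      have f: "continuous_on UNIV (\<lambda>t. max 0 (- t) :: real)" "max 0 (- 0) = (0 :: real)"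
        by (auto intro!: continuous_intros)
      obtain c where c: "c \<in> carrier I"
        "\<And>\<eta>. \<eta> \<in> chars I \<Longrightarrow> \<eta> c = complex_of_real (max 0 (- Re (\<eta> s)))"
        using I.functional_calculus[OF s f] by blast
      have s_char: "Re (\<eta> s) = Re (\<eta> t) + z" if "\<eta> \<in> chars I" "\<eta> e = 1" for \<eta>
        using that tc by (simp add: s_def)
      obtain p where kp: "k p = c"
        using k by (metis surjD)
      have "\<zeta> p c = 0"
        using c(2)[OF \<zeta>(1)] s_char[OF \<zeta>] p[of p] by simp
      then have "c = \<zero>\<^bsub>I\<^esub>"
        using separating[of p] c(1) kp by auto
      then have "\<eta> c = 0"
        using I.chars_zero[OF \<eta>(1)] by simp
      then show False
        using c(2)[OF \<eta>(1)] s_char[OF \<eta>] neg by simp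
    qed
    have im: "Im (\<xi> (\<phi> t)) = 0"
      unfolding \<phi>t by (rule P2.\<Phi>_real[OF \<xi> x(1) sx])
    have "0 \<le> Re (\<xi> (\<phi> t)) + z * Re (\<xi> e)"
    proof (cases "\<xi> e = 0")
      case True
      then show ?thesis
        using char_unit_zero[OF \<xi> True, of "\<phi> t"] \<phi>t x(1) by simp
    next
      case False
      then have \<xi>e: "\<xi> e = 1"
        using unit_at_char[OF unit \<xi>] by simp
      \<comment> \<open>The slack \<open>r\<close> supplies the strict inequality that
        \<open>order_reflect\<close> requires.\<close>
      have "0 \<le> Re (\<xi> (\<Phi>2 x)) + z"
      proof (rule field_le_epsilon)
        fix r :: real assume r: "0 < r"
        have "0 \<le> Re (\<eta> x) + (z + r)" if \<eta>: "\<eta> \<in> chars A" "y \<in> carrier A" "\<eta> y \<noteq> 0" for \<eta> y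
        proof (rule P1.order_reflect[OF ess x(1) sx _ \<eta>])
          fix \<xi>' assume "\<xi>' \<in> chars I" "\<xi>' e = 1"
          from all[OF this] show "0 < Re (\<xi>' (\<Phi>1 x)) + (z + r)"
            using r x(2) by simp
        qed
        then have "0 \<le> Re (\<xi> (\<Phi>2 x)) + (z + r)"
          by (rule P2.order_push[OF x(1) sx _ \<xi> \<xi>e])
        then show "0 \<le> Re (\<xi> (\<Phi>2 x)) + z + r"
          by simp
      qed
      then show ?thesis
        using \<phi>t \<xi>e by simp
    qed
    with im show ?thesis
      by blast
  qed
  show ?thesis
  proof (rule extension_through_characters[where \<eta> = \<zeta> and T = T and \<phi> = \<phi>, OF injective I.comm_cstar_axioms unit
        I.comm_cstar_axioms \<zeta>(1) T T_star lin pos])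
    fix \<Psi>
    assume \<Psi>: "cp_map I I \<Psi>" "\<And>t. t \<in> T \<Longrightarrow> \<Psi> t = \<phi> t"
      and \<Psi>e: "\<And>u. \<lbrakk>u \<in> carrier I; \<And>p. \<zeta> p u = 1\<rbrakk> \<Longrightarrow> \<Psi> u = e"
    have "\<Psi> e = e"
      by (rule \<Psi>e[OF unit_carrier \<zeta>(2)])
    then have up: "unit_preserving I I \<Psi>"
      unfolding unit_preserving_def using unit is_unit_unique[OF _ unit] by metis
    have \<Psi>\<Phi>: "\<Psi> (\<Phi>1 x) = \<Phi>2 x" if "x \<in> carrier A" for x
      using \<Psi>(2)[OF TI[OF that]] \<phi>[OF that] by simp
    have fixed: "\<Psi> r = r" if "r \<in> \<iota> ` B" for r
    proof -
      obtain b where b: "b \<in> B" "r = \<iota> b"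
        using \<open>r \<in> \<iota> ` B\<close> by blast
      show ?thesis
        using \<Psi>\<Phi>[OF B_carrier[OF b(1)]] P1.on_B[OF b(1)] P2.on_B[OF b(1)] b(2) by simp
    qed
    have "rigid I (\<iota> ` B)"
      using envelope by (simp add: rigid_envelope_def)
    then have "\<Psi> (\<Phi>1 a) = \<Phi>1 a"
      unfolding rigid_def using \<Psi>(1) up fixed P1.\<Phi>_closed[OF a] by blast
    then show ?thesis
      using \<Psi>\<Phi>[OF a] by simp
  qed
qed

section \<open>Annihilators, regular ideals and the passage to the quotient\<close>

lemma (in comm_cstar) annihilator_ideal:
  assumes S: "S \<subseteq> carrier A"
  shows "closed_ideal A (annihilator A S)"
  unfolding closed_ideal_def linear_subspace_def norm_closed_def
proof (intro conjI ballI allI impI)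
  have D: "x \<in> carrier A" "s \<in> S \<Longrightarrow> s \<in> carrier A" "s \<in> S \<Longrightarrow> x \<otimes> s = \<zero>" if "x \<in> annihilator A S" for x s
    using that S by (auto simp: annihilator_def)
  have I: "x \<in> annihilator A S" if "x \<in> carrier A" "\<And>s. s \<in> S \<Longrightarrow> x \<otimes> s = \<zero>" for x
    using that S mult_comm[of _ x] unfolding annihilator_def by auto
  show "annihilator A S \<subseteq> carrier A"
    using D(1) by blast
  show "\<zero> \<in> annihilator A S"
    using S by (intro I) auto
  show "x \<oplus> y \<in> annihilator A S" if "x \<in> annihilator A S" "y \<in> annihilator A S" for x y
    by (rule I) (simp_all add: D[OF that(1)] D[OF that(2)] distrib_right)
  show "c \<odot> x \<in> annihilator A S" if "x \<in> annihilator A S" for x c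
    by (rule I) (simp_all add: D[OF that] smult_mult_left)
  show ideal: "a \<otimes> x \<in> annihilator A S" if "a \<in> carrier A" "x \<in> annihilator A S" for a x
    by (rule I) (simp_all add: D[OF that(2)] that(1) mult_assoc)
  show "x \<otimes> a \<in> annihilator A S" if "a \<in> carrier A" "x \<in> annihilator A S" for a x
    using ideal[OF that] mult_comm[OF that(1) D(1)[OF that(2)]] by simp
  show "x \<in> annihilator A S"
    if x: "x \<in> carrier A" and Y: "(\<forall>n. Y n \<in> annihilator A S) \<and> (\<lambda>n. cnorm A (Y n \<ominus> x)) \<longlonglongrightarrow> 0" for x Y
  proof (rule I[OF x])
    fix s assume s: "s \<in> S"
    then have sc: "s \<in> carrier A"
      using S by blast
    have "cnorm A (x \<otimes> s) \<le> cnorm A (Y n \<ominus> x) * cnorm A s" for n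
    proof -
      have Yn: "Y n \<in> annihilator A S"
        using Y by simp
      have "(Y n \<ominus> x) \<otimes> s = \<zero> \<ominus> x \<otimes> s"
        using D(3)[OF Yn s] D(1)[OF Yn] x sc by (simp add: mult_diff_right)
      also have "\<dots> = (- 1) \<odot> (x \<otimes> s)"
        using x sc by (simp add: minus_eq_smult)
      finally have "cnorm A (x \<otimes> s) = cnorm A ((Y n \<ominus> x) \<otimes> s)"
        using x sc by (simp add: cnorm_smult)
      also have "\<dots> \<le> cnorm A (Y n \<ominus> x) * cnorm A s"
        using D(1)[OF Yn] x sc by (intro cnorm_mult) simp_all
      finally show ?thesis .
    qed
    moreover have "(\<lambda>n. cnorm A (Y n \<ominus> x) * cnorm A s) \<longlonglongrightarrow> 0"
      using tendsto_mult_right[OF conjunct2[OF Y], of "cnorm A s"] by simp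
    ultimately have "cnorm A (x \<otimes> s) \<le> 0"
      using LIMSEQ_le_const[of "\<lambda>n. cnorm A (Y n \<ominus> x) * cnorm A s" 0 "cnorm A (x \<otimes> s)"] by blast
    then show "x \<otimes> s = \<zero>"
      using cnorm_nonneg[of "x \<otimes> s"] cnorm_eq_zero[of "x \<otimes> s"] x sc by simp
  qed
qed

text \<open>An ideal of \<open>A/J\<close> that meets the image of \<open>B\<close> trivially lifts to an ideal whose intersection with \<open>J\<^sup>\<bottom>\<close>
  meets \<open>B\<close> trivially, hence is zero; so the lift lies in \<open>J\<^sup>\<bottom>\<^sup>\<bottom>\<close>.\<close>

lemma (in comm_cstar_ideal) essential_quotient:
  assumes ess: "essential A B" and regular: "annihilator A (annihilator A J) = J" and B: "cstar_subalgebra A B"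
  shows "essential Q (q ` B)"
  unfolding essential_def
proof (intro allI impI)
  fix K' assume K'K: "closed_ideal Q K' \<and> K' \<inter> q ` B \<subseteq> {\<zero>\<^bsub>Q\<^esub>}"
  then have K': "closed_ideal Q K'" and triv: "K' \<inter> q ` B \<subseteq> {\<zero>\<^bsub>Q\<^esub>}"
    by auto
  interpret Q: comm_cstar Q
    by (rule comm_cstar_Q)
  note K'_rules = Q.closed_ideal_rules[OF K']
  have J_sub: "J \<subseteq> carrier A"
    using J_carrier by blast
  define N where "N = annihilator A J"
  have N: "closed_ideal A N"
    unfolding N_def by (rule annihilator_ideal[OF J_sub])
  note N_rules = closed_ideal_rules[OF N]
  define K where "K = {a \<in> carrier A. q a \<in> K'}"
  have KD: "a \<in> carrier A" "q a \<in> K'" if "a \<in> K" for a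
    using that by (simp_all add: K_def)
  have KI: "a \<in> K" if "a \<in> carrier A" "q a \<in> K'" for a
    using that by (simp add: K_def)
  have L: "closed_ideal A (K \<inter> N)"
    unfolding closed_ideal_def linear_subspace_def norm_closed_def
  proof (intro conjI ballI allI impI)
    show "K \<inter> N \<subseteq> carrier A"
      using KD(1) by blast
    have "\<zero> \<in> K"
      using K'_rules(2) by (intro KI) (simp_all add: Q_zero)
    then show "\<zero> \<in> K \<inter> N"
      using N_rules(2) by blast
    fix x assume x: "x \<in> K \<inter> N"
    then have xc: "x \<in> carrier A" and xK: "q x \<in> K'" and xN: "x \<in> N"
      using KD by auto
    show "c \<odot> x \<in> K \<inter> N" for c
      using KI[of "c \<odot> x"] xc K'_rules(4)[OF xK, of c] N_rules(4)[OF xN, of c] by (simp add: q_smult)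
    show "x \<oplus> y \<in> K \<inter> N" if "y \<in> K \<inter> N" for y
    proof -
      have y: "y \<in> carrier A" "q y \<in> K'" "y \<in> N"
        using that KD by auto
      show ?thesis
        using KI[of "x \<oplus> y"] xc y(1) K'_rules(3)[OF xK y(2)] N_rules(3)[OF xN y(3)] by (simp add: q_add)
    qed
  next
    fix a x assume a: "a \<in> carrier A" and "x \<in> K \<inter> N"
    then have xc: "x \<in> carrier A" and xK: "q x \<in> K'" and xN: "x \<in> N"
      using KD by auto
    show "a \<otimes> x \<in> K \<inter> N"
      using KI[of "a \<otimes> x"] a xc K'_rules(5)[OF q_closed[OF a] xK] N_rules(5)[OF a xN] by (simp add: q_mult)
    then show "x \<otimes> a \<in> K \<inter> N"
      using mult_comm[OF a xc] by simp
  next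
    fix Y x assume x: "x \<in> carrier A" and Y: "(\<forall>n. Y n \<in> K \<inter> N) \<and> (\<lambda>n. cnorm A (Y n \<ominus> x)) \<longlonglongrightarrow> 0"
    have YK: "Y n \<in> K" and YN: "Y n \<in> N" for n
      using Y by simp_all
    have "(\<lambda>n. cnorm Q (q (Y n) \<ominus>\<^bsub>Q\<^esub> q x)) \<longlonglongrightarrow> 0"
    proof (rule tendsto_sandwich[OF always_eventually always_eventually tendsto_const conjunct2[OF Y]])
      show "\<forall>n. 0 \<le> cnorm Q (q (Y n) \<ominus>\<^bsub>Q\<^esub> q x)"
        using KD(1)[OF YK] x by (simp add: q_diff q_norm qn_nonneg)
      show "\<forall>n. cnorm Q (q (Y n) \<ominus>\<^bsub>Q\<^esub> q x) \<le> cnorm A (Y n \<ominus> x)"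
        using KD(1)[OF YK] x by (simp add: q_diff q_norm qn_le_cnorm)
    qed
    then have "q x \<in> K'"
      by (rule K'_rules(8)[of "\<lambda>n. q (Y n)", OF KD(2)[OF YK] q_closed[OF x]])
    moreover have "x \<in> N"
      by (rule N_rules(8)[of Y, OF YN x conjunct2[OF Y]])
    ultimately show "x \<in> K \<inter> N"
      using KI[OF x] by blast
  qed
  have "(K \<inter> N) \<inter> B \<subseteq> {\<zero>}"
  proof
    fix b assume "b \<in> (K \<inter> N) \<inter> B"
    then have b: "b \<in> K" "b \<in> N" "b \<in> B"
      by auto
    note bc = KD(1)[OF b(1)]
    have "q b = \<zero>\<^bsub>Q\<^esub>"
      using triv KD(2)[OF b(1)] b(3) by blast
    then have "b \<in> J"
      using q_zero_iff[OF bc] by simp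
    \<comment> \<open>As \<open>b\<close> annihilates \<open>J\<close>, the product of
      \<open>star A b\<close> and \<open>b\<close> vanishes.\<close>
    then have "star A b \<in> J"
      by (rule J_star)
    then have "star A b \<otimes> b = \<zero>"
      using b(2) by (simp add: N_def annihilator_def)
    then have "cnorm A b = 0"
      using cnorm_star_mult[OF bc] cnorm_eq_zero[of \<zero>] by simp
    then show "b \<in> {\<zero>}"
      using cnorm_eq_zero[OF bc] by simp
  qed
  with L ess have L0: "K \<inter> N \<subseteq> {\<zero>}"
    by (simp add: essential_def)
  show "K' \<subseteq> {\<zero>\<^bsub>Q\<^esub>}"
  proof
    fix y assume y: "y \<in> K'"
    then obtain a where a: "a \<in> carrier A" "y = q a"
      using K'_rules(1) by (auto simp: Q_carrier)
    have "a \<otimes> n = \<zero>" if n: "n \<in> N" for n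
    proof -
      note nc = N_rules(1)[OF n]
      have "q (a \<otimes> n) \<in> K'"
        using K'_rules(6)[OF q_closed[OF nc] y] a nc by (simp add: q_mult)
      then have "a \<otimes> n \<in> K \<inter> N"
        using KI[of "a \<otimes> n"] a(1) nc N_rules(5)[OF a(1) n] by simp
      with L0 show ?thesis
        by blast
    qed
    then have "a \<in> annihilator A N"
      unfolding annihilator_def using a(1) mult_comm[OF N_rules(1) a(1)] by simp
    then have "a \<in> J"
      using regular by (simp add: N_def)
    then show "y \<in> {\<zero>\<^bsub>Q\<^esub>}"
      using q_zero_iff[OF a(1)] a(2) by simp
  qed
qed

text \<open>Lets a pseudo-expectation be restricted to the carrier, as uniqueness is stated for
  extensional maps.\<close>

lemma pseudo_expectation_cong:
  assumes A: "cstar_algebra A" and B: "B \<subseteq> carrier A"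
    and \<Phi>: "pseudo_expectation A B I \<iota> \<Phi>" and eq: "\<And>a. a \<in> carrier A \<Longrightarrow> \<Phi>' a = \<Phi> a"
  shows "pseudo_expectation A B I \<iota> \<Phi>'"
proof -
  interpret cstar_algebra A
    by fact
  have cp: "cp_map A I \<Phi>"
    using \<Phi> by (simp add: pseudo_expectation_def)
  then have "linear_map_on A (carrier A) I \<Phi>"
    by (simp add: cp_map_on_def)
  then have lin: "linear_map_on A (carrier A) I \<Phi>'"
    by (simp add: linear_map_on_def eq Pi_iff)
  have "matrix_positive I n (\<lambda>i j. \<Phi>' (X i j))"
    if "\<forall>i<n. \<forall>j<n. X i j \<in> carrier A" "matrix_positive A n X" for n X
    using cp_map_onD[OF cp that] that(1) by (simp add: matrix_positive_def eq)
  with lin have "cp_map A I \<Phi>'"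
    by (simp add: cp_map_on_def)
  moreover have "\<Phi>' b = \<Phi> b" if "b \<in> B" for b
    using B that by (intro eq) blast
  ultimately show ?thesis
    using \<Phi> by (simp add: pseudo_expectation_def eq)
qed

text \<open>Existence comes from \<open>pseudo_expectation_vanishing\<close>, with the annihilator
  of \<open>B\<close> as an ideal that meets \<open>B\<close> trivially.\<close>

lemma (in abelian_inclusion) faithful_unique_if_essential:
  fixes g :: "'x \<Rightarrow> 'a" and k :: "'x \<Rightarrow> 'i"
  assumes g: "surj g" and k: "surj k" and ess: "essential A B"
    and env: "injective_envelope (subalg A B) I \<iota>"
  shows "faithful_unique_pseudo_expectation A B I \<iota>"
proof -
  have "annihilator A B \<inter> B \<subseteq> {\<zero>}"
  proof
    fix b assume "b \<in> annihilator A B \<inter> B"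
    then have b: "b \<in> B" "b \<in> carrier A" "b \<in> annihilator A B"
      using B_carrier by auto
    have "star A b \<otimes> b = \<zero>"
      using b(3) B_closed(4)[OF b(1)] by (simp add: annihilator_def)
    then have "cnorm A b = 0"
      using cnorm_star_mult[OF b(2)] cnorm_eq_zero[of \<zero>] by simp
    then show "b \<in> {\<zero>}"
      using cnorm_eq_zero[OF b(2)] by simp
  qed
  then obtain \<Phi> where \<Phi>: "pseudo_expectation A B I \<iota> \<Phi>"
    using pseudo_expectation_vanishing[OF g annihilator_ideal[OF B_subset]] by blast
  have faithful: "faithful_map A I \<Phi>'" if "pseudo_expectation A B I \<iota> \<Phi>'" for \<Phi>'
  proof -
    interpret abelian_pseudo_expectation A B I \<iota> X e \<Phi>'
      by standard (rule that)
    show ?thesis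
      by (rule faithful_if_essential[OF ess])
  qed
  have "\<exists>!\<Phi>. \<Phi> \<in> extensional (carrier A) \<and> pseudo_expectation A B I \<iota> \<Phi>"
  proof (rule ex1I)
    show "restrict \<Phi> (carrier A) \<in> extensional (carrier A) \<and> pseudo_expectation A B I \<iota> (restrict \<Phi> (carrier A))"
      using pseudo_expectation_cong[OF cstar_algebra_axioms B_subset \<Phi>, of "restrict \<Phi> (carrier A)"] by simp
    fix \<Phi>' assume \<Phi>': "\<Phi>' \<in> extensional (carrier A) \<and> pseudo_expectation A B I \<iota> \<Phi>'"
    show "\<Phi>' = restrict \<Phi> (carrier A)"
    proof (rule extensionalityI)
      show "\<Phi>' \<in> extensional (carrier A)" "restrict \<Phi> (carrier A) \<in> extensional (carrier A)"
        using \<Phi>' by simp_all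
      show "\<Phi>' a = restrict \<Phi> (carrier A) a" if "a \<in> carrier A" for a
        using unique_if_essential[OF k ess conjunct2[OF \<Phi>'] \<Phi> that] that by simp
    qed
  qed
  with faithful inclusion env show ?thesis
    by (simp add: faithful_unique_pseudo_expectation_def)
qed

text \<open>Both index types that occur map onto the type of \<open>A\<close> and onto that of
  \<open>I\<close>, so every element has an index.\<close>

lemma surj_case_sum: "surj (case_sum id h)" "surj (case_sum fst h)" "surj (case_sum h id)"
proof -
  show "surj (case_sum id h)"
    by (rule surjI[of _ Inl]) simp
  show "surj (case_sum fst h)"
    by (rule surjI[of _ "\<lambda>x. Inl (x, undefined)"]) simp
  show "surj (case_sum h id)"
    by (rule surjI[of _ Inr]) simp
qed

lemma rigid_envelope_has_unit: "rigid_envelope X D I \<iota> \<Longrightarrow> \<exists>e. is_unit I e"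
  unfolding rigid_envelope_def injective_cstar_def unital_def by blast

lemma abelian_inclusion_cases:
  fixes A :: "'a cstar" and I :: "'i cstar"
  assumes A: "comm_cstar A" and incl: "cstar_inclusion A B" and env: "injective_envelope (subalg A B) I \<iota>"
  obtains e where "abelian_inclusion A B I \<iota> TYPE('a + 'i) e" | e where "abelian_inclusion A B I \<iota> TYPE('a \<times> complex + 'i) e"
proof -
  have B: "comm_cstar (subalg A B)"
    using incl by (intro comm_cstar.comm_cstar_subalg[OF A]) (simp add: cstar_inclusion_def)
  from rigid_envelope_cases[OF env B] show ?thesis
  proof
    assume env: "rigid_envelope TYPE('a + 'i) (subalg A B) I \<iota>"
    obtain e where "is_unit I e"
      using rigid_envelope_has_unit[OF env] by blast
    with env A incl have "abelian_inclusion A B I \<iota> TYPE('a + 'i) e"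
      by (simp add: abelian_inclusion_def abelian_inclusion_axioms_def)
    then show ?thesis
      by (rule that(1))
  next
    assume env: "rigid_envelope TYPE('a \<times> complex + 'i) (subalg A B) I \<iota>"
    obtain e where "is_unit I e"
      using rigid_envelope_has_unit[OF env] by blast
    with env A incl have "abelian_inclusion A B I \<iota> TYPE('a \<times> complex + 'i) e"
      by (simp add: abelian_inclusion_def abelian_inclusion_axioms_def)
    then show ?thesis
      by (rule that(2))
  qed
qed

text \<open>The index type is a parameter of the locale \<open>abelian_inclusion\<close>, hence the
  argument is run once for each of the two types.\<close>

lemma essential_if_faithful_unique:
  assumes "comm_cstar A" and fup: "faithful_unique_pseudo_expectation A B I \<iota>"
  shows "essential A B"
proof -
  have incl: "cstar_inclusion A B" and env: "injective_envelope (subalg A B) I \<iota>"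
    and faithful: "\<And>\<Phi>. pseudo_expectation A B I \<iota> \<Phi> \<Longrightarrow> faithful_map A I \<Phi>"
    using fup by (auto simp: faithful_unique_pseudo_expectation_def)
  from assms(1) incl env show ?thesis
  proof (cases rule: abelian_inclusion_cases)
    case (1 e)
    then show ?thesis
      using surj_case_sum(1) faithful by (rule abelian_inclusion.essential_if_faithful)
  next
    case (2 e)
    then show ?thesis
      using surj_case_sum(2) faithful by (rule abelian_inclusion.essential_if_faithful)
  qed
qed

lemma faithful_unique_if_essential:
  assumes "comm_cstar A" "cstar_inclusion A B" and env: "injective_envelope (subalg A B) I \<iota>" and ess: "essential A B"
  shows "faithful_unique_pseudo_expectation A B I \<iota>"
  using assms(1-3)
proof (cases rule: abelian_inclusion_cases)
  case (1 e)
  then show ?thesis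
    using surj_case_sum(1) surj_case_sum(3) ess env by (rule abelian_inclusion.faithful_unique_if_essential)
next
  case (2 e)
  then show ?thesis
    using surj_case_sum(2) surj_case_sum(3) ess env by (rule abelian_inclusion.faithful_unique_if_essential)
qed

theorem corollary4p4:
  fixes A :: "'a cstar" and B J :: "'a set"
    and I :: "'i cstar" and \<iota> :: "'a \<Rightarrow> 'i"
    and I' :: "'j cstar" and \<iota>' :: "'a set \<Rightarrow> 'j"
  assumes "cstar_inclusion A B" and "abelian A"
    and "faithful_unique_pseudo_expectation A B I \<iota>"
    and "regular_ideal A J"
    and "injective_envelope (subalg (quotient_cstar A J) (quotient_image A J B)) I' \<iota>'"
  shows "faithful_unique_pseudo_expectation (quotient_cstar A J) (quotient_image A J B) I' \<iota>'"
proof -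
  have A: "comm_cstar A"
    using assms(1,2) by (simp add: cstar_inclusion_def comm_cstar_def comm_cstar_axioms_def)
  have regular: "closed_ideal A J" "annihilator A (annihilator A J) = J"
    using assms(4) by (simp_all add: regular_ideal_def)
  interpret comm_cstar_ideal A J
    using A regular(1) by (simp add: comm_cstar_ideal_def comm_cstar_ideal_axioms_def)
  have image: "quotient_image A J B = q ` B"
    by (simp add: quotient_image_def q_def)
  have "essential A B"
    by (rule essential_if_faithful_unique[OF A assms(3)])
  \<comment> \<open>Regularity of \<open>J\<close> enters here: essentiality can be lost in the
    quotient by a proper ideal with zero annihilator.\<close>
  then have "essential Q (q ` B)"
    using regular(2) assms(1) by (intro essential_quotient) (simp_all add: cstar_inclusion_def)
  then show ?thesis
    using assms(5) unfolding image
    by (intro faithful_unique_if_essential comm_cstar_Q cstar_inclusion_quotient assms(1))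
qed

end
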